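(* Let $\rho_0$ be a Vishik–Fursikov stationary statistical solution on $H$. Then $\rho_0$ is carried by the weak global attractor $\mathcal A_w=\Pi_0\mathcal W$, i.e. $\rho_0(\mathcal A_w)=1$; consequently $\operatorname{supp}\rho_0\subset\mathcal A_w$.
   Context: Setting. $\Omega\subset\mathbb R^3$ is either the box $\prod_{i=1}^3(0,L_i)$ with periodic boundary conditions (fields with zero mean), or a bounded smooth domain with no-slip condition. $H$ is the closure in $L^2(\Omega)^3$ of the smooth divergence-free test fields, norm $|\cdot|$; $V$ their closure in $H^1(\Omega)^3$, norm $\|u\|=(\sum_i|\partial_iu|^2)^{1/2}$. $A$ is the Stokes operator, $B$ the bilinear term $\langle B(u,v),w\rangle=\int_\Omega(u\cdot\nabla)v\cdot w$. Fix $\nu>0$, time-independent $f\in H$; equations $u'+\nu Au+B(u,u)=f$. Weak solutions. A (Leray–Hopf) weak solution on an interval $I$ is $u:I\to H$ with $u\in L^\infty_{loc}(I;H)\cap L^2_{loc}(I;V)$, $\partial_tu\in L^{4/3}_{loc}(I;V')$, weakly continuous into $H$, satisfying the equation in distributions in $V'$, satisfying for a.e. $t'\in I$ the energy inequality $\frac12|u(t)|^2+\nu\int_{t'}^t\|u\|^2\le\frac12|u(t')|^2+\int_{t'}^t(f,u)$ for all $t>t'$ in $I$, and strongly right-continuous in $H$ at the left endpoint of $I$ when $I$ is closed and bounded on the left. Trajectory spaces. $H_w$: $H$ with weak topology. $\mathcal C_{loc}(I,H_w)$: weakly continuous maps $I\to H$ with the topology of uniform $H_w$-convergence on compact subintervals.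 $\Pi_tu=u(t)$, $(\sigma_\tau u)(t)=u(t+\tau)$. $\mathcal U_I^\sharp$: elements of $\mathcal C_{loc}(I,H_w)$ which are weak solutions on the interior of $I$. $\mathcal W$: weak solutions on $\mathbb R$ with $\sup_t|u(t)|<\infty$. The weak global attractor is $\mathcal A_w=\Pi_0\mathcal W=\{u(0):u\in\mathcal W\}$. Vishik–Fursikov measures. A Vishik–Fursikov measure over $I$ is a Borel probability measure $\rho$ on $\mathcal C_{loc}(I,H_w)$ with (i) $\rho(\mathcal U_I^\sharp)=1$; (ii) $t\mapsto\int|u(t)|^2d\rho\in L^\infty_{loc}(I)$; (iii) if $I$ is closed and bounded on the left with endpoint $t_0$, then for every nonnegative increasing $C^1$ $\psi$ with bounded derivative, $\lim_{t\to t_0^+}\int\psi(|u(t)|^2)d\rho=\int\psi(|u(t_0)|^2)d\rho<\infty$. For $I$ unbounded on the right, $\rho$ is invariant if $\rho(\sigma_\tau^{-1}\mathcal E)=\rho(\mathcal E)$ for all Borel $\mathcal E$, $\tau\ge0$. A Vishik–Fursikov stationary statistical solution is a Borel probability measure $\rho_0$ on $H$ such that $\rho_0=\Pi_t\rho$ (push-forward) for all $t\in I$, for some invariant Vishik–Fursikov measure $\rho$ over some interval $I$ unbounded on the right. *)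

theory Defs
  imports "HOL-Analysis.Analysis" "HOL-Probability.Probability"
begin

type_synonym vf = "real^3 \<Rightarrow> real^3"

definition pd :: "'n::finite \<Rightarrow> (real^'n \<Rightarrow> 'b::real_normed_vector) \<Rightarrow> real^'n \<Rightarrow> 'b" where
  "pd i f x = vector_derivative (\<lambda>s. f (x + s *\<^sub>R axis i 1)) (at 0)"

fun iter_pd :: "'n::finite list \<Rightarrow> (real^'n \<Rightarrow> 'b::real_normed_vector) \<Rightarrow> real^'n \<Rightarrow> 'b" where
  "iter_pd [] f = f"
| "iter_pd (i # is) f = pd i (iter_pd is f)"

definition smooth_fun :: "(real^'n::finite \<Rightarrow> 'b::real_normed_vector) \<Rightarrow> bool" where
  "smooth_fun f \<longleftrightarrow> (\<forall>is. continuous_on UNIV (iter_pd is f) \<and>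
     (\<forall>i x. ((\<lambda>s. iter_pd is f (x + s *\<^sub>R axis i 1)) has_vector_derivative iter_pd (i # is) f x) (at 0)))"

definition div_free :: "vf \<Rightarrow> bool" where
  "div_free \<phi> \<longleftrightarrow> (\<forall>x. (\<Sum>i\<in>UNIV. pd i \<phi> x $ i) = 0)"

definition D_per :: "real^3 \<Rightarrow> vf set" where
  "D_per L = {\<phi>. smooth_fun \<phi> \<and> div_free \<phi> \<and> (\<forall>i x. \<phi> (x + (L $ i) *\<^sub>R axis i 1) = \<phi> x) \<and>
                  set_lebesgue_integral lborel (box 0 L) \<phi> = 0}"

definition D_noslip :: "(real^3) set \<Rightarrow> vf set" where
  "D_noslip \<Omega> = {\<phi>. smooth_fun \<phi> \<and> div_free \<phi> \<and> compact (closure {x. \<phi> x \<noteq> 0}) \<and>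
                      closure {x. \<phi> x \<noteq> 0} \<subseteq> \<Omega>}"

definition smooth_domain :: "(real^3) set \<Rightarrow> bool" where
  "smooth_domain \<Omega> \<longleftrightarrow> open \<Omega> \<and> connected \<Omega> \<and> bounded \<Omega> \<and> \<Omega> \<noteq> {} \<and>
     (\<forall>p\<in>frontier \<Omega>. \<exists>r>0. \<exists>(R :: real^3 \<Rightarrow> real^3) \<gamma>. orthogonal_transformation R \<and> smooth_fun (\<gamma> :: real^2 \<Rightarrow> real) \<and>
        \<Omega> \<inter> ball p r = {x\<in>ball p r. R (x - p) $ 3 < \<gamma> (vector [R (x - p) $ 1, R (x - p) $ 2])})"

definition NSE_setting :: "(real^3) set \<Rightarrow> vf set \<Rightarrow> bool" where
  "NSE_setting \<Omega> D \<longleftrightarrow>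
     (\<exists>L::real^3. (\<forall>i. L $ i > 0) \<and> \<Omega> = box 0 L \<and> D = D_per L) \<or>
     (smooth_domain \<Omega> \<and> D = D_noslip \<Omega>)"

definition L2sq :: "(real^3) set \<Rightarrow> (real^3 \<Rightarrow> 'b::real_normed_vector) \<Rightarrow> ennreal" where
  "L2sq \<Omega> w = (\<integral>\<^sup>+x. ennreal ((norm (w x))\<^sup>2) * indicator \<Omega> x \<partial>lborel)"

definition Hspace :: "(real^3) set \<Rightarrow> vf set \<Rightarrow> vf set" where
  "Hspace \<Omega> D = {u. u \<in> borel_measurable lborel \<and> L2sq \<Omega> u < \<infinity> \<and>
      (\<exists>\<phi>. (\<forall>n. \<phi> n \<in> D) \<and> (\<lambda>n. L2sq \<Omega> (\<lambda>x. \<phi> n x - u x)) \<longlonglongrightarrow> 0)}"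

definition ip :: "(real^3) set \<Rightarrow> vf \<Rightarrow> vf \<Rightarrow> real" where
  "ip \<Omega> u v = set_lebesgue_integral lborel \<Omega> (\<lambda>x. u x \<bullet> v x)"

definition Hnorm :: "(real^3) set \<Rightarrow> vf \<Rightarrow> real" where
  "Hnorm \<Omega> u = sqrt (ip \<Omega> u u)"

text \<open>phi is a sequence of test fields converging to u in H^1, G being the limit of the
  partial derivatives (so G i is the weak derivative of u in direction i).\<close>
definition H1_approx :: "(real^3) set \<Rightarrow> vf set \<Rightarrow> vf \<Rightarrow> (nat \<Rightarrow> vf) \<Rightarrow> (3 \<Rightarrow> vf) \<Rightarrow> bool" where
  "H1_approx \<Omega> D u \<phi> G \<longleftrightarrow> (\<forall>n. \<phi> n \<in> D) \<and> (\<lambda>n. L2sq \<Omega> (\<lambda>x. \<phi> n x - u x)) \<longlonglongrightarrow> 0 \<and>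
     (\<forall>i. G i \<in> borel_measurable lborel \<and> L2sq \<Omega> (G i) < \<infinity> \<and>
          (\<lambda>n. L2sq \<Omega> (\<lambda>x. pd i (\<phi> n) x - G i x)) \<longlonglongrightarrow> 0)"

definition Vspace :: "(real^3) set \<Rightarrow> vf set \<Rightarrow> vf set" where
  "Vspace \<Omega> D = {u\<in>Hspace \<Omega> D. \<exists>\<phi> G. H1_approx \<Omega> D u \<phi> G}"

definition Vgrad :: "(real^3) set \<Rightarrow> vf set \<Rightarrow> vf \<Rightarrow> 3 \<Rightarrow> vf" where
  "Vgrad \<Omega> D u = (SOME G. \<exists>\<phi>. H1_approx \<Omega> D u \<phi> G)"

definition Vip :: "(real^3) set \<Rightarrow> vf set \<Rightarrow> vf \<Rightarrow> vf \<Rightarrow> real" where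
  "Vip \<Omega> D u v = (\<Sum>i\<in>UNIV. ip \<Omega> (Vgrad \<Omega> D u i) (Vgrad \<Omega> D v i))"

definition Vnorm :: "(real^3) set \<Rightarrow> vf set \<Rightarrow> vf \<Rightarrow> real" where
  "Vnorm \<Omega> D u = sqrt (Vip \<Omega> D u u)"

definition btri :: "(real^3) set \<Rightarrow> vf set \<Rightarrow> vf \<Rightarrow> vf \<Rightarrow> vf \<Rightarrow> real" where
  "btri \<Omega> D u w v = set_lebesgue_integral lborel \<Omega>
      (\<lambda>x. \<Sum>i\<in>UNIV. \<Sum>j\<in>UNIV. (u x $ i) * (Vgrad \<Omega> D w i x $ j) * (v x $ j))"

definition borel_of :: "'a topology \<Rightarrow> 'a measure" where
  "borel_of X = sigma (topspace X) {U. openin X U}"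

definition Hw :: "(real^3) set \<Rightarrow> vf set \<Rightarrow> vf topology" where
  "Hw \<Omega> D = topology (\<lambda>U. U \<subseteq> Hspace \<Omega> D \<and>
     (\<forall>u\<in>U. \<exists>F \<epsilon>. finite F \<and> F \<subseteq> Hspace \<Omega> D \<and> \<epsilon> > 0 \<and>
        {v\<in>Hspace \<Omega> D. \<forall>\<phi>\<in>F. \<bar>ip \<Omega> v \<phi> - ip \<Omega> u \<phi>\<bar> < \<epsilon>} \<subseteq> U))"

definition weakly_cont :: "(real^3) set \<Rightarrow> vf set \<Rightarrow> real set \<Rightarrow> (real \<Rightarrow> vf) \<Rightarrow> bool" where
  "weakly_cont \<Omega> D I u \<longleftrightarrow> (\<forall>\<phi>\<in>Hspace \<Omega> D. continuous_on I (\<lambda>t. ip \<Omega> (u t) \<phi>))"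

text \<open>C_loc(I,H_w); trajectories are extended by 0 outside I.\<close>
definition Cloc :: "(real^3) set \<Rightarrow> vf set \<Rightarrow> real set \<Rightarrow> (real \<Rightarrow> vf) set" where
  "Cloc \<Omega> D I = {u. (\<forall>t\<in>I. u t \<in> Hspace \<Omega> D) \<and> (\<forall>t. t \<notin> I \<longrightarrow> u t = (\<lambda>x. 0)) \<and> weakly_cont \<Omega> D I u}"

definition Cloc_top :: "(real^3) set \<Rightarrow> vf set \<Rightarrow> real set \<Rightarrow> (real \<Rightarrow> vf) topology" where
  "Cloc_top \<Omega> D I = topology (\<lambda>U. U \<subseteq> Cloc \<Omega> D I \<and>
     (\<forall>u\<in>U. \<exists>K F \<epsilon>. compact K \<and> K \<subseteq> I \<and> finite F \<and> F \<subseteq> Hspace \<Omega> D \<and> \<epsilon> > 0 \<and>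
        {v\<in>Cloc \<Omega> D I. \<forall>t\<in>K. \<forall>\<phi>\<in>F. \<bar>ip \<Omega> (v t) \<phi> - ip \<Omega> (u t) \<phi>\<bar> < \<epsilon>} \<subseteq> U))"

definition test_fun :: "real set \<Rightarrow> (real \<Rightarrow> real) \<Rightarrow> bool" where
  "test_fun J \<theta> \<longleftrightarrow> (\<forall>n x. (deriv ^^ n) \<theta> field_differentiable (at x)) \<and>
      compact (closure {t. \<theta> t \<noteq> 0}) \<and> closure {t. \<theta> t \<noteq> 0} \<subseteq> J"

definition weak_solution ::
  "(real^3) set \<Rightarrow> vf set \<Rightarrow> real \<Rightarrow> vf \<Rightarrow> real set \<Rightarrow> (real \<Rightarrow> vf) \<Rightarrow> bool" where
  "weak_solution \<Omega> D \<nu> f I u \<longleftrightarrow>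
     \<comment> \<open>u in L-infinity-loc(I;H)\<close>
     (\<forall>t\<in>I. u t \<in> Hspace \<Omega> D) \<and>
     (\<forall>K. compact K \<and> K \<subseteq> I \<longrightarrow> (\<exists>C. AE t in lborel. t \<in> K \<longrightarrow> Hnorm \<Omega> (u t) \<le> C)) \<and>
     \<comment> \<open>u in L2-loc(I;V)\<close>
     (AE t in lborel. t \<in> I \<longrightarrow> u t \<in> Vspace \<Omega> D) \<and>
     (\<forall>K. compact K \<and> K \<subseteq> I \<longrightarrow>
        (\<integral>\<^sup>+t. ennreal ((Vnorm \<Omega> D (u t))\<^sup>2) * indicator K t \<partial>lborel) < \<infinity>) \<and>
     \<comment> \<open>weak continuity into H\<close>
     weakly_cont \<Omega> D I u \<and>
     \<comment> \<open>g = du/dt in L^{4/3}-loc(I;V') (h dominates its V'-norm), and the equation in V'\<close>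
     (\<exists>g :: real \<Rightarrow> vf \<Rightarrow> real. \<exists>h :: real \<Rightarrow> real.
        (AE t in lborel. t \<in> I \<longrightarrow> (\<forall>v\<in>Vspace \<Omega> D. \<bar>g t v\<bar> \<le> h t * Vnorm \<Omega> D v)) \<and>
        (\<forall>K. compact K \<and> K \<subseteq> I \<longrightarrow>
           (\<integral>\<^sup>+t. ennreal (\<bar>h t\<bar> powr (4/3)) * indicator K t \<partial>lborel) < \<infinity>) \<and>
        (\<forall>v\<in>Vspace \<Omega> D. \<forall>\<theta>. test_fun (interior I) \<theta> \<longrightarrow>
           integrable lborel (\<lambda>t. ip \<Omega> (u t) v * deriv \<theta> t) \<and>
           integrable lborel (\<lambda>t. g t v * \<theta> t) \<and>
           - (\<integral>t. ip \<Omega> (u t) v * deriv \<theta> t \<partial>lborel) = (\<integral>t. g t v * \<theta> t \<partial>lborel)) \<and>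
        (AE t in lborel. t \<in> I \<longrightarrow>
           (\<forall>v\<in>Vspace \<Omega> D. g t v + \<nu> * Vip \<Omega> D (u t) v + btri \<Omega> D (u t) (u t) v = ip \<Omega> f v))) \<and>
     \<comment> \<open>energy inequality for a.e. t'\<close>
     (AE t' in lborel. t' \<in> I \<longrightarrow> (\<forall>t\<in>I. t' < t \<longrightarrow>
        (Hnorm \<Omega> (u t))\<^sup>2 / 2 + \<nu> * set_lebesgue_integral lborel {t'..t} (\<lambda>s. (Vnorm \<Omega> D (u s))\<^sup>2)
          \<le> (Hnorm \<Omega> (u t'))\<^sup>2 / 2 + set_lebesgue_integral lborel {t'..t} (\<lambda>s. ip \<Omega> f (u s)))) \<and>
     \<comment> \<open>strong right continuity at a left endpoint belonging to I\<close>
     (\<forall>t0\<in>I. (\<forall>t\<in>I. t0 \<le> t) \<longrightarrow> ((\<lambda>t. Hnorm \<Omega> (\<lambda>x. u t x - u t0 x)) \<longlongrightarrow> 0) (at t0 within I))"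

definition U_sharp :: "(real^3) set \<Rightarrow> vf set \<Rightarrow> real \<Rightarrow> vf \<Rightarrow> real set \<Rightarrow> (real \<Rightarrow> vf) set" where
  "U_sharp \<Omega> D \<nu> f I = {u\<in>Cloc \<Omega> D I. weak_solution \<Omega> D \<nu> f (interior I) u}"

definition W_sol :: "(real^3) set \<Rightarrow> vf set \<Rightarrow> real \<Rightarrow> vf \<Rightarrow> (real \<Rightarrow> vf) set" where
  "W_sol \<Omega> D \<nu> f = {u. weak_solution \<Omega> D \<nu> f UNIV u \<and> (\<exists>C. \<forall>t. Hnorm \<Omega> (u t) \<le> C)}"

definition weak_attractor :: "(real^3) set \<Rightarrow> vf set \<Rightarrow> real \<Rightarrow> vf \<Rightarrow> vf set" where
  "weak_attractor \<Omega> D \<nu> f = (\<lambda>u. u 0) ` W_sol \<Omega> D \<nu> f"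

definition admissible_psi :: "(real \<Rightarrow> real) \<Rightarrow> bool" where
  "admissible_psi \<psi> \<longleftrightarrow> (\<forall>x\<ge>0. \<psi> x \<ge> 0) \<and> mono_on {0..} \<psi> \<and>
     (\<exists>\<psi>'. (\<forall>x\<ge>0. (\<psi> has_real_derivative \<psi>' x) (at x within {0..})) \<and>
           continuous_on {0..} \<psi>' \<and> bounded (\<psi>' ` {0..}))"

definition VF_measure ::
  "(real^3) set \<Rightarrow> vf set \<Rightarrow> real \<Rightarrow> vf \<Rightarrow> real set \<Rightarrow> (real \<Rightarrow> vf) measure \<Rightarrow> bool" where
  "VF_measure \<Omega> D \<nu> f I \<rho> \<longleftrightarrow>
     sets \<rho> = sets (borel_of (Cloc_top \<Omega> D I)) \<and> prob_space \<rho> \<and>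
     emeasure \<rho> (U_sharp \<Omega> D \<nu> f I) = 1 \<and>
     (\<forall>K. compact K \<and> K \<subseteq> I \<longrightarrow>
        (\<exists>C. AE t in lborel. t \<in> K \<longrightarrow> (\<integral>\<^sup>+u. ennreal ((Hnorm \<Omega> (u t))\<^sup>2) \<partial>\<rho>) \<le> ennreal C)) \<and>
     (\<forall>t0\<in>I. (\<forall>t\<in>I. t0 \<le> t) \<longrightarrow> (\<forall>\<psi>. admissible_psi \<psi> \<longrightarrow>
        ((\<lambda>t. \<integral>\<^sup>+u. ennreal (\<psi> ((Hnorm \<Omega> (u t))\<^sup>2)) \<partial>\<rho>)
            \<longlongrightarrow> (\<integral>\<^sup>+u. ennreal (\<psi> ((Hnorm \<Omega> (u t0))\<^sup>2)) \<partial>\<rho>)) (at_right t0) \<and>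
        (\<integral>\<^sup>+u. ennreal (\<psi> ((Hnorm \<Omega> (u t0))\<^sup>2)) \<partial>\<rho>) < \<infinity>))"

definition shift :: "real set \<Rightarrow> real \<Rightarrow> (real \<Rightarrow> vf) \<Rightarrow> (real \<Rightarrow> vf)" where
  "shift I \<tau> u = (\<lambda>t. if t \<in> I then u (t + \<tau>) else (\<lambda>x. 0))"

definition invariant_measure :: "real set \<Rightarrow> (real \<Rightarrow> vf) measure \<Rightarrow> bool" where
  "invariant_measure I \<rho> \<longleftrightarrow> (\<forall>\<tau>\<ge>0. \<forall>E\<in>sets \<rho>.
      emeasure \<rho> (shift I \<tau> -` E \<inter> space \<rho>) = emeasure \<rho> E)"

definition VF_stationary :: "(real^3) set \<Rightarrow> vf set \<Rightarrow> real \<Rightarrow> vf \<Rightarrow> vf measure \<Rightarrow> bool" where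
  "VF_stationary \<Omega> D \<nu> f \<rho>0 \<longleftrightarrow>
     sets \<rho>0 = sets (borel_of (Hw \<Omega> D)) \<and> prob_space \<rho>0 \<and>
     (\<exists>I \<rho>. is_interval I \<and> (\<forall>a. \<exists>t\<in>I. a < t) \<and>
        VF_measure \<Omega> D \<nu> f I \<rho> \<and> invariant_measure I \<rho> \<and>
        (\<forall>t\<in>I. \<rho>0 = distr \<rho> (borel_of (Hw \<Omega> D)) (\<lambda>u. u t)))"

definition Hsupp :: "(real^3) set \<Rightarrow> vf set \<Rightarrow> vf measure \<Rightarrow> vf set" where
  "Hsupp \<Omega> D \<rho>0 = {x\<in>Hspace \<Omega> D. \<forall>U. openin (Hw \<Omega> D) U \<and> x \<in> U \<longrightarrow> emeasure \<rho>0 U > 0}"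

end

theory Submission
  imports Defs "HOL-Complex_Analysis.Great_Picard"
begin

text \<open>
  The weak formulation only involves $L^2$ classes, so trajectories are studied as weakly continuous curves in one
  Hilbert space. By the energy inequality and the Poincare inequality every weak solution on a half-line enters a fixed
  ball. Stationarity makes the mass outside this ball independent of time, hence zero, and almost every trajectory
  stays in the ball for all times. Bounded families of weak solutions are compact: they are equicontinuous against test
  fields, Friedrichs' inequality upgrades weak to strong $L^2$ convergence, and the energy inequality passes to the
  limit at almost every initial time. Hence the set of initial states of solutions on $(-n,\infty)$ bounded by the
  radius is weakly closed; it has full measure, since a stationary state can be observed at a late time. A diagonal
  limit as $n \to \infty$ shows that almost every state lies on a bounded complete solution.
\<close>

text \<open>Weak solutions are not known to be unique, so there is no semigroup with which to push
  measures; sets of trajectories and of initial states take its place. A measure sees only Borel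
  sets of the weak topology, which is not metrizable on \<open>H\<close>, so every set of states in
  play must be weakly closed or a countable union of such sets. The energy inequality holds only
  from almost every initial time and contains \<open>|u(t')|^2\<close>, which is not weakly
  continuous; hence the effort spent on strong convergence at almost every time. To keep limits
  easy, the equation is tested with smooth fields only: all derivatives are moved onto the test
  field and the right-hand side becomes continuous on \<open>L^2\<close>. The bound on the time
  derivative in \<open>V'\<close> is not carried through the limits; the Sobolev inequality restores
  it at the end, for complete solutions only. Absorption times vary with the trajectory, but each is
  finite, and dominated convergence along late times needs no more. Fields are functions rather than
  classes, and off \<open>V\<close> the chosen gradient is a junk value; the map \<open>cl\<close>
  to classes and a few measurability arguments absorb both.\<close>

abbreviation (input) seq_lim :: "(nat => 'a::topological_space) => 'a => bool" (infix "---->" 60) where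
 "X ----> l \<equiv> X \<longlonglongrightarrow> l"

abbreviation (input) eventually_seq :: "(nat => bool) => bool" (binder "EV " 10) where
 "eventually_seq P \<equiv> eventually P sequentially"

section \<open>Convex sets and weak limits in Hilbert spaces\<close>

text \<open>Parallelogram identity: the midpoint of \<open>x\<close> and \<open>y\<close> lies in
  \<open>S\<close>, so its norm is at least \<open>d\<close>. Near-minimizers of the norm are
  therefore close to each other.\<close>

lemma convex_norm_gap:
 fixes S :: "'a::real_inner set"
 assumes S: "convex S" and x: "x \<in> S" and y: "y \<in> S" and d: "\<forall>z\<in>S. d <= norm z" "0 <= d"
 shows "(norm (x - y))^2 <= 2 * ((norm x)^2 - d\<^sup>2) + 2 * ((norm y)^2 - d\<^sup>2)"
proof -
 have "(1/2) *\<^sub>R x + (1/2) *\<^sub>R y \<in> S"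
  using convexD[OF S x y, of "1/2" "1/2"] by simp
 hence "d\<^sup>2 <= (norm ((1/2) *\<^sub>R x + (1/2) *\<^sub>R y))^2"
  using d by (intro power_mono) auto
 also have "\<dots> = (norm x)^2 / 4 + (norm y)^2 / 4 + (x \<bullet> y) / 2"
  by (simp add: power2_norm_eq_inner inner_add inner_commute algebra_simps)
 finally have "4 * d\<^sup>2 <= (norm x)^2 + (norm y)^2 + 2 * (x \<bullet> y)" by simp
 moreover have "(norm (x - y))^2 = (norm x)^2 + (norm y)^2 - 2 * (x \<bullet> y)"
  by (simp add: power2_norm_eq_inner inner_diff inner_commute algebra_simps)
 ultimately show ?thesis by simp
qed

lemma Cauchy_norm_sq_bound:
 fixes p :: "nat => 'a::real_normed_vector"
 assumes "!!m n. n <= m ==> (norm (p m - p n))^2 <= e n" and e: "e ----> 0"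
 shows "Cauchy p"
proof (rule CauchyI')
 fix r :: real assume r: "r > 0"
 hence "EV n. e n < r\<^sup>2"
  using e by (intro order_tendstoD(2)[OF e]) auto
 then obtain N where N: "e n < r\<^sup>2" if "n \<ge> N" for n by (auto simp: eventually_sequentially)
 have "norm (p m - p n) < r" if "n \<ge> N" "m > n" for m n
 proof -
  have "(norm (p m - p n))^2 < r\<^sup>2" using assms(1)[of n m] N[of n] that by auto
  thus ?thesis using r by (simp add: power2_less_imp_less)
 qed
 thus "\<exists>M. \<forall>m\<ge>M. \<forall>n>m. dist (p m) (p n) < r"
  by (metis norm_minus_commute dist_norm)
qed

text \<open>By the gap inequality every minimizing sequence is Cauchy.\<close>

lemma closed_convex_min_norm:
 fixes S :: "'a::{real_inner,complete_space} set"
 assumes "closed S" "convex S" "S \<noteq> {}"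
 obtains p where "p \<in> S" "!!y. y \<in> S ==> norm p <= norm y"
proof -
 define d where "d = Inf (norm ` S)"
 have bdd: "bdd_below (norm ` S)" by (rule bdd_belowI[of _ 0]) auto
 have dle: "\<forall>z\<in>S. d <= norm z"
  unfolding d_def using bdd by (simp add: cINF_lower)
 have d0: "0 <= d" unfolding d_def using assms(3) by (intro cINF_greatest) auto
 have "\<exists>y\<in>S. (norm y)^2 < d\<^sup>2 + 1 / real (Suc n)" for n
 proof -
  have "d < sqrt (d\<^sup>2 + 1 / real (Suc n))" by (rule real_less_rsqrt) simp
  then obtain y where y: "y \<in> S" "norm y < sqrt (d\<^sup>2 + 1 / real (Suc n))"
   using cInf_lessD[of "norm ` S"] assms(3) unfolding d_def by blast
  have "(norm y)^2 < (sqrt (d\<^sup>2 + 1 / real (Suc n)))^2"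
   using y by (intro power_strict_mono) auto
  thus ?thesis using y(1) by (auto intro!: bexI[of _ y])
 qed
 then obtain y where y: "!!n. y n \<in> S" "!!n. (norm (y n))^2 < d\<^sup>2 + 1 / real (Suc n)" by metis
 have "Cauchy y"
 proof (rule Cauchy_norm_sq_bound[where e="%n. 4 * (1 / real (Suc n))"])
  fix m n :: nat assume "n <= m"
  hence "1 / real (Suc m) <= 1 / real (Suc n)" by (simp add: frac_le)
  thus "(norm (y m - y n))^2 <= 4 * (1 / real (Suc n))"
   using convex_norm_gap[OF assms(2) y(1)[of m] y(1)[of n] dle d0] y(2)[of n] y(2)[of m]
   by (smt (verit))
 next
  have "(%n. 4 * (1 / real (Suc n))) ----> 4 * 0" by (intro tendsto_intros lim_1_over_n[THEN LIMSEQ_Suc])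
  thus "(%n. 4 * (1 / real (Suc n))) ----> 0" by simp
 qed
 then obtain p where p: "y ----> p" using Cauchy_convergent convergent_def by blast
 have "p \<in> S" using closed_sequentially[OF assms(1)] y(1) p by blast
 moreover have "norm p <= norm z" if "z \<in> S" for z
 proof -
  have "(norm p)^2 <= d\<^sup>2 + 0"
  proof (rule LIMSEQ_le)
   show "(%n. (norm (y n))^2) ----> (norm p)^2" by (intro tendsto_intros p)
   show "(%n. d\<^sup>2 + 1 / real (Suc n)) ----> d\<^sup>2 + 0" by (intro tendsto_intros lim_1_over_n[THEN LIMSEQ_Suc])
  qed (use y(2) less_imp_le in blast)
  hence "norm p <= d" using d0 power2_le_imp_le[of "norm p" d] by simp
  thus ?thesis using dle that by force
 qed
 ultimately show ?thesis by (rule that)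
qed

text \<open>Move \<open>x\<close> to the origin and take the point of least norm; the inequality is
  the first-order condition along segments inside \<open>S\<close>.\<close>

lemma closed_convex_nearest:
 fixes S :: "'a::{real_inner,complete_space} set"
 assumes "closed S" "convex S" "S \<noteq> {}"
 obtains p where "p \<in> S" "!!y. y \<in> S ==> (y - p) \<bullet> (x - p) <= 0"
proof -
 have "closed ((%y. y - x) ` S)" "convex ((%y. y - x) ` S)" "(%y. y - x) ` S \<noteq> {}"
  using closed_translation_subtract[OF assms(1), of x] convex_translation_subtract[OF assms(2), of x] assms(3)
  by auto
 then obtain q where q: "q \<in> (%y. y - x) ` S" "!!y. y \<in> (%y. y - x) ` S ==> norm q <= norm y"
  using closed_convex_min_norm by metis
 then obtain p where p: "p \<in> S" "q = p - x" by auto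
 have min: "norm (p - x) <= norm (y - x)" if "y \<in> S" for y using q(2) p(2) that by auto
 have "(y - p) \<bullet> (x - p) <= 0" if y: "y \<in> S" for y
 proof (rule ccontr)
  assume neg: "\<not> (y - p) \<bullet> (x - p) <= 0"
  define c where "c = (y - p) \<bullet> (x - p)"
  define n where "n = (norm (y - p))^2"
  have c: "c > 0" using neg c_def by simp
  have n: "n > 0" using c unfolding n_def c_def by auto
  \<comment> \<open>Moving by \<open>t\<close> towards \<open>y\<close> changes the squared distance
    by \<open>t * t * n - 2 * t * c\<close>; \<open>t * n <= c\<close> keeps this negative, and
    \<open>t <= 1\<close> keeps the point in \<open>S\<close>.\<close>
  define t where "t = min 1 (c / n)"
  have t: "0 < t" "t <= 1" "t * n <= c" using c n by (auto simp: t_def field_simps min_def)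
  have "p + t *\<^sub>R (y - p) \<in> S"
   using convexD_alt[OF assms(2) p(1) y, of t] t by (simp add: algebra_simps)
  hence "(norm (p - x))^2 <= (norm (p + t *\<^sub>R (y - p) - x))^2"
   using min by (intro power_mono) auto
  also have "\<dots> = (norm ((p - x) + t *\<^sub>R (y - p)))^2" by (simp add: algebra_simps)
  also have "\<dots> = (norm (p - x))^2 + 2 * t * ((p - x) \<bullet> (y - p)) + t * t * n"
   unfolding n_def power2_norm_eq_inner
   by (simp add: inner_add_left inner_add_right inner_commute[of "y - p" "p - x"] distrib_left)
  also have "(p - x) \<bullet> (y - p) = - c" unfolding c_def
   by (simp add: inner_commute[of "y - p"] flip: inner_minus_left)
  finally have "2 * t * c <= t * (t * n)" by simp
  also have "\<dots> <= t * c" using t by (intro mult_left_mono) auto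
  finally show False using t c by simp
 qed
 thus ?thesis using p(1) that by blast
qed

text \<open>In a subspace the variational inequality can be used in the directions \<open>s\<close>
  and \<open>- s\<close>, so it becomes an equality.\<close>

lemma closed_subspace_projection:
 fixes S :: "'a::{real_inner,complete_space} set"
 assumes "closed S" "subspace S"
 obtains p where "p \<in> S" "!!s. s \<in> S ==> s \<bullet> x = s \<bullet> p"
proof -
 obtain p where p: "p \<in> S" "!!y. y \<in> S ==> (y - p) \<bullet> (x - p) <= 0"
  using closed_convex_nearest[of S x] assms subspace_imp_convex subspace_0 by (metis empty_iff)
 have "s \<bullet> (x - p) = 0" if "s \<in> S" for s
 proof -
  have "p + s \<in> S" "p - s \<in> S" using assms(2) p(1) that by (auto intro: subspace_add subspace_diff)
  from p(2)[OF this(1)] p(2)[OF this(2)] show ?thesis by simp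
 qed
 thus ?thesis using p(1) that by (simp add: inner_diff_right)
qed

text \<open>Separate \<open>x\<close> from \<open>S\<close> by the hyperplane at the nearest point.
  The filter is arbitrary because lower semicontinuity of gradients is later read along a filter
  finer than \<open>sequentially\<close>.\<close>

lemma closed_convex_weakly_closed:
 fixes S :: "'a::{real_inner,complete_space} set"
 assumes "closed S" "convex S" "F \<noteq> bot" "\<forall>\<^sub>F n in F. z n \<in> S"
  and lim: "!!w. ((%n. z n \<bullet> w) \<longlongrightarrow> x \<bullet> w) F"
 shows "x \<in> S"
proof -
 have "S \<noteq> {}" using assms(3,4) eventually_happens' by fastforce
 then obtain p where p: "p \<in> S" "!!y. y \<in> S ==> (y - p) \<bullet> (x - p) <= 0"
  using closed_convex_nearest[of S x] assms by metis
 have "((%n. z n \<bullet> (x - p) - p \<bullet> (x - p)) \<longlongrightarrow> x \<bullet> (x - p) - p \<bullet> (x - p)) F"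
  by (intro tendsto_intros lim)
 hence "((%n. (z n - p) \<bullet> (x - p)) \<longlongrightarrow> (x - p) \<bullet> (x - p)) F" by (simp add: inner_diff_left)
 hence "(x - p) \<bullet> (x - p) <= 0"
  by (rule tendsto_upperbound) (use assms p in \<open>auto elim: eventually_mono\<close>)
 hence "x - p = 0" by (metis inner_eq_zero_iff inner_ge_zero order_antisym)
 thus ?thesis using p(1) by simp
qed

text \<open>The least norms of the sets \<open>S n\<close> increase and are bounded, so they
  converge, and \<open>convex_norm_gap\<close> makes the minimizers a Cauchy sequence.\<close>

lemma nested_closed_convex_Inter:
 fixes S :: "nat => 'a::{real_inner,complete_space} set"
 assumes "!!n. closed (S n)" "!!n. convex (S n)" "!!n. S n \<noteq> {}" "decseq S" "S 0 \<subseteq> cball 0 B"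
 shows "\<exists>z. \<forall>n. z \<in> S n"
proof -
 have "\<exists>p. p \<in> S n \<and> (\<forall>y\<in>S n. norm p <= norm y)" for n
  using closed_convex_min_norm[of "S n"] assms(1-3) by metis
 then obtain p where p: "!!n. p n \<in> S n" "!!n y. y \<in> S n ==> norm (p n) <= norm y" by metis
 have sub: "S m \<subseteq> S n" if "n <= m" for m n using assms(4) that by (auto simp: decseq_def)
 define c where "c n = (norm (p n))^2" for n
 have "incseq c" unfolding c_def incseq_def
  using p sub by (simp add: power_mono subset_iff)
 moreover have cB: "c n <= B\<^sup>2" for n
  using p(1)[of n] sub[of 0 n] assms(5) unfolding c_def by (intro power_mono) auto
 ultimately obtain l where l: "c ----> l" "!!n. c n <= l"
  using incseq_convergent[of c "B\<^sup>2"] by metis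
 have "Cauchy p"
 proof (rule Cauchy_norm_sq_bound[where e="%n. 2 * (l - c n)"])
  fix m n :: nat assume "n <= m"
  hence "p m \<in> S n" using p(1) sub by blast
  from convex_norm_gap[OF assms(2) this p(1), of "norm (p n)"] p(2) l(2)[of m]
  show "(norm (p m - p n))^2 <= 2 * (l - c n)" by (simp add: c_def)
 next
  have "(%n. 2 * (l - c n)) ----> 2 * (l - l)" by (intro tendsto_intros l)
  thus "(%n. 2 * (l - c n)) ----> 0" by simp
 qed
 then obtain z where z: "p ----> z" using Cauchy_convergent convergent_def by blast
 have "z \<in> S n" for n
 proof (rule Lim_in_closed_set[OF assms(1) _ _ z])
  show "EV k. p k \<in> S n"
   using p(1) sub by (auto simp: eventually_sequentially intro!: exI[of _ n])
 qed auto
 thus ?thesis by blast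
qed

text \<open>Stands in for weak sequential compactness, with no subsequence extracted:
  \<open>x\<close> is common to the closed convex hulls of all tails. A functional that converges
  along \<open>z\<close> confines the tails to thin slabs, which fixes its value at
  \<open>x\<close>.\<close>

lemma bounded_weak_cluster:
 fixes z :: "nat => 'a::{real_inner,complete_space}"
 assumes B: "!!n. norm (z n) <= B"
 obtains x where "!!S. closed S ==> convex S ==> EV n. z n \<in> S ==> x \<in> S"
  and "!!w l. (%n. z n \<bullet> w) ----> l ==> x \<bullet> w = l"
proof -
 define S where "S n = closure (convex hull (z ` {n..}))" for n
 have "\<exists>x. \<forall>n. x \<in> S n"
 proof (rule nested_closed_convex_Inter)
  show "decseq S" unfolding decseq_def S_def
   by (intro allI impI closure_mono hull_mono image_mono) auto
  show "S 0 \<subseteq> cball 0 B" unfolding S_def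
   by (intro closure_minimal hull_minimal) (auto simp: B)
 qed (auto simp: S_def)
 then obtain x where x: "!!n. x \<in> S n" by blast
 have 1: "x \<in> T" if T: "closed T" "convex T" "EV n. z n \<in> T" for T
 proof -
  obtain n where "!!k. k \<ge> n ==> z k \<in> T" using T(3) by (auto simp: eventually_sequentially)
  hence "S n \<subseteq> T" unfolding S_def by (intro closure_minimal hull_minimal) (auto simp: T)
  thus ?thesis using x by blast
 qed
 have "x \<bullet> w = l" if l: "(%n. z n \<bullet> w) ----> l" for w l
 proof -
  have "\<bar>x \<bullet> w - l\<bar> <= e" if e: "e > 0" for e
  proof -
   define T where "T = {y. w \<bullet> y <= l + e} \<inter> {y. w \<bullet> y \<ge> l - e}"
   have "closed T" "convex T" unfolding T_def
    by (auto intro!: closed_Int closed_halfspace_le closed_halfspace_ge convex_Int convex_halfspace_le convex_halfspace_ge)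
   moreover have "EV n. z n \<in> T"
    using tendstoD[OF l e] by eventually_elim (auto simp: T_def dist_real_def inner_commute)
   ultimately have "x \<in> T" by (rule 1)
   thus ?thesis by (auto simp: T_def inner_commute)
  qed
  hence "\<bar>x \<bullet> w - l\<bar> <= 0" by (metis add_0 field_le_epsilon)
  thus ?thesis by simp
 qed
 with 1 show ?thesis by (rule that)
qed

section \<open>The Hilbert space of square integrable vector fields\<close>

definition l2fun :: "vf => bool" where
 "l2fun f \<longleftrightarrow> f \<in> borel_measurable lborel \<and> integrable lborel (%x. (norm (f x))^2)"

lemma l2fun_measurable [measurable_dest]: "l2fun f ==> f \<in> borel_measurable borel"
 by (simp add: l2fun_def)

lemma l2fun_mono:
 assumes "l2fun g" "f \<in> borel_measurable borel" "!!x. norm (f x) <= c * norm (g x)"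
 shows "l2fun f"
proof -
 have "integrable lborel (%x. (norm (f x))^2)"
 proof (rule Bochner_Integration.integrable_bound)
  show "integrable lborel (%x. c\<^sup>2 * (norm (g x))^2)" using assms(1) by (simp add: l2fun_def)
  show "AE x in lborel. norm ((norm (f x))^2) <= norm (c\<^sup>2 * (norm (g x))^2)"
   using power_mono[OF assms(3), of _ 2] by (auto simp: power_mult_distrib)
 qed (use assms(2) in measurable)
 thus ?thesis using assms(2) by (simp add: l2fun_def)
qed

lemma l2fun_0: "l2fun (%x. 0)" by (simp add: l2fun_def)

lemma l2fun_scale: "l2fun f ==> l2fun (%x. c *\<^sub>R f x)"
 by (rule l2fun_mono[where c="\<bar>c\<bar>"]) (auto simp: l2fun_def)

lemma l2fun_minus: "l2fun f ==> l2fun (%x. - f x)"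
 using l2fun_scale[of f "-1"] by simp

lemma norm_add_sq_le: "(norm (a + b :: 'a::real_normed_vector))^2 <= 2 * (norm a)^2 + 2 * (norm b)^2"
proof -
 have "(norm (a + b))^2 <= (norm a + norm b)^2" by (intro power_mono norm_triangle_ineq) auto
 also have "\<dots> <= 2 * (norm a)^2 + 2 * (norm b)^2"
  using sum_squares_bound[of "norm a" "norm b"] by (simp add: power2_sum)
 finally show ?thesis .
qed

lemma l2fun_add: assumes "l2fun f" "l2fun g" shows "l2fun (%x. f x + g x)"
proof -
 have "integrable lborel (%x. (norm (f x + g x))^2)"
 proof (rule Bochner_Integration.integrable_bound)
  show "integrable lborel (%x. 2 * (norm (f x))^2 + 2 * (norm (g x))^2)"
   using assms by (simp add: l2fun_def)
 qed (use assms in \<open>auto simp: norm_add_sq_le\<close>)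
 thus ?thesis using assms by (auto simp: l2fun_def)
qed

lemma l2fun_diff: "l2fun f ==> l2fun g ==> l2fun (%x. f x - g x)"
 using l2fun_add[of f "%x. - g x"] l2fun_minus[of g] by simp

lemma integrable_mult_l2fun:
 assumes "l2fun f" "l2fun g" "h \<in> borel_measurable borel" "!!x. \<bar>h x\<bar> <= c * (norm (f x) * norm (g x))" "0 <= c"
 shows "integrable lborel (h :: real^3 => real)"
proof (rule Bochner_Integration.integrable_bound)
 show "integrable lborel (%x. c * ((norm (f x))^2 + (norm (g x))^2))"
  using assms by (simp add: l2fun_def)
 show "AE x in lborel. norm (h x) <= norm (c * ((norm (f x))^2 + (norm (g x))^2))"
 proof (rule AE_I2)
  fix x
  have "norm (f x) * norm (g x) <= (norm (f x))^2 + (norm (g x))^2"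
   using sum_squares_bound[of "norm (f x)" "norm (g x)"] mult_nonneg_nonneg[OF norm_ge_zero norm_ge_zero, of "f x" "g x"]
   by linarith
  hence "c * (norm (f x) * norm (g x)) <= c * ((norm (f x))^2 + (norm (g x))^2)"
   using assms(5) by (rule mult_left_mono)
  thus "norm (h x) <= norm (c * ((norm (f x))^2 + (norm (g x))^2))"
   using assms(4)[of x] abs_ge_self[of "c * ((norm (f x))^2 + (norm (g x))^2)"]
   unfolding real_norm_def by linarith
 qed
qed (use assms in measurable)

lemma integrable_inner_l2fun: "l2fun f ==> l2fun g ==> integrable lborel (%x. f x \<bullet> g x)"
 by (rule integrable_mult_l2fun[where f=f and g=g and c=1]) (auto simp: Cauchy_Schwarz_ineq2)

\<comment> \<open>A type rather than a carrier set, so that the type classes of Hilbert spaces and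
  the theory of Borel measurable maps apply. Fields live on the whole space; those on
  \<open>\<Omega>\<close> enter after extension by 0.\<close>
quotient_type l2 = "real^3 => real^3" / partial: "%f g. l2fun f \<and> l2fun g \<and> (AE x in lborel. f x = g x)"
 morphisms rep_l2 abs_l2
proof (rule part_equivpI)
 show "\<exists>f. l2fun f \<and> l2fun f \<and> (AE x in lborel. f x = f x)" using l2fun_0 by auto
qed (auto intro!: sympI transpI elim: AE_symmetric)

instantiation l2 :: real_inner
begin

lift_definition zero_l2 :: l2 is "%_. 0" by (simp add: l2fun_0)
lift_definition plus_l2 :: "l2 => l2 => l2" is "%f g x. f x + g x" by (auto intro: l2fun_add)
lift_definition uminus_l2 :: "l2 => l2" is "%f x. - f x" by (auto intro: l2fun_minus)
lift_definition minus_l2 :: "l2 => l2 => l2" is "%f g x. f x - g x" by (auto intro: l2fun_diff)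
lift_definition scaleR_l2 :: "real => l2 => l2" is "%c f x. c *\<^sub>R f x" by (auto intro: l2fun_scale)
lift_definition inner_l2 :: "l2 => l2 => real" is "%f g. \<integral>x. f x \<bullet> g x \<partial>lborel"
 by (rule integral_cong_AE) auto

definition norm_l2 :: "l2 => real" where "norm_l2 x = sqrt (x \<bullet> x)"
definition dist_l2 :: "l2 => l2 => real" where "dist_l2 x y = norm (x - y)"
definition sgn_l2 :: "l2 => l2" where "sgn_l2 x = inverse (norm x) *\<^sub>R x"
definition uniformity_l2 :: "(l2 \<times> l2) filter"
 where "uniformity_l2 = (INF e\<in>{0<..}. principal {(x, y). dist x y < e})"
definition open_l2 :: "l2 set => bool"
 where "open_l2 U \<longleftrightarrow> (\<forall>x\<in>U. \<forall>\<^sub>F (x', y) in uniformity. x' = x --> y \<in> U)"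

instance
proof
 fix x y z :: l2 and a b :: real
 show "x + y + z = x + (y + z)" by transfer (auto intro!: l2fun_add simp: add.assoc)
 show "x + y = y + x" by transfer (auto intro!: l2fun_add simp: add.commute)
 show "0 + x = x" by transfer (auto intro!: l2fun_add)
 show "- x + x = 0" by transfer (auto intro!: l2fun_0)
 show "x - y = x + - y" by transfer (auto intro!: l2fun_diff l2fun_add l2fun_minus)
 show "a *\<^sub>R (x + y) = a *\<^sub>R x + a *\<^sub>R y"
  by transfer (auto intro!: l2fun_add l2fun_scale simp: scaleR_right_distrib)
 show "(a + b) *\<^sub>R x = a *\<^sub>R x + b *\<^sub>R x"
  by transfer (auto intro!: l2fun_add l2fun_scale simp: scaleR_left_distrib)
 show "a *\<^sub>R b *\<^sub>R x = (a * b) *\<^sub>R x" by transfer (auto intro!: l2fun_scale)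
 show "1 *\<^sub>R x = x" by transfer auto
 show "x \<bullet> y = y \<bullet> x" by transfer (simp add: inner_commute)
 show "(x + y) \<bullet> z = x \<bullet> z + y \<bullet> z" by transfer (simp add: inner_add_left integrable_inner_l2fun)
 show "(a *\<^sub>R x) \<bullet> y = a * (x \<bullet> y)" by transfer simp
 show "0 <= x \<bullet> x" by transfer simp
 show "(x \<bullet> x = 0) = (x = 0)"
  by transfer (auto simp: integral_nonneg_eq_0_iff_AE integrable_inner_l2fun l2fun_0)
 show "norm x = sqrt (x \<bullet> x)" by (rule norm_l2_def)
 show "dist x y = norm (x - y)" by (rule dist_l2_def)
 show "sgn x = inverse (norm x) *\<^sub>R x" by (rule sgn_l2_def)
 show "uniformity = (INF e\<in>{0<..}. principal {(x :: l2, y). dist x y < e})" by (rule uniformity_l2_def)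
 show "open U = (\<forall>x\<in>U. \<forall>\<^sub>F (x', y) in uniformity. x' = x --> y \<in> U)" for U :: "l2 set"
  by (rule open_l2_def)
qed

end

lemma l2fun_rep: "l2fun (rep_l2 x)"
 using Quotient3_rep_reflp[OF Quotient3_l2] by blast

lemma abs_rep_l2 [simp]: "abs_l2 (rep_l2 x) = x"
 using Quotient3_abs_rep[OF Quotient3_l2] by blast

lemma rep_l2_measurable [measurable]: "rep_l2 x \<in> borel_measurable borel"
 using l2fun_rep by (rule l2fun_measurable)

lemma abs_l2_eq_iff: "l2fun f ==> l2fun g ==> abs_l2 f = abs_l2 g \<longleftrightarrow> (AE x in lborel. f x = g x)"
 using Quotient3_rel[OF Quotient3_l2, of f g] by auto

lemma rep_abs_l2: "l2fun f ==> AE x in lborel. rep_l2 (abs_l2 f) x = f x"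
 using abs_l2_eq_iff[of "rep_l2 (abs_l2 f)" f] l2fun_rep by simp

lemma abs_l2_add: "l2fun f ==> l2fun g ==> abs_l2 (%x. f x + g x) = abs_l2 f + abs_l2 g"
 by (simp add: plus_l2.abs_eq)

lemma abs_l2_diff: "l2fun f ==> l2fun g ==> abs_l2 (%x. f x - g x) = abs_l2 f - abs_l2 g"
 by (simp add: minus_l2.abs_eq)

lemma abs_l2_scale: "l2fun f ==> abs_l2 (%x. c *\<^sub>R f x) = c *\<^sub>R abs_l2 f"
 by (simp add: scaleR_l2.abs_eq)

lemma abs_l2_0: "abs_l2 (%x. 0) = 0" by (simp add: zero_l2_def)

lemma inner_abs_l2: "l2fun f ==> l2fun g ==> abs_l2 f \<bullet> abs_l2 g = (LBINT x. f x \<bullet> g x)"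
 by (simp add: inner_l2.abs_eq)

lemma norm_abs_l2: "l2fun f ==> (norm (abs_l2 f))^2 = (LBINT x. (norm (f x))^2)"
 by (simp add: power2_norm_eq_inner inner_abs_l2)

lemma nn_integral_l2: "l2fun f ==> (\<integral>\<^sup>+x. ennreal ((norm (f x))^2) \<partial>lborel) = ennreal ((norm (abs_l2 f))^2)"
 by (simp add: norm_abs_l2 nn_integral_eq_integral l2fun_def)

lemma l2fun_iff_nn_integral:
 "l2fun f \<longleftrightarrow> f \<in> borel_measurable borel \<and> (\<integral>\<^sup>+x. ennreal ((norm (f x))^2) \<partial>lborel) < \<infinity>"
 unfolding l2fun_def by (auto simp: integrable_iff_bounded)

section \<open>Riesz-Fischer: completeness and almost everywhere convergent subsequences\<close>

text \<open>The sum of all terms has a finite integral, hence is finite almost everywhere, and it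
  bounds each term.\<close>

lemma AE_bounded_terms:
 fixes F :: "nat => 'a => ennreal"
 assumes [measurable]: "!!k. F k \<in> borel_measurable M"
  and "!!k. (\<integral>\<^sup>+x. F k x \<partial>M) <= ennreal ((1/2) ^ k)"
 shows "AE x in M. \<exists>C. \<forall>k. F k x <= ennreal C"
proof -
 have "(\<integral>\<^sup>+x. (\<Sum>k. F k x) \<partial>M) = (\<Sum>k. \<integral>\<^sup>+x. F k x \<partial>M)" by (intro nn_integral_suminf) simp
 also have "\<dots> <= (\<Sum>k. ennreal ((1/2) ^ k))" by (intro suminf_le assms(2)) auto
 also have "\<dots> = ennreal (\<Sum>k. (1/2) ^ k)" by (intro suminf_ennreal2) auto
 also have "\<dots> < \<infinity>" by simp
 finally have "AE x in M. (\<Sum>k. F k x) \<noteq> \<infinity>" by (intro nn_integral_PInf_AE) auto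
 thus ?thesis
 proof eventually_elim
  case (elim x)
  have "F k x <= (\<Sum>k. F k x)" for k
   using sum_le_suminf[of "%k. F k x" "{k}"] by simp
  thus ?case using elim by (intro exI[of _ "enn2real (\<Sum>k. F k x)"]) (simp add: ennreal_enn2real_if)
 qed
qed

lemma power_half_decay:
 assumes "!!k. ennreal (4 ^ k * (d k)^2) <= ennreal C" "!!k. 0 <= d k"
 shows "d k <= sqrt \<bar>C\<bar> * (1/2) ^ k"
proof -
 have "4 ^ k * (d k)^2 <= \<bar>C\<bar>"
  using assms(1)[of k] ennreal_le_iff2[of "4 ^ k * (d k)^2" C] by (smt (verit) zero_le_power2 zero_le_power mult_nonneg_nonneg)
 hence "(2 ^ k * d k)^2 <= \<bar>C\<bar>" by (simp add: power_mult_distrib flip: power_mult) (simp add: mult.commute[of k] power_mult)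
 hence "2 ^ k * d k <= sqrt \<bar>C\<bar>" by (rule real_le_rsqrt)
 thus ?thesis by (simp add: field_simps power_divide)
qed

instance l2 :: complete_space
proof
 fix X :: "nat => l2" assume X: "Cauchy X"
 \<comment> \<open>The rate \<open>(1/8) ^ k\<close> leaves room for the weight
   \<open>4 ^ k\<close>: the weighted integrals are at most \<open>(1/2) ^ k\<close>, and pointwise
   the increments decay like \<open>(1/2) ^ k\<close> too.\<close>
 have "\<exists>N. \<forall>m\<ge>N. \<forall>n\<ge>N. (norm (X m - X n))^2 <= (1/8) ^ k" for k :: nat
 proof -
  obtain N where N: "\<forall>m\<ge>N. \<forall>n\<ge>N. norm (X m - X n) < sqrt ((1/8) ^ k)"
   using CauchyD[OF X, of "sqrt ((1/8) ^ k)"] by auto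
  have "(norm (X m - X n))^2 <= (1/8) ^ k" if "m \<ge> N" "n \<ge> N" for m n
   using power_mono[of "norm (X m - X n)" "sqrt ((1/8) ^ k)" 2] N that
   by (force simp: less_imp_le)
  thus ?thesis by blast
 qed
 then obtain N where N: "!!k m n. m \<ge> N k ==> n \<ge> N k ==> (norm (X m - X n))^2 <= (1/8) ^ k" by metis
 \<comment> \<open>Partial sums of the thresholds are monotone in \<open>k\<close> and still at
   least \<open>N k\<close>.\<close>
 define r where "r k = (\<Sum>j\<le>k. N j)" for k
 have rN: "r k \<ge> N k" for k unfolding r_def by (intro member_le_sum) auto
 have rmono: "r k <= r m" if "k <= m" for k m unfolding r_def using that by (intro sum_mono2) auto
 have Nr: "(norm (X m - X n))^2 <= (1/8) ^ k" if "m \<ge> r k" "n \<ge> r k" for k m n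
  using N rN that le_trans by metis
 define f where "f k = rep_l2 (X (r k))" for k
 have f[simp]: "l2fun (f k)" "abs_l2 (f k) = X (r k)" for k by (simp_all add: f_def l2fun_rep)
 have [measurable]: "f k \<in> borel_measurable borel" for k using f(1) by (rule l2fun_measurable)
 have nnf: "(\<integral>\<^sup>+x. ennreal ((norm (f m x - f k x))^2) \<partial>lborel) <= ennreal ((1/8) ^ k)" if "k <= m" for k m
  using Nr[of k "r m" "r k"] rmono[OF that] by (simp add: nn_integral_l2 l2fun_diff abs_l2_diff ennreal_leI)
 have "AE x in lborel. \<exists>C. \<forall>k. ennreal (4 ^ k * (norm (f (Suc k) x - f k x))^2) <= ennreal C"
 proof (rule AE_bounded_terms)
  fix k
  have "(\<integral>\<^sup>+x. ennreal (4 ^ k * (norm (f (Suc k) x - f k x))^2) \<partial>lborel)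
   = 4 ^ k * (\<integral>\<^sup>+x. ennreal ((norm (f (Suc k) x - f k x))^2) \<partial>lborel)"
   by (subst nn_integral_cmult[symmetric]) (auto simp: ennreal_mult' simp flip: ennreal_numeral ennreal_power)
  also have "\<dots> <= 4 ^ k * ennreal ((1/8) ^ k)" by (intro mult_left_mono nnf) auto
  also have "\<dots> = ennreal (4 ^ k * (1/8) ^ k)" by (simp add: ennreal_mult' flip: ennreal_numeral ennreal_power)
  also have "4 ^ k * (1/8) ^ k = (1/2::real) ^ k" by (simp flip: power_mult_distrib)
  finally show "(\<integral>\<^sup>+x. ennreal (4 ^ k * (norm (f (Suc k) x - f k x))^2) \<partial>lborel) <= ennreal ((1/2) ^ k)" .
 qed simp
 hence AEconv: "AE x in lborel. convergent (%k. f k x)"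
 proof eventually_elim
  case (elim x)
  then obtain C where C: "!!k. ennreal (4 ^ k * (norm (f (Suc k) x - f k x))^2) <= ennreal C" by blast
  have "summable (%k. f (Suc k) x - f k x)"
  proof (rule summable_comparison_test')
   show "summable (%k. sqrt \<bar>C\<bar> * (1/2::real) ^ k)" by (intro summable_mult) simp
   show "norm (f (Suc k) x - f k x) <= sqrt \<bar>C\<bar> * (1/2) ^ k" if "k \<ge> 0" for k
    by (rule power_half_decay[OF C]) simp
  qed
  hence "convergent (%n. f n x - f 0 x)"
   by (simp add: summable_iff_convergent sum_lessThan_telescope[of "%n. f n x"])
  hence "convergent (%n. f n x - f 0 x + f 0 x)" by (intro convergent_add convergent_const)
  thus ?case by simp
 qed
 define g where "g x = lim (%k. f k x)" for x
 have [measurable]: "g \<in> borel_measurable borel" unfolding g_def by measurable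
 \<comment> \<open>Fatou in the later index \<open>m\<close>: the rate survives the passage to the
   pointwise limit.\<close>
 have gk: "(\<integral>\<^sup>+x. ennreal ((norm (g x - f k x))^2) \<partial>lborel) <= ennreal ((1/8) ^ k)" for k
 proof -
  have "(\<integral>\<^sup>+x. ennreal ((norm (g x - f k x))^2) \<partial>lborel)
   = (\<integral>\<^sup>+x. liminf (%m. ennreal ((norm (f m x - f k x))^2)) \<partial>lborel)"
  proof (rule nn_integral_cong_AE)
   show "AE x in lborel. ennreal ((norm (g x - f k x))^2) = liminf (%m. ennreal ((norm (f m x - f k x))^2))"
    using AEconv
   proof eventually_elim
    case (elim x)
    hence "(%m. f m x) ----> g x" unfolding g_def by (simp add: convergent_LIMSEQ_iff)
    hence "(%m. ennreal ((norm (f m x - f k x))^2)) ----> ennreal ((norm (g x - f k x))^2)"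
     by (intro tendsto_intros tendsto_ennrealI)
    thus ?case by (metis lim_imp_Liminf sequentially_bot)
   qed
  qed
  also have "\<dots> <= liminf (%m. \<integral>\<^sup>+x. ennreal ((norm (f m x - f k x))^2) \<partial>lborel)"
   by (intro nn_integral_liminf) simp
  also have "\<dots> <= liminf (%m. ennreal ((1/8) ^ k))"
   by (rule Liminf_mono) (use nnf in \<open>auto simp: eventually_sequentially\<close>)
  also have "\<dots> = ennreal ((1/8) ^ k)" by (simp add: Liminf_const)
  finally show ?thesis .
 qed
 have gf: "l2fun (%x. g x - f k x)" for k
  unfolding l2fun_iff_nn_integral using gk[of k] by (auto intro: le_less_trans)
 have g: "l2fun g" using l2fun_add[OF gf[of 0] f(1)[of 0]] by simp
 have "(norm (abs_l2 g - X (r k)))^2 <= (1/8) ^ k" for k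
  using gk[of k] g by (simp add: nn_integral_l2[OF gf] abs_l2_diff)
 hence gX: "norm (X n - abs_l2 g) <= 2 * sqrt ((1/8) ^ k)" if "n \<ge> r k" for n k
  using Nr[OF that order_refl] norm_triangle_ineq4[of "X n - X (r k)" "abs_l2 g - X (r k)"]
   real_le_rsqrt[of "norm (X n - X (r k))"] real_le_rsqrt[of "norm (abs_l2 g - X (r k))" "(1/8) ^ k"]
  by (smt (verit) diff_diff_eq2 diff_add_cancel)
 have "X ----> abs_l2 g"
 proof (rule LIMSEQ_I)
  fix e :: real assume e: "e > 0"
  have "(%k. 2 * sqrt ((1/8::real) ^ k)) ----> 2 * sqrt 0"
   by (intro tendsto_intros LIMSEQ_realpow_zero) auto
  hence "EV k. 2 * sqrt ((1/8::real) ^ k) < e" by (rule order_tendstoD) (use e in simp)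
  then obtain k where "2 * sqrt ((1/8::real) ^ k) < e" using eventually_happens by force
  thus "\<exists>no. \<forall>n\<ge>no. norm (X n - abs_l2 g) < e" using gX[of k] by force
 qed
 thus "convergent X" by (auto simp: convergent_def)
qed

instance l2 :: banach ..

text \<open>Geometric rates as in the completeness proof; the \<open>Suc\<close> in \<open>r\<close>
  makes the subsequence strictly increasing.\<close>

lemma l2_AE_subseq:
 assumes "X ----> x"
 obtains r where "strict_mono (r::nat=>nat)" "AE t in lborel. (%k. rep_l2 (X (r k)) t) ----> rep_l2 x t"
proof -
 have "\<exists>N. \<forall>n\<ge>N. (norm (X n - x))^2 <= (1/8) ^ k" for k :: nat
 proof -
  have "(%n. (norm (X n - x))^2) ----> (norm (x - x))^2" by (intro tendsto_intros assms)
  hence "EV n. (norm (X n - x))^2 < (1/8) ^ k" by (rule order_tendstoD) simp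
  thus ?thesis by (auto simp: eventually_sequentially intro: less_imp_le)
 qed
 then obtain N where N: "!!k n. n \<ge> N k ==> (norm (X n - x))^2 <= (1/8) ^ k" by metis
 define r where "r k = (\<Sum>j\<le>k. Suc (N j))" for k
 have rN: "r k \<ge> N k" for k
  unfolding r_def using member_le_sum[of k "{..k}" "%j. Suc (N j)"] by simp
 have sm: "strict_mono r" unfolding r_def by (rule strict_monoI_Suc) simp
 define f where "f k t = rep_l2 (X (r k)) t - rep_l2 x t" for k t
 have [measurable]: "f k \<in> borel_measurable borel" for k unfolding f_def by measurable
 have "AE t in lborel. \<exists>C. \<forall>k. ennreal (4 ^ k * (norm (f k t))^2) <= ennreal C"
 proof (rule AE_bounded_terms)
  fix k
  have "l2fun (f k)" "abs_l2 (f k) = X (r k) - x"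
   unfolding f_def by (simp_all add: l2fun_diff l2fun_rep abs_l2_diff)
  hence *: "(\<integral>\<^sup>+t. ennreal ((norm (f k t))^2) \<partial>lborel) <= ennreal ((1/8) ^ k)"
   using N[OF rN, of k] by (simp add: nn_integral_l2 ennreal_leI)
  have "(\<integral>\<^sup>+t. ennreal (4 ^ k * (norm (f k t))^2) \<partial>lborel) = 4 ^ k * (\<integral>\<^sup>+t. ennreal ((norm (f k t))^2) \<partial>lborel)"
   by (subst nn_integral_cmult[symmetric]) (auto simp: ennreal_mult' simp flip: ennreal_numeral ennreal_power)
  also have "\<dots> <= 4 ^ k * ennreal ((1/8) ^ k)" by (intro mult_left_mono *) auto
  also have "\<dots> = ennreal (4 ^ k * (1/8) ^ k)" by (simp add: ennreal_mult' flip: ennreal_numeral ennreal_power)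
  also have "4 ^ k * (1/8) ^ k = (1/2::real) ^ k" by (simp flip: power_mult_distrib)
  finally show "(\<integral>\<^sup>+t. ennreal (4 ^ k * (norm (f k t))^2) \<partial>lborel) <= ennreal ((1/2) ^ k)" .
 qed simp
 hence "AE t in lborel. (%k. rep_l2 (X (r k)) t) ----> rep_l2 x t"
 proof eventually_elim
  case (elim t)
  then obtain C where C: "!!k. ennreal (4 ^ k * (norm (f k t))^2) <= ennreal C" by blast
  have "(%k. f k t) ----> 0"
  proof (rule Lim_null_comparison)
   show "EV k. norm (f k t) <= sqrt \<bar>C\<bar> * (1/2) ^ k"
    using power_half_decay[OF C] by simp
   have "(%k. sqrt \<bar>C\<bar> * (1/2::real) ^ k) ----> sqrt \<bar>C\<bar> * 0"
    by (intro tendsto_intros LIMSEQ_realpow_zero) auto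
   thus "(%k. sqrt \<bar>C\<bar> * (1/2::real) ^ k) ----> 0" by simp
  qed
  thus ?case unfolding f_def by (rule LIM_zero_cancel)
 qed
 with sm show ?thesis by (rule that)
qed

section \<open>Rational boxes and separability\<close>

text \<open>Boxes with rational corners form a countable generator of the Borel sets that is stable
  under intersection. This one family serves uniqueness of measures, separability and the exhaustion
  of \<open>\<Omega>\<close>.\<close>

definition rat_vec :: "rat^'n => real^'n" where "rat_vec q = (\<chi> i. of_rat (q $ i))"

lemma rat_vec_exists: fixes x :: "real^'n" assumes "!!i. x $ i \<in> \<rat>" shows "\<exists>q. x = rat_vec q"
proof -
 have "\<forall>i. \<exists>q. x $ i = of_rat q" using assms by (metis Rats_cases)
 then obtain q where "!!i. x $ i = of_rat (q i)" by metis
 hence "x = rat_vec (\<chi> i. q i)" by (simp add: rat_vec_def vec_eq_iff)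
 thus ?thesis by blast
qed

abbreviation "rat_boxes \<equiv> range (%(a, b). box (rat_vec a) (rat_vec b))"

lemma rat_box_Int:
 fixes a b c d :: "rat^'n"
 shows "box (rat_vec a) (rat_vec b) \<inter> box (rat_vec c) (rat_vec d) =
   box (rat_vec (\<chi> i. max (a $ i) (c $ i))) (rat_vec (\<chi> i. min (b $ i) (d $ i)))"
proof -
 have "real_of_rat (max p q) = max (of_rat p) (of_rat q)" "real_of_rat (min p q) = min (of_rat p) (of_rat q)" for p q
  by (auto simp: max_def min_def of_rat_less_eq)
 thus ?thesis by (auto simp: set_eq_iff mem_box_cart rat_vec_def)
qed

lemma rat_boxes_Int_stable: "Int_stable (rat_boxes :: (real^'n) set set)"
 unfolding Int_stable_def
proof (intro ballI)
 fix A B :: "(real^'n) set" assume "A \<in> rat_boxes" "B \<in> rat_boxes"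
 then obtain a b c d where "A = box (rat_vec a) (rat_vec b)" "B = box (rat_vec c) (rat_vec d)" by auto
 hence "A \<inter> B = (%(a, b). box (rat_vec a) (rat_vec b)) ((\<chi> i. max (a $ i) (c $ i)), (\<chi> i. min (b $ i) (d $ i)))"
  by (simp add: rat_box_Int)
 thus "A \<inter> B \<in> rat_boxes" by (rule range_eqI)
qed

lemma borel_eq_rat_boxes: "sets borel = sigma_sets UNIV (rat_boxes :: (real^'n) set set)"
proof
 show "sigma_sets UNIV (rat_boxes :: (real^'n) set set) \<subseteq> sets borel"
  by (rule sets.sigma_sets_subset[of _ borel, unfolded space_borel]) auto
 have "U \<in> sigma_sets UNIV rat_boxes" if U: "open U" for U :: "(real^'n) set"
 proof -
  have "\<exists>q. x \<in> box (rat_vec (fst q)) (rat_vec (snd q)) \<and> box (rat_vec (fst q)) (rat_vec (snd q)) \<subseteq> U"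
   if xU: "x \<in> U" for x
  proof -
   obtain e where e: "e > 0" "ball x e \<subseteq> U" using U xU by (auto simp: open_contains_ball)
   obtain a b where ab: "\<forall>i\<in>Basis. a \<bullet> i \<in> \<rat> \<and> b \<bullet> i \<in> \<rat>" "x \<in> box a b" "box a b \<subseteq> ball x e"
    using rational_boxes[OF e(1)] by blast
   hence "!!i. a $ i \<in> \<rat>" "!!i. b $ i \<in> \<rat>" by (auto simp: cart_eq_inner_axis axis_in_Basis_iff)
   then obtain p q where "a = rat_vec p" "b = rat_vec q" using rat_vec_exists by metis
   thus ?thesis using ab e by (intro exI[of _ "(p, q)"]) auto
  qed
  hence "U = (\<Union>q\<in>{q. box (rat_vec (fst q)) (rat_vec (snd q)) \<subseteq> U}. box (rat_vec (fst q)) (rat_vec (snd q)))"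
   by fast
  also have "\<dots> \<in> sigma_sets UNIV rat_boxes"
  proof (rule sigma_sets_UNION)
   show "countable ((%q. box (rat_vec (fst q)) (rat_vec (snd q))) ` {q. box (rat_vec (fst q)) (rat_vec (snd q)) \<subseteq> U})" by auto
  qed (auto intro!: sigma_sets.Basic)
  finally show ?thesis .
 qed
 hence "sigma_sets UNIV {U. open U} \<subseteq> sigma_sets UNIV (rat_boxes :: (real^'n) set set)"
  by (intro sigma_sets_mono) auto
 thus "sets borel \<subseteq> sigma_sets UNIV (rat_boxes :: (real^'n) set set)"
  by (simp add: borel_def)
qed

text \<open>The densities given by the positive and the negative part of \<open>h\<close> agree on a
  generator stable under intersection, so they are the same measure.\<close>

lemma rat_box_integrals_zero_AE:
 fixes h :: "real^'n => real"
 assumes h: "integrable lborel h"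
  and 0: "!!a b. (LBINT x. indicator (box (rat_vec a) (rat_vec b)) x * h x) = 0"
 shows "AE x in lborel. h x = 0"
proof -
 define M where "M s = density lborel (%x. ennreal (max 0 (s * h x)))" for s
 have [measurable]: "h \<in> borel_measurable borel" using h by auto
 have fin: "integrable lborel (%x. max 0 (s * h x))" for s :: real using h by (intro Bochner_Integration.integrable_max) auto
 have ii: "integrable lborel (%x. indicator A x * max 0 (s * h x))" if "A \<in> sets borel" for A and s :: real
  using integrable_mult_indicator[OF _ fin, of A s] that by simp
 have emM: "emeasure (M s) A = ennreal (LBINT x. indicator A x * max 0 (s * h x))" if [measurable]: "A \<in> sets borel" for A s
 proof -
  have "emeasure (M s) A = (\<integral>\<^sup>+x. ennreal (indicator A x * max 0 (s * h x)) \<partial>lborel)"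
   unfolding M_def by (subst emeasure_density) (auto intro!: nn_integral_cong split: split_indicator)
  also have "\<dots> = ennreal (LBINT x. indicator A x * max 0 (s * h x))"
   using ii[OF that] by (intro nn_integral_eq_integral) auto
  finally show ?thesis .
 qed
 have eq: "emeasure (M 1) X = emeasure (M (-1)) X" if X: "X \<in> rat_boxes" for X
 proof -
  have [measurable]: "X \<in> sets borel" using X by auto
  have "(LBINT x. indicator X x * max 0 (1 * h x)) - (LBINT x. indicator X x * max 0 ((-1) * h x))
    = (LBINT x. indicator X x * max 0 (1 * h x) - indicator X x * max 0 ((-1) * h x))"
   by (intro Bochner_Integration.integral_diff[symmetric] ii) auto
  also have "\<dots> = (LBINT x. indicator X x * h x)"
   by (intro Bochner_Integration.integral_cong) (auto simp: max_def split: split_indicator)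
  also have "\<dots> = 0" using 0 X by auto
  finally show ?thesis by (simp add: emM)
 qed
 have "M 1 = M (-1)"
 proof (rule measure_eqI_generator_eq[OF rat_boxes_Int_stable, of UNIV])
  show "rat_boxes \<subseteq> Pow UNIV" by simp
  show "sets (M 1) = sigma_sets UNIV rat_boxes" "sets (M (-1)) = sigma_sets UNIV rat_boxes"
   by (simp_all add: M_def borel_eq_rat_boxes)
  define A where "A n = box (rat_vec (\<chi> i. - rat_of_nat n)) (rat_vec (\<chi> i. rat_of_nat n) :: real^'n)" for n
  show "range A \<subseteq> rat_boxes" by (auto simp: A_def)
  show "emeasure (M 1) (A i) \<noteq> \<infinity>" for i by (simp add: A_def emM)
  have "\<exists>n. x \<in> A n" for x :: "real^'n"
  proof -
   obtain n where n: "norm x < real n" using reals_Archimedean2 by blast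
   have "\<bar>x $ i\<bar> < real n" for i using component_le_norm_cart[of x i] n by simp
   thus ?thesis by (intro exI[of _ n]) (auto simp: A_def mem_box_cart rat_vec_def abs_less_iff of_rat_minus minus_less_iff)
  qed
  thus "(\<Union>i. A i) = UNIV" by auto
 qed (rule eq)
 hence "AE x in lborel. ennreal (max 0 (1 * h x)) = ennreal (max 0 ((-1) * h x))"
  unfolding M_def by (subst (asm) sigma_finite_measure.density_unique_iff[OF sigma_finite_lborel]) auto
 thus ?thesis by eventually_elim (auto simp: max_def split: if_splits)
qed

lemma l2fun_indicator_box: "l2fun (%x. indicator (box a b) x *\<^sub>R c)"
proof -
 have "integrable lborel (%x. indicator (box a b) x *\<^sub>R (norm c)^2)"
  by (intro integrable_indicator) (auto simp: emeasure_lborel_box_eq)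
 also have "(%x. indicator (box a b) x *\<^sub>R (norm c)^2) = (%x. (norm (indicator (box a b) x *\<^sub>R c))^2)"
  by (auto simp: fun_eq_iff split: split_indicator)
 finally show ?thesis by (simp add: l2fun_def)
qed

lemma inner_indicator_box:
 "x \<bullet> abs_l2 (%t. indicator (box a b) t *\<^sub>R axis j 1) = (LBINT t. indicator (box a b) t * rep_l2 x t $ j)"
 using inner_abs_l2[OF l2fun_rep[of x] l2fun_indicator_box[of a b "axis j 1"]]
 by (simp add: inner_axis)

text \<open>A square integrable field need not be integrable on the whole space, so it is first cut
  to a rational box; the intersection of two such boxes is again one.\<close>

lemma l2_eq_0I:
 assumes "!!a b j. x \<bullet> abs_l2 (%t. indicator (box (rat_vec a) (rat_vec b)) t *\<^sub>R axis j 1) = 0"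
 shows "x = 0"
proof -
 have sq: "integrable lborel (%t. (norm (rep_l2 x t))^2)" using l2fun_rep[of x] by (simp add: l2fun_def)
 have loc: "AE t in lborel. indicator (box (rat_vec p) (rat_vec q)) t * rep_l2 x t $ j = 0" for p q j
 proof (rule rat_box_integrals_zero_AE)
  show "integrable lborel (%t. indicator (box (rat_vec p) (rat_vec q)) t * rep_l2 x t $ j)"
   using integrable_inner_l2fun[OF l2fun_rep[of x] l2fun_indicator_box[of "rat_vec p" "rat_vec q" "axis j 1"]]
   by (simp add: inner_axis)
  fix a b :: "rat^3"
  obtain c d where "box (rat_vec a) (rat_vec b) \<inter> box (rat_vec p) (rat_vec q) = box (rat_vec c) (rat_vec d)"
   using rat_box_Int by metis
  hence "(LBINT t. indicator (box (rat_vec a) (rat_vec b)) t * (indicator (box (rat_vec p) (rat_vec q)) t * rep_l2 x t $ j))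
   = (LBINT t. indicator (box (rat_vec c) (rat_vec d)) t * rep_l2 x t $ j)"
   by (intro Bochner_Integration.integral_cong refl) (metis indicator_inter_arith mult.assoc)
  thus "(LBINT t. indicator (box (rat_vec a) (rat_vec b)) t * (indicator (box (rat_vec p) (rat_vec q)) t * rep_l2 x t $ j)) = 0"
   using assms[of c d j] by (simp add: inner_indicator_box)
 qed
 have "AE t in lborel. \<forall>n::nat. \<forall>j. indicator (box (rat_vec (\<chi> i. - rat_of_nat n)) (rat_vec (\<chi> i. rat_of_nat n))) t * rep_l2 x t $ j = 0"
  unfolding AE_all_countable by (intro allI eventually_all_finite loc)
 hence "AE t in lborel. rep_l2 x t = 0"
 proof eventually_elim
  case (elim t)
  obtain n where n: "norm t < real n" using reals_Archimedean2 by blast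
  have "\<bar>t $ i\<bar> < real n" for i using component_le_norm_cart[of t i] n by simp
  hence "t \<in> box (rat_vec (\<chi> i. - rat_of_nat n)) (rat_vec (\<chi> i. rat_of_nat n))"
   by (auto simp: mem_box_cart rat_vec_def abs_less_iff of_rat_minus minus_less_iff)
  thus ?case using elim[rule_format, of n] by (simp add: vec_eq_iff)
 qed
 hence "abs_l2 (rep_l2 x) = abs_l2 (%t. 0)" using l2fun_rep l2fun_0 by (subst abs_l2_eq_iff) auto
 thus ?thesis by (simp add: abs_l2_0)
qed

text \<open>Finite sums of rational vectors on rational boxes. Indexing by lists makes the family
  countable by its type alone.\<close>

definition rat_step :: "((rat^3) \<times> (rat^3) \<times> (rat^3)) list => l2" where
 "rat_step l = (\<Sum>(c, a, b)\<leftarrow>l. abs_l2 (%t. indicator (box (rat_vec a) (rat_vec b)) t *\<^sub>R rat_vec c))"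

lemma rat_step_append: "rat_step (k @ l) = rat_step k + rat_step l"
 by (simp add: rat_step_def)

lemma rat_step_scale: "\<exists>k. rat_step k = of_rat q *\<^sub>R rat_step l"
proof
 have "abs_l2 (%t. indicator (box (rat_vec a) (rat_vec b)) t *\<^sub>R rat_vec (\<chi> i. q * c $ i))
   = of_rat q *\<^sub>R abs_l2 (%t. indicator (box (rat_vec a) (rat_vec b)) t *\<^sub>R rat_vec c)" for a b c
 proof -
  have "(%t. indicator (box (rat_vec a) (rat_vec b)) t *\<^sub>R (rat_vec (\<chi> i. q * c $ i) :: real^3))
   = (%t. of_rat q *\<^sub>R (indicator (box (rat_vec a) (rat_vec b)) t *\<^sub>R rat_vec c))"
   by (auto simp: fun_eq_iff vec_eq_iff rat_vec_def of_rat_mult)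
  thus ?thesis by (simp only: abs_l2_scale[OF l2fun_indicator_box])
 qed
 thus "rat_step (map (%(c, a, b). ((\<chi> i. q * c $ i), a, b)) l) = of_rat q *\<^sub>R rat_step l"
  by (induction l) (auto simp: rat_step_def scaleR_add_right)
qed

text \<open>A class orthogonal to all steps has zero integral over rational boxes, hence is 0. The
  closure is a real subspace although only rational coefficients occur, as rational multiples
  approximate real ones.\<close>

lemma rat_step_dense: "closure (range rat_step) = UNIV"
proof -
 let ?S = "closure (range rat_step)"
 have sub: "subspace ?S"
 proof (rule subspaceI)
  have "0 = rat_step []" by (simp add: rat_step_def)
  thus "0 \<in> ?S" using closure_subset[of "range rat_step"] by auto
 next
  fix x y assume "x \<in> ?S" "y \<in> ?S"
  then obtain f g where fg: "!!n. f n \<in> range rat_step" "f ----> x" "!!n. g n \<in> range rat_step" "g ----> y"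
   by (metis closure_sequential)
  hence "f n + g n \<in> range rat_step" for n by (metis rangeE rangeI rat_step_append)
  moreover have "(%n. f n + g n) ----> x + y" using fg by (intro tendsto_intros)
  ultimately show "x + y \<in> ?S"
   by (intro closure_sequential[THEN iffD2] exI[of _ "%n. f n + g n"]) simp
 next
  fix x :: l2 and c :: real assume "x \<in> ?S"
  then obtain f where f: "!!n. f n \<in> range rat_step" "f ----> x" by (metis closure_sequential)
  have "c \<in> closure \<rat>" by (simp add: Rats_closure_real)
  then obtain q where q: "!!n. q n \<in> \<rat>" "q ----> c" by (metis closure_sequential)
  have "q n *\<^sub>R f n \<in> range rat_step" for n
   using q(1)[of n] f(1)[of n] rat_step_scale by (metis Rats_cases rangeE rangeI)
  moreover have "(%n. q n *\<^sub>R f n) ----> c *\<^sub>R x" using f q by (intro tendsto_intros)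
  ultimately show "c *\<^sub>R x \<in> ?S"
   by (intro closure_sequential[THEN iffD2] exI[of _ "%n. q n *\<^sub>R f n"]) simp
 qed
 have "x \<in> ?S" for x
 proof -
  obtain p where p: "p \<in> ?S" "!!s. s \<in> ?S ==> s \<bullet> x = s \<bullet> p"
   using closed_subspace_projection[OF closed_closure sub] by metis
  have "x - p = 0"
  proof (rule l2_eq_0I)
   fix a b :: "rat^3" and j :: 3
   have "rat_vec (axis j 1) = (axis j 1 :: real^3)" by (auto simp: rat_vec_def axis_def vec_eq_iff)
   hence "abs_l2 (%t. indicator (box (rat_vec a) (rat_vec b)) t *\<^sub>R axis j 1) = rat_step [(axis j 1, a, b)]"
    by (simp add: rat_step_def)
   hence "abs_l2 (%t. indicator (box (rat_vec a) (rat_vec b)) t *\<^sub>R axis j 1) \<in> ?S"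
    using closure_subset[of "range rat_step"] by auto
   from p(2)[OF this] show "(x - p) \<bullet> abs_l2 (%t. indicator (box (rat_vec a) (rat_vec b)) t *\<^sub>R axis j 1) = 0"
    by (simp add: inner_diff_left inner_commute)
  qed
  thus ?thesis using p(1) by simp
 qed
 thus ?thesis by auto
qed

text \<open>Makes sums and differences of Borel measurable curves in \<open>l2\<close> measurable,
  and later supplies a countable dense set of test classes.\<close>

instance l2 :: second_countable_topology
proof
 define B where "B = (%(l, n). ball (rat_step l) (1 / real (Suc n))) ` UNIV"
 have "topological_basis B"
 proof (rule topological_basisI)
  fix U :: "l2 set" and x assume "open U" "x \<in> U"
  then obtain e where e: "e > 0" "ball x e \<subseteq> U" by (auto simp: open_contains_ball)
  obtain n where n: "1 / real (Suc n) < e / 2" using nat_approx_posE[of "e/2"] e by auto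
  have "x \<in> closure (range rat_step)" by (simp add: rat_step_dense)
  then obtain l where l: "dist (rat_step l) x < 1 / real (Suc n)"
   unfolding closure_approachable by (metis of_nat_0_less_iff rangeE zero_less_Suc zero_less_divide_1_iff)
  have "ball (rat_step l) (1 / real (Suc n)) \<subseteq> ball x e"
  proof
   fix y assume "y \<in> ball (rat_step l) (1 / real (Suc n))"
   thus "y \<in> ball x e"
    using l n dist_triangle[of x y "rat_step l"] by (auto simp: dist_commute)
  qed
  thus "\<exists>V\<in>B. x \<in> V \<and> V \<subseteq> U"
   using e l unfolding B_def by (intro bexI[of _ "ball (rat_step l) (1 / real (Suc n))"]) auto
 qed (auto simp: B_def)
 moreover have "countable B" unfolding B_def by auto
 ultimately show "\<exists>B::l2 set set. countable B \<and> open = generate_topology B"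
  using topological_basis_imp_subbasis by blast
qed

text \<open>Pettis' argument: a closed ball is convex, hence weakly closed, so its preimage is
  closed in \<open>J\<close>; every open set is a countable union of balls centred in the dense
  family. Cutting with \<open>indicator J\<close> turns the curve into a total function.\<close>

lemma weakly_continuous_measurable:
 fixes v :: "real => l2"
 assumes J: "open J" and v: "!!y. continuous_on J (%t. v t \<bullet> y)"
 shows "(%t. indicator J t *\<^sub>R v t) \<in> borel_measurable borel"
proof -
 have cl: "{t\<in>J. v t \<in> cball c r} \<in> sets borel" for c r
 proof -
  have "closedin (top_of_set J) {t\<in>J. v t \<in> cball c r}"
   unfolding closedin_limpt
  proof (intro conjI allI impI)
   fix t assume t: "t islimpt {t\<in>J. v t \<in> cball c r} \<and> t \<in> J"
   then obtain s where s: "!!n. s n \<in> {t\<in>J. v t \<in> cball c r}" "s ----> t"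
    unfolding islimpt_sequential by blast
   have "v t \<in> cball c r"
   proof (rule closed_convex_weakly_closed[of _ sequentially "%n. v (s n)"])
    show "(%n. v (s n) \<bullet> w) ----> v t \<bullet> w" for w
     using v[of w] s t continuous_on_tendsto_compose[OF v[of w] s(2)] by auto
   qed (use s in auto)
   thus "t \<in> {t\<in>J. v t \<in> cball c r}" using t by auto
  qed auto
  then obtain C where "closed C" "{t\<in>J. v t \<in> cball c r} = C \<inter> J" by (auto simp: closedin_closed)
  thus ?thesis using J by auto
 qed
 have op: "{t\<in>J. v t \<in> U} \<in> sets borel" if "open U" for U
 proof -
  define E where "E = {(l, n). cball (rat_step l) (1 / real (Suc n)) \<subseteq> U}"
  have "\<exists>l n. x \<in> cball (rat_step l) (1 / real (Suc n)) \<and> cball (rat_step l) (1 / real (Suc n)) \<subseteq> U" if "x \<in> U" for x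
  proof -
   obtain e where e: "e > 0" "ball x e \<subseteq> U" using \<open>open U\<close> \<open>x \<in> U\<close> by (auto simp: open_contains_ball)
   obtain n where n: "1 / real (Suc n) < e / 2" using nat_approx_posE[of "e/2"] e by auto
   have "x \<in> closure (range rat_step)" by (simp add: rat_step_dense)
   then obtain l where l: "dist (rat_step l) x < 1 / real (Suc n)"
    unfolding closure_approachable by (metis of_nat_0_less_iff rangeE zero_less_Suc zero_less_divide_1_iff)
   have "cball (rat_step l) (1 / real (Suc n)) \<subseteq> ball x e"
   proof
    fix y assume "y \<in> cball (rat_step l) (1 / real (Suc n))"
    thus "y \<in> ball x e"
     using l n dist_triangle[of x y "rat_step l"] by (auto simp: dist_commute)
   qed
   thus ?thesis using l e by (intro exI[of _ l] exI[of _ n]) auto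
  qed
  hence "{t\<in>J. v t \<in> U} = (\<Union>(l, n)\<in>E. {t\<in>J. v t \<in> cball (rat_step l) (1 / real (Suc n))})"
   unfolding E_def by fast
  also have "\<dots> \<in> sets borel" using cl by (intro sets.countable_UN') (auto simp del: mem_cball)
  finally show ?thesis .
 qed
 show ?thesis
 proof (rule borel_measurableI)
  fix U :: "l2 set" assume U: "open U"
  have "(%t. indicator J t *\<^sub>R v t) -` U \<inter> space borel = {t\<in>J. v t \<in> U} \<union> (if 0 \<in> U then - J else {})"
   by (auto split: split_indicator_asm)
  also have "\<dots> \<in> sets borel" using op[OF U] J by auto
  finally show "(%t. indicator J t *\<^sub>R v t) -` U \<inter> space borel \<in> sets borel" .
 qed
qed

section \<open>Integration over boxes in three dimensions\<close>

text \<open>Coordinates in a chosen order, so that iterated integrals can be taken in whichever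
  order an estimate wants.\<close>

definition p3 :: "3 => 3 => 3 => real => real => real => real^3" where
 "p3 i j k t s r = t *\<^sub>R axis i 1 + s *\<^sub>R axis j 1 + r *\<^sub>R axis k 1"

definition perm3 :: "3 => 3 => 3 => bool" where
 "perm3 i j k \<longleftrightarrow> i \<noteq> j \<and> i \<noteq> k \<and> j \<noteq> k \<and> (UNIV :: 3 set) = {i, j, k}"

lemma perm3_cases: "perm3 1 2 3" "perm3 2 1 3" "perm3 3 1 2" "perm3 2 3 1" "perm3 3 2 1"
proof -
 have "1 \<noteq> (2::3)" "1 \<noteq> (3::3)" "2 \<noteq> (3::3)" by simp_all
 thus "perm3 1 2 3" "perm3 2 1 3" "perm3 3 1 2" "perm3 2 3 1" "perm3 3 2 1"
  unfolding perm3_def using UNIV_3 by (metis insert_commute)+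
qed

lemma perm3_exists: "\<exists>j k. perm3 i j k"
 using perm3_cases exhaust_3[of i] by auto

lemma p3_nth: "perm3 i j k ==> p3 i j k t s r $ i = t" "perm3 i j k ==> p3 i j k t s r $ j = s"
 "perm3 i j k ==> p3 i j k t s r $ k = r"
 by (auto simp: p3_def perm3_def axis_def)

lemma all_perm3: "perm3 i j k ==> (\<forall>l. P l) \<longleftrightarrow> P i \<and> P j \<and> P k"
 unfolding perm3_def by (metis UNIV_I insertE singletonD)

lemma p3_measurable [measurable]: "(%(t, s, r). p3 i j k t s r) \<in> borel_measurable (borel \<Otimes>\<^sub>M borel \<Otimes>\<^sub>M borel)"
 unfolding p3_def by measurable

lemma p3_measurable' [measurable (raw)]:
 assumes [measurable]: "f \<in> borel_measurable M" "g \<in> borel_measurable M" "h \<in> borel_measurable M"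
 shows "(%x. p3 i j k (f x) (g x) (h x)) \<in> borel_measurable M"
 unfolding p3_def by measurable

text \<open>Lebesgue measure is determined by its values on boxes, and the volume of a box does not
  depend on the order of its sides.\<close>

lemma lborel_perm3:
 assumes p: "perm3 i j k"
 shows "(lborel :: (real^3) measure) = distr (lborel \<Otimes>\<^sub>M lborel \<Otimes>\<^sub>M lborel) borel (%(t, s, r). p3 i j k t s r)"
proof (rule lborel_eqI)
 fix l u :: "real^3" assume lu: "!!b. b \<in> Basis ==> l \<bullet> b <= u \<bullet> b"
 have lu': "l $ m <= u $ m" for m using lu[of "axis m 1"] by (simp add: inner_axis axis_in_Basis_iff)
 have "(%(t, s, r). p3 i j k t s r) -` box l u \<inter> space (lborel \<Otimes>\<^sub>M lborel \<Otimes>\<^sub>M lborel)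
   = {l$i<..<u$i} \<times> {l$j<..<u$j} \<times> {l$k<..<u$k}"
  by (auto simp: mem_box_cart all_perm3[OF p] p3_nth[OF p] space_pair_measure)
 hence "emeasure (distr (lborel \<Otimes>\<^sub>M lborel \<Otimes>\<^sub>M lborel) borel (%(t, s, r). p3 i j k t s r)) (box l u)
   = emeasure (lborel \<Otimes>\<^sub>M lborel \<Otimes>\<^sub>M lborel) ({l$i<..<u$i} \<times> {l$j<..<u$j} \<times> {l$k<..<u$k})"
  by (subst emeasure_distr) auto
 also have "\<dots> = ennreal (u$i - l$i) * (ennreal (u$j - l$j) * ennreal (u$k - l$k))"
 proof -
  have "sigma_finite_measure (lborel \<Otimes>\<^sub>M lborel :: (real \<times> real) measure)"
   unfolding lborel_prod by (rule sigma_finite_lborel)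
  thus ?thesis using lu'
   by (subst sigma_finite_measure.emeasure_pair_measure_Times, simp, simp, simp)
     (subst lborel.emeasure_pair_measure_Times, auto)
 qed
 also have "\<dots> = ennreal ((u$i - l$i) * ((u$j - l$j) * (u$k - l$k)))"
  using lu' by (simp add: ennreal_mult)
 also have "(u$i - l$i) * ((u$j - l$j) * (u$k - l$k)) = (\<Prod>m\<in>UNIV. (u - l) $ m)"
  using p unfolding perm3_def by (elim conjE) (erule ssubst, simp)
 also have "\<dots> = (\<Prod>b\<in>Basis. (u - l) \<bullet> b)"
 proof -
  have B: "(Basis :: (real^3) set) = range (%m::3. axis m (1::real))" by (auto simp: Basis_vec_def)
  have "inj (%m::3. axis m (1::real))" by (auto simp: inj_on_def axis_eq_axis)
  thus ?thesis unfolding B by (subst prod.reindex) (auto simp: inner_axis)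
 qed
 finally show "emeasure (distr (lborel \<Otimes>\<^sub>M lborel \<Otimes>\<^sub>M lborel) borel (%(t, s, r). p3 i j k t s r)) (box l u)
   = ennreal (\<Prod>b\<in>Basis. (u - l) \<bullet> b)" .
qed simp

text \<open>Lebesgue measure on an interval as a density on the line: iterated integrals carry no
  indicators, and measurability is that of the whole line.\<close>

definition iv :: "real => real => real measure" where
 "iv a b = density lborel (indicator {a..b})"

lemma sets_iv [simp, measurable_cong]: "sets (iv a b) = sets borel" and space_iv [simp]: "space (iv a b) = UNIV"
 by (simp_all add: iv_def)

lemma emeasure_iv [simp]: "a <= b ==> emeasure (iv a b) UNIV = ennreal (b - a)"
 unfolding iv_def by (subst emeasure_density) auto

lemma finite_measure_iv: "finite_measure (iv a b)"
proof
 show "emeasure (iv a b) (space (iv a b)) \<noteq> \<infinity>"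
  unfolding iv_def by (subst emeasure_density) (auto simp: emeasure_lborel_Icc_eq)
qed

lemma sigma_finite_iv: "sigma_finite_measure (iv a b)"
 using finite_measure_iv finite_measure.axioms(1) by blast

lemma nn_integral_iv: "f \<in> borel_measurable borel ==> (\<integral>\<^sup>+t. f t \<partial>iv a b) = (\<integral>\<^sup>+t. indicator {a..b} t * f t \<partial>lborel)"
 unfolding iv_def by (subst nn_integral_density) auto

lemma AE_iv: "AE t in iv a b. t \<in> {a..b}"
 unfolding iv_def by (subst AE_density) (auto split: split_indicator)

lemma nn_integral_iv_mono: "(!!t. t \<in> {a..b} ==> f t <= g t) ==> (\<integral>\<^sup>+t. f t \<partial>iv a b) <= (\<integral>\<^sup>+t. g t \<partial>iv a b)"
 by (rule nn_integral_mono_AE, rule eventually_mono[OF AE_iv[of a b]]) simp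

lemma measurable_nn_integral_iv [measurable (raw)]:
 assumes "case_prod f \<in> borel_measurable (N \<Otimes>\<^sub>M borel)"
 shows "(%x. \<integral>\<^sup>+t. f x t \<partial>iv a b) \<in> borel_measurable N"
proof -
 interpret sigma_finite_measure "iv a b" by (rule sigma_finite_iv)
 show ?thesis using assms by (intro borel_measurable_nn_integral) (simp cong: measurable_cong_sets sets_pair_measure_cong)
qed

lemma nn_integral_cbox_iv:
 assumes p: "perm3 i j k" and [measurable]: "F \<in> borel_measurable borel"
 shows "(\<integral>\<^sup>+x. F x * indicator (cbox a b) x \<partial>lborel)
  = (\<integral>\<^sup>+t. \<integral>\<^sup>+s. \<integral>\<^sup>+r. F (p3 i j k t s r) \<partial>iv (a$k) (b$k) \<partial>iv (a$j) (b$j) \<partial>iv (a$i) (b$i))"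
proof -
 have sf: "sigma_finite_measure (lborel \<Otimes>\<^sub>M lborel :: (real \<times> real) measure)"
  unfolding lborel_prod by (rule sigma_finite_lborel)
 have ind: "indicator (cbox a b) (p3 i j k t s r) = (indicator {a$i..b$i} t * (indicator {a$j..b$j} s * indicator {a$k..b$k} r) :: ennreal)" for t s r
  by (auto simp: mem_box_cart all_perm3[OF p] p3_nth[OF p] split: split_indicator)
 have "(\<integral>\<^sup>+x. F x * indicator (cbox a b) x \<partial>lborel)
   = (\<integral>\<^sup>+(t, s, r). F (p3 i j k t s r) * indicator (cbox a b) (p3 i j k t s r) \<partial>(lborel \<Otimes>\<^sub>M lborel \<Otimes>\<^sub>M lborel))"
  by (subst lborel_perm3[OF p], subst nn_integral_distr) (auto intro!: nn_integral_cong)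
 also have "\<dots> = (\<integral>\<^sup>+t. \<integral>\<^sup>+(s, r). F (p3 i j k t s r) * indicator (cbox a b) (p3 i j k t s r) \<partial>(lborel \<Otimes>\<^sub>M lborel) \<partial>lborel)"
  by (subst sigma_finite_measure.nn_integral_fst[OF sf, symmetric]) (auto simp: case_prod_beta')
 also have "\<dots> = (\<integral>\<^sup>+t. \<integral>\<^sup>+s. \<integral>\<^sup>+r. F (p3 i j k t s r) * indicator (cbox a b) (p3 i j k t s r) \<partial>lborel \<partial>lborel \<partial>lborel)"
  by (subst lborel.nn_integral_fst[symmetric]) (auto simp: case_prod_beta')
 also have "\<dots> = (\<integral>\<^sup>+t. \<integral>\<^sup>+s. \<integral>\<^sup>+r. indicator {a$i..b$i} t * (indicator {a$j..b$j} s * (indicator {a$k..b$k} r * F (p3 i j k t s r))) \<partial>lborel \<partial>lborel \<partial>lborel)"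
  by (simp add: ind mult_ac)
 also have "\<dots> = (\<integral>\<^sup>+t. indicator {a$i..b$i} t * (\<integral>\<^sup>+s. indicator {a$j..b$j} s * (\<integral>\<^sup>+r. indicator {a$k..b$k} r * F (p3 i j k t s r) \<partial>lborel) \<partial>lborel) \<partial>lborel)"
  by (simp add: nn_integral_cmult)
 also have "\<dots> = (\<integral>\<^sup>+t. \<integral>\<^sup>+s. \<integral>\<^sup>+r. F (p3 i j k t s r) \<partial>iv (a$k) (b$k) \<partial>iv (a$j) (b$j) \<partial>iv (a$i) (b$i))"
  by (simp add: nn_integral_iv)
 finally show ?thesis .
qed

section \<open>Directional derivatives and integrals along lines\<close>

text \<open>\<open>C^1\<close> in one direction only, and as a relation between a function and its
  derivative, so that sums and products come with explicit derivatives.\<close>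

definition has_pd :: "3 => (real^3 => real) => (real^3 => real) => bool" where
 "has_pd i g g' \<longleftrightarrow> continuous_on UNIV g \<and> continuous_on UNIV g' \<and>
   (\<forall>x. ((%s. g (x + s *\<^sub>R axis i 1)) has_real_derivative g' x) (at 0))"

lemma has_pd_measurable: "has_pd i g g' ==> g \<in> borel_measurable borel" "has_pd i g g' ==> g' \<in> borel_measurable borel"
 by (auto simp: has_pd_def intro: borel_measurable_continuous_onI)

lemma has_pd_line:
 assumes "has_pd i g g'"
 shows "((%t. g (x + t *\<^sub>R axis i 1)) has_real_derivative g' (x + t *\<^sub>R axis i 1)) (at t)"
proof -
 have "((%s. g ((x + t *\<^sub>R axis i 1) + s *\<^sub>R axis i 1)) has_real_derivative g' (x + t *\<^sub>R axis i 1)) (at 0)"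
  using assms by (simp add: has_pd_def)
 hence "((%s. g (x + (s + t) *\<^sub>R axis i 1)) has_real_derivative g' (x + t *\<^sub>R axis i 1)) (at 0)"
  by (simp add: algebra_simps)
 thus ?thesis using DERIV_shift[of "%s. g (x + s *\<^sub>R axis i 1)" _ 0 t] by simp
qed

lemma has_pd_line_cont:
 assumes "has_pd i g g'"
 shows "continuous_on UNIV (%t. g' (x + t *\<^sub>R axis i 1))"
proof -
 have "continuous_on UNIV (g' \<circ> (%t. x + t *\<^sub>R axis i 1))"
  using assms by (intro continuous_on_compose continuous_intros) (auto simp: has_pd_def intro: continuous_on_subset)
 thus ?thesis by (simp add: o_def)
qed

lemma FTC_abs_le:
 fixes k k' :: "real => real"
 assumes d: "!!t. (k has_real_derivative k' t) (at t)" and c: "continuous_on UNIV k'"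
  and st: "s \<in> {a..b}" "t \<in> {a..b}"
 shows "ennreal \<bar>k s - k t\<bar> <= (\<integral>\<^sup>+\<tau>. ennreal \<bar>k' \<tau>\<bar> \<partial>iv a b)"
proof -
 have [measurable]: "k' \<in> borel_measurable borel" using c by (rule borel_measurable_continuous_onI)
 have *: "ennreal \<bar>k t - k s\<bar> <= (\<integral>\<^sup>+\<tau>. ennreal \<bar>k' \<tau>\<bar> \<partial>iv a b)" if st: "s \<in> {a..b}" "t \<in> {a..b}" "s <= t" for s t
 proof -
  have int: "integrable lborel (%x. indicator {s..t} x *\<^sub>R k' x)"
   using borel_integrable_compact[of "{s..t}" k'] c continuous_on_subset by auto
  have "k t - k s = (LBINT x. k' x * indicator {s..t} x)"
   using integral_FTC_Icc_real[OF st(3), of k k'] d c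
   by (metis continuous_on_eq_continuous_at open_UNIV UNIV_I)
  hence "\<bar>k t - k s\<bar> <= (LBINT x. \<bar>k' x * indicator {s..t} x\<bar>)" by simp
  hence "ennreal \<bar>k t - k s\<bar> <= ennreal (LBINT x. \<bar>k' x * indicator {s..t} x\<bar>)" by (rule ennreal_leI)
  also have "\<dots> = (\<integral>\<^sup>+x. ennreal \<bar>k' x * indicator {s..t} x\<bar> \<partial>lborel)"
   using int by (intro nn_integral_eq_integral[symmetric]) (auto simp: mult.commute)
  also have "\<dots> <= (\<integral>\<^sup>+x. indicator {a..b} x * ennreal \<bar>k' x\<bar> \<partial>lborel)"
   using st by (intro nn_integral_mono) (auto split: split_indicator)
  also have "\<dots> = (\<integral>\<^sup>+\<tau>. ennreal \<bar>k' \<tau>\<bar> \<partial>iv a b)" by (simp add: nn_integral_iv)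
  finally show ?thesis .
 qed
 show ?thesis using *[of s t] *[of t s] st by (cases "s <= t") (auto simp: abs_minus_commute)
qed

text \<open>Fundamental theorem and Cauchy-Schwarz. The bound does not depend on \<open>s\<close>
  and \<open>t\<close>, which decouples the variables in the Poincare inequality.\<close>

lemma FTC_sq_le:
 fixes k k' :: "real => real"
 assumes d: "!!t. (k has_real_derivative k' t) (at t)" and c: "continuous_on UNIV k'"
  and st: "s \<in> {a..b}" "t \<in> {a..b}"
 shows "ennreal ((k s - k t)^2) <= ennreal (b - a) * (\<integral>\<^sup>+\<tau>. ennreal ((k' \<tau>)^2) \<partial>iv a b)"
proof -
 have [measurable]: "k' \<in> borel_measurable borel" using c by (rule borel_measurable_continuous_onI)
 have "ennreal ((k s - k t)^2) = (ennreal \<bar>k s - k t\<bar>)^2" by (simp add: ennreal_power)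
 also have "\<dots> <= (\<integral>\<^sup>+\<tau>. ennreal \<bar>k' \<tau>\<bar> \<partial>iv a b)^2" by (intro power_mono FTC_abs_le assms) auto
 also have "\<dots> = (\<integral>\<^sup>+\<tau>. ennreal \<bar>k' \<tau>\<bar> * 1 \<partial>iv a b)^2" by simp
 also have "\<dots> <= (\<integral>\<^sup>+\<tau>. (ennreal \<bar>k' \<tau>\<bar>)^2 \<partial>iv a b) * (\<integral>\<^sup>+\<tau>. 1\<^sup>2 \<partial>iv a b)"
  by (rule Cauchy_Schwarz_nn_integral) (auto simp: iv_def)
 also have "(\<integral>\<^sup>+\<tau>. 1\<^sup>2 \<partial>iv a b) = ennreal (b - a)" using st by simp
 also have "(%\<tau>. (ennreal \<bar>k' \<tau>\<bar>)^2) = (%\<tau>. ennreal ((k' \<tau>)^2))" by (simp add: ennreal_power fun_eq_iff)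
 finally show ?thesis by (simp add: mult.commute)
qed

text \<open>Young's inequality with a weight, integrated. Asking only for a pointwise bound on the
  square of \<open>I\<close> keeps square roots of \<open>F\<close> and \<open>G\<close> out and
  admits infinite values.\<close>

lemma nn_integral_Cauchy_Schwarz_pointwise:
 assumes [measurable]: "F \<in> borel_measurable M" "G \<in> borel_measurable M" "I \<in> borel_measurable M"
  and le: "!!x. (I x)^2 <= F x * G x"
 shows "(\<integral>\<^sup>+x. I x \<partial>M)^2 <= (\<integral>\<^sup>+x. F x \<partial>M) * (\<integral>\<^sup>+x. G x \<partial>M)"
proof -
 define f where "f = (\<integral>\<^sup>+x. F x \<partial>M)"
 define g where "g = (\<integral>\<^sup>+x. G x \<partial>M)"
 have zero: "(\<integral>\<^sup>+x. I x \<partial>M) = 0" if "f = 0 \<or> g = 0"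
 proof -
  have "AE x in M. F x * G x = 0"
   using that unfolding f_def g_def by (auto simp: nn_integral_0_iff_AE elim: eventually_mono)
  hence "AE x in M. I x = 0"
   by eventually_elim (use le in \<open>metis le_zero_eq power_eq_0_iff\<close>)
  thus ?thesis by (simp add: nn_integral_0_iff_AE)
 qed
 consider "f = 0 \<or> g = 0" | "f \<noteq> 0" "g \<noteq> 0" "f = \<infinity> \<or> g = \<infinity>" | "f \<noteq> 0" "g \<noteq> 0" "f \<noteq> \<infinity>" "g \<noteq> \<infinity>" by blast
 thus ?thesis
 proof cases
  case 1 thus ?thesis using zero by simp
 next
  case 2 hence "f * g = \<infinity>" by (auto simp: ennreal_mult_eq_top_iff)
  thus ?thesis by (simp add: f_def g_def)
 next
  case 3
  \<comment> \<open>The weight for which \<open>c * f\<close> and \<open>g / c\<close> both become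
    the geometric mean of the two integrals.\<close>
  define c where "c = sqrt (enn2real g / enn2real f)"
  have fg: "f = ennreal (enn2real f)" "g = ennreal (enn2real g)" "enn2real f > 0" "enn2real g > 0"
   using 3 by (auto simp: enn2real_positive_iff less_top zero_less_iff_neq_zero)
  have c: "c > 0" "c * enn2real f = sqrt (enn2real f * enn2real g)" "enn2real g / c = sqrt (enn2real f * enn2real g)"
   using fg by (auto simp: c_def real_sqrt_mult real_sqrt_divide field_simps)
  have four_mult_le: "4 * (A * B) <= (A + B)^2" for A B :: real
   using sum_squares_bound[of A B] by (simp add: power2_sum)
  have e: "ennreal (c * u + 1 / c * w) = ennreal c * ennreal u + ennreal (1 / c) * ennreal w"
   if "u \<ge> 0" "w \<ge> 0" for u w
  proof -
   have nn: "0 <= c" "0 <= 1 / c" "0 <= c * u" "0 <= 1 / c * w" using c(1) that by auto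
   show ?thesis by (simp only: ennreal_plus[OF nn(3,4)] ennreal_mult[OF nn(1) that(1)] ennreal_mult[OF nn(2) that(2)])
  qed
  have pt: "2 * I x <= ennreal c * F x + ennreal (1 / c) * G x" for x
  proof (cases "F x = \<infinity> \<or> G x = \<infinity>")
   case True thus ?thesis using c by (auto simp: ennreal_mult_eq_top_iff)
  next
   case False
   then obtain u w where uw: "F x = ennreal u" "G x = ennreal w" "u \<ge> 0" "w \<ge> 0"
    by (metis ennreal_cases infinity_ennreal_def)
   have "(I x)^2 <= ennreal (u * w)" using le[of x] uw by (simp add: ennreal_mult)
   hence "I x \<noteq> \<infinity>" by (auto simp: power2_eq_square top_unique)
   then obtain v where v: "I x = ennreal v" "v \<ge> 0" by (metis ennreal_cases infinity_ennreal_def)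
   have "v\<^sup>2 <= u * w" using \<open>(I x)^2 <= ennreal (u * w)\<close> v uw by (simp add: ennreal_power)
   have "(2 * v)^2 <= 4 * ((c * u) * (w / c))" using \<open>v\<^sup>2 <= u * w\<close> c(1) by (simp add: power2_eq_square)
   also have "\<dots> <= (c * u + w / c)^2"
    by (rule four_mult_le)
   finally have "2 * v <= c * u + w / c"
    by (rule power2_le_imp_le) (use uw c in auto)
   hence "ennreal (2 * v) <= ennreal (c * u + 1 / c * w)" by (intro ennreal_leI) simp
   hence "ennreal (2 * v) <= ennreal c * ennreal u + ennreal (1 / c) * ennreal w"
    unfolding e[OF uw(3,4)] .
   thus ?thesis using uw v by (simp add: ennreal_mult)
  qed
  have "2 * (\<integral>\<^sup>+x. I x \<partial>M) = (\<integral>\<^sup>+x. 2 * I x \<partial>M)" by (simp add: nn_integral_cmult)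
  also have "\<dots> <= (\<integral>\<^sup>+x. ennreal c * F x + ennreal (1 / c) * G x \<partial>M)" by (intro nn_integral_mono pt)
  also have "\<dots> = ennreal c * f + ennreal (1 / c) * g"
   unfolding f_def g_def by (simp add: nn_integral_add nn_integral_cmult)
  also have "\<dots> = ennreal (c * enn2real f + enn2real g / c)"
   using e[of "enn2real f" "enn2real g"] fg(1,2) by simp
  also have "\<dots> = 2 * ennreal (sqrt (enn2real f * enn2real g))" by (simp add: c ennreal_mult flip: ennreal_numeral)
  finally have "(\<integral>\<^sup>+x. I x \<partial>M) <= ennreal (sqrt (enn2real f * enn2real g))"
   by (simp add: ennreal_mult_le_mult_iff)
  hence "(\<integral>\<^sup>+x. I x \<partial>M)^2 <= (ennreal (sqrt (enn2real f * enn2real g)))^2" by (intro power_mono) auto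
  also have "\<dots> = ennreal (enn2real f * enn2real g)" using fg by (simp add: ennreal_power)
  also have "\<dots> = f * g" using fg by (simp add: ennreal_mult)
  finally show ?thesis by (simp add: f_def g_def)
 qed
qed

lemma set_integrable_cbox: "continuous_on UNIV f ==> set_integrable lborel (cbox a b) (f :: real^3 => real)"
 unfolding set_integrable_def
 by (rule borel_integrable_compact) (auto intro: continuous_on_subset)

lemma nn_integral_cbox:
 assumes "continuous_on UNIV (f :: real^3 => real)" "!!x. 0 <= f x"
 shows "(\<integral>\<^sup>+x. ennreal (f x) * indicator (cbox a b) x \<partial>lborel) = ennreal (LBINT x:cbox a b. f x)"
proof -
 have "(\<integral>\<^sup>+x. ennreal (f x) * indicator (cbox a b) x \<partial>lborel) = (\<integral>\<^sup>+x. ennreal (indicator (cbox a b) x *\<^sub>R f x) \<partial>lborel)"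
  by (intro nn_integral_cong) (auto split: split_indicator)
 also have "\<dots> = ennreal (LBINT x:cbox a b. f x)"
  unfolding set_lebesgue_integral_def using set_integrable_cbox[OF assms(1)] assms(2)
  by (intro nn_integral_eq_integral) (auto simp: set_integrable_def)
 finally show ?thesis .
qed

text \<open>Fubini with direction \<open>i\<close> innermost: each line integral is a difference of
  values on opposite faces. Equal values there cover the periodic condition as well as vanishing on
  the boundary.\<close>

lemma integral_pd_faces_zero:
 assumes g: "has_pd i g g'" and ab: "a $ i <= b $ i"
  and faces: "!!x. x \<in> cbox a b ==> x $ i = a $ i ==> g (x + (b $ i - a $ i) *\<^sub>R axis i 1) = g x"
 shows "(LBINT x:cbox a b. g' x) = 0"
proof -
 obtain j k where p: "perm3 j k i" using perm3_exists[of i] unfolding perm3_def by (metis insert_commute)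
 have cg': "continuous_on UNIV g'" using g by (simp add: has_pd_def)
 define f where "f = (%x. indicator (cbox a b) x * g' x)"
 have f: "integrable lborel f" using set_integrable_cbox[OF cg', of a b] by (simp add: set_integrable_def f_def)
 define N where "N = (lborel \<Otimes>\<^sub>M lborel :: (real \<times> real) measure)"
 have sfN: "sigma_finite_measure N" unfolding N_def lborel_prod by (rule sigma_finite_lborel)
 interpret P: pair_sigma_finite lborel N by (intro pair_sigma_finite.intro sfN sigma_finite_lborel)
 define F where "F = (%(s, r, t). f (p3 j k i s r t))"
 have pm: "(%(s, r, t). p3 j k i s r t) \<in> lborel \<Otimes>\<^sub>M lborel \<Otimes>\<^sub>M lborel \<rightarrow>\<^sub>M borel" by measurable
 have [measurable]: "f \<in> borel_measurable borel" using f by auto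
 have F: "integrable (lborel \<Otimes>\<^sub>M N) F"
  using f unfolding N_def F_def by (subst (asm) lborel_perm3[OF p], subst (asm) integrable_distr_eq[OF pm]) (auto simp: case_prod_beta')
 have If: "integral\<^sup>L lborel f = integral\<^sup>L (lborel \<Otimes>\<^sub>M N) F"
  unfolding N_def F_def by (subst lborel_perm3[OF p], subst integral_distr[OF pm]) (auto simp: case_prod_beta')
 have line: "p3 j k i s r t = p3 j k i s r 0 + t *\<^sub>R axis i 1" for s r t by (simp add: p3_def)
 have inner: "(LBINT t. f (p3 j k i s r t)) = 0" for s r
 proof (cases "s \<in> {a$j..b$j} \<and> r \<in> {a$k..b$k}")
  case True
  hence ind: "indicator (cbox a b) (p3 j k i s r t) = (indicator {a$i..b$i} t :: real)" for t
   by (auto simp: mem_box_cart all_perm3[OF p] p3_nth[OF p] split: split_indicator)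
  define x where "x = p3 j k i s r (a $ i)"
  have x: "x \<in> cbox a b" "x $ i = a $ i"
   using True ab by (auto simp: x_def mem_box_cart all_perm3[OF p] p3_nth[OF p])
  have "(LBINT t. f (p3 j k i s r t)) = (LBINT t. g' (p3 j k i s r 0 + t *\<^sub>R axis i 1) * indicator {a$i..b$i} t)"
   unfolding f_def ind by (subst line) (simp add: mult.commute)
  also have "\<dots> = g (p3 j k i s r 0 + (b$i) *\<^sub>R axis i 1) - g (p3 j k i s r 0 + (a$i) *\<^sub>R axis i 1)"
   using has_pd_line[OF g] has_pd_line_cont[OF g]
   by (intro integral_FTC_Icc_real ab) (auto simp: continuous_on_eq_continuous_at)
  also have "\<dots> = g (x + (b $ i - a $ i) *\<^sub>R axis i 1) - g x"
   by (simp add: x_def p3_def algebra_simps)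
  also have "\<dots> = 0" using faces[OF x] by simp
  finally show ?thesis .
 next
  case False
  hence "f (p3 j k i s r t) = 0" for t
   by (auto simp: f_def mem_box_cart all_perm3[OF p] p3_nth[OF p] split: split_indicator)
  thus ?thesis by simp
 qed
 \<comment> \<open>Fubini gives integrability in the remaining variables only for almost every
   \<open>s\<close>.\<close>
 have "AE s in lborel. (\<integral>y. F (s, y) \<partial>N) = 0"
  using P.AE_integrable_fst'[OF F]
 proof eventually_elim
  case (elim s)
  have "(\<integral>y. F (s, y) \<partial>N) = (LBINT r. (LBINT t. F (s, r, t)))"
   using elim unfolding N_def by (subst lborel_pair.integral_fst') auto
  also have "\<dots> = 0" by (simp add: F_def inner)
  finally show ?case .
 qed
 hence "(LBINT s. (\<integral>y. F (s, y) \<partial>N)) = (\<integral>s. 0 \<partial>(lborel::real measure))"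
  using F by (intro integral_cong_AE) (auto intro!: P.borel_measurable_lebesgue_integral P.M2.borel_measurable_lebesgue_integral)
 hence "integral\<^sup>L lborel f = 0" using P.integral_fst'[OF F] If by simp
 thus ?thesis by (simp add: set_lebesgue_integral_def f_def)
qed

section \<open>Poincare and Friedrichs inequalities on a box\<close>

lemma sum3_sq_le: "(A + B + C)^2 <= 3 * (A\<^sup>2 + B\<^sup>2 + (C::real)^2)"
proof -
 have "0 <= (A - B)^2 + (A - C)^2 + (B - C)^2" by simp
 thus ?thesis by (simp add: power2_eq_square algebra_simps)
qed

text \<open>The points \<open>x\<close> and \<open>y\<close> are joined by a path that changes one
  coordinate at a time. By \<open>FTC_sq_le\<close> each leg costs an integral over a full line
  through the box; the factor 3 comes from the three legs.\<close>

lemma poincare_nn: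
 assumes pd: "!!i. has_pd i g (g' i)" and ab: "!!m. a $ m <= b $ m" and h: "!!m. b $ m - a $ m <= h"
 shows "(\<integral>\<^sup>+x. (\<integral>\<^sup>+y. ennreal ((g x - g y)^2) * indicator (cbox a b) y \<partial>lborel) * indicator (cbox a b) x \<partial>lborel)
  <= ennreal (3 * h\<^sup>2 * ((b$1 - a$1) * (b$2 - a$2) * (b$3 - a$3))) *
    (\<Sum>i\<in>UNIV. \<integral>\<^sup>+x. ennreal ((g' i x)^2) * indicator (cbox a b) x \<partial>lborel)"
proof -
 let ?p = "p3 1 2 3"
 have [measurable]: "g \<in> borel_measurable borel" "g' i \<in> borel_measurable borel" for i
  using has_pd_measurable pd by blast+
 define M1 where "M1 = iv (a$1) (b$1)"
 define M2 where "M2 = iv (a$2) (b$2)"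
 define M3 where "M3 = iv (a$3) (b$3)"
 have [measurable_cong, simp]: "sets M1 = sets borel" "sets M2 = sets borel" "sets M3 = sets borel"
  and [simp]: "space M1 = UNIV" "space M2 = UNIV" "space M3 = UNIV" by (simp_all add: M1_def M2_def M3_def)
 define e where "e m = ennreal (b $ m - a $ m)" for m
 have em[simp]: "emeasure M1 UNIV = e 1" "emeasure M2 UNIV = e 2" "emeasure M3 UNIV = e 3"
  using ab by (simp_all add: M1_def M2_def M3_def e_def)
 define P1 where "P1 s r = (\<integral>\<^sup>+\<tau>. ennreal ((g' 1 (?p \<tau> s r))^2) \<partial>M1)" for s r
 define P2 where "P2 t r = (\<integral>\<^sup>+\<tau>. ennreal ((g' 2 (?p t \<tau> r))^2) \<partial>M2)" for t r
 define P3 where "P3 t s = (\<integral>\<^sup>+\<tau>. ennreal ((g' 3 (?p t s \<tau>))^2) \<partial>M3)" for t s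
 have [measurable]: "case_prod P1 \<in> borel_measurable (borel \<Otimes>\<^sub>M borel)" "case_prod P2 \<in> borel_measurable (borel \<Otimes>\<^sub>M borel)"
   "case_prod P3 \<in> borel_measurable (borel \<Otimes>\<^sub>M borel)"
  unfolding P1_def P2_def P3_def M1_def M2_def M3_def by measurable
 define J where "J i = (\<integral>\<^sup>+x. ennreal ((g' i x)^2) * indicator (cbox a b) x \<partial>lborel)" for i
 have perms: "perm3 2 3 1" "perm3 3 1 2" "perm3 1 2 3" by (rule perm3_cases)+
 have comm: "p3 2 3 1 s r t = ?p t s r" "p3 3 1 2 r t s = ?p t s r" for t s r by (simp_all add: p3_def algebra_simps)
 have J1: "(\<integral>\<^sup>+s. \<integral>\<^sup>+r. P1 s r \<partial>M3 \<partial>M2) = J 1"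
  unfolding J_def P1_def M1_def M2_def M3_def by (subst nn_integral_cbox_iv[OF perms(1)]) (auto simp: comm)
 have J2: "(\<integral>\<^sup>+r. \<integral>\<^sup>+t. P2 t r \<partial>M1 \<partial>M3) = J 2"
  unfolding J_def P2_def M1_def M2_def M3_def by (subst nn_integral_cbox_iv[OF perms(2)]) (auto simp: comm)
 have J3: "(\<integral>\<^sup>+t. \<integral>\<^sup>+s. P3 t s \<partial>M2 \<partial>M1) = J 3"
  unfolding J_def P3_def M1_def M2_def M3_def by (subst nn_integral_cbox_iv[OF perms(3)]) (auto simp: comm)
 have [measurable]: "(%x. \<integral>\<^sup>+t. H x t \<partial>M1) \<in> borel_measurable borel" "(%x. \<integral>\<^sup>+t. H x t \<partial>M2) \<in> borel_measurable borel"
  "(%x. \<integral>\<^sup>+t. H x t \<partial>M3) \<in> borel_measurable borel" if "case_prod H \<in> borel_measurable (borel \<Otimes>\<^sub>M borel)" for H :: "real => real => ennreal"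
  using that unfolding M1_def M2_def M3_def by measurable
 \<comment> \<open>Each of \<open>P1\<close>, \<open>P2\<close>, \<open>P3\<close> depends on only
   two of the six variables; hence the sixfold integral factors into side lengths and the integrals
   \<open>J\<close>.\<close>
 have pt: "ennreal ((g (?p t s r) - g (?p t' s' r'))^2) <= 3 * (e 1 * P1 s r + e 2 * P2 t' r + e 3 * P3 t' s')"
  if r: "t \<in> {a$1..b$1}" "t' \<in> {a$1..b$1}" "s \<in> {a$2..b$2}" "s' \<in> {a$2..b$2}" "r \<in> {a$3..b$3}" "r' \<in> {a$3..b$3}" for t s r t' s' r'
 proof -
  have l1: "?p t s r = (s *\<^sub>R axis 2 1 + r *\<^sub>R axis 3 1) + t *\<^sub>R axis 1 1" for t s r by (simp add: p3_def)
  have l2: "?p t s r = (t *\<^sub>R axis 1 1 + r *\<^sub>R axis 3 1) + s *\<^sub>R axis 2 1" for t s r by (simp add: p3_def)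
  have l3: "?p t s r = (t *\<^sub>R axis 1 1 + s *\<^sub>R axis 2 1) + r *\<^sub>R axis 3 1" for t s r by (simp add: p3_def)
  have A: "ennreal ((g (?p t s r) - g (?p t' s r))^2) <= e 1 * P1 s r"
   unfolding P1_def e_def M1_def l1 by (rule FTC_sq_le[OF has_pd_line[OF pd] has_pd_line_cont[OF pd] r(1,2)])
  have B: "ennreal ((g (?p t' s r) - g (?p t' s' r))^2) <= e 2 * P2 t' r"
   unfolding P2_def e_def M2_def l2 by (rule FTC_sq_le[OF has_pd_line[OF pd] has_pd_line_cont[OF pd] r(3,4)])
  have C: "ennreal ((g (?p t' s' r) - g (?p t' s' r'))^2) <= e 3 * P3 t' s'"
   unfolding P3_def e_def M3_def l3 by (rule FTC_sq_le[OF has_pd_line[OF pd] has_pd_line_cont[OF pd] r(5,6)])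
  have "ennreal ((g (?p t s r) - g (?p t' s' r'))^2) <= ennreal (3 * ((g (?p t s r) - g (?p t' s r))^2 + (g (?p t' s r) - g (?p t' s' r))^2 + (g (?p t' s' r) - g (?p t' s' r'))^2))"
   using sum3_sq_le[of "g (?p t s r) - g (?p t' s r)" "g (?p t' s r) - g (?p t' s' r)" "g (?p t' s' r) - g (?p t' s' r')"]
   by (intro ennreal_leI) simp
  also have "\<dots> = 3 * (ennreal ((g (?p t s r) - g (?p t' s r))^2) + ennreal ((g (?p t' s r) - g (?p t' s' r))^2) + ennreal ((g (?p t' s' r) - g (?p t' s' r'))^2))"
   by (simp add: ennreal_mult ennreal_plus)
  also have "\<dots> <= 3 * (e 1 * P1 s r + e 2 * P2 t' r + e 3 * P3 t' s')"
   using A B C by (intro mult_left_mono add_mono) auto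
  finally show ?thesis .
 qed
 have "(\<integral>\<^sup>+x. (\<integral>\<^sup>+y. ennreal ((g x - g y)^2) * indicator (cbox a b) y \<partial>lborel) * indicator (cbox a b) x \<partial>lborel)
  = (\<integral>\<^sup>+t. \<integral>\<^sup>+s. \<integral>\<^sup>+r. \<integral>\<^sup>+t'. \<integral>\<^sup>+s'. \<integral>\<^sup>+r'. ennreal ((g (?p t s r) - g (?p t' s' r'))^2) \<partial>M3 \<partial>M2 \<partial>M1 \<partial>M3 \<partial>M2 \<partial>M1)"
  unfolding M1_def M2_def M3_def
  by (subst nn_integral_cbox_iv[OF perms(3)], measurable) (subst nn_integral_cbox_iv[OF perms(3)], measurable)
 also have "\<dots> <= (\<integral>\<^sup>+t. \<integral>\<^sup>+s. \<integral>\<^sup>+r. \<integral>\<^sup>+t'. \<integral>\<^sup>+s'. \<integral>\<^sup>+r'. 3 * (e 1 * P1 s r + e 2 * P2 t' r + e 3 * P3 t' s') \<partial>M3 \<partial>M2 \<partial>M1 \<partial>M3 \<partial>M2 \<partial>M1)"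
  unfolding M1_def M2_def M3_def by (intro nn_integral_iv_mono pt[unfolded M1_def M2_def M3_def])
 also have "\<dots> = 3 * (e 1 * e 2 * e 3) * (e 1 * e 1 * J 1 + e 2 * e 2 * J 2 + e 3 * e 3 * J 3)"
  by (simp add: nn_integral_add nn_integral_cmult nn_integral_multc J1 J2 J3) (simp add: algebra_simps)
 also have "\<dots> <= 3 * (e 1 * e 2 * e 3) * (ennreal (h\<^sup>2) * J 1 + ennreal (h\<^sup>2) * J 2 + ennreal (h\<^sup>2) * J 3)"
 proof -
  have "e m * e m <= ennreal (h\<^sup>2)" for m
   using ab[of m] h[of m] unfolding e_def power2_eq_square
   by (subst ennreal_mult[symmetric]) (auto intro!: ennreal_leI mult_mono)
  thus ?thesis by (intro mult_left_mono add_mono mult_right_mono) auto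
 qed
 also have "\<dots> = (3 * (e 1 * e 2 * e 3) * ennreal (h\<^sup>2)) * (\<Sum>i\<in>UNIV. J i)"
  by (simp only: sum_3 distrib_left mult.assoc)
 also have "3 * (e 1 * e 2 * e 3) * ennreal (h\<^sup>2) = ennreal (3 * h\<^sup>2 * ((b$1 - a$1) * (b$2 - a$2) * (b$3 - a$3)))"
  unfolding e_def using ab by (simp add: ennreal_mult mult_ac)
 finally show ?thesis by (simp add: J_def)
qed

lemma measure_cbox3: "(!!m. a $ m <= b $ m) ==> measure lborel (cbox a b :: (real^3) set) = (b$1 - a$1) * (b$2 - a$2) * (b$3 - a$3)"
proof -
 assume "!!m. a $ m <= b $ m"
 hence "cbox a b \<noteq> {}" by (simp add: interval_ne_empty_cart)
 hence "measure lborel (cbox a b) = (\<Prod>m\<in>UNIV. b $ m - a $ m)" by (rule content_cbox_cart)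
 also have "\<dots> = (b$1 - a$1) * (b$2 - a$2) * (b$3 - a$3)" unfolding UNIV_3 by simp
 finally show ?thesis .
qed

text \<open>With \<open>q\<close> the integral of the square and \<open>m\<close> the integral of
  \<open>g\<close>, the double integral of \<open>(g x - g y)^2\<close> is
  \<open>2 * V * q - 2 * m^2\<close>. Division by \<open>2 * V\<close> turns the factor 3 of
  \<open>poincare_nn\<close> into 3/2.\<close>

lemma poincare_box:
 assumes pd: "!!i. has_pd i g (g' i)" and ab: "!!m. a $ m <= b $ m" and h: "!!m. b $ m - a $ m <= h"
 shows "(LBINT x:cbox a b. (g x)^2) <= (LBINT x:cbox a b. g x)^2 / measure lborel (cbox a b)
   + 3 / 2 * h\<^sup>2 * (\<Sum>i\<in>UNIV. LBINT x:cbox a b. (g' i x)^2)"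
proof -
 define V where "V = measure lborel (cbox a b)"
 define m where "m = (LBINT x:cbox a b. g x)"
 define q where "q = (LBINT x:cbox a b. (g x)^2)"
 define G where "G = (\<Sum>i\<in>UNIV. LBINT x:cbox a b. (g' i x)^2)"
 have cont[continuous_intros]: "continuous_on UNIV g" "continuous_on UNIV (g' i)" for i using pd by (auto simp: has_pd_def)
 have G0: "G \<ge> 0" unfolding G_def set_lebesgue_integral_def by (intro sum_nonneg Bochner_Integration.integral_nonneg) auto
 show ?thesis
 proof (cases "V = 0")
  \<comment> \<open>A degenerate box: the quotient by its volume is 0, and so is the integral on the
    left.\<close>
  case True
  hence "emeasure lborel (cbox a b) = 0" unfolding V_def using emeasure_bounded_finite[OF bounded_cbox, of a b] by (auto simp: measure_def enn2real_eq_0_iff)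
  hence "cbox a b \<in> null_sets lborel" by auto
  hence "q = 0" unfolding q_def set_lebesgue_integral_def by (intro integral_eq_zero_AE AE_I'[where N="cbox a b"]) (auto split: split_indicator_asm)
  thus ?thesis using G0 True unfolding q_def[symmetric] G_def[symmetric] V_def by simp
 next
  case False
  hence V: "V > 0" unfolding V_def using measure_nonneg[of lborel "cbox a b"] by linarith
  have int: "set_integrable lborel (cbox a b) (%x. (g x)^2)" "set_integrable lborel (cbox a b) g" "set_integrable lborel (cbox a b) (%x. c)" for c :: real
   using set_integrable_cbox[OF continuous_on_const] by (auto intro!: set_integrable_cbox continuous_intros)
  have c1: "(LBINT y:cbox a b. c) = V * c" for c
   unfolding V_def set_lebesgue_integral_def using emeasure_bounded_finite[OF bounded_cbox, of a b] by simp
  have lin: "(LBINT y:cbox a b. c\<^sub>0 + c\<^sub>1 * g y + c\<^sub>2 * (g y)^2) = V * c\<^sub>0 + c\<^sub>1 * m + c\<^sub>2 * q" for c\<^sub>0 c\<^sub>1 c\<^sub>2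
  proof -
   have i1: "set_integrable lborel (cbox a b) (%y. c\<^sub>1 * g y)" and i2: "set_integrable lborel (cbox a b) (%y. c\<^sub>2 * (g y)^2)"
    using int by auto
   have "(LBINT y:cbox a b. c\<^sub>0 + c\<^sub>1 * g y + c\<^sub>2 * (g y)^2) = (LBINT y:cbox a b. c\<^sub>0 + c\<^sub>1 * g y) + (LBINT y:cbox a b. c\<^sub>2 * (g y)^2)"
    by (rule set_integral_add(2)[OF set_integral_add(1)[OF int(3) i1] i2])
   also have "(LBINT y:cbox a b. c\<^sub>0 + c\<^sub>1 * g y) = (LBINT y:cbox a b. c\<^sub>0) + (LBINT y:cbox a b. c\<^sub>1 * g y)"
    by (rule set_integral_add(2)[OF int(3) i1])
   finally show ?thesis by (simp add: c1 m_def q_def)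
  qed
  have D: "(LBINT y:cbox a b. (g x - g y)^2) = V * (g x)^2 - 2 * m * g x + q" for x
   using lin[of "(g x)^2" "- 2 * g x" 1] by (simp add: power2_diff algebra_simps)
  have DD: "(LBINT x:cbox a b. V * (g x)^2 - 2 * m * g x + q) = 2 * V * q - 2 * m\<^sup>2"
   using lin[of q "- 2 * m" V] by (simp add: power2_eq_square algebra_simps)
  have "ennreal (2 * V * q - 2 * m\<^sup>2) = (\<integral>\<^sup>+x. ennreal (V * (g x)^2 - 2 * m * g x + q) * indicator (cbox a b) x \<partial>lborel)"
  proof (subst nn_integral_cbox)
   show "0 <= V * (g x)^2 - 2 * m * g x + q" for x
    unfolding D[symmetric] set_lebesgue_integral_def by (intro Bochner_Integration.integral_nonneg) auto
  qed (auto intro!: continuous_intros simp: DD)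
  also have "\<dots> = (\<integral>\<^sup>+x. (\<integral>\<^sup>+y. ennreal ((g x - g y)^2) * indicator (cbox a b) y \<partial>lborel) * indicator (cbox a b) x \<partial>lborel)"
   by (subst nn_integral_cbox) (auto intro!: continuous_intros simp: D)
  also have "\<dots> <= ennreal (3 * h\<^sup>2 * V) * (\<Sum>i\<in>UNIV. \<integral>\<^sup>+x. ennreal ((g' i x)^2) * indicator (cbox a b) x \<partial>lborel)"
   unfolding V_def measure_cbox3[OF ab] by (rule poincare_nn[OF assms])
  also have "(\<Sum>i\<in>UNIV. \<integral>\<^sup>+x. ennreal ((g' i x)^2) * indicator (cbox a b) x \<partial>lborel) = (\<Sum>i\<in>UNIV. ennreal (LBINT x:cbox a b. (g' i x)^2))"
   by (intro sum.cong refl nn_integral_cbox) (auto intro!: continuous_intros)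
  also have "\<dots> = ennreal G"
   unfolding G_def by (intro sum_ennreal) (auto simp: set_lebesgue_integral_def intro!: Bochner_Integration.integral_nonneg)
  also have "ennreal (3 * h\<^sup>2 * V) * ennreal G = ennreal (3 * h\<^sup>2 * V * G)" using V G0 by (simp add: ennreal_mult)
  finally have "2 * V * q - 2 * m\<^sup>2 <= 3 * h\<^sup>2 * V * G" using V G0 by (simp add: ennreal_le_iff)
  hence "q <= m\<^sup>2 / V + 3 / 2 * h\<^sup>2 * G" using V by (simp add: field_simps)
  thus ?thesis by (simp add: V_def m_def q_def G_def)
 qed
qed

text \<open>Poincare on each cell of a fine division: the gradient terms of the cells add up, and
  the integrals over the cells are the finitely many quantities that remain.\<close>

lemma friedrichs_box:
 fixes a b :: "real^3"
 assumes \<delta>: "\<delta> > 0"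
 obtains K where "finite K" "!!k. k \<in> K ==> \<exists>u v. k = cbox u v \<and> k \<subseteq> cbox a b"
  "!!g g'. (!!i. has_pd i g (g' i)) ==> (LBINT x:cbox a b. (g x)^2) \<le>
    (\<Sum>k\<in>K. (LBINT x:k. g x)^2 / measure lborel k) + \<delta> * (\<Sum>i\<in>UNIV. LBINT x:cbox a b. (g' i x)^2)"
proof -
 \<comment> \<open>Makes \<open>3 / 2 * h^2\<close> equal to
   \<open>3 / 8 * \<delta>\<close>.\<close>
 define h where "h = sqrt \<delta> / 2"
 have h: "h > 0" "3 / 2 * h\<^sup>2 <= \<delta>" using \<delta> by (auto simp: h_def power_divide)
 \<comment> \<open>Cells inside balls of radius \<open>h / 2\<close> have sides shorter than
   \<open>h\<close>.\<close>
 obtain p where p: "p tagged_division_of (cbox a b)" "(%x. ball x (h/2)) fine p"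
  using fine_division_exists[OF gauge_ball[of "h/2"]] h by auto
 define K where "K = snd ` p"
 have K: "K division_of (cbox a b)" unfolding K_def by (rule division_of_tagged_division[OF p(1)])
 have add: "(LBINT x:cbox a b. f x) = (\<Sum>k\<in>K. LBINT x:k. f x)" if f: "continuous_on UNIV f" for f :: "real^3 => real"
 proof -
  have i: "set_integrable lborel (cbox u v) f" for u v by (rule set_integrable_cbox[OF f])
  have "(LBINT x:cbox a b. f x) = integral (cbox a b) f" using set_borel_integral_eq_integral(2)[OF i] by simp
  also have "\<dots> = (\<Sum>k\<in>K. integral k f)"
   using set_borel_integral_eq_integral(1)[OF i] by (intro integral_combine_division_topdown K)
  also have "\<dots> = (\<Sum>k\<in>K. LBINT x:k. f x)"
   using set_borel_integral_eq_integral(2)[OF i] division_ofD(4)[OF K] by (intro sum.cong refl) metis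
  finally show ?thesis .
 qed
 have "(LBINT x:cbox a b. (g x)^2) \<le>
    (\<Sum>k\<in>K. (LBINT x:k. g x)^2 / measure lborel k) + \<delta> * (\<Sum>i\<in>UNIV. LBINT x:cbox a b. (g' i x)^2)"
  if pd: "!!i. has_pd i g (g' i)" for g g'
 proof -
  have cont[continuous_intros]: "continuous_on UNIV g" "continuous_on UNIV (g' i)" for i using pd by (auto simp: has_pd_def)
  have cell: "(LBINT x:k. (g x)^2) <= (LBINT x:k. g x)^2 / measure lborel k + 3 / 2 * h\<^sup>2 * (\<Sum>i\<in>UNIV. LBINT x:k. (g' i x)^2)"
   if k: "k \<in> K" for k
  proof -
   obtain u v where uv: "k = cbox u v" using division_ofD(4)[OF K k] by blast
   have ne: "cbox u v \<noteq> {}" using division_ofD(3)[OF K k] uv by blast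
   obtain x where x: "cbox u v \<subseteq> ball x (h/2)" using p(2) k uv unfolding K_def fine_def by fastforce
   have le: "u $ m <= v $ m" for m using ne by (simp add: interval_ne_empty_cart)
   have "u \<in> cbox u v" "v \<in> cbox u v" using le by (auto simp: mem_box_cart)
   hence "dist u v < h" using x dist_triangle2[of u v x] dist_commute by (smt (verit) mem_ball subsetD field_sum_of_halves)
   hence "v $ m - u $ m <= h" for m
    using component_le_norm_cart[of "v - u" m] by (simp add: dist_norm norm_minus_commute)
   thus ?thesis unfolding uv by (intro poincare_box pd le)
  qed
  have "(LBINT x:cbox a b. (g x)^2) = (\<Sum>k\<in>K. LBINT x:k. (g x)^2)"
   by (intro add continuous_intros)
  also have "\<dots> <= (\<Sum>k\<in>K. (LBINT x:k. g x)^2 / measure lborel k + 3 / 2 * h\<^sup>2 * (\<Sum>i\<in>UNIV. LBINT x:k. (g' i x)^2))"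
   by (intro sum_mono cell)
  also have "\<dots> = (\<Sum>k\<in>K. (LBINT x:k. g x)^2 / measure lborel k) + 3 / 2 * h\<^sup>2 * (\<Sum>i\<in>UNIV. \<Sum>k\<in>K. LBINT x:k. (g' i x)^2)"
   by (subst sum.swap) (simp add: sum.distrib sum_distrib_left)
  also have "(\<Sum>i\<in>UNIV. \<Sum>k\<in>K. LBINT x:k. (g' i x)^2) = (\<Sum>i\<in>UNIV. LBINT x:cbox a b. (g' i x)^2)"
   by (intro sum.cong refl add[symmetric] continuous_intros)
  finally show ?thesis
   using mult_right_mono[OF h(2), of "\<Sum>i\<in>UNIV. LBINT x:cbox a b. (g' i x)^2"]
   by (smt (verit) sum_nonneg set_lebesgue_integral_def Bochner_Integration.integral_nonneg scaleR_nonneg_nonneg indicator_pos_le zero_le_power2)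
 qed
 moreover have "\<exists>u v. k = cbox u v \<and> k \<subseteq> cbox a b" if "k \<in> K" for k
  using division_ofD(2,4)[OF K that] by blast
 moreover have "finite K" using division_ofD(1)[OF K] .
 ultimately show ?thesis by (intro that) auto
qed

section \<open>Loomis-Whitney and Gagliardo-Nirenberg inequalities\<close>

text \<open>Cauchy-Schwarz in \<open>s\<close>, then in \<open>t\<close>, then in \<open>r\<close>;
  each time the factor that is free of the current variable comes out of the integral.\<close>

lemma loomis_whitney:
 fixes a b :: "real^3"
 defines "M m \<equiv> iv (a $ m) (b $ m)"
 assumes q[measurable]: "q \<in> borel_measurable borel"
  and A[measurable]: "case_prod A1 \<in> borel_measurable (borel \<Otimes>\<^sub>M borel)" "case_prod A2 \<in> borel_measurable (borel \<Otimes>\<^sub>M borel)"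
   "case_prod A3 \<in> borel_measurable (borel \<Otimes>\<^sub>M borel)"
  and le: "!!t s r. p3 1 2 3 t s r \<in> cbox a b ==> (q (p3 1 2 3 t s r))^2 <= A1 s r * (A2 t r * A3 t s)"
 shows "(\<integral>\<^sup>+x. q x * indicator (cbox a b) x \<partial>lborel)^2 \<le>
  (\<integral>\<^sup>+r. \<integral>\<^sup>+s. A1 s r \<partial>M 2 \<partial>M 3) * ((\<integral>\<^sup>+r. \<integral>\<^sup>+t. A2 t r \<partial>M 1 \<partial>M 3) * (\<integral>\<^sup>+t. \<integral>\<^sup>+s. A3 t s \<partial>M 2 \<partial>M 1))"
proof -
 let ?p = "p3 1 2 3"
 have [measurable_cong, simp]: "sets (M m) = sets borel" for m by (simp add: M_def)
 have sf: "sigma_finite_measure (M m)" for m unfolding M_def by (rule sigma_finite_iv)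
 define Q where "Q t s r = q (?p t s r) * indicator (cbox a b) (?p t s r)" for t s r
 have [measurable]: "(%(t, s, r). Q t s r) \<in> borel_measurable (borel \<Otimes>\<^sub>M borel \<Otimes>\<^sub>M borel)"
  unfolding Q_def by measurable
 have Q: "(Q t s r)^2 <= A1 s r * (A2 t r * A3 t s)" for t s r
  using le[of t s r] by (auto simp: Q_def split: split_indicator)
 have perm: "perm3 3 1 2" by (rule perm3_cases)+
 have comm: "p3 3 1 2 r t s = ?p t s r" for t s r by (simp add: p3_def algebra_simps)
 define F1 where "F1 r = (\<integral>\<^sup>+s. A1 s r \<partial>M 2)" for r
 define F2 where "F2 r = (\<integral>\<^sup>+t. A2 t r \<partial>M 1)" for r
 define F3 where "F3 t = (\<integral>\<^sup>+s. A3 t s \<partial>M 2)" for t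
 define a3 where "a3 = (\<integral>\<^sup>+t. F3 t \<partial>M 1)"
 have [measurable]: "F1 \<in> borel_measurable borel" "F2 \<in> borel_measurable borel" "F3 \<in> borel_measurable borel"
  unfolding F1_def F2_def F3_def M_def by measurable
 have 1: "(\<integral>\<^sup>+s. Q t s r \<partial>M 2)^2 <= (F1 r * A2 t r) * F3 t" for t r
 proof -
  have "(\<integral>\<^sup>+s. Q t s r \<partial>M 2)^2 <= (\<integral>\<^sup>+s. A1 s r \<partial>M 2) * (\<integral>\<^sup>+s. A2 t r * A3 t s \<partial>M 2)"
   by (rule nn_integral_Cauchy_Schwarz_pointwise[OF _ _ _ Q]) measurable
  also have "(\<integral>\<^sup>+s. A2 t r * A3 t s \<partial>M 2) = A2 t r * F3 t" unfolding F3_def by (rule nn_integral_cmult) measurable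
  finally show ?thesis by (simp add: F1_def mult.assoc)
 qed
 have 2: "(\<integral>\<^sup>+t. \<integral>\<^sup>+s. Q t s r \<partial>M 2 \<partial>M 1)^2 <= F1 r * (F2 r * a3)" for r
 proof -
  have "(\<integral>\<^sup>+t. \<integral>\<^sup>+s. Q t s r \<partial>M 2 \<partial>M 1)^2 <= (\<integral>\<^sup>+t. F1 r * A2 t r \<partial>M 1) * (\<integral>\<^sup>+t. F3 t \<partial>M 1)"
   by (rule nn_integral_Cauchy_Schwarz_pointwise[OF _ _ _ 1]) (unfold M_def Q_def, measurable)
  also have "(\<integral>\<^sup>+t. F1 r * A2 t r \<partial>M 1) = F1 r * F2 r" unfolding F2_def by (rule nn_integral_cmult) measurable
  finally show ?thesis by (simp add: a3_def mult.assoc)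
 qed
 have "(\<integral>\<^sup>+x. q x * indicator (cbox a b) x \<partial>lborel) = (\<integral>\<^sup>+x. (q x * indicator (cbox a b) x) * indicator (cbox a b) x \<partial>lborel)"
  by (intro nn_integral_cong) (auto split: split_indicator)
 also have "\<dots> = (\<integral>\<^sup>+r. \<integral>\<^sup>+t. \<integral>\<^sup>+s. Q t s r \<partial>M 2 \<partial>M 1 \<partial>M 3)"
  by (subst nn_integral_cbox_iv[OF perm]) (auto simp: Q_def M_def comm)
 finally have "(\<integral>\<^sup>+x. q x * indicator (cbox a b) x \<partial>lborel)^2 = (\<integral>\<^sup>+r. \<integral>\<^sup>+t. \<integral>\<^sup>+s. Q t s r \<partial>M 2 \<partial>M 1 \<partial>M 3)^2" by simp
 also have "\<dots> <= (\<integral>\<^sup>+r. F1 r \<partial>M 3) * (\<integral>\<^sup>+r. F2 r * a3 \<partial>M 3)"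
  by (rule nn_integral_Cauchy_Schwarz_pointwise[OF _ _ _ 2]) (unfold M_def Q_def, measurable)
 also have "(\<integral>\<^sup>+r. F2 r * a3 \<partial>M 3) = (\<integral>\<^sup>+r. F2 r \<partial>M 3) * a3" by (rule nn_integral_multc) measurable
 finally show ?thesis by (simp add: F1_def F2_def F3_def a3_def)
qed

text \<open>A value is at most the average plus the total variation. Keeping the average makes the
  bound available for periodic fields, which do not vanish at the end points.\<close>

lemma FTC_average_le:
 fixes k k' :: "real => real"
 assumes d: "!!t. (k has_real_derivative k' t) (at t)" and c: "continuous_on UNIV k'"
  and ab: "a < b" and t: "t \<in> {a..b}" and k0: "!!t. 0 <= k t"
 shows "ennreal (k t) <= (\<integral>\<^sup>+\<tau>. ennreal (k \<tau> / (b - a) + \<bar>k' \<tau>\<bar>) \<partial>iv a b)"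
proof -
 have [measurable]: "k' \<in> borel_measurable borel" using c by (rule borel_measurable_continuous_onI)
 have [measurable]: "k \<in> borel_measurable borel"
  using d by (intro borel_measurable_continuous_onI) (meson DERIV_continuous_on has_field_derivative_at_within)
 define T where "T = (\<integral>\<^sup>+\<tau>. ennreal \<bar>k' \<tau>\<bar> \<partial>iv a b)"
 have one: "ennreal (1 / (b - a)) * ennreal (b - a) = 1" using ab by (simp flip: ennreal_mult)
 have "ennreal (k t) = (\<integral>\<^sup>+\<tau>. ennreal (1 / (b - a)) * ennreal (k t) \<partial>iv a b)"
  using ab one by (simp add: mult.assoc mult.commute[of "ennreal (k t)"]) (simp add: mult.assoc[symmetric] one)
 also have "\<dots> <= (\<integral>\<^sup>+\<tau>. ennreal (1 / (b - a)) * (ennreal (k \<tau>) + T) \<partial>iv a b)"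
 proof (rule nn_integral_iv_mono)
  fix \<tau> assume "\<tau> \<in> {a..b}"
  have "ennreal (k t) <= ennreal (k \<tau> + \<bar>k t - k \<tau>\<bar>)" by (intro ennreal_leI) simp
  also have "\<dots> = ennreal (k \<tau>) + ennreal \<bar>k t - k \<tau>\<bar>" using k0 by (simp add: ennreal_plus)
  also have "\<dots> <= ennreal (k \<tau>) + T"
   unfolding T_def by (intro add_left_mono FTC_abs_le[OF d c t] \<open>\<tau> \<in> {a..b}\<close>)
  finally show "ennreal (1 / (b - a)) * ennreal (k t) <= ennreal (1 / (b - a)) * (ennreal (k \<tau>) + T)"
   by (intro mult_left_mono) auto
 qed
 also have "\<dots> = (\<integral>\<^sup>+\<tau>. ennreal (1 / (b - a)) * ennreal (k \<tau>) \<partial>iv a b) + ennreal (1 / (b - a)) * T * ennreal (b - a)"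
  using ab by (simp add: distrib_left nn_integral_add)
 also have "ennreal (1 / (b - a)) * T * ennreal (b - a) = T"
  using one by (metis mult.commute mult.assoc mult_1)
 also have "(\<integral>\<^sup>+\<tau>. ennreal (1 / (b - a)) * ennreal (k \<tau>) \<partial>iv a b) + T = (\<integral>\<^sup>+\<tau>. ennreal (1 / (b - a)) * ennreal (k \<tau>) + ennreal \<bar>k' \<tau>\<bar> \<partial>iv a b)"
  unfolding T_def by (rule nn_integral_add[symmetric]) measurable
 also have "\<dots> = (\<integral>\<^sup>+\<tau>. ennreal (k \<tau> / (b - a) + \<bar>k' \<tau>\<bar>) \<partial>iv a b)"
 proof (intro nn_integral_cong)
  fix \<tau>
  have "ennreal (1 / (b - a)) * ennreal (k \<tau>) = ennreal (k \<tau> / (b - a))"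
   using ab k0 by (subst ennreal_mult[symmetric]) auto
  thus "ennreal (1 / (b - a)) * ennreal (k \<tau>) + ennreal \<bar>k' \<tau>\<bar> = ennreal (k \<tau> / (b - a) + \<bar>k' \<tau>\<bar>)"
   using ab k0 by (simp add: ennreal_plus)
 qed
 finally show ?thesis .
qed

text \<open>\<open>w\<close> is dominated by its integrals along the three axis directions, and
  Loomis-Whitney multiplies these bounds. The function \<open>v\<close> stands for the power 3/2 of
  \<open>w\<close>, given through squares and cubes to keep real exponents out.\<close>

lemma gagliardo_nirenberg_box:
 assumes pd: "!!i. has_pd i w (w' i)" and ab: "!!m. a $ m < b $ m" and w0: "!!x. 0 <= w x"
  and v: "continuous_on UNIV v" "!!x. 0 <= v x" "!!x. (v x)^2 = (w x) ^ 3"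
 shows "(LBINT x:cbox a b. v x)^2 <= (\<Prod>i\<in>UNIV. LBINT x:cbox a b. w x / (b $ i - a $ i) + \<bar>w' i x\<bar>)"
proof -
 let ?p = "p3 1 2 3"
 have cont[continuous_intros]: "continuous_on UNIV w" "continuous_on UNIV (w' i)" for i using pd by (auto simp: has_pd_def)
 have [measurable]: "w \<in> borel_measurable borel" "w' i \<in> borel_measurable borel" "v \<in> borel_measurable borel" for i
  using has_pd_measurable pd v(1) borel_measurable_continuous_onI by blast+
 define Z where "Z i x = w x / (b $ i - a $ i) + \<bar>w' i x\<bar>" for i x
 have [measurable]: "Z i \<in> borel_measurable borel" for i unfolding Z_def by measurable
 have Zc: "continuous_on UNIV (Z i)" for i
  unfolding Z_def using ab[of i] by (intro continuous_intros) auto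
 have Z0: "0 <= Z i x" for i x unfolding Z_def using w0[of x] ab[of i] by (auto intro!: add_nonneg_nonneg divide_nonneg_pos)
 define A1 where "A1 s r = (\<integral>\<^sup>+\<tau>. ennreal (Z 1 (?p \<tau> s r)) \<partial>iv (a$1) (b$1))" for s r
 define A2 where "A2 t r = (\<integral>\<^sup>+\<tau>. ennreal (Z 2 (?p t \<tau> r)) \<partial>iv (a$2) (b$2))" for t r
 define A3 where "A3 t s = (\<integral>\<^sup>+\<tau>. ennreal (Z 3 (?p t s \<tau>)) \<partial>iv (a$3) (b$3))" for t s
 define J where "J i = (\<integral>\<^sup>+x. ennreal (Z i x) * indicator (cbox a b) x \<partial>lborel)" for i
 have perms: "perm3 3 2 1" "perm3 3 1 2" "perm3 1 2 3" by (rule perm3_cases)+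
 have comm: "p3 3 2 1 r s t = ?p t s r" "p3 3 1 2 r t s = ?p t s r" for t s r by (simp_all add: p3_def algebra_simps)
 have J1: "(\<integral>\<^sup>+r. \<integral>\<^sup>+s. A1 s r \<partial>iv (a$2) (b$2) \<partial>iv (a$3) (b$3)) = J 1"
  unfolding J_def A1_def by (subst nn_integral_cbox_iv[OF perms(1)]) (auto simp: comm)
 have J2: "(\<integral>\<^sup>+r. \<integral>\<^sup>+t. A2 t r \<partial>iv (a$1) (b$1) \<partial>iv (a$3) (b$3)) = J 2"
  unfolding J_def A2_def by (subst nn_integral_cbox_iv[OF perms(2)]) (auto simp: comm)
 have J3: "(\<integral>\<^sup>+t. \<integral>\<^sup>+s. A3 t s \<partial>iv (a$2) (b$2) \<partial>iv (a$1) (b$1)) = J 3"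
  unfolding J_def A3_def by (subst nn_integral_cbox_iv[OF perms(3)]) (auto simp: comm)
 have "(\<integral>\<^sup>+x. ennreal (v x) * indicator (cbox a b) x \<partial>lborel)^2 <= J 1 * (J 2 * J 3)"
  unfolding J1[symmetric] J2[symmetric] J3[symmetric]
 proof (rule loomis_whitney)
  fix t s r assume "?p t s r \<in> cbox a b"
  hence r: "t \<in> {a$1..b$1}" "s \<in> {a$2..b$2}" "r \<in> {a$3..b$3}"
   by (auto simp: mem_box_cart all_perm3[OF perms(3)] p3_nth[OF perms(3)])
  have l1: "?p t s r = (s *\<^sub>R axis 2 1 + r *\<^sub>R axis 3 1) + t *\<^sub>R axis 1 1" for t s r by (simp add: p3_def)
  have l2: "?p t s r = (t *\<^sub>R axis 1 1 + r *\<^sub>R axis 3 1) + s *\<^sub>R axis 2 1" for t s r by (simp add: p3_def)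
  have l3: "?p t s r = (t *\<^sub>R axis 1 1 + s *\<^sub>R axis 2 1) + r *\<^sub>R axis 3 1" for t s r by (simp add: p3_def)
  have A: "ennreal (w (?p t s r)) <= A1 s r"
   unfolding A1_def Z_def l1 by (rule FTC_average_le[OF has_pd_line[OF pd] has_pd_line_cont[OF pd] ab r(1) w0])
  have B: "ennreal (w (?p t s r)) <= A2 t r"
   unfolding A2_def Z_def l2 by (rule FTC_average_le[OF has_pd_line[OF pd] has_pd_line_cont[OF pd] ab r(2) w0])
  have C: "ennreal (w (?p t s r)) <= A3 t s"
   unfolding A3_def Z_def l3 by (rule FTC_average_le[OF has_pd_line[OF pd] has_pd_line_cont[OF pd] ab r(3) w0])
  have "(ennreal (v (?p t s r)))^2 = ennreal ((w (?p t s r)) ^ 3)" using v(2,3) by (simp add: ennreal_power)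
  also have "\<dots> = ennreal (w (?p t s r)) * (ennreal (w (?p t s r)) * ennreal (w (?p t s r)))"
   using w0 by (simp add: power3_eq_cube ennreal_mult mult.assoc)
  also have "\<dots> <= A1 s r * (A2 t r * A3 t s)" using A B C by (intro mult_mono) auto
  finally show "(ennreal (v (?p t s r)))^2 <= A1 s r * (A2 t r * A3 t s)" .
 qed (unfold A1_def A2_def A3_def, measurable)
 also have "J 1 * (J 2 * J 3) = (\<Prod>i\<in>UNIV. J i)" unfolding UNIV_3 by simp
 also have "J = (%i. ennreal (LBINT x:cbox a b. Z i x))"
  unfolding J_def using nn_integral_cbox[OF Zc Z0] by auto
 also have "(\<Prod>i\<in>UNIV. ennreal (LBINT x:cbox a b. Z i x)) = ennreal (\<Prod>i\<in>UNIV. LBINT x:cbox a b. Z i x)"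
  using Z0 by (intro prod_ennreal) (auto simp: set_lebesgue_integral_def intro!: Bochner_Integration.integral_nonneg)
 also have "(\<integral>\<^sup>+x. ennreal (v x) * indicator (cbox a b) x \<partial>lborel)^2 = ennreal ((LBINT x:cbox a b. v x)^2)"
  using v by (subst nn_integral_cbox) (auto simp: ennreal_power set_lebesgue_integral_def intro!: Bochner_Integration.integral_nonneg)
 finally have "(LBINT x:cbox a b. v x)^2 <= (\<Prod>i\<in>UNIV. LBINT x:cbox a b. Z i x)"
  using Z0 by (subst (asm) ennreal_le_iff) (auto simp: set_lebesgue_integral_def intro!: prod_nonneg Bochner_Integration.integral_nonneg)
 thus ?thesis by (simp add: Z_def)
qed

section \<open>Test functions on the line\<close>

definition smooth_real :: "(real => real) => bool" where
 "smooth_real f \<longleftrightarrow> (\<forall>n x. (deriv ^^ n) f field_differentiable (at x))"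

text \<open>Replaces the computation of higher derivatives by exhibiting a family of differentiable
  functions that is closed under \<open>deriv\<close>.\<close>

lemma smooth_real_coinduct:
 assumes "f \<in> S" "!!g x. g \<in> S ==> g field_differentiable (at x)" "!!g. g \<in> S ==> deriv g \<in> S"
 shows "smooth_real f"
proof -
 have "(deriv ^^ n) f \<in> S" for n by (induction n) (auto simp: assms)
 thus ?thesis using assms(2) by (auto simp: smooth_real_def)
qed

lemma smooth_realD: "smooth_real f ==> f field_differentiable (at x)" "smooth_real f ==> smooth_real (deriv f)"
proof -
 assume f: "smooth_real f"
 show "f field_differentiable (at x)" using f[unfolded smooth_real_def, rule_format, of 0 x] by simp
 have "(deriv ^^ n) (deriv f) field_differentiable (at x)" for n x
  using f[unfolded smooth_real_def, rule_format, of "Suc n" x] by (simp only: funpow_Suc_right o_apply)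
 thus "smooth_real (deriv f)" by (simp add: smooth_real_def)
qed

lemma smooth_real_antideriv:
 assumes "!!x. (f has_real_derivative g x) (at x)" "smooth_real g"
 shows "smooth_real f"
proof -
 have "deriv f = g" using assms(1) DERIV_imp_deriv by blast
 hence "(deriv ^^ n) f field_differentiable (at x)" for n x
  using assms by (cases n) (auto simp: funpow_Suc_right smooth_real_def field_differentiable_def simp del: funpow.simps)
 thus ?thesis by (simp add: smooth_real_def)
qed

lemma smooth_real_lincomb:
 assumes "smooth_real f" "smooth_real g"
 shows "smooth_real (%x. c * f x + d * g x)"
proof (rule smooth_real_coinduct[where S="{%x. c * f x + d * g x | f g. smooth_real f \<and> smooth_real g}"])
 have D: "((%x. c * f x + d * g x) has_real_derivative c * deriv f x + d * deriv g x) (at x)"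
  if "smooth_real f" "smooth_real g" for f g x
  using that by (auto intro!: derivative_eq_intros smooth_realD(1)[THEN field_differentiable_derivI])
 show "h field_differentiable (at x)" if "h \<in> {%x. c * f x + d * g x | f g. smooth_real f \<and> smooth_real g}" for h x
  using that D by (auto simp: field_differentiable_def)
 show "deriv h \<in> {%x. c * f x + d * g x | f g. smooth_real f \<and> smooth_real g}"
  if h: "h \<in> {%x. c * f x + d * g x | f g. smooth_real f \<and> smooth_real g}" for h
 proof -
  obtain f g where fg: "h = (%x. c * f x + d * g x)" "smooth_real f" "smooth_real g" using h by blast
  have "deriv h = (%x. c * deriv f x + d * deriv g x)"
   unfolding fg(1) by (intro ext DERIV_imp_deriv D fg)
  thus ?thesis using fg smooth_realD(2) by blast
 qed
qed (use assms in blast)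

section \<open>Smooth bumps and mollifiers\<close>

text \<open>Serves the end points of the bumps, where the formula inside and the value 0 outside
  meet.\<close>

lemma DERIV_zero_of_quadratic_bound:
 fixes f :: "real => real"
 assumes "!!x. \<bar>f x\<bar> <= C * (x - c)^2"
 shows "(f has_real_derivative 0) (at c)"
proof -
 have fc: "f c = 0" using assms[of c] by simp
 have "((%x. (f x - f c) / (x - c)) \<longlongrightarrow> 0) (at c)"
 proof (rule Lim_null_comparison)
  show "\<forall>\<^sub>F x in at c. norm ((f x - f c) / (x - c)) <= C * \<bar>x - c\<bar>"
  proof (rule eventually_at_filter[THEN iffD2], rule always_eventually, intro allI impI)
   fix x assume "x \<noteq> c"
   hence "\<bar>f x\<bar> / \<bar>x - c\<bar> <= C * (x - c)^2 / \<bar>x - c\<bar>" using assms[of x] by (intro divide_right_mono) auto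
   also have "(x - c)^2 = \<bar>x - c\<bar> * \<bar>x - c\<bar>" by (simp add: power2_eq_square flip: abs_mult)
   also have "C * (\<bar>x - c\<bar> * \<bar>x - c\<bar>) / \<bar>x - c\<bar> = C * \<bar>x - c\<bar>"
    using \<open>x \<noteq> c\<close> nonzero_mult_div_cancel_right[of "\<bar>x - c\<bar>" "C * \<bar>x - c\<bar>"] by (simp only: mult.assoc)
   finally show "norm ((f x - f c) / (x - c)) <= C * \<bar>x - c\<bar>" by (simp add: fc)
  qed
  have "((%x. C * \<bar>x - c\<bar>) \<longlongrightarrow> C * \<bar>c - c\<bar>) (at c)" by (intro tendsto_intros)
  thus "((%x. C * \<bar>x - c\<bar>) \<longlongrightarrow> 0) (at c)" by simp
 qed
 thus ?thesis by (simp add: has_field_derivative_iff)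
qed

text \<open>All derivatives of the standard bump have this shape for suitable \<open>p\<close> and
  \<open>k\<close>, so the family is closed under differentiation.\<close>

definition bump_fam :: "real => real => real poly => nat => real => real" where
 "bump_fam a b p k x = (if a < x \<and> x < b then poly p x / ((x - a) * (b - x)) ^ k * exp (- 1 / ((x - a) * (b - x))) else 0)"

lemma bump_fam_bound:
 assumes "a < b"
 obtains C where "!!x. \<bar>bump_fam a b p k x\<bar> <= C * (x - a)^2" "!!x. \<bar>bump_fam a b p k x\<bar> <= C * (x - b)^2"
proof -
 have "compact (poly p ` {a..b})" by (intro compact_continuous_image continuous_intros) auto
 then obtain B where B: "!!x. x \<in> {a..b} ==> \<bar>poly p x\<bar> <= B" by (force dest: compact_imp_bounded simp: bounded_iff)
 have B0: "B \<ge> 0" using B[of a] assms by force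
 define C where "C = B * fact (k + 2) * (b - a)^2"
 have main: "\<bar>bump_fam a b p k x\<bar> <= B * fact (k + 2) * ((x - a) * (b - x))^2" if x: "a < x" "x < b" for x
 proof -
  define q where "q = (x - a) * (b - x)"
  have q: "q > 0" using x by (simp add: q_def)
  \<comment> \<open>A single term of the exponential series. Order \<open>k + 2\<close> beats the
    pole of order \<open>k\<close> and leaves \<open>q^2\<close>, hence quadratic contact with 0 at
    both ends.\<close>
  have "(1 / q) ^ (k + 2) / fact (k + 2) <= exp (1 / q)"
  proof -
   have "(\<Sum>n\<in>{k + 2}. (1 / q) ^ n /\<^sub>R fact n) <= (\<Sum>n. (1 / q) ^ n /\<^sub>R fact n)"
    using q by (intro sum_le_suminf summable_exp_generic) auto
   thus ?thesis by (simp add: exp_def divide_inverse mult.commute)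
  qed
  hence "1 <= exp (1 / q) * (fact (k + 2) * q ^ (k + 2))"
  proof -
   define n where "n = k + 2"
   assume "(1 / q) ^ (k + 2) / fact (k + 2) <= exp (1 / q)"
   hence "(1 / q) ^ n / fact n <= exp (1 / q)" by (simp only: n_def)
   hence "1 <= exp (1 / q) * (fact n * q ^ n)" using q by (simp add: power_divide field_simps)
   thus ?thesis by (simp only: n_def)
  qed
  hence "exp (- (1 / q)) <= fact (k + 2) * q ^ (k + 2)"
   unfolding exp_minus by (simp only: inverse_eq_divide pos_divide_le_eq[OF exp_gt_zero] mult.commute)
  hence "exp (- 1 / q) <= fact (k + 2) * q ^ (k + 2)" by simp
  hence "1 / q ^ k * exp (- 1 / q) <= 1 / q ^ k * (fact (k + 2) * q ^ (k + 2))"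
   using q by (intro mult_left_mono) auto
  also have "\<dots> = fact (k + 2) * q\<^sup>2" using q by (simp add: power2_eq_square)
  finally have e: "1 / q ^ k * exp (- 1 / q) <= fact (k + 2) * q\<^sup>2" .
  have "\<bar>bump_fam a b p k x\<bar> = \<bar>poly p x\<bar> * (1 / q ^ k * exp (- 1 / q))"
   using x q by (simp add: bump_fam_def q_def[symmetric] abs_mult)
  also have "\<dots> <= B * (fact (k + 2) * q\<^sup>2)"
   by (rule mult_mono[OF _ e B0]) (use B[of x] x q in auto)
  finally show ?thesis by (simp add: q_def)
 qed
 have "\<bar>bump_fam a b p k x\<bar> <= C * (x - a)^2 \<and> \<bar>bump_fam a b p k x\<bar> <= C * (x - b)^2" for x
 proof (cases "a < x \<and> x < b")
  case True
  have "((x - a) * (b - x))^2 <= (b - a)^2 * (x - a)^2" "((x - a) * (b - x))^2 <= (b - a)^2 * (x - b)^2"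
   using True by (auto simp: power_mult_distrib mult.commute power2_commute[of x b] intro!: mult_mono power_mono)
  hence "B * fact (k + 2) * ((x - a) * (b - x))^2 <= C * (x - a)^2" "B * fact (k + 2) * ((x - a) * (b - x))^2 <= C * (x - b)^2"
   unfolding C_def mult.assoc using B0 by (auto intro!: mult_left_mono)
  thus ?thesis using main[of x] True by auto
 next
  case False
  thus ?thesis using B0 by (auto simp: bump_fam_def C_def)
 qed
 thus ?thesis using that by blast
qed

text \<open>Inside the interval this is the quotient rule, the exponential contributing two powers
  of the denominator; at the end points and outside both sides are 0.\<close>

lemma bump_fam_deriv:
 assumes ab: "a < b"
 defines "Q \<equiv> [:- a * b, a + b, -1:]"
 shows "(bump_fam a b p k has_real_derivative
   bump_fam a b (pderiv p * Q\<^sup>2 - smult (real k) (p * Q * pderiv Q) + p * pderiv Q) (k + 2) x) (at x)"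
proof -
 have Q: "poly Q x = (x - a) * (b - x)" for x by (simp add: Q_def algebra_simps)
 let ?R = "pderiv p * Q\<^sup>2 - smult (real k) (p * Q * pderiv Q) + p * pderiv Q"
 consider "x = a" | "x = b" | "x < a \<or> b < x" | "a < x" "x < b" by linarith
 thus ?thesis
 proof cases
  case 1
  thus ?thesis using bump_fam_bound[OF ab, of p k] DERIV_zero_of_quadratic_bound[of "bump_fam a b p k" _ a]
   by (metis bump_fam_def less_irrefl)
 next
  case 2
  thus ?thesis using bump_fam_bound[OF ab, of p k] DERIV_zero_of_quadratic_bound[of "bump_fam a b p k" _ b]
   by (metis bump_fam_def less_irrefl)
 next
  case 3
  have "\<forall>\<^sub>F y in nhds x. y < a \<or> b < y"
   using 3 open_Un[OF open_lessThan open_greaterThan, of a b] eventually_nhds_in_open[of "{..<a} \<union> {b<..}" x] by (auto elim!: eventually_mono)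
  hence ev: "\<forall>\<^sub>F y in nhds x. bump_fam a b p k y = 0"
   by eventually_elim (use ab in \<open>auto simp: bump_fam_def\<close>)
  have "(bump_fam a b p k has_real_derivative 0) (at x)"
   using DERIV_cong_ev[OF refl ev refl, of 0] by simp
  thus ?thesis using 3 by (auto simp: bump_fam_def)
 next
  case 4
  define q where "q = poly Q x"
  have q: "q > 0" using 4 by (simp add: q_def Q)
  have "((%y. poly p y / (poly Q y) ^ k * exp (- 1 / poly Q y)) has_real_derivative
    poly ?R x / q ^ (k + 2) * exp (- 1 / q)) (at x)"
  proof -
   have d1: "((%y. poly p y / (poly Q y) ^ k) has_real_derivative
     (poly (pderiv p) x * q ^ k - poly p x * (real k * q ^ (k - 1) * poly (pderiv Q) x)) / (q ^ k * q ^ k)) (at x)"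
    using q unfolding q_def by (auto intro!: derivative_eq_intros poly_DERIV)
   have d2: "((%y. exp (- 1 / poly Q y)) has_real_derivative exp (- 1 / q) * (poly (pderiv Q) x / (q * q))) (at x)"
    using q unfolding q_def by (auto intro!: derivative_eq_intros poly_DERIV)
   have "((%y. poly p y / (poly Q y) ^ k * exp (- 1 / poly Q y)) has_real_derivative
    (poly (pderiv p) x * q ^ k - poly p x * (real k * q ^ (k - 1) * poly (pderiv Q) x)) / (q ^ k * q ^ k) * exp (- 1 / q)
    + poly p x / q ^ k * (exp (- 1 / q) * (poly (pderiv Q) x / (q * q)))) (at x)"
    using DERIV_mult'[OF d1 d2] by (simp only: q_def[symmetric] add.commute)
   also have "(poly (pderiv p) x * q ^ k - poly p x * (real k * q ^ (k - 1) * poly (pderiv Q) x)) / (q ^ k * q ^ k) * exp (- 1 / q)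
    + poly p x / q ^ k * (exp (- 1 / q) * (poly (pderiv Q) x / (q * q))) = poly ?R x / q ^ (k + 2) * exp (- 1 / q)"
    using q by (cases k) (simp_all add: q_def[symmetric] field_simps power2_eq_square)
   finally show ?thesis .
  qed
  moreover have "\<forall>\<^sub>F y in nhds x. poly p y / (poly Q y) ^ k * exp (- 1 / poly Q y) = bump_fam a b p k y"
  proof -
   have "\<forall>\<^sub>F y in nhds x. y \<in> {a<..<b}" using 4 by (intro eventually_nhds_in_open) auto
   thus ?thesis by eventually_elim (auto simp: bump_fam_def Q)
  qed
  ultimately have "(bump_fam a b p k has_real_derivative poly ?R x / q ^ (k + 2) * exp (- 1 / q)) (at x)"
   by (subst DERIV_cong_ev[OF refl _ refl, symmetric]) auto
  thus ?thesis using 4 by (simp add: bump_fam_def q_def Q)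
 qed
qed

lemma smooth_bump_fam: assumes "a < b" shows "smooth_real (bump_fam a b p k)"
proof (rule smooth_real_coinduct[where S="{bump_fam a b p k | p k. True}"])
 show "g field_differentiable (at x)" if "g \<in> {bump_fam a b p k | p k. True}" for g x
  using that bump_fam_deriv[OF assms] by (auto simp: field_differentiable_def)
 show "deriv g \<in> {bump_fam a b p k | p k. True}" if g: "g \<in> {bump_fam a b p k | p k. True}" for g
 proof -
  obtain p k where pk: "g = bump_fam a b p k" using g by blast
  have "deriv g = bump_fam a b (pderiv p * [:- a * b, a + b, -1:]\<^sup>2 - smult (real k) (p * [:- a * b, a + b, -1:] * pderiv [:- a * b, a + b, -1:]) + p * pderiv [:- a * b, a + b, -1:]) (k + 2)"
   unfolding pk by (intro ext DERIV_imp_deriv bump_fam_deriv assms)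
  thus ?thesis by blast
 qed
qed blast

lemma smooth_real_continuous: "smooth_real f ==> continuous_on UNIV f"
 using smooth_realD(1) by (auto simp: continuous_on_eq_continuous_at intro: field_differentiable_imp_continuous_at)

lemma mollifier_exists:
 fixes a b :: real
 assumes ab: "a < b"
 obtains \<beta> where "smooth_real \<beta>" "!!x. 0 <= \<beta> x" "!!x. x \<notin> {a..b} ==> \<beta> x = 0" "integrable lborel \<beta>" "(LBINT x. \<beta> x) = 1"
proof -
 define f where "f = bump_fam a b 1 0"
 have sm: "smooth_real f" unfolding f_def using ab by (rule smooth_bump_fam)
 have nn: "0 <= f x" for x by (simp add: f_def bump_fam_def)
 have pos: "0 < f x" if "a < x" "x < b" for x using that by (simp add: f_def bump_fam_def)
 have out: "f x = 0" if "x \<notin> {a..b}" for x using that by (auto simp: f_def bump_fam_def)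
 have "integrable lborel (%x. indicator {a..b} x *\<^sub>R f x)"
  by (rule borel_integrable_compact) (auto intro: continuous_on_subset[OF smooth_real_continuous[OF sm]])
 also have "(%x. indicator {a..b} x *\<^sub>R f x) = f" using out by (auto simp: fun_eq_iff split: split_indicator)
 finally have int: "integrable lborel f" .
 define c where "c = (LBINT x. f x)"
 have "c \<noteq> 0"
 proof
  assume "c = 0"
  hence "AE x in lborel. f x = 0" unfolding c_def using nn int by (subst (asm) integral_nonneg_eq_0_iff_AE) auto
  hence "AE x in lborel. x \<notin> {a<..<b}" by eventually_elim (use pos in force)
  hence "{a<..<b} \<in> null_sets lborel" by (subst (asm) AE_iff_null_sets[symmetric]) auto
  thus False using ab by (simp add: null_sets_def)
 qed
 moreover have "c \<ge> 0" unfolding c_def using nn by simp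
 ultimately have c: "c > 0" by simp
 \<comment> \<open>The summand \<open>0 * f x\<close> brings the scaled bump into the form of
   \<open>smooth_real_lincomb\<close>.\<close>
 define \<beta> where "\<beta> x = (1/c) * f x + 0 * f x" for x
 have "smooth_real \<beta>" unfolding \<beta>_def by (rule smooth_real_lincomb[OF sm sm])
 moreover have "integrable lborel \<beta>" "(LBINT x. \<beta> x) = 1" unfolding \<beta>_def using int c by (auto simp: c_def[symmetric])
 ultimately show ?thesis using that nn out c by (auto simp: \<beta>_def)
qed

text \<open>Integration starts at \<open>a - 1\<close>, so that \<open>a\<close> is an interior
  point and the derivative there is two-sided.\<close>

lemma antiderivative_compact_support:
 fixes h :: "real => real"
 assumes h: "continuous_on UNIV h" "!!x. x \<notin> {a..b} ==> h x = 0" and 0: "integral {a-1..b} h = 0" and ab: "a <= b"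
 obtains F where "!!x. (F has_real_derivative h x) (at x)" "!!x. x \<notin> {a..b} ==> F x = 0" "!!x. F x = integral {a-1..x} h"
proof -
 define F where "F x = integral {a-1..x} h" for x
 have hi: "h integrable_on {u..v}" for u v by (intro integrable_continuous_real continuous_on_subset[OF h(1)]) auto
 have Fl: "F x = 0" if "x < a" for x
 proof -
  have "integral {a-1..x} h = integral {a-1..x} (%_. 0)" by (rule integral_cong) (use that h(2) in auto)
  thus ?thesis by (simp add: F_def)
 qed
 have "(F has_real_derivative h x) (at x)" for x
 proof (cases "x < a")
  case True
  have "\<forall>\<^sub>F y in nhds x. F y = 0"
   using eventually_nhds_in_open[of "{..<a}" x] True by (auto elim!: eventually_mono simp: Fl)
  hence "(F has_real_derivative 0) (at x)" by (subst DERIV_cong_ev[OF refl, of F "%_. 0"]) auto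
  thus ?thesis using h(2) True by simp
 next
  case False
  have "(F has_real_derivative h x) (at x within {a-1..x+1})"
   unfolding F_def using False
   by (intro integral_has_real_derivative continuous_on_subset[OF h(1)]) auto
  thus ?thesis using False by (subst (asm) at_within_interior) (auto simp: interior_atLeastAtMost_real)
 qed
 moreover have "F x = 0" if "x \<notin> {a..b}" for x
 proof (cases "x < a")
  case True thus ?thesis by (rule Fl)
 next
  case False
  hence x: "b < x" using that by auto
  have "integral {a-1..x} h = integral {a-1..b} h + integral {b..x} h"
   using Henstock_Kurzweil_Integration.integral_combine[of "a-1" b x h] hi ab x by simp
  also have "integral {b..x} h = integral {b..x} (%_. 0)"
  proof (rule integral_spike[of "{b}"])
   show "0 = h y" if "y \<in> {b..x} - {b}" for y using h(2)[of y] that by auto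
  qed auto
  finally show ?thesis using 0 by (simp add: F_def)
 qed
 ultimately show ?thesis using that F_def by blast
qed

lemma test_funI:
 assumes "smooth_real \<theta>" "!!x. x \<notin> {p..q} ==> \<theta> x = 0" "{p..q} \<subseteq> J"
 shows "test_fun J \<theta>"
proof -
 have s: "{t. \<theta> t \<noteq> 0} \<subseteq> {p..q}" using assms(2) by blast
 hence "closure {t. \<theta> t \<noteq> 0} \<subseteq> {p..q}" by (intro closure_minimal) auto
 thus ?thesis unfolding test_fun_def using assms
  using bounded_subset[OF bounded_closed_interval s] by (auto simp: smooth_real_def compact_closure)
qed

lemma smooth_real_integrable:
 fixes m \<beta> :: "real => real"
 assumes "continuous_on {p..q} m" "continuous_on UNIV \<beta>" "!!x. x \<notin> {p..q} ==> \<beta> x = 0"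
 shows "integrable lborel (%x. m x * \<beta> x)"
proof -
 have "integrable lborel (%x. indicator {p..q} x *\<^sub>R (m x * \<beta> x))"
  using assms by (intro borel_integrable_compact continuous_intros) (auto intro: continuous_on_subset)
 also have "(%x. indicator {p..q} x *\<^sub>R (m x * \<beta> x)) = (%x. m x * \<beta> x)"
  using assms(3) by (auto simp: fun_eq_iff split: split_indicator)
 finally show ?thesis .
qed

lemma mollifier_average:
 fixes m \<beta> :: "real => real"
 assumes m: "continuous_on {s..s'} m" "!!x. x \<in> {s..s'} ==> \<bar>m x - y\<bar> <= e"
  and \<beta>: "continuous_on UNIV \<beta>" "!!x. 0 <= \<beta> x" "!!x. x \<notin> {s..s'} ==> \<beta> x = 0" "integrable lborel \<beta>" "(LBINT x. \<beta> x) = 1"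
 shows "\<bar>(LBINT x. m x * \<beta> x) - y\<bar> <= e"
proof -
 have i: "integrable lborel (%x. m x * \<beta> x)" by (rule smooth_real_integrable[OF m(1) \<beta>(1,3)])
 have "(LBINT x. m x * \<beta> x) - y = (LBINT x. m x * \<beta> x - y * \<beta> x)"
  using i \<beta>(4,5) by simp
 also have "\<bar>\<dots>\<bar> <= (LBINT x. \<bar>m x * \<beta> x - y * \<beta> x\<bar>)" by (rule integral_abs_bound)
 also have "\<dots> <= (LBINT x. e * \<beta> x)"
 proof (rule integral_mono)
  show "\<bar>m x * \<beta> x - y * \<beta> x\<bar> <= e * \<beta> x" for x
  proof (cases "x \<in> {s..s'}")
   case True
   have "\<bar>m x * \<beta> x - y * \<beta> x\<bar> = \<bar>m x - y\<bar> * \<beta> x" using \<beta>(2)[of x] by (simp add: abs_mult flip: left_diff_distrib)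
   thus ?thesis using m(2)[OF True] \<beta>(2)[of x] by (simp add: mult_right_mono)
  qed (use \<beta>(3) in auto)
 qed (use i \<beta> in auto)
 finally show ?thesis using \<beta> by simp
qed

text \<open>Test with the antiderivative of a mollifier near \<open>s\<close> minus a mollifier near
  \<open>t\<close>: it is bounded by 1, the left side becomes a difference of averages of
  \<open>m\<close>, and the right side is at most \<open>C\<close> times the length of the
  support.\<close>

lemma weak_derivative_bound_imp_lipschitz:
 fixes m G :: "real => real"
 assumes J: "open J" "is_interval J" and m: "continuous_on J m" and G: "!!t. t \<in> J ==> \<bar>G t\<bar> <= C" and C: "C \<ge> 0"
  and weak: "!!\<theta>. test_fun J \<theta> ==> - (LBINT t. m t * deriv \<theta> t) = (LBINT t. G t * \<theta> t)"
  and st: "s \<in> J" "t \<in> J" "s < t"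
 shows "\<bar>m t - m s\<bar> <= C * (t - s)"
proof -
 obtain d where d: "d > 0" "cball t d \<subseteq> J" using J(1) st(2) by (meson open_contains_cball)
 have key: "\<bar>m t - m s\<bar> <= C * (t - s) + C * e + 2 * e" if e: "e > 0" for e
 proof -
  have cts: "isCont m s" "isCont m t" using m J(1) st by (auto simp: continuous_on_eq_continuous_at)
  obtain d1 where d1: "d1 > 0" "!!x. \<bar>x - s\<bar> < d1 ==> \<bar>m x - m s\<bar> <= e"
   using cts(1) e unfolding continuous_at_eps_delta dist_real_def by (meson less_imp_le)
  obtain d2 where d2: "d2 > 0" "!!x. \<bar>x - t\<bar> < d2 ==> \<bar>m x - m t\<bar> <= e"
   using cts(2) e unfolding continuous_at_eps_delta dist_real_def by (meson less_imp_le)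
  \<comment> \<open>The mollifiers sit to the right of \<open>s\<close> and of \<open>t\<close>. The
    bounds on \<open>r\<close> keep the second one inside \<open>J\<close>, both averages within
    \<open>e\<close> of the point values, and the two supports in order.\<close>
  define r where "r = Min {d, d1/2, d2/2, e, t - s}"
  have r: "r > 0" "r <= d" "r < d1" "r < d2" "r <= e" "r <= t - s"
   using d(1) d1(1) d2(1) e st(3) unfolding r_def by (auto simp: min_def)
  have tJ: "t + r \<in> J" using d(2) r by (auto simp: dist_real_def)
  have sub: "{s..t + r} \<subseteq> J" using J(2) st(1) tJ unfolding is_interval_1 by (meson atLeastAtMost_iff subsetI)
  obtain \<beta> where \<beta>: "smooth_real \<beta>" "!!x. 0 <= \<beta> x" "!!x. x \<notin> {s..s+r} ==> \<beta> x = 0" "integrable lborel \<beta>" "(LBINT x. \<beta> x) = 1"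
   using mollifier_exists[of s "s + r"] r by auto
  obtain \<gamma> where \<gamma>: "smooth_real \<gamma>" "!!x. 0 <= \<gamma> x" "!!x. x \<notin> {t..t+r} ==> \<gamma> x = 0" "integrable lborel \<gamma>" "(LBINT x. \<gamma> x) = 1"
   using mollifier_exists[of t "t + r"] r by auto
  define h where "h x = 1 * \<beta> x + (-1) * \<gamma> x" for x
  have sh: "smooth_real h" unfolding h_def by (rule smooth_real_lincomb[OF \<beta>(1) \<gamma>(1)])
  have cont: "continuous_on A \<beta>" "continuous_on A \<gamma>" "continuous_on A h" for A
   using smooth_real_continuous \<beta>(1) \<gamma>(1) sh continuous_on_subset by blast+
  have h0: "h x = 0" if "x \<notin> {s..t + r}" for x using \<beta>(3) \<gamma>(3) that r st(3) by (auto simp: h_def)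
  have part: "0 <= integral {s-1..x} f" "integral {s-1..x} f <= 1" "x \<ge> q ==> integral {s-1..x} f = 1"
   if f: "smooth_real f" "!!x. 0 <= f x" "!!x. x \<notin> {p..q} ==> f x = 0" "integrable lborel f" "(LBINT x. f x) = 1" "s <= p" for f p q x
  proof -
   have si: "set_integrable lborel {s-1..x} f" unfolding set_integrable_def
    by (rule borel_integrable_compact) (auto intro: continuous_on_subset[OF smooth_real_continuous[OF f(1)]])
   have eq: "integral {s-1..x} f = (LBINT y. indicator {s-1..x} y *\<^sub>R f y)"
    using set_borel_integral_eq_integral(2)[OF si] by (simp add: set_lebesgue_integral_def)
   show "0 <= integral {s-1..x} f" unfolding eq using f(2) by (intro Bochner_Integration.integral_nonneg) auto
   have "integral {s-1..x} f <= (LBINT x. f x)" unfolding eq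
    using si f(2,4) by (intro integral_mono) (auto simp: set_integrable_def split: split_indicator)
   thus "integral {s-1..x} f <= 1" using f(5) by simp
   assume "x \<ge> q"
   hence "(%y. indicator {s-1..x} y *\<^sub>R f y) = f" using f(3,6) by (fastforce simp: fun_eq_iff split: split_indicator)
   thus "integral {s-1..x} f = 1" unfolding eq using f(5) by simp
  qed
  note p\<beta> = part[where f=\<beta> and p=s and q="s + r", OF \<beta>(1) \<beta>(2) \<beta>(3) \<beta>(4) \<beta>(5) order_refl]
  note p\<gamma> = part[where f=\<gamma> and p=t and q="t + r", OF \<gamma>(1) \<gamma>(2) \<gamma>(3) \<gamma>(4) \<gamma>(5) less_imp_le[OF st(3)]]
  have inth: "integral {s-1..x} h = integral {s-1..x} \<beta> - integral {s-1..x} \<gamma>" for x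
   unfolding h_def using integrable_continuous_real[OF cont(1)] integrable_continuous_real[OF cont(2)]
   by (simp add: Henstock_Kurzweil_Integration.integral_diff)
  have "integral {s-1..t + r} h = 0"
   unfolding inth using p\<beta>(3)[of "t + r"] p\<gamma>(3)[of "t + r"] r st(3) by simp
  then obtain \<theta> where \<theta>: "!!x. (\<theta> has_real_derivative h x) (at x)" "!!x. x \<notin> {s..t + r} ==> \<theta> x = 0" "!!x. \<theta> x = integral {s-1..x} h"
   using antiderivative_compact_support[OF cont(3) h0] r st(3) by (smt (verit))
  have d\<theta>: "deriv \<theta> = h" using \<theta>(1) DERIV_imp_deriv by blast
  \<comment> \<open>The primitives of both mollifiers lie between 0 and 1, hence their difference
    has modulus at most 1.\<close>
  have \<theta>1: "\<bar>\<theta> x\<bar> <= indicator {s..t + r} x" for x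
   using p\<beta>(1,2)[of x] p\<gamma>(1,2)[of x] \<theta>(2,3)[of x] st(3) unfolding inth
   by (auto split: split_indicator)
  have mi: "integrable lborel (%x. m x * \<beta> x)" "integrable lborel (%x. m x * \<gamma> x)"
   using r st(3) by (intro smooth_real_integrable[of s "t + r"] cont continuous_on_subset[OF m sub]; use \<beta>(3) \<gamma>(3) in force)+
  have "test_fun J \<theta>" using smooth_real_antideriv[OF \<theta>(1) sh] \<theta>(2) sub by (rule test_funI)
  from weak[OF this] have "(LBINT x. m x * \<gamma> x) - (LBINT x. m x * \<beta> x) = (LBINT t. G t * \<theta> t)"
   unfolding d\<theta> h_def using mi by (simp add: right_diff_distrib)
  moreover have "\<bar>\<integral>x. G x * \<theta> x \<partial>lborel\<bar> <= C * (t + r - s)"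
  proof -
   have "\<bar>\<integral>x. G x * \<theta> x \<partial>lborel\<bar> <= (LBINT x. \<bar>G x * \<theta> x\<bar>)" by (rule integral_abs_bound)
   also have "\<dots> <= (LBINT x. C * indicator {s..t + r} x)"
   \<comment> \<open>Only the upper bound has to be integrable here: a Bochner integral that does
     not exist is 0.\<close>
   proof (rule integral_mono')
    show "\<bar>G x * \<theta> x\<bar> <= C * indicator {s..t + r} x" for x
    proof (cases "x \<in> {s..t + r}")
     case True
     hence "\<bar>G x\<bar> * \<bar>\<theta> x\<bar> <= C * 1" using G[of x] sub \<theta>1[of x] C by (intro mult_mono) auto
     thus ?thesis using True by (simp add: abs_mult)
    qed (use \<theta>(2) in auto)
    show "integrable lborel (%x. C * indicator {s..t + r} x)"
     by (intro integrable_mult_right integrable_real_indicator) (auto simp: emeasure_lborel_Icc_eq)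
   qed (use C in auto)
   also have "\<dots> = C * (t + r - s)" using r st(3) by simp
   finally show ?thesis .
  qed
  moreover have "\<bar>(LBINT x. m x * \<beta> x) - m s\<bar> <= e"
   using sub r by (intro mollifier_average[OF _ _ cont(1) \<beta>(2-5)] continuous_on_subset[OF m] d1(2)) auto
  moreover have "\<bar>(LBINT x. m x * \<gamma> x) - m t\<bar> <= e"
   using sub r st(3) by (intro mollifier_average[OF _ _ cont(2) \<gamma>(2-5)] continuous_on_subset[OF m] d2(2)) auto
  ultimately have "\<bar>m t - m s\<bar> <= C * (t + r - s) + 2 * e" by linarith
  also have "C * (t + r - s) <= C * (t - s) + C * e" using r C by (simp add: algebra_simps mult_left_mono)
  finally show ?thesis by simp
 qed
 have "\<bar>m t - m s\<bar> <= C * (t - s) + e" if "e > 0" for e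
 proof -
  have "(C + 2) * (e / (C + 2)) = e" using C by simp
  hence "C * (e / (C + 2)) + 2 * (e / (C + 2)) = e" by (simp only: distrib_right)
  thus ?thesis using key[of "e / (C + 2)"] that C by simp
 qed
 thus ?thesis by (rule field_le_epsilon)
qed

section \<open>The spaces H and V as subspaces of the Hilbert space\<close>

lemma has_pd_const: "has_pd i (%x. c) (%x. 0)" by (simp add: has_pd_def)

lemma has_pd_add: "has_pd i f f' ==> has_pd i g g' ==> has_pd i (%x. f x + g x) (%x. f' x + g' x)"
 unfolding has_pd_def by (auto intro!: continuous_intros derivative_intros)

lemma has_pd_mult: "has_pd i f f' ==> has_pd i g g' ==> has_pd i (%x. f x * g x) (%x. f' x * g x + f x * g' x)"
 unfolding has_pd_def by (auto intro!: continuous_intros derivative_eq_intros)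

lemma has_pd_sum: "(!!j. j \<in> S ==> has_pd i (f j) (f' j)) ==> has_pd i (%x. \<Sum>j\<in>S. f j x) (%x. \<Sum>j\<in>S. f' j x)"
 by (induction S rule: infinite_finite_induct) (auto intro: has_pd_const has_pd_add)

lemma has_pd_prod: "finite S ==> (!!j. j \<in> S ==> \<exists>g'. has_pd i (f j) g') ==> \<exists>g'. has_pd i (%x. \<Prod>j\<in>S. f j x) g'"
proof (induction S rule: finite_induct)
 case empty
 show ?case using has_pd_const[of i 1] by auto
next
 case (insert j S)
 obtain g' where "has_pd i (f j) g'" using insert.prems by blast
 moreover obtain h' where "has_pd i (%x. \<Prod>j\<in>S. f j x) h'" using insert by blast
 ultimately show ?case using insert.hyps has_pd_mult by (fastforce simp: prod.insert)
qed

lemma has_pd_nth: "has_pd i (%x. x $ m) (%x. if m = i then 1 else 0)"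
 unfolding has_pd_def by (auto simp: axis_def intro!: continuous_intros derivative_eq_intros)

lemma has_pd_power: "has_pd i f f' ==> \<exists>g'. has_pd i (%x. f x ^ n) g'"
proof (induction n)
 case 0
 show ?case using has_pd_const[of i 1] by auto
next
 case (Suc n)
 then obtain g' where "has_pd i (%x. f x ^ n) g'" by blast
 from has_pd_mult[OF Suc.prems this] show ?case by auto
qed

lemma smooth_iter_pd_cont: "smooth_fun \<phi> ==> continuous_on UNIV (iter_pd is \<phi>)"
 by (auto simp: smooth_fun_def)

lemma smooth_iter_pd_deriv:
 "smooth_fun \<phi> ==> ((%s. iter_pd is \<phi> (x + s *\<^sub>R axis i 1)) has_vector_derivative iter_pd (i # is) \<phi> x) (at 0)"
 by (auto simp: smooth_fun_def simp del: iter_pd.simps)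

lemma smooth_has_pd:
 fixes \<phi> :: vf
 assumes "smooth_fun \<phi>"
 shows "has_pd i (%x. iter_pd is \<phi> x $ j) (%x. iter_pd (i # is) \<phi> x $ j)"
 unfolding has_pd_def
proof (intro conjI allI)
 show "continuous_on UNIV (%x. iter_pd is \<phi> x $ j)" "continuous_on UNIV (%x. iter_pd (i # is) \<phi> x $ j)"
  using smooth_iter_pd_cont[OF assms] by (auto intro!: continuous_intros simp del: iter_pd.simps)
 show "((%s. iter_pd is \<phi> (x + s *\<^sub>R axis i 1) $ j) has_real_derivative iter_pd (i # is) \<phi> x $ j) (at 0)" for x
  unfolding has_real_derivative_iff_has_vector_derivative
  by (rule bounded_linear.has_vector_derivative[OF bounded_linear_vec_nth smooth_iter_pd_deriv[OF assms]])
qed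

lemma iter_pd_lincomb:
 fixes \<phi> \<psi> :: "real^'n => 'b::real_normed_vector"
 assumes "smooth_fun \<phi>" "smooth_fun \<psi>"
 shows "iter_pd is (%x. c *\<^sub>R \<phi> x + d *\<^sub>R \<psi> x) = (%x. c *\<^sub>R iter_pd is \<phi> x + d *\<^sub>R iter_pd is \<psi> x)"
proof (induction "is")
 case (Cons i "is")
 have "((%s. c *\<^sub>R iter_pd is \<phi> (x + s *\<^sub>R axis i 1) + d *\<^sub>R iter_pd is \<psi> (x + s *\<^sub>R axis i 1))
   has_vector_derivative c *\<^sub>R iter_pd (i # is) \<phi> x + d *\<^sub>R iter_pd (i # is) \<psi> x) (at 0)" for x
  using assms by (auto intro!: derivative_eq_intros smooth_iter_pd_deriv simp del: iter_pd.simps)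
 hence "pd i (%x. c *\<^sub>R iter_pd is \<phi> x + d *\<^sub>R iter_pd is \<psi> x) x = c *\<^sub>R iter_pd (i # is) \<phi> x + d *\<^sub>R iter_pd (i # is) \<psi> x" for x
  unfolding pd_def by (rule vector_derivative_at)
 thus ?case by (simp add: Cons.IH fun_eq_iff)
qed simp

lemma smooth_fun_lincomb:
 fixes \<phi> \<psi> :: "real^'n => 'b::real_normed_vector"
 assumes "smooth_fun \<phi>" "smooth_fun \<psi>"
 shows "smooth_fun (%x. c *\<^sub>R \<phi> x + d *\<^sub>R \<psi> x)"
 unfolding smooth_fun_def iter_pd_lincomb[OF assms]
proof (intro allI conjI)
 fix "is" i x
 show "continuous_on UNIV (%x. c *\<^sub>R iter_pd is \<phi> x + d *\<^sub>R iter_pd is \<psi> x)"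
  by (intro continuous_intros smooth_iter_pd_cont assms)
 show "((%s. c *\<^sub>R iter_pd is \<phi> (x + s *\<^sub>R axis i 1) + d *\<^sub>R iter_pd is \<psi> (x + s *\<^sub>R axis i 1))
   has_vector_derivative c *\<^sub>R iter_pd (i # is) \<phi> x + d *\<^sub>R iter_pd (i # is) \<psi> x) (at 0)"
  using assms by (auto intro!: derivative_eq_intros smooth_iter_pd_deriv simp del: iter_pd.simps)
qed

lemma subspace_closure:
 fixes S :: "'a::real_normed_vector set"
 assumes "subspace S" shows "subspace (closure S)"
proof (rule subspaceI)
 show "0 \<in> closure S" using subspace_0[OF assms] closure_subset by blast
next
 fix x y assume "x \<in> closure S" "y \<in> closure S"
 then obtain f g where fg: "!!n. f n \<in> S" "f ----> x" "!!n. g n \<in> S" "g ----> y" by (metis closure_sequential)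
 thus "x + y \<in> closure S"
  by (intro closure_sequential[THEN iffD2] exI[of _ "%n. f n + g n"]) (auto intro!: tendsto_intros subspace_add[OF assms])
next
 fix x and c :: real assume "x \<in> closure S"
 then obtain f where f: "!!n. f n \<in> S" "f ----> x" by (metis closure_sequential)
 thus "c *\<^sub>R x \<in> closure S"
  by (intro closure_sequential[THEN iffD2] exI[of _ "%n. c *\<^sub>R f n"]) (auto intro!: tendsto_intros subspace_scale[OF assms])
qed

section \<open>A common frame for both boundary conditions\<close>

text \<open>Integration by parts on the surrounding box uses only equality on opposite faces. In the
  periodic case \<open>\<Omega>\<close> is the open box and its boundary is a null set, which is why
  \<open>D_outside\<close> is an almost everywhere statement; in the no-slip case the fields vanish
  off \<open>\<Omega>\<close>.\<close>

locale flow_domain =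
 fixes \<Omega> :: "(real^3) set" and D :: "vf set" and a b :: "real^3"
 assumes open_\<Omega>: "open \<Omega>" and \<Omega>_box: "\<Omega> \<subseteq> box a b" and ab: "!!m. a $ m < b $ m"
  and D_smooth: "!!\<phi>. \<phi> \<in> D ==> smooth_fun \<phi>"
  and D_div: "!!\<phi>. \<phi> \<in> D ==> div_free \<phi>"
  and D_0: "(%x. 0) \<in> D"
  and D_lincomb: "!!\<phi> \<psi> c d. \<phi> \<in> D ==> \<psi> \<in> D ==> (%x. c *\<^sub>R \<phi> x + d *\<^sub>R \<psi> x) \<in> D"
  and D_faces: "!!\<phi> is i x. \<phi> \<in> D ==> x \<in> cbox a b ==> x $ i = a $ i ==>
     iter_pd is \<phi> (x + (b $ i - a $ i) *\<^sub>R axis i 1) = iter_pd is \<phi> x"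
  and D_outside: "!!\<phi> is. \<phi> \<in> D ==> AE x in lborel. x \<in> cbox a b --> x \<notin> \<Omega> --> iter_pd is \<phi> x = 0"
  and D_mean: "!!\<phi>. \<phi> \<in> D ==> set_lebesgue_integral lborel \<Omega> \<phi> = 0"
begin

definition cut :: "vf => vf" where "cut u = (%x. indicator \<Omega> x *\<^sub>R u x)"
definition cl :: "vf => l2" where "cl u = abs_l2 (cut u)"
definition L2\<Omega> :: "vf => bool" where "L2\<Omega> u \<longleftrightarrow> u \<in> borel_measurable borel \<and> l2fun (cut u)"
definition gr :: "vf => l2 \<times> (l2^3)" where "gr \<phi> = (cl \<phi>, \<chi> i. cl (pd i \<phi>))"
definition HH :: "l2 set" where "HH = closure (cl ` D)"
text \<open>The closed graph of the weak gradient: limits in \<open>H^1\<close> become limits in a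
  product of Hilbert spaces, and \<open>V\<close> becomes the domain of a closed operator.\<close>

definition Gam :: "(l2 \<times> (l2^3)) set" where "Gam = closure (gr ` D)"
definition VV :: "l2 set" where "VV = fst ` Gam"

lemma \<Omega>_sets [measurable]: "\<Omega> \<in> sets borel" using open_\<Omega> by auto

lemma \<Omega>_cbox: "\<Omega> \<subseteq> cbox a b" using \<Omega>_box box_subset_cbox by blast

lemma L2\<Omega>_cut: "L2\<Omega> u ==> l2fun (cut u)" by (simp add: L2\<Omega>_def)

lemma cont_bounded_box:
 fixes u :: "real^3 => 'c::real_normed_vector"
 assumes "continuous_on UNIV u"
 obtains B where "B \<ge> 0" "!!x. x \<in> cbox a b ==> norm (u x) <= B"
proof -
 have "compact (u ` cbox a b)" by (intro compact_continuous_image continuous_on_subset[OF assms]) auto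
 then obtain B where "B > 0" "\<forall>y\<in>u ` cbox a b. norm y <= B" using compact_imp_bounded bounded_pos by blast
 thus ?thesis using that[of B] by auto
qed

lemma L2\<Omega>_cont: assumes "continuous_on UNIV u" shows "L2\<Omega> u"
proof -
 have [measurable]: "u \<in> borel_measurable borel" using assms by (rule borel_measurable_continuous_onI)
 obtain B where B: "B \<ge> 0" "!!x. x \<in> cbox a b ==> norm (u x) <= B" using cont_bounded_box[OF assms] by blast
 have "l2fun (cut u)"
 proof (rule l2fun_mono[where c=B])
  show "l2fun (%x. indicator (box a b) x *\<^sub>R axis 1 1)" by (rule l2fun_indicator_box)
  show "cut u \<in> borel_measurable borel" unfolding cut_def by measurable
  show "norm (cut u x) <= B * norm (indicator (box a b) x *\<^sub>R axis 1 (1::real) :: real^3)" for x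
   using B \<Omega>_box \<Omega>_cbox by (auto simp: cut_def subset_iff split: split_indicator)
 qed
 thus ?thesis by (simp add: L2\<Omega>_def)
qed

lemma D_cont: "\<phi> \<in> D ==> continuous_on UNIV (iter_pd is \<phi>)" using D_smooth smooth_iter_pd_cont by blast
lemma D_cont0: "\<phi> \<in> D ==> continuous_on UNIV \<phi>" using D_cont[of \<phi> "[]"] by simp
lemma D_cont1: "\<phi> \<in> D ==> continuous_on UNIV (pd i \<phi>)" using D_cont[of \<phi> "[i]"] by simp

lemma L2\<Omega>_D: "\<phi> \<in> D ==> L2\<Omega> (iter_pd is \<phi>)" by (intro L2\<Omega>_cont D_cont)
lemma L2\<Omega>_D0: "\<phi> \<in> D ==> L2\<Omega> \<phi>" using L2\<Omega>_D[of \<phi> "[]"] by simp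
lemma L2\<Omega>_D1: "\<phi> \<in> D ==> L2\<Omega> (pd i \<phi>)" using L2\<Omega>_D[of \<phi> "[i]"] by simp

lemma cl_inner: "L2\<Omega> u ==> L2\<Omega> v ==> cl u \<bullet> cl v = (LBINT x:\<Omega>. u x \<bullet> v x)"
proof -
 assume uv: "L2\<Omega> u" "L2\<Omega> v"
 have "(%x. cut u x \<bullet> cut v x) = (%x. indicator \<Omega> x *\<^sub>R (u x \<bullet> v x))"
  by (auto simp: cut_def fun_eq_iff split: split_indicator)
 thus ?thesis using uv by (simp add: cl_def inner_abs_l2 L2\<Omega>_cut set_lebesgue_integral_def)
qed

lemma L2\<Omega>_lincomb: "L2\<Omega> u ==> L2\<Omega> v ==> L2\<Omega> (%x. c *\<^sub>R u x + d *\<^sub>R v x)"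
proof -
 assume "L2\<Omega> u" "L2\<Omega> v"
 moreover have "cut (%x. c *\<^sub>R u x + d *\<^sub>R v x) = (%x. c *\<^sub>R cut u x + d *\<^sub>R cut v x)"
  by (auto simp: cut_def fun_eq_iff split: split_indicator)
 ultimately show ?thesis unfolding L2\<Omega>_def by (auto intro!: l2fun_add l2fun_scale)
qed

lemma cl_lincomb: "L2\<Omega> u ==> L2\<Omega> v ==> cl (%x. c *\<^sub>R u x + d *\<^sub>R v x) = c *\<^sub>R cl u + d *\<^sub>R cl v"
proof -
 assume uv: "L2\<Omega> u" "L2\<Omega> v"
 have "cut (%x. c *\<^sub>R u x + d *\<^sub>R v x) = (%x. c *\<^sub>R cut u x + d *\<^sub>R cut v x)"
  by (auto simp: cut_def fun_eq_iff split: split_indicator)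
 thus ?thesis using uv by (simp add: cl_def abs_l2_add abs_l2_scale l2fun_scale L2\<Omega>_cut)
qed

lemma L2\<Omega>_diff: "L2\<Omega> u ==> L2\<Omega> v ==> L2\<Omega> (%x. u x - v x)"
 using L2\<Omega>_lincomb[of u v 1 "-1"] by simp

lemma cl_diff: "L2\<Omega> u ==> L2\<Omega> v ==> cl (%x. u x - v x) = cl u - cl v"
 using cl_lincomb[of u v 1 "-1"] by simp

lemma gr_lincomb: assumes "\<phi> \<in> D" "\<psi> \<in> D"
 shows "gr (%x. c *\<^sub>R \<phi> x + d *\<^sub>R \<psi> x) = c *\<^sub>R gr \<phi> + d *\<^sub>R gr \<psi>"
proof -
 have "pd i (%x. c *\<^sub>R \<phi> x + d *\<^sub>R \<psi> x) = (%x. c *\<^sub>R pd i \<phi> x + d *\<^sub>R pd i \<psi> x)" for i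
  using iter_pd_lincomb[OF D_smooth[OF assms(1)] D_smooth[OF assms(2)], of "[i]" c d] by simp
 thus ?thesis
  using assms by (simp add: gr_def cl_lincomb L2\<Omega>_D0 L2\<Omega>_D1 vec_eq_iff)
qed

lemma subspace_gr: "subspace (gr ` D)"
proof (rule subspaceI)
 have "gr (%x. 0) = 0" using gr_lincomb[OF D_0 D_0, of 0 0] by simp
 thus "0 \<in> gr ` D" using D_0 by force
 show "x + y \<in> gr ` D" if xy: "x \<in> gr ` D" "y \<in> gr ` D" for x y
 proof -
  obtain \<phi> \<psi> where \<phi>: "\<phi> \<in> D" "\<psi> \<in> D" "x = gr \<phi>" "y = gr \<psi>" using xy by auto
  have "x + y = gr (%t. 1 *\<^sub>R \<phi> t + 1 *\<^sub>R \<psi> t)" using \<phi> by (subst gr_lincomb) auto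
  thus ?thesis using D_lincomb[OF \<phi>(1,2), of 1 1] by blast
 qed
 show "c *\<^sub>R x \<in> gr ` D" if x: "x \<in> gr ` D" for c x
 proof -
  obtain \<phi> where \<phi>: "\<phi> \<in> D" "x = gr \<phi>" using x by auto
  have "c *\<^sub>R x = gr (%t. c *\<^sub>R \<phi> t + 0 *\<^sub>R \<phi> t)" using \<phi> by (subst gr_lincomb) auto
  thus ?thesis using D_lincomb[OF \<phi>(1,1), of c 0] by blast
 qed
qed

lemma subspace_Gam: "subspace Gam" unfolding Gam_def by (rule subspace_closure[OF subspace_gr])
lemma closed_Gam: "closed Gam" by (simp add: Gam_def)

lemma subspace_cl: "subspace (cl ` D)"
proof -
 have "cl ` D = fst ` (gr ` D)" by (auto simp: gr_def image_image)
 thus ?thesis using linear_subspace_image[OF _ subspace_gr, of fst] by (simp add: linear_fst)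
qed

lemma subspace_HH: "subspace HH" unfolding HH_def by (rule subspace_closure[OF subspace_cl])
lemma closed_HH: "closed HH" by (simp add: HH_def)

lemma cl_D_HH: "\<phi> \<in> D ==> cl \<phi> \<in> HH" unfolding HH_def by (rule closure_subset[THEN subsetD]) simp

lemma gr_Gam: "\<phi> \<in> D ==> gr \<phi> \<in> Gam" unfolding Gam_def by (rule closure_subset[THEN subsetD]) simp

text \<open>Density of test fields: identities and estimates for \<open>V\<close> are proved below
  as closed conditions on the graph.\<close>

lemma Gam_induct:
 assumes "z \<in> Gam" "closed {z. P z}" "!!\<phi>. \<phi> \<in> D ==> P (gr \<phi>)" shows "P z"
proof -
 have "Gam \<subseteq> {z. P z}" unfolding Gam_def using assms by (intro closure_minimal) auto
 thus ?thesis using assms(1) by blast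
qed

lemma Gam_seq:
 assumes "z \<in> Gam" obtains \<phi> where "!!n. \<phi> n \<in> D" "(%n. gr (\<phi> n)) ----> z"
proof -
 obtain f where f: "!!n::nat. f n \<in> gr ` D" "f ----> z" using assms unfolding Gam_def closure_sequential by blast
 hence "\<forall>n. \<exists>\<phi>. \<phi> \<in> D \<and> f n = gr \<phi>" by blast
 then obtain \<phi> where \<phi>: "\<forall>n. \<phi> n \<in> D \<and> f n = gr (\<phi> n)" by (rule choice[THEN exE])
 hence "f = (%n. gr (\<phi> n))" by auto
 thus ?thesis using f(2) \<phi> by (intro that[of \<phi>]) auto
qed

lemma VV_HH: "VV \<subseteq> HH"
proof
 fix x assume "x \<in> VV"
 then obtain G where G: "(x, G) \<in> Gam" unfolding VV_def by auto
 have "closed {z. fst z \<in> HH}" using closed_vimage_fst[OF closed_HH] by (simp add: vimage_def)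
 from Gam_induct[OF G this] show "x \<in> HH" by (simp add: gr_def cl_D_HH)
qed

text \<open>Moves integrals from \<open>\<Omega>\<close> to the box, where Fubini and the box
  inequalities apply.\<close>

lemma integral_\<Omega>_cbox:
 fixes f :: "real^3 => 'c::{banach,second_countable_topology}"
 assumes "f \<in> borel_measurable borel" "AE x in lborel. x \<in> cbox a b --> x \<notin> \<Omega> --> f x = 0"
 shows "(LBINT x:\<Omega>. f x) = (LBINT x:cbox a b. f x)"
 unfolding set_lebesgue_integral_def
proof (rule integral_cong_AE)
 show "AE x in lborel. indicat_real \<Omega> x *\<^sub>R f x = indicat_real (cbox a b) x *\<^sub>R f x"
  using assms(2) by eventually_elim (use \<Omega>_cbox in \<open>auto split: split_indicator\<close>)
qed (use assms(1) in measurable)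

lemma integral_pd_zero:
 assumes "has_pd i g g'" "!!x. x \<in> cbox a b ==> x $ i = a $ i ==> g (x + (b $ i - a $ i) *\<^sub>R axis i 1) = g x"
  and "AE x in lborel. x \<in> cbox a b --> x \<notin> \<Omega> --> g' x = 0"
 shows "(LBINT x:\<Omega>. g' x) = 0"
 using integral_pd_faces_zero[OF assms(1) less_imp_le[OF ab] assms(2)] integral_\<Omega>_cbox[OF has_pd_measurable(2)[OF assms(1)] assms(3)]
 by simp

text \<open>The scalar product of the two iterated derivatives takes equal values on opposite faces,
  so the integral of its derivative vanishes.\<close>

lemma integration_by_parts:
 assumes \<phi>: "\<phi> \<in> D" and w: "w \<in> D"
 shows "cl (iter_pd (i # is) \<phi>) \<bullet> cl (iter_pd js w) = - (cl (iter_pd is \<phi>) \<bullet> cl (iter_pd (i # js) w))"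
proof -
 let ?f = "iter_pd is \<phi>" and ?g = "iter_pd js w" and ?f' = "iter_pd (i # is) \<phi>" and ?g' = "iter_pd (i # js) w"
 have pd: "has_pd i (%x. \<Sum>j\<in>UNIV. ?f x $ j * ?g x $ j) (%x. \<Sum>j\<in>UNIV. ?f' x $ j * ?g x $ j + ?f x $ j * ?g' x $ j)"
  by (intro has_pd_sum has_pd_mult smooth_has_pd D_smooth \<phi> w)
 have "(LBINT x:\<Omega>. (\<Sum>j\<in>UNIV. ?f' x $ j * ?g x $ j + ?f x $ j * ?g' x $ j)) = 0"
 proof (rule integral_pd_zero[OF pd])
  fix x assume "x \<in> cbox a b" "x $ i = a $ i"
  thus "(\<Sum>j\<in>UNIV. ?f (x + (b $ i - a $ i) *\<^sub>R axis i 1) $ j * ?g (x + (b $ i - a $ i) *\<^sub>R axis i 1) $ j) = (\<Sum>j\<in>UNIV. ?f x $ j * ?g x $ j)"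
   using D_faces[OF \<phi>] D_faces[OF w] by simp
 next
  show "AE x in lborel. x \<in> cbox a b --> x \<notin> \<Omega> --> (\<Sum>j\<in>UNIV. ?f' x $ j * ?g x $ j + ?f x $ j * ?g' x $ j) = 0"
   using D_outside[OF \<phi>, of "is"] D_outside[OF w, of js] by eventually_elim (auto simp del: iter_pd.simps)
 qed
 hence "(LBINT x:\<Omega>. ?f' x \<bullet> ?g x + ?f x \<bullet> ?g' x) = 0"
  by (simp add: inner_vec_def sum.distrib del: iter_pd.simps)
 moreover have "(LBINT x:\<Omega>. ?f' x \<bullet> ?g x + ?f x \<bullet> ?g' x) = (LBINT x:\<Omega>. ?f' x \<bullet> ?g x) + (LBINT x:\<Omega>. ?f x \<bullet> ?g' x)"
 proof (rule set_integral_add(2))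
  have "set_integrable lborel \<Omega> (%x. u x \<bullet> v x)" if "L2\<Omega> u" "L2\<Omega> v" for u v
  proof -
   have "integrable lborel (%x. cut u x \<bullet> cut v x)" using that by (intro integrable_inner_l2fun L2\<Omega>_cut)
   also have "(%x. cut u x \<bullet> cut v x) = (%x. indicator \<Omega> x *\<^sub>R (u x \<bullet> v x))" by (auto simp: cut_def split: split_indicator)
   finally show ?thesis by (simp add: set_integrable_def)
  qed
  thus "set_integrable lborel \<Omega> (%x. ?f' x \<bullet> ?g x)" "set_integrable lborel \<Omega> (%x. ?f x \<bullet> ?g' x)"
   using L2\<Omega>_D \<phi> w by (blast intro: L2\<Omega>_D)+
 qed
 ultimately show ?thesis
  using L2\<Omega>_D[OF \<phi>] L2\<Omega>_D[OF w] by (simp add: cl_inner del: iter_pd.simps)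
qed

definition lap :: "vf => l2" where "lap w = (\<Sum>i\<in>UNIV. cl (iter_pd [i, i] w))"

text \<open>Frees the viscous term of the gradient of \<open>x\<close>: it becomes a bounded
  functional of the class \<open>x\<close> in \<open>L^2\<close>.\<close>

lemma Gam_lap:
 assumes "(x, G) \<in> Gam" "w \<in> D" shows "G \<bullet> snd (gr w) = - (x \<bullet> lap w)"
proof -
 have "snd (x, G) \<bullet> snd (gr w) = - (fst (x, G) \<bullet> lap w)"
 proof (rule Gam_induct[OF assms(1)])
  show "closed {z. snd z \<bullet> snd (gr w) = - (fst z \<bullet> lap w)}" by (intro closed_Collect_eq continuous_intros)
  fix \<phi> assume \<phi>: "\<phi> \<in> D"
  have "cl (pd i \<phi>) \<bullet> cl (pd i w) = - (cl \<phi> \<bullet> cl (iter_pd [i, i] w))" for i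
   using integration_by_parts[OF \<phi> assms(2), of i "[]" "[i]"] by simp
  thus "snd (gr \<phi>) \<bullet> snd (gr w) = - (fst (gr \<phi>) \<bullet> lap w)"
   by (simp add: gr_def inner_vec_def lap_def inner_sum_right sum_negf del: iter_pd.simps)
 qed
 thus ?thesis by simp
qed

end

lemma norm_abs_l2_le:
 assumes "l2fun f" "l2fun g" "c \<ge> 0" "!!t. norm (f t) <= c * norm (g t)"
 shows "norm (abs_l2 f) <= c * norm (abs_l2 g)"
proof (rule power2_le_imp_le)
 have "(norm (abs_l2 f))^2 = (LBINT x. (norm (f x))^2)" using assms by (simp add: norm_abs_l2)
 also have "\<dots> <= (LBINT x. c\<^sup>2 * (norm (g x))^2)"
  using assms power_mono[OF assms(4), of _ 2] by (intro integral_mono) (auto simp: l2fun_def power_mult_distrib)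
 also have "\<dots> = (c * norm (abs_l2 g))^2" using assms by (simp add: norm_abs_l2 power_mult_distrib)
 finally show "(norm (abs_l2 f))^2 <= (c * norm (abs_l2 g))^2" .
qed (use assms in simp)

context flow_domain
begin

section \<open>The convective term with a smooth test field\<close>

text \<open>Takes a field to its scalar product with \<open>c\<close>, placed in the
  \<open>i\<close>-th component. With it the trilinear term with a smooth factor is a sum of inner
  products with bounded operators on \<open>L^2\<close>.\<close>

definition mop :: "vf => 3 => l2 => l2" where
 "mop c i y = abs_l2 (%t. indicator \<Omega> t *\<^sub>R ((c t \<bullet> rep_l2 y t) *\<^sub>R axis i 1))"

lemma mop_l2fun:
 assumes c: "continuous_on UNIV c" and y: "l2fun y"
 obtains B where "B \<ge> 0" "l2fun (%t. indicator \<Omega> t *\<^sub>R ((c t \<bullet> y t) *\<^sub>R axis i 1))"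
  "!!t. norm (indicator \<Omega> t *\<^sub>R ((c t \<bullet> y t) *\<^sub>R axis i (1::real) :: real^3)) <= B * norm (y t)"
  "!!t. t \<in> \<Omega> ==> norm (c t) <= B"
proof -
 obtain B where B: "B \<ge> 0" "!!x. x \<in> cbox a b ==> norm (c x) <= B" using cont_bounded_box[OF c] by blast
 have [measurable]: "c \<in> borel_measurable borel" "y \<in> borel_measurable borel"
  using c y by (auto intro: borel_measurable_continuous_onI l2fun_measurable)
 have le: "norm (indicator \<Omega> t *\<^sub>R ((c t \<bullet> y t) *\<^sub>R axis i (1::real) :: real^3)) <= B * norm (y t)" for t
 proof (cases "t \<in> \<Omega>")
  case True
  have "\<bar>c t \<bullet> y t\<bar> <= norm (c t) * norm (y t)" by (rule Cauchy_Schwarz_ineq2)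
  also have "\<dots> <= B * norm (y t)" using B(2)[of t] True \<Omega>_cbox by (intro mult_right_mono) auto
  finally show ?thesis using True by simp
 qed (use B in auto)
 have "l2fun (%t. indicator \<Omega> t *\<^sub>R ((c t \<bullet> y t) *\<^sub>R axis i 1))"
  by (rule l2fun_mono[OF y _ le]) measurable
 thus ?thesis using that[of B] B le \<Omega>_cbox by auto
qed

lemma mop_abs:
 assumes c: "continuous_on UNIV c" and y: "l2fun y"
 shows "mop c i (abs_l2 y) = abs_l2 (%t. indicator \<Omega> t *\<^sub>R ((c t \<bullet> y t) *\<^sub>R axis i 1))"
 unfolding mop_def
proof (subst abs_l2_eq_iff)
 show "l2fun (%t. indicat_real \<Omega> t *\<^sub>R ((c t \<bullet> rep_l2 (abs_l2 y) t) *\<^sub>R axis i 1))"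
  using mop_l2fun[OF c l2fun_rep, of "abs_l2 y" i] by blast
 show "l2fun (%t. indicat_real \<Omega> t *\<^sub>R ((c t \<bullet> y t) *\<^sub>R axis i 1))"
  using mop_l2fun[OF c y, of i] by blast
 show "AE x in lborel. indicat_real \<Omega> x *\<^sub>R ((c x \<bullet> rep_l2 (abs_l2 y) x) *\<^sub>R axis i 1) = (indicat_real \<Omega> x *\<^sub>R ((c x \<bullet> y x) *\<^sub>R axis i 1) :: real^3)"
  using rep_abs_l2[OF y] by eventually_elim simp
qed

lemma bounded_linear_mop:
 assumes c: "continuous_on UNIV c" shows "bounded_linear (mop c i)"
proof -
 let ?F = "%y t. indicator \<Omega> t *\<^sub>R ((c t \<bullet> y t) *\<^sub>R axis i (1::real)) :: real^3"
 have l2: "l2fun (?F y)" if "l2fun y" for y using mop_l2fun[OF c that, of i] by blast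
 obtain B where B0: "B \<ge> 0" "!!x. x \<in> cbox a b ==> norm (c x) <= B" using cont_bounded_box[OF c] by blast
 have B: "B \<ge> 0" "!!t. t \<in> \<Omega> ==> norm (c t) <= B" using B0 \<Omega>_cbox by auto
 show ?thesis
 proof (rule bounded_linear_intro[where K=B])
  fix x y :: l2 and r :: real
  have "x + y = abs_l2 (%t. rep_l2 x t + rep_l2 y t)" by (simp add: abs_l2_add l2fun_rep)
  hence "mop c i (x + y) = abs_l2 (?F (%t. rep_l2 x t + rep_l2 y t))"
   by (simp add: mop_abs[OF c] l2fun_add l2fun_rep)
  also have "?F (%t. rep_l2 x t + rep_l2 y t) = (%t. ?F (rep_l2 x) t + ?F (rep_l2 y) t)"
   by (auto simp: fun_eq_iff inner_add_right scaleR_add_left split: split_indicator)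
  also have "abs_l2 \<dots> = mop c i x + mop c i y"
   unfolding mop_def by (intro abs_l2_add l2 l2fun_rep)
  finally show "mop c i (x + y) = mop c i x + mop c i y" .
  have "r *\<^sub>R x = abs_l2 (%t. r *\<^sub>R rep_l2 x t)" by (simp add: abs_l2_scale l2fun_rep)
  hence "mop c i (r *\<^sub>R x) = abs_l2 (?F (%t. r *\<^sub>R rep_l2 x t))"
   by (simp add: mop_abs[OF c] l2fun_scale l2fun_rep)
  also have "?F (%t. r *\<^sub>R rep_l2 x t) = (%t. r *\<^sub>R ?F (rep_l2 x) t)"
   by (auto simp: fun_eq_iff split: split_indicator)
  also have "abs_l2 \<dots> = r *\<^sub>R mop c i x" unfolding mop_def by (intro abs_l2_scale l2 l2fun_rep)
  finally show "mop c i (r *\<^sub>R x) = r *\<^sub>R mop c i x" .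
  have "norm (mop c i x) <= B * norm (abs_l2 (rep_l2 x))"
   unfolding mop_def
  proof (rule norm_abs_l2_le)
   show "norm (?F (rep_l2 x) t) <= B * norm (rep_l2 x t)" for t
   proof (cases "t \<in> \<Omega>")
    case True
    have "\<bar>c t \<bullet> rep_l2 x t\<bar> <= norm (c t) * norm (rep_l2 x t)" by (rule Cauchy_Schwarz_ineq2)
    also have "\<dots> <= B * norm (rep_l2 x t)" using B(2)[OF True] by (intro mult_right_mono) auto
    finally show ?thesis using True by simp
   qed (use B in auto)
  qed (use l2 l2fun_rep B in auto)
  thus "norm (mop c i x) <= norm x * B" by (simp add: mult.commute)
 qed
qed

lemma inner_mop:
 assumes c: "continuous_on UNIV c"
 shows "x \<bullet> mop c i y = (LBINT t. indicator \<Omega> t * (rep_l2 x t $ i * (c t \<bullet> rep_l2 y t)))"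
proof -
 have "l2fun (%t. indicator \<Omega> t *\<^sub>R ((c t \<bullet> rep_l2 y t) *\<^sub>R axis i 1))" using mop_l2fun[OF c l2fun_rep, of y i] by blast
 from inner_abs_l2[OF l2fun_rep[of x] this] show ?thesis
  by (simp add: mop_def inner_axis mult_ac)
qed

lemma inner_mop_cl:
 assumes c: "continuous_on UNIV c" and u: "L2\<Omega> u" and v: "L2\<Omega> v"
 shows "cl u \<bullet> mop c i (cl v) = (LBINT x:\<Omega>. u x $ i * (c x \<bullet> v x))"
proof -
 have "l2fun (%t. indicator \<Omega> t *\<^sub>R ((c t \<bullet> cut v t) *\<^sub>R axis i 1))" using mop_l2fun[OF c L2\<Omega>_cut[OF v], of i] by blast
 from inner_abs_l2[OF L2\<Omega>_cut[OF u] this]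
 have "cl u \<bullet> mop c i (cl v) = (LBINT t. cut u t \<bullet> (indicator \<Omega> t *\<^sub>R ((c t \<bullet> cut v t) *\<^sub>R axis i 1)))"
  unfolding cl_def by (simp add: mop_abs[OF c L2\<Omega>_cut[OF v]])
 also have "(%t. cut u t \<bullet> (indicator \<Omega> t *\<^sub>R ((c t \<bullet> cut v t) *\<^sub>R axis i 1))) = (%t. indicator \<Omega> t *\<^sub>R (u t $ i * (c t \<bullet> v t)))"
  by (auto simp: fun_eq_iff cut_def inner_axis split: split_indicator)
 finally show ?thesis by (simp add: set_lebesgue_integral_def)
qed

text \<open>\<open>Tri\<close> is the convective term tested with \<open>w\<close>, with
  \<open>G\<close> for the gradient; \<open>Qf\<close> is the same up to sign after the derivative
  has been moved to \<open>w\<close>, and is defined for every class in \<open>L^2\<close>.\<close>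

definition Tri :: "l2 => l2^3 => vf => real" where "Tri x G w = (\<Sum>i\<in>UNIV. x \<bullet> mop w i (G $ i))"
definition Qf :: "vf => l2 => real" where "Qf w x = (\<Sum>i\<in>UNIV. x \<bullet> mop (pd i w) i x)"

lemma set_integrable_\<Omega>_cont: "continuous_on UNIV f ==> set_integrable lborel \<Omega> (f :: real^3 => real)"
 by (rule set_integrable_subset[OF set_integrable_cbox[of f a b]]) (use \<Omega>_cbox in auto)

lemma set_integral_\<Omega>_sum:
 assumes "!!i::3. continuous_on UNIV (f i)"
 shows "(LBINT x:\<Omega>. (\<Sum>i\<in>UNIV. f i x :: real)) = (\<Sum>i\<in>UNIV. LBINT x:\<Omega>. f i x)"
 unfolding set_lebesgue_integral_def scaleR_sum_right
 using set_integrable_\<Omega>_cont[OF assms] by (intro Bochner_Integration.integral_sum) (auto simp: set_integrable_def)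

text \<open>Integrate the derivative in direction \<open>i\<close> of
  \<open>\<phi> x $ i * (w x \<bullet> \<phi> x)\<close> and sum over \<open>i\<close>; the terms in
  which the first factor is differentiated add up to the divergence of \<open>\<phi>\<close> and
  drop out.\<close>

lemma Tri_gr:
 assumes \<phi>: "\<phi> \<in> D" and w: "w \<in> D"
 shows "Tri (cl \<phi>) (snd (gr \<phi>)) w = - Qf w (cl \<phi>)"
proof -
 note [continuous_intros] = D_cont0[OF \<phi>] D_cont0[OF w] D_cont1[OF \<phi>] D_cont1[OF w]
 have A: "Tri (cl \<phi>) (snd (gr \<phi>)) w = (\<Sum>i\<in>UNIV. LBINT x:\<Omega>. \<phi> x $ i * (w x \<bullet> pd i \<phi> x))"
  unfolding Tri_def gr_def by (simp add: inner_mop_cl D_cont0 w L2\<Omega>_D0 L2\<Omega>_D1 \<phi>)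
 have B: "Qf w (cl \<phi>) = (\<Sum>i\<in>UNIV. LBINT x:\<Omega>. \<phi> x $ i * (pd i w x \<bullet> \<phi> x))"
  unfolding Qf_def by (simp add: inner_mop_cl D_cont1 w L2\<Omega>_D0 \<phi>)
 define g' where "g' i x = pd i \<phi> x $ i * (w x \<bullet> \<phi> x) + \<phi> x $ i * (pd i w x \<bullet> \<phi> x + w x \<bullet> pd i \<phi> x)" for i x
 have sm: "has_pd i (%x. \<psi> x $ j) (%x. pd i \<psi> x $ j)" if "\<psi> \<in> D" for \<psi> i j
  using smooth_has_pd[OF D_smooth[OF that], of i "[]" j] by simp
 have pd: "has_pd i (%x. \<phi> x $ i * (\<Sum>j\<in>UNIV. w x $ j * \<phi> x $ j))
   (%x. pd i \<phi> x $ i * (\<Sum>j\<in>UNIV. w x $ j * \<phi> x $ j) + \<phi> x $ i * (\<Sum>j\<in>UNIV. pd i w x $ j * \<phi> x $ j + w x $ j * pd i \<phi> x $ j))" for i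
  by (intro has_pd_sum has_pd_mult sm \<phi> w)
 have g'0: "(LBINT x:\<Omega>. g' i x) = 0" for i
 proof -
  have "(LBINT x:\<Omega>. pd i \<phi> x $ i * (\<Sum>j\<in>UNIV. w x $ j * \<phi> x $ j) + \<phi> x $ i * (\<Sum>j\<in>UNIV. pd i w x $ j * \<phi> x $ j + w x $ j * pd i \<phi> x $ j)) = 0"
  proof (rule integral_pd_zero[OF pd])
   fix x assume "x \<in> cbox a b" "x $ i = a $ i"
   thus "\<phi> (x + (b $ i - a $ i) *\<^sub>R axis i 1) $ i * (\<Sum>j\<in>UNIV. w (x + (b $ i - a $ i) *\<^sub>R axis i 1) $ j * \<phi> (x + (b $ i - a $ i) *\<^sub>R axis i 1) $ j)
    = \<phi> x $ i * (\<Sum>j\<in>UNIV. w x $ j * \<phi> x $ j)"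
    using D_faces[OF \<phi>, of x i "[]"] D_faces[OF w, of x i "[]"] by simp
  next
   show "AE x in lborel. x \<in> cbox a b --> x \<notin> \<Omega> -->
    pd i \<phi> x $ i * (\<Sum>j\<in>UNIV. w x $ j * \<phi> x $ j) + \<phi> x $ i * (\<Sum>j\<in>UNIV. pd i w x $ j * \<phi> x $ j + w x $ j * pd i \<phi> x $ j) = 0"
    using D_outside[OF \<phi>, of "[]"] by eventually_elim auto
  qed
  moreover have "g' i = (%x. pd i \<phi> x $ i * (\<Sum>j\<in>UNIV. w x $ j * \<phi> x $ j) + \<phi> x $ i * (\<Sum>j\<in>UNIV. pd i w x $ j * \<phi> x $ j + w x $ j * pd i \<phi> x $ j))"
   unfolding g'_def inner_vec_def sum.distrib by simp
  ultimately show ?thesis by (simp only:)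
 qed
 have "(\<Sum>i\<in>UNIV. g' i x) = (\<Sum>i\<in>UNIV. \<phi> x $ i * (w x \<bullet> pd i \<phi> x) + \<phi> x $ i * (pd i w x \<bullet> \<phi> x))" for x
 proof -
  have "(\<Sum>i\<in>UNIV. pd i \<phi> x $ i * (w x \<bullet> \<phi> x)) = 0"
   using D_div[OF \<phi>] by (simp add: div_free_def flip: sum_distrib_right)
  thus ?thesis by (simp add: g'_def sum.distrib distrib_left)
 qed
 hence "(LBINT x:\<Omega>. (\<Sum>i\<in>UNIV. \<phi> x $ i * (w x \<bullet> pd i \<phi> x) + \<phi> x $ i * (pd i w x \<bullet> \<phi> x))) = (LBINT x:\<Omega>. (\<Sum>i\<in>UNIV. g' i x))"
  by simp
 also have "\<dots> = 0" unfolding g'_def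
  by (subst set_integral_\<Omega>_sum) (auto intro!: continuous_intros simp: g'0[unfolded g'_def])
 also have "(LBINT x:\<Omega>. (\<Sum>i\<in>UNIV. \<phi> x $ i * (w x \<bullet> pd i \<phi> x) + \<phi> x $ i * (pd i w x \<bullet> \<phi> x)))
  = (\<Sum>i\<in>UNIV. LBINT x:\<Omega>. \<phi> x $ i * (w x \<bullet> pd i \<phi> x) + \<phi> x $ i * (pd i w x \<bullet> \<phi> x))"
  by (rule set_integral_\<Omega>_sum) (intro continuous_intros)
 also have "\<dots> = (\<Sum>i\<in>UNIV. (LBINT x:\<Omega>. \<phi> x $ i * (w x \<bullet> pd i \<phi> x)) + (LBINT x:\<Omega>. \<phi> x $ i * (pd i w x \<bullet> \<phi> x)))"
  by (intro sum.cong refl set_integral_add(2) set_integrable_\<Omega>_cont continuous_intros)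
 finally show ?thesis unfolding A B by (simp add: sum.distrib)
qed

lemma continuous_mop [continuous_intros]:
 "continuous_on UNIV c ==> continuous_on S f ==> continuous_on S (%x. mop c i (f x))"
 using bounded_linear.continuous_on[OF bounded_linear_mop] by blast

lemma continuous_Qf: "w \<in> D ==> continuous_on UNIV (Qf w)"
 unfolding Qf_def by (intro continuous_intros D_cont1)

lemma Gam_Tri:
 assumes "(x, G) \<in> Gam" and w: "w \<in> D" shows "Tri x G w = - Qf w x"
proof -
 have "Tri (fst (x, G)) (snd (x, G)) w = - Qf w (fst (x, G))"
 proof (rule Gam_induct[OF assms(1)])
  show "closed {z. Tri (fst z) (snd z) w = - Qf w (fst z)}"
   unfolding Tri_def Qf_def by (intro closed_Collect_eq continuous_intros D_cont0 D_cont1 w)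
  show "Tri (fst (gr \<phi>)) (snd (gr \<phi>)) w = - Qf w (fst (gr \<phi>))" if "\<phi> \<in> D" for \<phi>
   using Tri_gr[OF that w] by (simp add: gr_def)
 qed
 thus ?thesis by simp
qed

section \<open>Closability of the gradient\<close>

text \<open>Multiplication by the indicator of \<open>\<Omega>\<close>. It fixes \<open>HH\<close>
  and all gradients, so their representatives vanish almost everywhere off
  \<open>\<Omega>\<close>.\<close>

definition proj :: "l2 => l2" where "proj y = abs_l2 (cut (rep_l2 y))"

lemma l2fun_cut: "l2fun f ==> l2fun (cut f)"
 by (rule l2fun_mono[where c=1]) (auto simp: cut_def l2fun_def split: split_indicator)

lemma proj_abs: "l2fun y ==> proj (abs_l2 y) = abs_l2 (cut y)"
proof -
 assume y: "l2fun y"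
 have "AE t in lborel. cut (rep_l2 (abs_l2 y)) t = cut y t"
  using rep_abs_l2[OF y] by eventually_elim (simp add: cut_def)
 thus ?thesis
  unfolding proj_def by (rule abs_l2_eq_iff[OF l2fun_cut[OF l2fun_rep] l2fun_cut[OF y], THEN iffD2])
qed

lemma bounded_linear_proj: "bounded_linear proj"
proof (rule bounded_linear_intro[where K=1])
 fix x y :: l2 and r :: real
 have "x + y = abs_l2 (%t. rep_l2 x t + rep_l2 y t)" by (simp add: abs_l2_add l2fun_rep)
 hence "proj (x + y) = abs_l2 (cut (%t. rep_l2 x t + rep_l2 y t))" by (simp add: proj_abs l2fun_add l2fun_rep)
 also have "cut (%t. rep_l2 x t + rep_l2 y t) = (%t. cut (rep_l2 x) t + cut (rep_l2 y) t)"
  by (auto simp: cut_def scaleR_add_right)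
 also have "abs_l2 \<dots> = proj x + proj y" unfolding proj_def by (intro abs_l2_add l2fun_cut l2fun_rep)
 finally show "proj (x + y) = proj x + proj y" .
 have "r *\<^sub>R x = abs_l2 (%t. r *\<^sub>R rep_l2 x t)" by (simp add: abs_l2_scale l2fun_rep)
 hence "proj (r *\<^sub>R x) = abs_l2 (cut (%t. r *\<^sub>R rep_l2 x t))" by (simp add: proj_abs l2fun_scale l2fun_rep)
 also have "cut (%t. r *\<^sub>R rep_l2 x t) = (%t. r *\<^sub>R cut (rep_l2 x) t)" by (auto simp: cut_def)
 also have "abs_l2 \<dots> = r *\<^sub>R proj x" unfolding proj_def by (intro abs_l2_scale l2fun_cut l2fun_rep)
 finally show "proj (r *\<^sub>R x) = r *\<^sub>R proj x" .
 have "norm (proj x) <= 1 * norm (abs_l2 (rep_l2 x))" unfolding proj_def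
  by (intro norm_abs_l2_le l2fun_cut l2fun_rep) (auto simp: cut_def split: split_indicator)
 thus "norm (proj x) <= norm x * 1" by simp
qed

lemma continuous_proj [continuous_intros]: "continuous_on S f ==> continuous_on S (%x. proj (f x))"
 using bounded_linear.continuous_on[OF bounded_linear_proj] by blast

lemma proj_cl: "L2\<Omega> u ==> proj (cl u) = cl u"
 unfolding cl_def by (subst proj_abs[OF L2\<Omega>_cut]) (auto simp: cut_def intro!: arg_cong[of _ _ abs_l2] split: split_indicator)

lemma proj_HH: "x \<in> HH ==> proj x = x"
proof -
 have "HH \<subseteq> {x. proj x = x}" unfolding HH_def
  by (intro closure_minimal closed_Collect_eq continuous_intros) (auto simp: proj_cl L2\<Omega>_D0)
 thus "x \<in> HH ==> proj x = x" by blast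
qed

lemma proj_Gam: assumes "(x, G) \<in> Gam" shows "proj (G $ i) = G $ i"
proof -
 have "proj (snd (x, G) $ i) = snd (x, G) $ i"
 proof (rule Gam_induct[OF assms])
  show "closed {z. proj (snd z $ i) = snd z $ i}" by (intro closed_Collect_eq continuous_intros)
 qed (auto simp: gr_def proj_cl L2\<Omega>_D1)
 thus ?thesis by simp
qed

lemma proj_eq_AE: "proj y = y ==> AE t in lborel. t \<notin> \<Omega> --> rep_l2 y t = 0"
proof -
 assume "proj y = y"
 hence "abs_l2 (cut (rep_l2 y)) = abs_l2 (rep_l2 y)" by (simp add: proj_def)
 hence "AE t in lborel. cut (rep_l2 y) t = rep_l2 y t" by (rule abs_l2_eq_iff[OF l2fun_cut[OF l2fun_rep] l2fun_rep, THEN iffD1])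
 thus ?thesis by eventually_elim (auto simp: cut_def)
qed

definition tst :: "(real^3) set => 3 => (real^3 => real) => l2" where
 "tst B j \<psi> = abs_l2 (%t. indicator B t *\<^sub>R (\<psi> t *\<^sub>R axis j 1))"

lemma tst_l2fun:
 assumes "B \<subseteq> \<Omega>" "B \<in> sets borel" "continuous_on UNIV \<psi>"
 shows "l2fun (%t. indicator B t *\<^sub>R (\<psi> t *\<^sub>R axis j 1))"
proof -
 have [measurable]: "\<psi> \<in> borel_measurable borel" using assms(3) by (rule borel_measurable_continuous_onI)
 note [measurable] = assms(2)
 obtain C where C: "C \<ge> 0" "!!x. x \<in> cbox a b ==> norm (\<psi> x) <= C" using cont_bounded_box[OF assms(3)] by blast
 show ?thesis
 proof (rule l2fun_mono[where c=C])
  show "l2fun (%x. indicator (box a b) x *\<^sub>R axis 1 1)" by (rule l2fun_indicator_box)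
  show "(%t. indicat_real B t *\<^sub>R (\<psi> t *\<^sub>R axis j (1::real)) :: real^3) \<in> borel_measurable borel" by measurable
  show "norm (indicat_real B t *\<^sub>R (\<psi> t *\<^sub>R axis j (1::real)) :: real^3) <= C * norm (indicator (box a b) t *\<^sub>R axis 1 (1::real) :: real^3)" for t
   using C assms(1) \<Omega>_box \<Omega>_cbox by (auto simp: subset_iff split: split_indicator)
 qed
qed

lemma inner_tst:
 assumes "B \<subseteq> \<Omega>" "B \<in> sets borel" "continuous_on UNIV \<psi>"
 shows "y \<bullet> tst B j \<psi> = (LBINT t. indicator B t * (\<psi> t * rep_l2 y t $ j))"
 unfolding tst_def using inner_abs_l2[OF l2fun_rep[of y] tst_l2fun[OF assms, of j]]
 by (simp add: inner_axis mult_ac)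

lemma inner_tst_cl:
 assumes "B \<subseteq> \<Omega>" "B \<in> sets borel" "continuous_on UNIV \<psi>" "L2\<Omega> u"
 shows "cl u \<bullet> tst B j \<psi> = (LBINT t:B. \<psi> t * u t $ j)"
proof -
 have "(%t. cut u t \<bullet> (indicator B t *\<^sub>R (\<psi> t *\<^sub>R axis j 1))) = (%t. indicator B t *\<^sub>R (\<psi> t * u t $ j))"
  using assms(1) by (auto simp: fun_eq_iff cut_def inner_axis split: split_indicator)
 thus ?thesis
  unfolding tst_def cl_def set_lebesgue_integral_def
  using inner_abs_l2[OF L2\<Omega>_cut[OF assms(4)] tst_l2fun[OF assms(1-3), of j]] by simp
qed

text \<open>\<open>\<psi>\<close> vanishes on the two faces in direction \<open>i\<close>, so the
  derivative can be moved inside the small box whatever values the field takes on its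
  boundary.\<close>

lemma Gam_tst:
 assumes xG: "(x, G) \<in> Gam" and B: "cbox u v \<subseteq> \<Omega>" and uv: "u $ i <= v $ i" and \<psi>: "has_pd i \<psi> \<psi>'"
  and 0: "!!t. t \<in> cbox u v ==> t $ i = u $ i \<or> t $ i = v $ i ==> \<psi> t = 0"
 shows "(G $ i) \<bullet> tst (cbox u v) j \<psi> = - (x \<bullet> tst (cbox u v) j \<psi>')"
proof -
 have c: "continuous_on UNIV \<psi>" "continuous_on UNIV \<psi>'" using \<psi> by (auto simp: has_pd_def)
 have "(snd (x, G) $ i) \<bullet> tst (cbox u v) j \<psi> = - (fst (x, G) \<bullet> tst (cbox u v) j \<psi>')"
 proof (rule Gam_induct[OF xG])
  show "closed {z. (snd z $ i) \<bullet> tst (cbox u v) j \<psi> = - (fst z \<bullet> tst (cbox u v) j \<psi>')}"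
   by (intro closed_Collect_eq continuous_intros)
  fix \<phi> assume \<phi>: "\<phi> \<in> D"
  note [continuous_intros] = D_cont0[OF \<phi>] D_cont1[OF \<phi>]
  have pd: "has_pd i (%x. \<psi> x * \<phi> x $ j) (%x. \<psi>' x * \<phi> x $ j + \<psi> x * pd i \<phi> x $ j)"
   using smooth_has_pd[OF D_smooth[OF \<phi>], of i "[]" j] by (intro has_pd_mult \<psi>) simp
  have "(LBINT t:cbox u v. \<psi>' t * \<phi> t $ j + \<psi> t * pd i \<phi> t $ j) = 0"
  proof (rule integral_pd_faces_zero[OF pd uv])
   fix t assume t: "t \<in> cbox u v" "t $ i = u $ i"
   hence "t + (v $ i - u $ i) *\<^sub>R axis i 1 \<in> cbox u v" using uv by (auto simp: mem_box_cart axis_def)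
   hence "\<psi> (t + (v $ i - u $ i) *\<^sub>R axis i 1) = 0" using t by (intro 0) auto
   thus "\<psi> (t + (v $ i - u $ i) *\<^sub>R axis i 1) * \<phi> (t + (v $ i - u $ i) *\<^sub>R axis i 1) $ j = \<psi> t * \<phi> t $ j"
    using 0[OF t(1)] t(2) by simp
  qed
  moreover have "(LBINT t:cbox u v. \<psi>' t * \<phi> t $ j + \<psi> t * pd i \<phi> t $ j) = (LBINT t:cbox u v. \<psi>' t * \<phi> t $ j) + (LBINT t:cbox u v. \<psi> t * pd i \<phi> t $ j)"
   by (intro set_integral_add(2) set_integrable_cbox continuous_intros c)
  ultimately show "(snd (gr \<phi>) $ i) \<bullet> tst (cbox u v) j \<psi> = - (fst (gr \<phi>) \<bullet> tst (cbox u v) j \<psi>')"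
   using B c by (simp add: gr_def inner_tst_cl L2\<Omega>_D0 L2\<Omega>_D1 \<phi>)
 qed
 thus ?thesis by simp
qed

end

lemma measurable_vec_nth [measurable (raw)]:
 fixes f :: "'a => real^'n"
 shows "f \<in> borel_measurable M ==> (%x. f x $ j) \<in> borel_measurable M"
 by (rule borel_measurable_continuous_on[of "%v. v $ j"]) (auto intro!: continuous_intros)

lemma four_mult_le_square: "4 * (A * B) <= (A + B :: real)^2"
 using sum_squares_bound[of A B] by (simp add: power2_sum)

lemma l2fun_indicator_finite:
 assumes "A \<in> sets borel" "emeasure lborel A < \<infinity>" shows "l2fun (%x. indicator A x *\<^sub>R c)"
proof -
 have "integrable lborel (%x. indicator A x *\<^sub>R (norm c)^2)"
  using assms by (intro integrable_indicator) auto
 also have "(%x. indicator A x *\<^sub>R (norm c)^2) = (%x. (norm (indicator A x *\<^sub>R c))^2)"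
  by (auto simp: fun_eq_iff split: split_indicator)
 finally show ?thesis using assms by (simp add: l2fun_def)
qed

lemma Cauchy_Schwarz_cbox:
 fixes f g h :: "real^3 => real"
 assumes "continuous_on UNIV f" "continuous_on UNIV g" "continuous_on UNIV h" "!!x. 0 <= f x" "!!x. 0 <= g x" "!!x. 0 <= h x"
  and le: "!!x. (h x)^2 <= f x * g x"
 shows "(LBINT x:cbox a b. h x)^2 <= (LBINT x:cbox a b. f x) * (LBINT x:cbox a b. g x)"
proof -
 have [measurable]: "f \<in> borel_measurable borel" "g \<in> borel_measurable borel" "h \<in> borel_measurable borel"
  using assms by (auto intro: borel_measurable_continuous_onI)
 have "(\<integral>\<^sup>+x. ennreal (h x) * indicator (cbox a b) x \<partial>lborel)^2 <= (\<integral>\<^sup>+x. ennreal (f x) * indicator (cbox a b) x \<partial>lborel) * (\<integral>\<^sup>+x. ennreal (g x) * indicator (cbox a b) x \<partial>lborel)"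
 proof (rule nn_integral_Cauchy_Schwarz_pointwise)
  show "(ennreal (h x) * indicator (cbox a b) x)^2 <= ennreal (f x) * indicator (cbox a b) x * (ennreal (g x) * indicator (cbox a b) x)" for x
   using ennreal_leI[OF le[of x]] assms(4-6) by (auto simp: ennreal_mult ennreal_power split: split_indicator)
 qed measurable
 hence "ennreal ((LBINT x:cbox a b. h x)^2) <= ennreal ((LBINT x:cbox a b. f x) * (LBINT x:cbox a b. g x))"
  using assms by (simp add: nn_integral_cbox ennreal_power ennreal_mult' set_lebesgue_integral_def Bochner_Integration.integral_nonneg)
 thus ?thesis
  using assms by (subst (asm) ennreal_le_iff) (auto simp: set_lebesgue_integral_def intro!: mult_nonneg_nonneg Bochner_Integration.integral_nonneg)
qed

context flow_domain
begin

text \<open>The indicator of the open box is a bounded pointwise limit, on the closed box, of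
  polynomials that vanish on the faces. For each of them \<open>Gam_tst\<close> moves the derivative
  onto the polynomial, where it is paired with the class 0.\<close>

lemma Gam_box_zero:
 assumes 0: "(0, G) \<in> Gam" and uv: "cbox u v \<subseteq> \<Omega>"
 shows "(LBINT t. indicator (box u v) t * rep_l2 (G $ i) t $ j) = 0"
proof (cases "box u v = {}")
 case False
 hence lt: "u $ m < v $ m" for m by (simp add: interval_ne_empty_cart)
 \<comment> \<open>A quadratic in one coordinate, scaled to lie between 0 and 1 on the box and to
   vanish at both end points. Sums and products are spelled out so that \<open>has_pd_add\<close>
   and \<open>has_pd_mult\<close> apply.\<close>
 define s where "s m x = 4 / (v $ m - u $ m)^2 * ((x $ m + (- (u $ m))) * (v $ m + (-1) * x $ m))" for m and x :: "real^3"
 \<comment> \<open>Each factor is \<open>1 - (1 - s)^(k+1)\<close>: it tends to 1 where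
   \<open>s\<close> is positive and is 0 where \<open>s\<close> is 0.\<close>
 define \<psi> where "\<psi> k x = (\<Prod>m\<in>UNIV. 1 + (-1) * (1 + (-1) * s m x) ^ Suc k)" for k and x :: "real^3"
 have pd: "\<exists>\<psi>'. has_pd i (\<psi> k) \<psi>'" for k
  unfolding \<psi>_def
 proof (rule has_pd_prod)
  fix m :: 3
  have "has_pd i (%x. 1 + (-1) * s m x) (%x. 0 + (0 * s m x + (-1) * (0 * ((x $ m + (- (u $ m))) * (v $ m + (-1) * x $ m)) + 4 / (v $ m - u $ m)^2 *
    (((if m = i then 1 else 0) + 0) * (v $ m + (-1) * x $ m) + (x $ m + (- (u $ m))) * (0 + (0 * x $ m + (-1) * (if m = i then 1 else 0)))))))"
   unfolding s_def by (intro has_pd_add has_pd_mult has_pd_const has_pd_nth)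
  from has_pd_power[OF this, of "Suc k"] obtain g' where "has_pd i (%x. (1 + (-1) * s m x) ^ Suc k) g'" by blast
  from has_pd_add[OF has_pd_const[of i 1] has_pd_mult[OF has_pd_const[of i "-1"] this]]
  show "\<exists>g'. has_pd i (%x. 1 + (-1) * (1 + (-1) * s m x) ^ Suc k) g'" by blast
 qed simp
 have s01: "0 <= s m x" "s m x <= 1" if "x \<in> cbox u v" for m x
 proof -
  have x: "u $ m <= x $ m" "x $ m <= v $ m" using that by (auto simp: mem_box_cart)
  thus "0 <= s m x" unfolding s_def by (intro mult_nonneg_nonneg) auto
  have "4 * ((x $ m - u $ m) * (v $ m - x $ m)) <= ((x $ m - u $ m) + (v $ m - x $ m))^2"
   by (rule four_mult_le_square)
  hence "4 * ((x $ m - u $ m) * (v $ m - x $ m)) <= (v $ m - u $ m)^2" by simp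
  thus "s m x <= 1" using lt[of m] unfolding s_def by (simp add: divide_le_eq)
 qed
 have sz: "s m x = 0" if "x $ m = u $ m \<or> x $ m = v $ m" for m x using that by (auto simp: s_def)
 have \<psi>z: "\<psi> k x = 0" if "s m x = 0" for k x m
  unfolding \<psi>_def using that by (intro prod_zero bexI[of _ m]) auto
 have sp: "0 < s m x" if "x \<in> box u v" for m x
  using that lt[of m] unfolding s_def by (auto simp: mem_box_cart intro!: mult_pos_pos)
 have \<psi>1: "\<bar>\<psi> k x\<bar> <= 1" if x: "x \<in> cbox u v" for k x
 proof -
  have "0 <= 1 + (-1) * (1 + (-1) * s m x) ^ Suc k \<and> 1 + (-1) * (1 + (-1) * s m x) ^ Suc k <= 1" for m
   using s01[OF x, of m] power_le_one[of "1 - s m x" "Suc k"] zero_le_power[of "1 - s m x" "Suc k"] by simp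
  thus ?thesis unfolding \<psi>_def by (auto intro!: prod_le_1 simp: abs_prod)
 qed
 have lim: "(%k. indicator (cbox u v) x * (\<psi> k x * rep_l2 (G $ i) x $ j)) ----> indicator (box u v) x * rep_l2 (G $ i) x $ j" for x
 proof (cases "x \<in> box u v")
  case True
  hence xc: "x \<in> cbox u v" using box_subset_cbox by blast
  have "(%k. (1 + (-1) * s m x) ^ Suc k) ----> 0" for m
   using s01[OF xc, of m] sp[OF True, of m] by (intro LIMSEQ_Suc LIMSEQ_realpow_zero) auto
  hence "(%k. \<psi> k x) ----> (\<Prod>m\<in>(UNIV::3 set). 1 + (-1) * 0)" unfolding \<psi>_def by (intro tendsto_intros)
  hence "(%k. \<psi> k x * rep_l2 (G $ i) x $ j) ----> 1 * rep_l2 (G $ i) x $ j" by (intro tendsto_intros) simp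
  thus ?thesis using True xc by simp
 next
  case False
  have "indicator (cbox u v) x * (\<psi> k x * rep_l2 (G $ i) x $ j) = 0" for k
  proof (cases "x \<in> cbox u v")
   case True
   obtain m where "\<not> (u $ m < x $ m \<and> x $ m < v $ m)" using False unfolding mem_box_cart by blast
   moreover have "u $ m <= x $ m" "x $ m <= v $ m" using True unfolding mem_box_cart by blast+
   ultimately have "x $ m = u $ m \<or> x $ m = v $ m" by linarith
   thus ?thesis using \<psi>z[OF sz] by simp
  qed simp
  hence z: "(%k. indicator (cbox u v) x * (\<psi> k x * rep_l2 (G $ i) x $ j)) = (%k. 0)" by (rule ext)
  show ?thesis unfolding z using False by simp
 qed
 have zero: "(LBINT x. indicator (cbox u v) x * (\<psi> k x * rep_l2 (G $ i) x $ j)) = 0" for k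
 proof -
  obtain \<psi>' where \<psi>': "has_pd i (\<psi> k) \<psi>'" using pd by blast
  have "(G $ i) \<bullet> tst (cbox u v) j (\<psi> k) = - (0 \<bullet> tst (cbox u v) j \<psi>')"
   by (rule Gam_tst[OF 0 uv less_imp_le[OF lt] \<psi>']) (use \<psi>z sz in blast)
  thus ?thesis using \<psi>' uv by (simp add: inner_tst has_pd_def)
 qed
 have "(%k. \<integral>x. indicator (cbox u v) x * (\<psi> k x * rep_l2 (G $ i) x $ j) \<partial>lborel) ----> (LBINT x. indicator (box u v) x * rep_l2 (G $ i) x $ j)"
 proof (rule integral_dominated_convergence)
  have "l2fun (%t. indicator (cbox u v) t *\<^sub>R axis j 1)" by (rule l2fun_indicator_finite[OF _ emeasure_bounded_finite[OF bounded_cbox]]) simp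
  from integrable_inner_l2fun[OF l2fun_rep[of "G $ i"] this]
  have "integrable lborel (%t. indicator (cbox u v) t * rep_l2 (G $ i) t $ j)" by (simp add: inner_axis)
  hence "integrable lborel (%t. norm (indicator (cbox u v) t * rep_l2 (G $ i) t $ j))" by (rule integrable_norm)
  thus "integrable lborel (%t. indicator (cbox u v) t * \<bar>rep_l2 (G $ i) t $ j\<bar>)"
   by (simp add: abs_mult)
  show "AE x in lborel. norm (indicat_real (cbox u v) x * (\<psi> k x * rep_l2 (G $ i) x $ j)) <= indicat_real (cbox u v) x * \<bar>rep_l2 (G $ i) x $ j\<bar>" for k
  proof (rule AE_I2)
   fix x
   show "norm (indicat_real (cbox u v) x * (\<psi> k x * rep_l2 (G $ i) x $ j)) <= indicat_real (cbox u v) x * \<bar>rep_l2 (G $ i) x $ j\<bar>"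
    using mult_right_mono[OF \<psi>1[of x k], of "\<bar>rep_l2 (G $ i) x $ j\<bar>"] by (auto simp: abs_mult split: split_indicator)
  qed
  show "(%x. indicat_real (cbox u v) x * (\<psi> k x * rep_l2 (G $ i) x $ j)) \<in> borel_measurable lborel" for k
  proof -
   have [measurable]: "\<psi> k \<in> borel_measurable borel" using pd[of k] has_pd_measurable by blast
   show ?thesis by measurable
  qed
  show "(%x. indicat_real (box u v) x * rep_l2 (G $ i) x $ j) \<in> borel_measurable lborel" by measurable
 qed (use lim in auto)
 thus ?thesis using LIMSEQ_unique[OF _ tendsto_const[of 0]] unfolding zero by blast
qed simp

text \<open>The integrals over all rational boxes inside a closed rational box in
  \<open>\<Omega>\<close> vanish, so \<open>G\<close> vanishes there. Such boxes cover the open set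
  \<open>\<Omega>\<close>, and off \<open>\<Omega>\<close> the gradient is 0 by
  \<open>proj\<close>.\<close>

lemma Gam_zero: assumes 0: "(0, G) \<in> Gam" shows "G = 0"
proof -
 have "G $ i = 0" for i
 proof -
  have loc: "AE t in lborel. cbox (rat_vec p) (rat_vec q) \<subseteq> \<Omega> --> (\<forall>j. indicator (box (rat_vec p) (rat_vec q)) t * rep_l2 (G $ i) t $ j = 0)" for p q
  proof (cases "cbox (rat_vec p) (rat_vec q) \<subseteq> \<Omega>")
   case True
   have "AE t in lborel. indicator (box (rat_vec p) (rat_vec q)) t * rep_l2 (G $ i) t $ j = 0" for j
   proof (rule rat_box_integrals_zero_AE)
    show "integrable lborel (%t. indicator (box (rat_vec p) (rat_vec q)) t * rep_l2 (G $ i) t $ j)"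
     using integrable_inner_l2fun[OF l2fun_rep[of "G $ i"] l2fun_indicator_box[of "rat_vec p" "rat_vec q" "axis j 1"]]
     by (simp add: inner_axis)
    fix c d :: "rat^3"
    let ?u = "rat_vec (\<chi> i. max (c $ i) (p $ i)) :: real^3" and ?v = "rat_vec (\<chi> i. min (d $ i) (q $ i)) :: real^3"
    have "(LBINT t. indicator (box (rat_vec c) (rat_vec d)) t * (indicator (box (rat_vec p) (rat_vec q)) t * rep_l2 (G $ i) t $ j))
     = (LBINT t. indicator (box ?u ?v) t * rep_l2 (G $ i) t $ j)"
     unfolding rat_box_Int[symmetric] by (simp add: indicator_inter_arith mult.assoc)
    also have "\<dots> = 0"
    proof (rule Gam_box_zero[OF 0])
     have "cbox ?u ?v \<subseteq> cbox (rat_vec p) (rat_vec q)"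
     proof
      fix x assume x: "x \<in> cbox ?u ?v"
      show "x \<in> cbox (rat_vec p) (rat_vec q)" unfolding mem_box_cart
      proof
       fix m
       have "rat_vec p $ m <= ?u $ m" "?v $ m <= rat_vec q $ m"
        by (simp_all add: rat_vec_def of_rat_less_eq)
       moreover have "?u $ m <= x $ m" "x $ m <= ?v $ m" using x unfolding mem_box_cart by blast+
       ultimately show "rat_vec p $ m <= x $ m \<and> x $ m <= rat_vec q $ m" by (meson order_trans)
      qed
     qed
     thus "cbox ?u ?v \<subseteq> \<Omega>" using True by blast
    qed
    finally show "(LBINT t. indicator (box (rat_vec c) (rat_vec d)) t * (indicator (box (rat_vec p) (rat_vec q)) t * rep_l2 (G $ i) t $ j)) = 0" .
   qed
   hence "AE t in lborel. \<forall>j. indicator (box (rat_vec p) (rat_vec q)) t * rep_l2 (G $ i) t $ j = 0"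
    by (rule eventually_all_finite)
   thus ?thesis by (rule eventually_mono) blast
  qed simp
  have "AE t in lborel. \<forall>p q. cbox (rat_vec p) (rat_vec q) \<subseteq> \<Omega> --> (\<forall>j. indicator (box (rat_vec p) (rat_vec q)) t * rep_l2 (G $ i) t $ j = 0)"
   unfolding AE_all_countable using loc by blast
  moreover have "AE t in lborel. t \<notin> \<Omega> --> rep_l2 (G $ i) t = 0" by (rule proj_eq_AE[OF proj_Gam[OF 0]])
  ultimately have "AE t in lborel. rep_l2 (G $ i) t = 0"
  proof eventually_elim
   case (elim t)
   show ?case
   proof (cases "t \<in> \<Omega>")
    case True
    then obtain e where e: "e > 0" "cball t e \<subseteq> \<Omega>" using open_\<Omega> open_contains_cball by blast
    obtain p' q' where pq: "\<forall>i\<in>Basis. p' \<bullet> i \<in> \<rat> \<and> q' \<bullet> i \<in> \<rat>" "t \<in> box p' q'" "box p' q' \<subseteq> ball t e"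
     using rational_boxes[OF e(1)] by blast
    hence "!!i. p' $ i \<in> \<rat>" "!!i. q' $ i \<in> \<rat>" by (auto simp: cart_eq_inner_axis axis_in_Basis_iff)
    then obtain p q where r: "p' = rat_vec p" "q' = rat_vec q" using rat_vec_exists by metis
    have "cbox p' q' = closure (box p' q')" using pq(2) by (intro closure_box[symmetric]) auto
    also have "\<dots> \<subseteq> cball t e" using pq(3) by (intro closure_minimal) (auto simp: subset_iff less_imp_le)
    finally have "cbox p' q' \<subseteq> \<Omega>" using e(2) by blast
    thus ?thesis using elim(1) pq(2) unfolding r by (auto simp: vec_eq_iff split: split_indicator_asm)
   qed (use elim in blast)
  qed
  hence "abs_l2 (rep_l2 (G $ i)) = abs_l2 (%t. 0)" by (rule abs_l2_eq_iff[OF l2fun_rep l2fun_0, THEN iffD2])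
  thus ?thesis by (simp add: abs_l2_0)
 qed
 thus ?thesis by (simp add: vec_eq_iff)
qed

text \<open>Single-valued by \<open>Gam_unique\<close>. Along solutions the default 0 off
  \<open>VV\<close> matters only on a null set of times, and it lets the norm of the gradient be
  measurable.\<close>

definition grad :: "l2 => l2^3" where "grad x = (if x \<in> VV then THE G. (x, G) \<in> Gam else 0)"

lemma Gam_unique: "(x, G) \<in> Gam ==> (x, G') \<in> Gam ==> G = G'"
 using subspace_diff[OF subspace_Gam, of "(x, G)" "(x, G')"] Gam_zero[of "G - G'"] by simp

lemma Gam_VV: "(x, G) \<in> Gam ==> x \<in> VV"
 unfolding VV_def by (rule image_eqI[of _ _ "(x, G)"]) auto

lemma grad_eq: assumes "(x, G) \<in> Gam" shows "grad x = G"
proof -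
 have "(THE G. (x, G) \<in> Gam) = G" by (rule the_equality, rule assms, rule Gam_unique[OF _ assms])
 thus ?thesis using Gam_VV[OF assms] by (simp add: grad_def)
qed

lemma grad_Gam: assumes "x \<in> VV" shows "(x, grad x) \<in> Gam"
proof -
 obtain G where "(x, G) \<in> Gam" using assms by (auto simp: VV_def)
 thus ?thesis using grad_eq by simp
qed

lemma grad_diff: "x \<in> VV ==> y \<in> VV ==> x - y \<in> VV \<and> grad (x - y) = grad x - grad y"
 using subspace_diff[OF subspace_Gam grad_Gam grad_Gam, of x y] grad_eq Gam_VV by auto

lemma grad_D: "\<phi> \<in> D ==> cl \<phi> \<in> VV \<and> grad (cl \<phi>) = snd (gr \<phi>)"
 using gr_Gam[of \<phi>] grad_eq Gam_VV by (auto simp: gr_def)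

text \<open>Classes with gradient norm at most \<open>C\<close> form the projection of a convex part
  of the graph. It is closed since bounded gradients have a weak cluster point, and a closed convex
  set is weakly closed.\<close>

lemma VV_weakly_closed:
 assumes "F \<noteq> bot" "\<forall>\<^sub>F n in F. z n \<in> VV \<and> norm (grad (z n)) <= C"
  and lim: "!!w. ((%n. z n \<bullet> w) \<longlongrightarrow> x \<bullet> w) F"
 shows "x \<in> VV \<and> norm (grad x) <= C"
proof -
 define S where "S = {x. \<exists>G. (x, G) \<in> Gam \<and> norm G <= C}"
 have S: "S = fst ` (Gam \<inter> snd -` cball 0 C)" 
 proof (intro set_eqI iffI)
  fix x assume "x \<in> S"
  then obtain G where "(x, G) \<in> Gam" "norm G <= C" by (auto simp: S_def)
  thus "x \<in> fst ` (Gam \<inter> snd -` cball 0 C)" by (intro image_eqI[of _ _ "(x, G)"]) auto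
 next
  fix x assume "x \<in> fst ` (Gam \<inter> snd -` cball 0 C)"
  thus "x \<in> S" by (auto simp: S_def)
 qed
 have "convex S" unfolding S
  by (intro convex_linear_image linear_fst convex_Int subspace_imp_convex[OF subspace_Gam] convex_linear_vimage linear_snd convex_cball)
 moreover have "closed S"
  unfolding closed_sequential_limits
 proof (intro allI impI)
  fix y l assume "(\<forall>n. y n \<in> S) \<and> y ----> l"
  hence y: "!!n. y n \<in> S" "y ----> l" by auto
  hence "\<forall>n. \<exists>G. (y n, G) \<in> Gam \<and> norm G <= C" by (auto simp: S_def)
  then obtain G where G: "\<forall>n. (y n, G n) \<in> Gam \<and> norm (G n) <= C" by (rule choice[THEN exE])
  obtain B where B: "!!n. norm (y n) <= B" using convergent_imp_bounded[OF y(2)] by (auto simp: bounded_iff)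
  have "norm (y n, G n) <= B + C" for n using norm_Pair_le[of "y n" "G n"] B[of n] G by (smt (verit))
  then obtain z where z: "!!S. closed S ==> convex S ==> EV n. (y n, G n) \<in> S ==> z \<in> S"
   "!!w l. (%n. (y n, G n) \<bullet> w) ----> l ==> z \<bullet> w = l"
   by (rule bounded_weak_cluster) (rule that)
  have "z \<in> Gam" using G by (intro z(1) closed_Gam subspace_imp_convex[OF subspace_Gam]) auto
  moreover have "z \<in> snd -` cball 0 C" using G
   by (intro z(1) closed_vimage_snd convex_linear_vimage linear_snd convex_cball closed_cball) auto
  moreover have "fst z = l"
  proof -
   have "z \<bullet> (w, 0) = l \<bullet> w" for w
    using z(2)[of "(w, 0)" "l \<bullet> w"] tendsto_inner[OF y(2) tendsto_const, of w] by simp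
   hence "fst z \<bullet> w = l \<bullet> w" for w by (cases z) simp
   thus ?thesis by (metis vector_eq_rdot)
  qed
  ultimately show "l \<in> S" unfolding S by force
 qed
 moreover have "\<forall>\<^sub>F n in F. z n \<in> S"
  using assms(2) by eventually_elim (use grad_Gam in \<open>auto simp: S_def\<close>)
 ultimately have "x \<in> S" using closed_convex_weakly_closed[OF _ _ assms(1) _ lim] by blast
 thus ?thesis using grad_eq Gam_VV by (auto simp: S_def)
qed

section \<open>Poincare, Friedrichs and Sobolev inequalities on V\<close>

lemma norm_cl_D:
 assumes \<phi>: "\<phi> \<in> D"
 shows "(norm (cl (iter_pd is \<phi>)))^2 = (\<Sum>j\<in>UNIV. LBINT x:cbox a b. (iter_pd is \<phi> x $ j)^2)"
proof -
 note [continuous_intros] = D_cont[OF \<phi>, of "is"]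
 have "(norm (cl (iter_pd is \<phi>)))^2 = (LBINT x:\<Omega>. iter_pd is \<phi> x \<bullet> iter_pd is \<phi> x)"
  using cl_inner[OF L2\<Omega>_D[OF \<phi>] L2\<Omega>_D[OF \<phi>], of "is" "is"] by (simp add: power2_norm_eq_inner)
 also have "\<dots> = (LBINT x:\<Omega>. (\<Sum>j\<in>UNIV. (iter_pd is \<phi> x $ j)^2))"
  by (simp add: inner_vec_def power2_eq_square)
 also have "\<dots> = (\<Sum>j\<in>UNIV. LBINT x:\<Omega>. (iter_pd is \<phi> x $ j)^2)"
  by (intro set_integral_\<Omega>_sum continuous_intros)
 also have "\<dots> = (\<Sum>j\<in>UNIV. LBINT x:cbox a b. (iter_pd is \<phi> x $ j)^2)"
 proof (intro sum.cong refl integral_\<Omega>_cbox)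
  show "(%x. (iter_pd is \<phi> x $ j)^2) \<in> borel_measurable borel" for j
   by (intro borel_measurable_continuous_onI continuous_intros)
  show "AE x in lborel. x \<in> cbox a b --> x \<notin> \<Omega> --> (iter_pd is \<phi> x $ j)^2 = 0" for j
   using D_outside[OF \<phi>, of "is"] by eventually_elim simp
 qed
 finally show ?thesis .
qed

lemma norm_gr:
 assumes \<phi>: "\<phi> \<in> D"
 shows "(norm (snd (gr \<phi>)))^2 = (\<Sum>i\<in>UNIV. (norm (cl (pd i \<phi>)))^2)"
 unfolding power2_norm_eq_inner by (simp add: gr_def inner_vec_def)

lemma norm_gr':
 assumes \<phi>: "\<phi> \<in> D"
 shows "(norm (snd (gr \<phi>)))^2 = (\<Sum>j\<in>UNIV. \<Sum>i\<in>UNIV. LBINT x:cbox a b. (pd i \<phi> x $ j)^2)"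
proof -
 have "(norm (cl (pd i \<phi>)))^2 = (\<Sum>j\<in>UNIV. LBINT x:cbox a b. (pd i \<phi> x $ j)^2)" for i
  using norm_cl_D[OF \<phi>, of "[i]"] by simp
 thus ?thesis unfolding norm_gr[OF \<phi>] by (simp only:) (rule sum.swap)
qed

lemma D_has_pd: "\<phi> \<in> D ==> has_pd i (%x. \<phi> x $ j) (%x. pd i \<phi> x $ j)"
 using smooth_has_pd[OF D_smooth, of \<phi> i "[]" j] by simp

text \<open>All components of a test field have mean 0, so the mean term of
  \<open>poincare_box\<close> drops out.\<close>

lemma poincare:
 obtains C where "C > 0" "!!x G. (x, G) \<in> Gam ==> (norm x)^2 <= C * (norm G)^2"
proof -
 define h where "h = (\<Sum>m\<in>UNIV. b $ m - a $ m)"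
 have h: "b $ m - a $ m <= h" for m
  unfolding h_def using ab by (intro member_le_sum) (auto simp: less_imp_le)
 define C where "C = 3 / 2 * h\<^sup>2"
 have h0: "h > 0" using h[of 1] ab[of 1] by simp
 have C: "C > 0" using h0 by (simp add: C_def)
 have "(norm x)^2 <= C * (norm G)^2" if xG: "(x, G) \<in> Gam" for x G
 proof -
  have "(norm (fst (x, G)))^2 <= C * (norm (snd (x, G)))^2"
  proof (rule Gam_induct[OF xG])
   show "closed {z::l2 \<times> (l2^3). (norm (fst z))^2 <= C * (norm (snd z))^2}" by (intro closed_Collect_le continuous_intros)
   fix \<phi> assume \<phi>: "\<phi> \<in> D"
   note [continuous_intros] = D_cont0[OF \<phi>]
   have [measurable]: "\<phi> \<in> borel_measurable borel" by (intro borel_measurable_continuous_onI D_cont0 \<phi>)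
   have m0: "(LBINT x:cbox a b. \<phi> x $ j) = 0" for j
   proof -
    have "(LBINT x:cbox a b. \<phi> x $ j) = (LBINT x:\<Omega>. \<phi> x $ j)"
    proof (rule integral_\<Omega>_cbox[symmetric])
     show "AE x in lborel. x \<in> cbox a b --> x \<notin> \<Omega> --> \<phi> x $ j = 0"
      using D_outside[OF \<phi>, of "[]"] by eventually_elim simp
    qed measurable
    also have "\<dots> = (LBINT x. (indicator \<Omega> x *\<^sub>R \<phi> x) $ j)" by (simp add: set_lebesgue_integral_def)
    also have "\<dots> = (LBINT x. indicator \<Omega> x *\<^sub>R \<phi> x) $ j"
    proof (rule integral_bounded_linear[OF bounded_linear_vec_nth])
     have "integrable lborel (%x. indicator (cbox a b) x *\<^sub>R \<phi> x)"
      by (rule borel_integrable_compact) (auto intro: continuous_on_subset[OF D_cont0[OF \<phi>]])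
     thus "integrable lborel (%x. indicator \<Omega> x *\<^sub>R \<phi> x)"
      by (rule Bochner_Integration.integrable_bound) (use \<Omega>_cbox in \<open>auto split: split_indicator\<close>)
    qed
    also have "\<dots> = 0" using D_mean[OF \<phi>] by (simp add: set_lebesgue_integral_def)
    finally show ?thesis .
   qed
   have "(norm (cl \<phi>))^2 = (\<Sum>j\<in>UNIV. LBINT x:cbox a b. (\<phi> x $ j)^2)"
    using norm_cl_D[OF \<phi>, of "[]"] by simp
   also have "\<dots> <= (\<Sum>j\<in>UNIV. C * (\<Sum>i\<in>UNIV. LBINT x:cbox a b. (pd i \<phi> x $ j)^2))"
   proof (rule sum_mono)
    fix j
    show "(LBINT x:cbox a b. (\<phi> x $ j)^2) <= C * (\<Sum>i\<in>UNIV. LBINT x:cbox a b. (pd i \<phi> x $ j)^2)"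
     using poincare_box[OF D_has_pd[OF \<phi>] less_imp_le[OF ab] h, of j] by (simp add: m0 C_def)
   qed
   also have "\<dots> = C * (norm (snd (gr \<phi>)))^2" unfolding norm_gr'[OF \<phi>] by (simp add: sum_distrib_left)
   finally show "(norm (fst (gr \<phi>)))^2 <= C * (norm (snd (gr \<phi>)))^2" by (simp add: gr_def)
  qed
  thus ?thesis by simp
 qed
 thus ?thesis using that C by blast
qed

text \<open>The compact embedding of \<open>V\<close> into \<open>H\<close> in quantitative form: up
  to a small multiple of the gradient, finitely many functionals control the norm.\<close>

lemma friedrichs:
 assumes "\<delta> > 0"
 obtains I :: "((real^3) set \<times> 3) set" and e where "finite I"
  "!!x G. (x, G) \<in> Gam ==> (norm x)^2 <= (\<Sum>k\<in>I. (x \<bullet> e k)^2) + \<delta> * (norm G)^2"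
proof -
 obtain K where K: "finite K" "!!k. k \<in> K ==> \<exists>u v. k = cbox u v \<and> k \<subseteq> cbox a b"
  "!!g g'. (!!i. has_pd i g (g' i)) ==> (LBINT x:cbox a b. (g x)^2) \<le>
    (\<Sum>k\<in>K. (LBINT x:k. g x)^2 / measure lborel k) + \<delta> * (\<Sum>i\<in>UNIV. LBINT x:cbox a b. (g' i x)^2)"
  using friedrichs_box[OF assms, of a b] by blast
 \<comment> \<open>Division by the root of the volume turns the square of the functional into the
   squared integral over the volume of the cell; both are 0 for a degenerate cell.\<close>
 define e where "e = (%(k, j). (1 / sqrt (measure lborel k)) *\<^sub>R abs_l2 (%x. indicator k x *\<^sub>R axis (j::3) 1))"
 have main: "(norm x)^2 <= (\<Sum>k\<in>K \<times> UNIV. (x \<bullet> e k)^2) + \<delta> * (norm G)^2" if xG: "(x, G) \<in> Gam" for x G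
 proof -
  have "(norm (fst (x, G)))^2 <= (\<Sum>k\<in>K \<times> UNIV. (fst (x, G) \<bullet> e k)^2) + \<delta> * (norm (snd (x, G)))^2"
  proof (rule Gam_induct[OF xG])
   show "closed {z::l2 \<times> (l2^3). (norm (fst z))^2 <= (\<Sum>k\<in>K \<times> UNIV. (fst z \<bullet> e k)^2) + \<delta> * (norm (snd z))^2}"
    by (intro closed_Collect_le continuous_intros)
   fix \<phi> assume \<phi>: "\<phi> \<in> D"
   have [measurable]: "\<phi> \<in> borel_measurable borel" by (intro borel_measurable_continuous_onI D_cont0 \<phi>)
   have ek: "(cl \<phi> \<bullet> e (k, j))^2 = (LBINT x:k. \<phi> x $ j)^2 / measure lborel k" if k: "k \<in> K" for k j
   proof -
    obtain u v where uv: "k = cbox u v" "k \<subseteq> cbox a b" using K(2)[OF k] by blast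
    have l2: "l2fun (%x. indicator k x *\<^sub>R axis j 1)" unfolding uv by (rule l2fun_indicator_finite[OF _ emeasure_bounded_finite[OF bounded_cbox]]) simp
    have "cl \<phi> \<bullet> abs_l2 (%x. indicator k x *\<^sub>R axis j 1) = (LBINT x. cut \<phi> x \<bullet> (indicator k x *\<^sub>R axis j 1))"
     unfolding cl_def by (rule inner_abs_l2[OF L2\<Omega>_cut[OF L2\<Omega>_D0[OF \<phi>]] l2])
    also have "\<dots> = (LBINT x:k. \<phi> x $ j)"
     unfolding set_lebesgue_integral_def
    proof (rule integral_cong_AE)
     show "AE x in lborel. cut \<phi> x \<bullet> (indicat_real k x *\<^sub>R axis j 1) = indicat_real k x *\<^sub>R \<phi> x $ j"
      using D_outside[OF \<phi>, of "[]"] by eventually_elim (use uv in \<open>auto simp: cut_def inner_axis split: split_indicator\<close>)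
    qed (auto simp: uv cut_def)
    finally have "(cl \<phi> \<bullet> e (k, j)) = (LBINT x:k. \<phi> x $ j) / sqrt (measure lborel k)" by (simp add: e_def)
    thus ?thesis by (simp add: power_divide)
   qed
   have "(norm (cl \<phi>))^2 = (\<Sum>j\<in>UNIV. LBINT x:cbox a b. (\<phi> x $ j)^2)"
    using norm_cl_D[OF \<phi>, of "[]"] by simp
   also have "\<dots> <= (\<Sum>j\<in>UNIV. (\<Sum>k\<in>K. (LBINT x:k. \<phi> x $ j)^2 / measure lborel k) + \<delta> * (\<Sum>i\<in>UNIV. LBINT x:cbox a b. (pd i \<phi> x $ j)^2))"
    by (intro sum_mono K(3) D_has_pd \<phi>)
   also have "\<dots> = (\<Sum>j\<in>UNIV. \<Sum>k\<in>K. (cl \<phi> \<bullet> e (k, j))^2) + \<delta> * (norm (snd (gr \<phi>)))^2"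
    unfolding norm_gr'[OF \<phi>] sum.distrib sum_distrib_left by (simp add: ek)
   also have "(\<Sum>j\<in>UNIV. \<Sum>k\<in>K. (cl \<phi> \<bullet> e (k, j))^2) = (\<Sum>k\<in>K \<times> UNIV. (cl \<phi> \<bullet> e k)^2)"
    by (subst sum.swap) (simp add: sum.cartesian_product)
   finally show "(norm (fst (gr \<phi>)))^2 <= (\<Sum>k\<in>K \<times> UNIV. (fst (gr \<phi>) \<bullet> e k)^2) + \<delta> * (norm (snd (gr \<phi>)))^2" by (simp add: gr_def)
  qed
  thus ?thesis by simp
 qed
 show ?thesis by (rule that[of "K \<times> UNIV" e], use K(1) in simp, rule main)
qed

text \<open>Gagliardo-Nirenberg for the fourth power of the length of \<open>\<phi>\<close>. With
  \<open>X\<close> the integral of the sixth power it leads to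
  \<open>X^2 <= (sqrt X * (\<kappa> * N))^3\<close>, and the finite number \<open>X\<close> can be
  divided out.\<close>

lemma sobolev_D:
 obtains K where "K \<ge> 0" "!!\<phi>. \<phi> \<in> D ==> (LBINT x:cbox a b. (\<phi> x \<bullet> \<phi> x) ^ 3) <= K * norm (snd (gr \<phi>)) ^ 6"
proof -
 obtain C where C: "C > 0" "!!x G. (x, G) \<in> Gam ==> (norm x)^2 <= C * (norm G)^2" using poincare by blast
 \<comment> \<open>The quotients come from the average along a line, through the Poincare constant
   \<open>C\<close>; the 4 comes from differentiating a fourth power.\<close>
 define \<kappa> where "\<kappa> = (\<Sum>i\<in>UNIV. sqrt C / (b $ i - a $ i)) + 4"
 have ki: "sqrt C / (b $ i - a $ i) + 4 <= \<kappa>" for i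
  unfolding \<kappa>_def using ab C by (intro add_right_mono member_le_sum) (auto simp: less_imp_le)
 have k0: "\<kappa> \<ge> 0" using ki[of 1] ab[of 1] C(1) by (smt (verit) divide_nonneg_pos real_sqrt_ge_zero)
 have "(LBINT x:cbox a b. (\<phi> x \<bullet> \<phi> x) ^ 3) <= \<kappa> ^ 6 * norm (snd (gr \<phi>)) ^ 6" if \<phi>: "\<phi> \<in> D" for \<phi>
 proof -
  note [continuous_intros] = D_cont0[OF \<phi>] D_cont1[OF \<phi>]
  define n where "n x = \<phi> x \<bullet> \<phi> x" for x
  define n' where "n' i x = 2 * (\<phi> x \<bullet> pd i \<phi> x)" for i x
  define N where "N = norm (snd (gr \<phi>))"
  have n0: "n x \<ge> 0" for x by (simp add: n_def)
  have cn[continuous_intros]: "continuous_on UNIV n" "continuous_on UNIV (n' i)" for i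
   unfolding n_def n'_def by (intro continuous_intros)+
  have pn: "has_pd i n (n' i)" for i
  proof -
   have "has_pd i (%x. \<Sum>j\<in>UNIV. \<phi> x $ j * \<phi> x $ j) (%x. \<Sum>j\<in>UNIV. pd i \<phi> x $ j * \<phi> x $ j + \<phi> x $ j * pd i \<phi> x $ j)"
    by (intro has_pd_sum has_pd_mult D_has_pd \<phi>)
   moreover have "(%x. \<Sum>j\<in>UNIV. \<phi> x $ j * \<phi> x $ j) = n" by (simp add: n_def inner_vec_def fun_eq_iff)
   moreover have "(%x. \<Sum>j\<in>UNIV. pd i \<phi> x $ j * \<phi> x $ j + \<phi> x $ j * pd i \<phi> x $ j) = n' i"
    by (simp add: n'_def inner_vec_def fun_eq_iff sum_distrib_left mult.commute)
   ultimately show ?thesis by (simp only:)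
  qed
  \<comment> \<open>The fourth power of the length, to be paired with \<open>v = n^3\<close>, the
    sixth power: then \<open>v^2 = w^3\<close>.\<close>
  define w where "w x = n x * n x" for x
  define w' where "w' i x = n' i x * n x + n x * n' i x" for i x
  have pw: "has_pd i w (w' i)" for i unfolding w_def w'_def by (intro has_pd_mult pn)
  define X where "X = (LBINT x:cbox a b. n x ^ 3)"
  have X0: "X \<ge> 0" unfolding X_def set_lebesgue_integral_def using n0 by (intro Bochner_Integration.integral_nonneg) auto
  have cw[continuous_intros]: "continuous_on UNIV w" "continuous_on UNIV (w' i)" for i
   unfolding w_def w'_def by (intro continuous_intros)+
  have phiN: "norm (cl \<phi>) <= sqrt C * N"
  proof (rule power2_le_imp_le)
   show "(norm (cl \<phi>))^2 <= (sqrt C * N)^2"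
    using C(2)[of "cl \<phi>" "snd (gr \<phi>)"] gr_Gam[OF \<phi>] C(1) by (simp add: gr_def power_mult_distrib N_def)
  qed (use C N_def in auto)
  have dN: "norm (cl (pd i \<phi>)) <= N" for i
  proof (rule power2_le_imp_le)
   show "(norm (cl (pd i \<phi>)))^2 <= N\<^sup>2" unfolding N_def norm_gr[OF \<phi>] by (rule member_le_sum) auto
  qed (simp add: N_def)
  have In: "(LBINT x:cbox a b. n x) = (norm (cl \<phi>))^2"
  proof -
   have "(LBINT x:cbox a b. n x) = (LBINT x:\<Omega>. n x)"
   proof (rule integral_\<Omega>_cbox[symmetric])
    show "AE x in lborel. x \<in> cbox a b --> x \<notin> \<Omega> --> n x = 0"
     using D_outside[OF \<phi>, of "[]"] by eventually_elim (simp add: n_def)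
   qed (intro borel_measurable_continuous_onI continuous_intros)
   thus ?thesis using cl_inner[OF L2\<Omega>_D0[OF \<phi>] L2\<Omega>_D0[OF \<phi>]] by (simp add: n_def power2_norm_eq_inner)
  qed
  have Id: "(LBINT x:cbox a b. pd i \<phi> x \<bullet> pd i \<phi> x) = (norm (cl (pd i \<phi>)))^2" for i
  proof -
   have "(LBINT x:cbox a b. pd i \<phi> x \<bullet> pd i \<phi> x) = (LBINT x:\<Omega>. pd i \<phi> x \<bullet> pd i \<phi> x)"
   proof (rule integral_\<Omega>_cbox[symmetric])
    show "AE x in lborel. x \<in> cbox a b --> x \<notin> \<Omega> --> pd i \<phi> x \<bullet> pd i \<phi> x = 0"
     using D_outside[OF \<phi>, of "[i]"] by eventually_elim simp
   qed (intro borel_measurable_continuous_onI continuous_intros)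
   thus ?thesis using cl_inner[OF L2\<Omega>_D1[OF \<phi>] L2\<Omega>_D1[OF \<phi>]] by (simp add: power2_norm_eq_inner)
  qed
  have W: "(LBINT x:cbox a b. w x) <= sqrt X * (sqrt C * N)"
  proof -
   have "(LBINT x:cbox a b. w x)^2 <= X * (LBINT x:cbox a b. n x)"
    unfolding X_def by (rule Cauchy_Schwarz_cbox) (auto intro!: continuous_intros simp: w_def n0 power2_eq_square power3_eq_cube mult_ac)
   also have "\<dots> <= X * (sqrt C * N)^2" unfolding In using phiN X0 by (intro mult_left_mono power_mono) auto
   also have "\<dots> = (sqrt X * (sqrt C * N))^2" using X0 by (simp add: power_mult_distrib)
   finally show ?thesis by (rule power2_le_imp_le) (use X0 C(1) in \<open>simp add: N_def\<close>)
  qed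
  have W': "(LBINT x:cbox a b. \<bar>w' i x\<bar>) <= sqrt X * (4 * N)" for i
  proof -
   have "(LBINT x:cbox a b. \<bar>w' i x\<bar>)^2 <= X * (LBINT x:cbox a b. 16 * (pd i \<phi> x \<bullet> pd i \<phi> x))"
    unfolding X_def
   proof (rule Cauchy_Schwarz_cbox)
    fix x
    have "(\<phi> x \<bullet> pd i \<phi> x)^2 <= n x * (pd i \<phi> x \<bullet> pd i \<phi> x)" unfolding n_def by (rule Cauchy_Schwarz_ineq)
    hence "(16 * (n x)^2) * (\<phi> x \<bullet> pd i \<phi> x)^2 <= (16 * (n x)^2) * (n x * (pd i \<phi> x \<bullet> pd i \<phi> x))"
     by (intro mult_left_mono) auto
    thus "\<bar>w' i x\<bar>\<^sup>2 <= n x ^ 3 * (16 * (pd i \<phi> x \<bullet> pd i \<phi> x))"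
     by (simp add: w'_def n'_def power2_eq_square power3_eq_cube mult_ac)
   qed (auto intro!: continuous_intros simp: n0)
   also have "(LBINT x:cbox a b. 16 * (pd i \<phi> x \<bullet> pd i \<phi> x)) = 16 * (norm (cl (pd i \<phi>)))^2" by (simp add: Id)
   also have "X * (16 * (norm (cl (pd i \<phi>)))^2) <= X * (16 * N\<^sup>2)" using dN X0 by (intro mult_left_mono power_mono) auto
   also have "\<dots> = (sqrt X * (4 * N))^2" using X0 by (simp add: power_mult_distrib)
   finally show ?thesis by (rule power2_le_imp_le) (use X0 in \<open>simp add: N_def\<close>)
  qed
  have fac: "(LBINT x:cbox a b. w x / (b $ i - a $ i) + \<bar>w' i x\<bar>) <= sqrt X * (\<kappa> * N)" for i
  proof -
   have "(LBINT x:cbox a b. w x / (b $ i - a $ i) + \<bar>w' i x\<bar>) = (LBINT x:cbox a b. w x) / (b $ i - a $ i) + (LBINT x:cbox a b. \<bar>w' i x\<bar>)"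
    using ab[of i] by (subst set_integral_add(2)) (auto intro!: set_integrable_cbox continuous_intros)
   also have "\<dots> <= sqrt X * (sqrt C * N) / (b $ i - a $ i) + sqrt X * (4 * N)"
    using W W'[of i] ab[of i] by (intro add_mono divide_right_mono) auto
   also have "\<dots> = sqrt X * ((sqrt C / (b $ i - a $ i) + 4) * N)" using ab[of i] by (simp add: field_simps)
   also have "\<dots> <= sqrt X * (\<kappa> * N)" using ki[of i] X0 by (intro mult_left_mono mult_right_mono) (auto simp: N_def)
   finally show ?thesis .
  qed
  have "X\<^sup>2 <= (\<Prod>i\<in>UNIV. LBINT x:cbox a b. w x / (b $ i - a $ i) + \<bar>w' i x\<bar>)"
   unfolding X_def
   by (rule gagliardo_nirenberg_box[OF pw ab]) (auto intro!: continuous_intros simp: w_def n0 power2_eq_square power3_eq_cube)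
  also have "\<dots> <= (\<Prod>i\<in>(UNIV::3 set). sqrt X * (\<kappa> * N))"
  proof (rule prod_mono, intro conjI fac)
   show "0 <= (LBINT x:cbox a b. w x / (b $ i - a $ i) + \<bar>w' i x\<bar>)" for i
    unfolding set_lebesgue_integral_def using ab[of i] n0
    by (intro Bochner_Integration.integral_nonneg scaleR_nonneg_nonneg add_nonneg_nonneg divide_nonneg_nonneg) (auto simp: w_def)
  qed
  also have "\<dots> = (sqrt X * (\<kappa> * N)) ^ 3" by simp
  finally have X4: "X\<^sup>2 <= (sqrt X * (\<kappa> * N)) ^ 3" .
  have "X <= \<kappa> ^ 6 * N ^ 6"
  proof (cases "X = 0")
   case False
   define r where "r = sqrt X"
   have r: "r > 0" "X = r\<^sup>2" using False X0 by (auto simp: r_def)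
   have "r ^ 3 * r <= r ^ 3 * (\<kappa> * N) ^ 3" using X4 r by (simp add: r_def[symmetric] power_mult_distrib eval_nat_numeral mult_ac)
   hence "r <= (\<kappa> * N) ^ 3" using r(1) by simp
   hence "r\<^sup>2 <= ((\<kappa> * N) ^ 3)^2" using r(1) by (intro power_mono) auto
   thus ?thesis using r(2) by (simp add: power_mult_distrib flip: power_mult)
  qed (use k0 in \<open>simp add: N_def\<close>)
  thus ?thesis by (simp add: X_def n_def N_def)
 qed
 thus ?thesis using that[of "\<kappa> ^ 6"] k0 by simp
qed

end

lemma ennreal_sq_eq_mult: "0 <= u ==> 0 <= f ==> 0 <= g ==> u\<^sup>2 = f * g ==> (ennreal u)^2 = ennreal f * ennreal g"
 by (simp add: ennreal_power flip: ennreal_mult)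

context flow_domain
begin

text \<open>Fatou along a subsequence of approximating test fields that converges almost
  everywhere.\<close>

lemma sobolev:
 obtains K where "K \<ge> 0" "!!x G. (x, G) \<in> Gam ==> (\<integral>\<^sup>+t. ennreal (norm (rep_l2 x t) ^ 6) \<partial>lborel) <= ennreal (K * norm G ^ 6)"
proof -
 obtain K where K: "K \<ge> 0" "!!\<phi>. \<phi> \<in> D ==> (LBINT x:cbox a b. (\<phi> x \<bullet> \<phi> x) ^ 3) <= K * norm (snd (gr \<phi>)) ^ 6"
  using sobolev_D by blast
 have "(\<integral>\<^sup>+t. ennreal (norm (rep_l2 x t) ^ 6) \<partial>lborel) <= ennreal (K * norm G ^ 6)" if xG: "(x, G) \<in> Gam" for x G
 proof -
  obtain \<phi> where \<phi>: "!!n. \<phi> n \<in> D" "(%n. gr (\<phi> n)) ----> (x, G)" using Gam_seq[OF xG] by blast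
  have 1: "(%n. cl (\<phi> n)) ----> x" using tendsto_fst[OF \<phi>(2)] by (simp add: gr_def)
  have 2: "(%n. snd (gr (\<phi> n))) ----> G" using tendsto_snd[OF \<phi>(2)] by simp
  obtain r where r: "strict_mono (r::nat=>nat)" "AE t in lborel. (%k. rep_l2 (cl (\<phi> (r k))) t) ----> rep_l2 x t"
   using l2_AE_subseq[OF 1] by blast
  have D6: "(\<integral>\<^sup>+t. ennreal (norm (rep_l2 (cl \<psi>) t) ^ 6) \<partial>lborel) <= ennreal (K * norm (snd (gr \<psi>)) ^ 6)" if \<psi>: "\<psi> \<in> D" for \<psi>
  proof -
   note [continuous_intros] = D_cont0[OF \<psi>]
   have "(\<integral>\<^sup>+t. ennreal (norm (rep_l2 (cl \<psi>) t) ^ 6) \<partial>lborel) = (\<integral>\<^sup>+t. ennreal (norm (cut \<psi> t) ^ 6) \<partial>lborel)"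
    unfolding cl_def by (intro nn_integral_cong_AE eventually_mono[OF rep_abs_l2[OF L2\<Omega>_cut[OF L2\<Omega>_D0[OF \<psi>]]]]) simp
   also have "\<dots> <= (\<integral>\<^sup>+t. ennreal ((\<psi> t \<bullet> \<psi> t) ^ 3) * indicator (cbox a b) t \<partial>lborel)"
   proof (rule nn_integral_mono)
    fix t
    have "norm (\<psi> t) ^ 6 = (\<psi> t \<bullet> \<psi> t) ^ 3" by (simp add: power2_norm_eq_inner[symmetric] flip: power_mult)
    thus "ennreal (norm (cut \<psi> t) ^ 6) <= ennreal ((\<psi> t \<bullet> \<psi> t) ^ 3) * indicator (cbox a b) t"
     using \<Omega>_cbox by (auto simp: cut_def split: split_indicator)
   qed
   also have "\<dots> = ennreal (LBINT t:cbox a b. (\<psi> t \<bullet> \<psi> t) ^ 3)"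
    by (rule nn_integral_cbox) (auto intro!: continuous_intros)
   also have "\<dots> <= ennreal (K * norm (snd (gr \<psi>)) ^ 6)" by (intro ennreal_leI K(2) \<psi>)
   finally show ?thesis .
  qed
  have "(\<integral>\<^sup>+t. ennreal (norm (rep_l2 x t) ^ 6) \<partial>lborel) = (\<integral>\<^sup>+t. liminf (%k. ennreal (norm (rep_l2 (cl (\<phi> (r k))) t) ^ 6)) \<partial>lborel)"
  proof (rule nn_integral_cong_AE)
   show "AE t in lborel. ennreal (norm (rep_l2 x t) ^ 6) = liminf (%k. ennreal (norm (rep_l2 (cl (\<phi> (r k))) t) ^ 6))"
    using r(2)
   proof eventually_elim
    case (elim t)
    hence "(%k. ennreal (norm (rep_l2 (cl (\<phi> (r k))) t) ^ 6)) ----> ennreal (norm (rep_l2 x t) ^ 6)"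
     by (intro tendsto_ennrealI tendsto_intros)
    thus ?case by (metis lim_imp_Liminf sequentially_bot)
   qed
  qed
  also have "\<dots> <= liminf (%k. \<integral>\<^sup>+t. ennreal (norm (rep_l2 (cl (\<phi> (r k))) t) ^ 6) \<partial>lborel)"
   by (intro nn_integral_liminf) simp
  also have "\<dots> <= liminf (%k. ennreal (K * norm (snd (gr (\<phi> (r k)))) ^ 6))"
   by (intro Liminf_mono always_eventually allI D6 \<phi>)
  also have "\<dots> = ennreal (K * norm G ^ 6)"
  proof -
   have "(%k. ennreal (K * norm (snd (gr (\<phi> (r k)))) ^ 6)) ----> ennreal (K * norm G ^ 6)"
    using LIMSEQ_subseq_LIMSEQ[OF 2 r(1)] by (intro tendsto_ennrealI tendsto_intros) (simp add: o_def)
   thus ?thesis by (metis lim_imp_Liminf sequentially_bot)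
  qed
  finally show ?thesis .
 qed
 thus ?thesis using that K(1) by blast
qed

text \<open>Interpolation by Cauchy-Schwarz alone: \<open>P^2 <= R * Y\<close> and
  \<open>R^2 <= P * X\<close> give \<open>P^3 <= X * Y^2\<close>, and two further applications bring
  in \<open>x\<close> and \<open>g\<close>. After the square root, \<open>x\<close> and its gradient
  enter with power 1/2 each, which is what makes the time derivative integrable to the power
  4/3.\<close>

lemma trilinear_nn_bound:
 obtains K where "K \<ge> 0"
  "!!x G y H g. (x, G) \<in> Gam ==> (y, H) \<in> Gam ==>
    (\<integral>\<^sup>+t. ennreal (norm (rep_l2 x t) * norm (rep_l2 y t) * norm (rep_l2 g t)) \<partial>lborel)^2 <= ennreal (K * norm x * norm G * (norm H)^2 * (norm g)^2)"
proof -
 obtain k where k: "k \<ge> 0" "!!x G. (x, G) \<in> Gam ==> (\<integral>\<^sup>+t. ennreal (norm (rep_l2 x t) ^ 6) \<partial>lborel) <= ennreal (k * norm G ^ 6)"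
  using sobolev by blast
 have "(\<integral>\<^sup>+t. ennreal (norm (rep_l2 x t) * norm (rep_l2 y t) * norm (rep_l2 g t)) \<partial>lborel)^2 <= ennreal (sqrt k * norm x * norm G * (norm H)^2 * (norm g)^2)"
  if xG: "(x, G) \<in> Gam" and yH: "(y, H) \<in> Gam" for x G y H g
 proof -
  define A where "A t = norm (rep_l2 x t)" for t
  define B where "B t = norm (rep_l2 y t)" for t
  have [measurable]: "A \<in> borel_measurable borel" "B \<in> borel_measurable borel" unfolding A_def B_def by measurable
  have AB[simp]: "A t \<ge> 0" "B t \<ge> 0" for t by (auto simp: A_def B_def)
  define P where "P = (\<integral>\<^sup>+t. ennreal (A t ^ 2 * B t ^ 4) \<partial>lborel)"
  define R where "R = (\<integral>\<^sup>+t. ennreal (A t ^ 4 * B t ^ 2) \<partial>lborel)"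
  define X where "X = (\<integral>\<^sup>+t. ennreal (A t ^ 6) \<partial>lborel)"
  define Y where "Y = (\<integral>\<^sup>+t. ennreal (B t ^ 6) \<partial>lborel)"
  have XY: "X <= ennreal (k * norm G ^ 6)" "Y <= ennreal (k * norm H ^ 6)"
   unfolding X_def Y_def A_def B_def using k(2) xG yH by auto
  have PR: "P\<^sup>2 <= R * Y" unfolding P_def R_def Y_def
   by (rule nn_integral_Cauchy_Schwarz_pointwise, measurable, rule eq_refl, rule ennreal_sq_eq_mult) (simp_all add: eval_nat_numeral mult_ac)
  have RP: "R\<^sup>2 <= P * X" unfolding P_def R_def X_def
   by (rule nn_integral_Cauchy_Schwarz_pointwise, measurable, rule eq_refl, rule ennreal_sq_eq_mult) (simp_all add: eval_nat_numeral mult_ac)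
  \<comment> \<open>Provides finiteness of \<open>P\<close> and \<open>R\<close>, without which
    \<open>p\<close> could not be divided out below.\<close>
  have le6: "A t ^ 2 * B t ^ 4 <= A t ^ 6 + B t ^ 6" "A t ^ 4 * B t ^ 2 <= A t ^ 6 + B t ^ 6" for t
  proof -
   have "A t ^ m * B t ^ n <= A t ^ 6 + B t ^ 6" if "m + n = 6" for m n
   proof (cases "A t <= B t")
    case True
    have "A t ^ m * B t ^ n <= B t ^ m * B t ^ n" using True by (intro mult_right_mono power_mono) auto
    also have "\<dots> = B t ^ 6" using that by (simp flip: power_add)
    finally show ?thesis using zero_le_power[OF AB(1), of t 6] by linarith
   next
    case False
    have "A t ^ m * B t ^ n <= A t ^ m * A t ^ n" using False by (intro mult_left_mono power_mono) auto
    also have "\<dots> = A t ^ 6" using that by (simp flip: power_add)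
    finally show ?thesis using zero_le_power[OF AB(2), of t 6] by linarith
   qed
   thus "A t ^ 2 * B t ^ 4 <= A t ^ 6 + B t ^ 6" "A t ^ 4 * B t ^ 2 <= A t ^ 6 + B t ^ 6" by auto
  qed
  have fin: "X + Y < \<infinity>"
  proof -
   have "X + Y <= ennreal (k * norm G ^ 6) + ennreal (k * norm H ^ 6)" by (rule add_mono[OF XY])
   also have "\<dots> < \<infinity>" by simp
   finally show ?thesis .
  qed
  have "P <= X + Y" "R <= X + Y"
   unfolding P_def R_def X_def Y_def using le6
   by (subst nn_integral_add[symmetric]; auto simp flip: ennreal_plus intro!: nn_integral_mono ennreal_leI)+
  hence "P < \<infinity>" "R < \<infinity>" using fin le_less_trans by blast+
  then obtain p r where pr: "P = ennreal p" "p \<ge> 0" "R = ennreal r" "r \<ge> 0"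
   by (metis ennreal_cases infinity_ennreal_def less_irrefl)
  define X' where "X' = k * norm G ^ 6"
  define Y' where "Y' = k * norm H ^ 6"
  have XY0: "X' \<ge> 0" "Y' \<ge> 0" using k(1) by (auto simp: X'_def Y'_def)
  have pr1: "p\<^sup>2 <= r * Y'"
  proof -
   have "P\<^sup>2 <= R * ennreal Y'" using PR mult_left_mono[OF XY(2), of R] unfolding Y'_def by (rule order_trans) simp
   thus ?thesis using pr XY0 by (simp add: ennreal_power flip: ennreal_mult)
  qed
  have pr2: "r\<^sup>2 <= p * X'"
  proof -
   have "R\<^sup>2 <= P * ennreal X'" using RP mult_left_mono[OF XY(1), of P] unfolding X'_def by (rule order_trans) simp
   thus ?thesis using pr XY0 by (simp add: ennreal_power flip: ennreal_mult)
  qed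
  have p: "p <= k * ((norm G)^2 * norm H ^ 4)"
  proof (cases "p = 0")
   case False
   have "(p\<^sup>2)^2 <= (r * Y')^2" using pr1 by (intro power_mono) auto
   also have "\<dots> = r\<^sup>2 * Y'\<^sup>2" by (simp add: power_mult_distrib)
   also have "\<dots> <= (p * X') * Y'\<^sup>2" using pr2 by (intro mult_right_mono) auto
   finally have "p * p ^ 3 <= p * (X' * Y'\<^sup>2)" by (simp add: eval_nat_numeral mult_ac)
   hence "p ^ 3 <= X' * Y'\<^sup>2" using False pr(2) by simp
   also have "\<dots> = (k * ((norm G)^2 * norm H ^ 4)) ^ 3"
    by (simp add: X'_def Y'_def eval_nat_numeral mult_ac)
   finally show ?thesis by (rule power_le_imp_le_base[of p 2, simplified]) (use k(1) in \<open>auto simp: numeral_3_eq_3\<close>)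
  qed (use k(1) in simp)
  define S where "S = (\<integral>\<^sup>+t. ennreal (A t ^ 2 * B t ^ 2) \<partial>lborel)"
  have S2: "S\<^sup>2 <= (\<integral>\<^sup>+t. ennreal (A t ^ 2) \<partial>lborel) * P" unfolding P_def S_def
   by (rule nn_integral_Cauchy_Schwarz_pointwise, measurable, rule eq_refl, rule ennreal_sq_eq_mult) (simp_all add: eval_nat_numeral mult_ac)
  have "S\<^sup>2 <= ennreal ((sqrt k * norm x * norm G * (norm H)^2)^2)"
  proof -
   have "(\<integral>\<^sup>+t. ennreal (A t ^ 2) \<partial>lborel) = ennreal ((norm x)^2)"
    unfolding A_def using nn_integral_l2[OF l2fun_rep[of x]] by simp
   hence "S\<^sup>2 <= ennreal ((norm x)^2) * ennreal p" using S2 pr by simp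
   also have "\<dots> = ennreal ((norm x)^2 * p)" using pr by (simp add: ennreal_mult)
   also have "\<dots> <= ennreal ((norm x)^2 * (k * ((norm G)^2 * norm H ^ 4)))" using p by (intro ennreal_leI mult_left_mono) auto
   also have "(norm x)^2 * (k * ((norm G)^2 * norm H ^ 4)) = (sqrt k * norm x * norm G * (norm H)^2)^2"
    using k(1) by (simp add: power_mult_distrib flip: power_mult)
   finally show ?thesis .
  qed
  hence S: "S <= ennreal (sqrt k * norm x * norm G * (norm H)^2)"
  proof (cases S)
   case (real s)
   assume "S\<^sup>2 <= ennreal ((sqrt k * norm x * norm G * (norm H)^2)^2)"
   hence "s\<^sup>2 <= (sqrt k * norm x * norm G * (norm H)^2)^2" using real by (simp add: ennreal_power)
   hence "s <= sqrt k * norm x * norm G * (norm H)^2" by (rule power2_le_imp_le) (use k(1) in simp)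
   thus ?thesis using real by (simp add: ennreal_leI)
  qed (auto simp: power2_eq_square top_unique)
  have "(\<integral>\<^sup>+t. ennreal (A t * B t * norm (rep_l2 g t)) \<partial>lborel)^2 <= S * (\<integral>\<^sup>+t. ennreal ((norm (rep_l2 g t))^2) \<partial>lborel)"
   unfolding S_def by (rule nn_integral_Cauchy_Schwarz_pointwise, measurable, rule eq_refl, rule ennreal_sq_eq_mult) (simp_all add: eval_nat_numeral mult_ac)
  also have "(\<integral>\<^sup>+t. ennreal ((norm (rep_l2 g t))^2) \<partial>lborel) = ennreal ((norm g)^2)"
   using nn_integral_l2[OF l2fun_rep[of g]] by simp
  also have "S * ennreal ((norm g)^2) <= ennreal (sqrt k * norm x * norm G * (norm H)^2) * ennreal ((norm g)^2)"
   using S by (rule mult_right_mono) simp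
  also have "\<dots> = ennreal (sqrt k * norm x * norm G * (norm H)^2 * (norm g)^2)" using k(1) by (simp add: ennreal_mult)
  finally show ?thesis unfolding A_def B_def .
 qed
 thus ?thesis using that[of "sqrt k"] k(1) by simp
qed

section \<open>The trilinear form with test classes in V\<close>

text \<open>Extends \<open>Tri\<close> from smooth test fields to test classes in \<open>V\<close>,
  where convergence of the integral rests on the Sobolev bound.\<close>

definition tri :: "l2 => l2^3 => l2 => real" where
 "tri x G y = (\<Sum>i\<in>UNIV. \<integral>t. rep_l2 x t $ i * (rep_l2 (G $ i) t \<bullet> rep_l2 y t) \<partial>lborel)"

lemma tri_integrable:
 assumes "x \<in> VV" "y \<in> VV"
 shows "integrable lborel (%t. rep_l2 x t $ i * (rep_l2 g t \<bullet> rep_l2 y t))"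
proof -
 obtain K where K: "K \<ge> 0"
  "!!x G y H g. (x, G) \<in> Gam ==> (y, H) \<in> Gam ==>
    (\<integral>\<^sup>+t. ennreal (norm (rep_l2 x t) * norm (rep_l2 y t) * norm (rep_l2 g t)) \<partial>lborel)^2 <= ennreal (K * norm x * norm G * (norm H)^2 * (norm g)^2)"
  using trilinear_nn_bound by blast
 have "(\<integral>\<^sup>+t. ennreal (norm (rep_l2 x t) * norm (rep_l2 y t) * norm (rep_l2 g t)) \<partial>lborel)^2 < \<infinity>"
  using K(2)[OF grad_Gam[OF assms(1)] grad_Gam[OF assms(2)], of g] by (auto intro: le_less_trans)
 hence fin: "(\<integral>\<^sup>+t. ennreal (norm (rep_l2 x t) * norm (rep_l2 y t) * norm (rep_l2 g t)) \<partial>lborel) < \<infinity>"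
  by (auto simp: power2_eq_square ennreal_mult_less_top less_top)
 have "integrable lborel (%t. norm (rep_l2 x t) * norm (rep_l2 y t) * norm (rep_l2 g t))"
  using fin by (intro integrableI_bounded) auto
 thus ?thesis
 proof (rule Bochner_Integration.integrable_bound)
  show "AE t in lborel. norm (rep_l2 x t $ i * (rep_l2 g t \<bullet> rep_l2 y t)) <= norm (norm (rep_l2 x t) * norm (rep_l2 y t) * norm (rep_l2 g t))"
  proof (rule AE_I2)
   fix t
   have "\<bar>rep_l2 x t $ i\<bar> * \<bar>rep_l2 g t \<bullet> rep_l2 y t\<bar> <= norm (rep_l2 x t) * (norm (rep_l2 g t) * norm (rep_l2 y t))"
    by (intro mult_mono component_le_norm_cart Cauchy_Schwarz_ineq2) auto
   thus "norm (rep_l2 x t $ i * (rep_l2 g t \<bullet> rep_l2 y t)) <= norm (norm (rep_l2 x t) * norm (rep_l2 y t) * norm (rep_l2 g t))"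
    by (simp add: abs_mult mult_ac)
  qed
 qed measurable
qed

lemma norm_nth_le_vec: "norm ((G::l2^3) $ i) <= norm G" by (rule Finite_Cartesian_Product.norm_nth_le)

lemma tri_bound:
 obtains K where "K \<ge> 0" "!!x y G. x \<in> VV ==> y \<in> VV ==>
   \<bar>tri x G y\<bar> <= K * sqrt (norm x * norm (grad x)) * norm (grad y) * norm G"
proof -
 obtain K where K: "K \<ge> 0"
  "!!x G y H g. (x, G) \<in> Gam ==> (y, H) \<in> Gam ==>
    (\<integral>\<^sup>+t. ennreal (norm (rep_l2 x t) * norm (rep_l2 y t) * norm (rep_l2 g t)) \<partial>lborel)^2 <= ennreal (K * norm x * norm G * (norm H)^2 * (norm g)^2)"
  using trilinear_nn_bound by blast
 have "\<bar>tri x G y\<bar> <= (3 * sqrt K) * sqrt (norm x * norm (grad x)) * norm (grad y) * norm G" if x: "x \<in> VV" and y: "y \<in> VV" for x y G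
 proof -
  define Z where "Z = sqrt K * sqrt (norm x * norm (grad x)) * norm (grad y) * norm G"
  have Z0: "Z \<ge> 0" using K(1) by (simp add: Z_def)
  have one: "\<bar>\<integral>t. rep_l2 x t $ i * (rep_l2 (G $ i) t \<bullet> rep_l2 y t) \<partial>lborel\<bar> <= Z" for i
  proof -
   let ?I = "%t. rep_l2 x t $ i * (rep_l2 (G $ i) t \<bullet> rep_l2 y t)"
   have "ennreal (\<bar>\<integral>t. ?I t \<partial>lborel\<bar>\<^sup>2) <= (\<integral>\<^sup>+t. ennreal \<bar>?I t\<bar> \<partial>lborel)^2"
   proof -
    have "ennreal \<bar>\<integral>t. ?I t \<partial>lborel\<bar> <= ennreal (LBINT t. \<bar>?I t\<bar>)" by (intro ennreal_leI integral_abs_bound)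
    also have "\<dots> = (\<integral>\<^sup>+t. ennreal \<bar>?I t\<bar> \<partial>lborel)"
     using tri_integrable[OF x y, of i "G $ i"] by (intro nn_integral_eq_integral[symmetric]) auto
    finally have "(ennreal \<bar>\<integral>t. ?I t \<partial>lborel\<bar>)^2 <= (\<integral>\<^sup>+t. ennreal \<bar>?I t\<bar> \<partial>lborel)^2" by (intro power_mono) auto
    thus ?thesis by (simp add: ennreal_power)
   qed
   also have "\<dots> <= (\<integral>\<^sup>+t. ennreal (norm (rep_l2 x t) * norm (rep_l2 y t) * norm (rep_l2 (G $ i) t)) \<partial>lborel)^2"
   proof (intro power_mono nn_integral_mono ennreal_leI)
    fix t
    have "\<bar>rep_l2 x t $ i\<bar> * \<bar>rep_l2 (G $ i) t \<bullet> rep_l2 y t\<bar> <= norm (rep_l2 x t) * (norm (rep_l2 (G $ i) t) * norm (rep_l2 y t))"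
     by (intro mult_mono component_le_norm_cart Cauchy_Schwarz_ineq2) auto
    thus "\<bar>?I t\<bar> <= norm (rep_l2 x t) * norm (rep_l2 y t) * norm (rep_l2 (G $ i) t)" by (simp add: abs_mult mult_ac)
   qed auto
   also have "\<dots> <= ennreal (K * norm x * norm (grad x) * (norm (grad y))^2 * (norm (G $ i))^2)"
    by (rule K(2)[OF grad_Gam[OF x] grad_Gam[OF y]])
   also have "\<dots> <= ennreal (K * norm x * norm (grad x) * (norm (grad y))^2 * (norm G)^2)"
    using K(1) norm_nth_le_vec[of G i] by (intro ennreal_leI mult_left_mono power_mono) auto
   also have "K * norm x * norm (grad x) * (norm (grad y))^2 * (norm G)^2 = Z\<^sup>2"
    using K(1) by (simp add: Z_def power_mult_distrib)
   finally have "\<bar>\<integral>t. ?I t \<partial>lborel\<bar>\<^sup>2 <= Z\<^sup>2" by (simp add: ennreal_le_iff)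
   thus ?thesis using Z0 by (rule power2_le_imp_le)
  qed
  have "\<bar>tri x G y\<bar> <= (\<Sum>i\<in>(UNIV::3 set). Z)"
   unfolding tri_def by (rule order_trans[OF sum_abs sum_mono[OF one]])
  thus ?thesis by (simp add: Z_def)
 qed
 thus ?thesis using that[of "3 * sqrt K"] K(1) by simp
qed

lemma rep_l2_diff: "AE t in lborel. rep_l2 (x - y) t = rep_l2 x t - rep_l2 y t"
proof -
 have "abs_l2 (rep_l2 (x - y)) = abs_l2 (%t. rep_l2 x t - rep_l2 y t)" by (simp add: abs_l2_diff l2fun_rep)
 thus ?thesis by (rule abs_l2_eq_iff[OF l2fun_rep l2fun_diff[OF l2fun_rep l2fun_rep], THEN iffD1])
qed

lemma tri_diff:
 assumes "x \<in> VV" "y \<in> VV" "z \<in> VV"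
 shows "tri x G (y - z) = tri x G y - tri x G z"
proof -
 have "(LBINT t. rep_l2 x t $ i * (rep_l2 (G $ i) t \<bullet> rep_l2 (y - z) t))
   = (LBINT t. rep_l2 x t $ i * (rep_l2 (G $ i) t \<bullet> rep_l2 y t) - rep_l2 x t $ i * (rep_l2 (G $ i) t \<bullet> rep_l2 z t))" for i
 proof (rule integral_cong_AE)
  show "AE t in lborel. rep_l2 x t $ i * (rep_l2 (G $ i) t \<bullet> rep_l2 (y - z) t) =
   rep_l2 x t $ i * (rep_l2 (G $ i) t \<bullet> rep_l2 y t) - rep_l2 x t $ i * (rep_l2 (G $ i) t \<bullet> rep_l2 z t)"
   using rep_l2_diff[of y z] by eventually_elim (simp add: inner_diff_right right_diff_distrib)
 qed measurable
 thus ?thesis unfolding tri_def using tri_integrable assms by (simp add: sum_subtractf)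
qed

lemma tri_cl: assumes w: "w \<in> D" shows "tri x G (cl w) = Tri x G w"
proof -
 have [measurable]: "w \<in> borel_measurable borel" by (intro borel_measurable_continuous_onI D_cont0 w)
 have "(LBINT t. rep_l2 x t $ i * (rep_l2 (G $ i) t \<bullet> rep_l2 (cl w) t)) = (LBINT t. indicator \<Omega> t * (rep_l2 x t $ i * (w t \<bullet> rep_l2 (G $ i) t)))" for i
 proof (rule integral_cong_AE)
  show "AE t in lborel. rep_l2 x t $ i * (rep_l2 (G $ i) t \<bullet> rep_l2 (cl w) t) = indicat_real \<Omega> t * (rep_l2 x t $ i * (w t \<bullet> rep_l2 (G $ i) t))"
   using rep_abs_l2[OF L2\<Omega>_cut[OF L2\<Omega>_D0[OF w]]] unfolding cl_def
   by eventually_elim (auto simp: cut_def inner_commute split: split_indicator)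
 qed measurable
 thus ?thesis unfolding tri_def Tri_def by (simp add: inner_mop[OF D_cont0[OF w]])
qed

end

section \<open>Weak solutions in the Hilbert space\<close>

context flow_domain
begin

lemma L2sq_cut: "L2sq \<Omega> w = (\<integral>\<^sup>+x. ennreal ((norm (cut w x))^2) \<partial>lborel)"
 unfolding L2sq_def by (intro nn_integral_cong) (auto simp: cut_def split: split_indicator)

lemma L2\<Omega>_iff: "L2\<Omega> w \<longleftrightarrow> w \<in> borel_measurable lborel \<and> L2sq \<Omega> w < \<infinity>"
proof -
 have "w \<in> borel_measurable borel ==> cut w \<in> borel_measurable borel" unfolding cut_def by measurable
 thus ?thesis unfolding L2\<Omega>_def L2sq_cut l2fun_iff_nn_integral by auto
qed

lemma L2sq_eq: "L2\<Omega> w ==> L2sq \<Omega> w = ennreal ((norm (cl w))^2)"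
 unfolding L2sq_cut cl_def by (rule nn_integral_l2[OF L2\<Omega>_cut])

lemma L2sq_tendsto:
 assumes "!!n. L2\<Omega> (\<phi> n)" "L2\<Omega> u"
 shows "(%n. L2sq \<Omega> (%x. \<phi> n x - u x)) ----> 0 \<longleftrightarrow> (%n. cl (\<phi> n)) ----> cl u"
proof -
 have "(%n. L2sq \<Omega> (%x. \<phi> n x - u x)) = (%n. ennreal ((norm (cl (\<phi> n) - cl u))^2))"
  using assms by (simp add: L2sq_eq L2\<Omega>_diff cl_diff)
 moreover have "(%n. ennreal ((norm (cl (\<phi> n) - cl u))^2)) ----> ennreal 0 \<longleftrightarrow> (%n. (norm (cl (\<phi> n) - cl u))^2) ----> 0"
  by (rule tendsto_ennreal_iff) auto
 moreover have "(%n. (norm (cl (\<phi> n) - cl u))^2) ----> 0 \<longleftrightarrow> (%n. cl (\<phi> n)) ----> cl u"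
  by (simp add: tendsto_norm_zero_iff LIM_zero_iff)
 ultimately show ?thesis by simp
qed

lemma Hspace_iff: "u \<in> Hspace \<Omega> D \<longleftrightarrow> L2\<Omega> u \<and> cl u \<in> HH"
proof (cases "L2\<Omega> u")
 case True
 have "(\<exists>\<phi>. (\<forall>n. \<phi> n \<in> D) \<and> (%n. L2sq \<Omega> (%x. \<phi> n x - u x)) ----> 0) \<longleftrightarrow> cl u \<in> HH"
 proof
  assume "\<exists>\<phi>. (\<forall>n. \<phi> n \<in> D) \<and> (%n. L2sq \<Omega> (%x. \<phi> n x - u x)) ----> 0"
  then obtain \<phi> where \<phi>: "!!n. \<phi> n \<in> D" "(%n. L2sq \<Omega> (%x. \<phi> n x - u x)) ----> 0" by blast
  hence "(%n. cl (\<phi> n)) ----> cl u" using L2sq_tendsto[of \<phi> u] L2\<Omega>_D0 True by blast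
  thus "cl u \<in> HH" unfolding HH_def closure_sequential using \<phi>(1) by (intro exI[of _ "%n. cl (\<phi> n)"]) auto
 next
  assume "cl u \<in> HH"
  then obtain f where f: "!!n::nat. f n \<in> cl ` D" "f ----> cl u" unfolding HH_def closure_sequential by blast
  hence "\<forall>n. \<exists>\<phi>. \<phi> \<in> D \<and> f n = cl \<phi>" by blast
  then obtain \<phi> where \<phi>: "\<forall>n. \<phi> n \<in> D \<and> f n = cl (\<phi> n)" by (rule choice[THEN exE])
  hence "f = (%n. cl (\<phi> n))" by auto
  hence "(%n. L2sq \<Omega> (%x. \<phi> n x - u x)) ----> 0" using f(2) L2sq_tendsto[of \<phi> u] \<phi> L2\<Omega>_D0 True by blast
  thus "\<exists>\<phi>. (\<forall>n. \<phi> n \<in> D) \<and> (%n. L2sq \<Omega> (%x. \<phi> n x - u x)) ----> 0" using \<phi> by blast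
 qed
 thus ?thesis using True L2\<Omega>_iff unfolding Hspace_def by simp
next
 case False
 thus ?thesis using L2\<Omega>_iff unfolding Hspace_def by auto
qed

lemma ip_eq: "L2\<Omega> u ==> L2\<Omega> v ==> ip \<Omega> u v = cl u \<bullet> cl v"
 by (simp add: ip_def cl_inner)

lemma Hnorm_eq: "L2\<Omega> u ==> Hnorm \<Omega> u = norm (cl u)"
 by (simp add: Hnorm_def ip_eq norm_eq_sqrt_inner)

lemma L2\<Omega>_rep: "L2\<Omega> (rep_l2 x)" by (simp add: L2\<Omega>_def l2fun_cut l2fun_rep)

lemma cl_rep: "cl (rep_l2 x) = proj x" by (simp add: cl_def proj_def)

text \<open>Replaces approximating sequences of functions by membership in the closed graph, for
  every choice of representatives.\<close>

lemma H1_iff: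
 assumes u: "L2\<Omega> u"
 shows "(\<exists>\<phi>. H1_approx \<Omega> D u \<phi> G) \<longleftrightarrow> (\<forall>i. L2\<Omega> (G i)) \<and> (cl u, \<chi> i. cl (G i)) \<in> Gam"
proof
 assume "\<exists>\<phi>. H1_approx \<Omega> D u \<phi> G"
 then obtain \<phi> where \<phi>: "!!n. \<phi> n \<in> D" "(%n. L2sq \<Omega> (%x. \<phi> n x - u x)) ----> 0"
  "!!i. L2\<Omega> (G i)" "!!i. (%n. L2sq \<Omega> (%x. pd i (\<phi> n) x - G i x)) ----> 0"
  unfolding H1_approx_def L2\<Omega>_iff by blast
 have "(%n. cl (\<phi> n)) ----> cl u" using \<phi>(2) L2sq_tendsto[of \<phi> u] \<phi>(1) L2\<Omega>_D0 u by blast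
 moreover have "(%n. cl (pd i (\<phi> n))) ----> cl (G i)" for i
  using \<phi>(4)[of i] L2sq_tendsto[of "%n. pd i (\<phi> n)" "G i"] \<phi>(1) L2\<Omega>_D1 \<phi>(3) by blast
 ultimately have "(%n. gr (\<phi> n)) ----> (cl u, \<chi> i. cl (G i))"
  unfolding gr_def by (intro tendsto_Pair vec_tendstoI) auto
 hence "(cl u, \<chi> i. cl (G i)) \<in> Gam"
  unfolding Gam_def closure_sequential using \<phi>(1) by (intro exI[of _ "%n. gr (\<phi> n)"]) auto
 thus "(\<forall>i. L2\<Omega> (G i)) \<and> (cl u, \<chi> i. cl (G i)) \<in> Gam" using \<phi>(3) by blast
next
 assume G: "(\<forall>i. L2\<Omega> (G i)) \<and> (cl u, \<chi> i. cl (G i)) \<in> Gam"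
 then obtain \<phi> where \<phi>: "!!n. \<phi> n \<in> D" "(%n. gr (\<phi> n)) ----> (cl u, \<chi> i. cl (G i))" using Gam_seq by blast
 have 1: "(%n. cl (\<phi> n)) ----> cl u" using tendsto_fst[OF \<phi>(2)] by (simp add: gr_def)
 have 2: "(%n. cl (pd i (\<phi> n))) ----> cl (G i)" for i
  using tendsto_vec_nth[OF tendsto_snd[OF \<phi>(2)], of i] by (simp add: gr_def)
 have "(%n. L2sq \<Omega> (%x. \<phi> n x - u x)) ----> 0" using 1 L2sq_tendsto[of \<phi> u] \<phi>(1) L2\<Omega>_D0 u by blast
 moreover have "(%n. L2sq \<Omega> (%x. pd i (\<phi> n) x - G i x)) ----> 0" for i
  using 2[of i] L2sq_tendsto[of "%n. pd i (\<phi> n)" "G i"] \<phi>(1) L2\<Omega>_D1 G by blast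
 ultimately have "H1_approx \<Omega> D u \<phi> G" unfolding H1_approx_def using \<phi>(1) G L2\<Omega>_iff by blast
 thus "\<exists>\<phi>. H1_approx \<Omega> D u \<phi> G" by blast
qed

lemma Vspace_iff: "u \<in> Vspace \<Omega> D \<longleftrightarrow> L2\<Omega> u \<and> cl u \<in> VV"
proof
 assume "u \<in> Vspace \<Omega> D"
 hence u: "u \<in> Hspace \<Omega> D" "\<exists>\<phi> G. H1_approx \<Omega> D u \<phi> G" by (auto simp: Vspace_def)
 hence "L2\<Omega> u" by (simp add: Hspace_iff)
 with u(2) show "L2\<Omega> u \<and> cl u \<in> VV" using H1_iff Gam_VV by metis
next
 assume u: "L2\<Omega> u \<and> cl u \<in> VV"
 \<comment> \<open>Gradients vanish off \<open>\<Omega>\<close>, so cutting their representatives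
   changes nothing and these serve as weak derivatives.\<close>
 have "(\<chi> i. cl (rep_l2 (grad (cl u) $ i))) = grad (cl u)"
  using proj_Gam[OF grad_Gam, of "cl u"] u by (simp add: cl_rep vec_eq_iff)
 hence "\<exists>\<phi>. H1_approx \<Omega> D u \<phi> (%i. rep_l2 (grad (cl u) $ i))"
  using u grad_Gam by (subst H1_iff) (auto simp: L2\<Omega>_rep)
 thus "u \<in> Vspace \<Omega> D" using u VV_HH unfolding Vspace_def Hspace_iff by blast
qed

text \<open>Whatever derivatives the choice operator picks, their classes are determined, since the
  graph is single-valued.\<close>

lemma Vgrad_spec:
 assumes "u \<in> Vspace \<Omega> D"
 shows "L2\<Omega> (Vgrad \<Omega> D u i)" "cl (Vgrad \<Omega> D u i) = grad (cl u) $ i"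
proof -
 have u: "L2\<Omega> u" using assms Vspace_iff by blast
 have "\<exists>G. \<exists>\<phi>. H1_approx \<Omega> D u \<phi> G" using assms by (auto simp: Vspace_def)
 hence "\<exists>\<phi>. H1_approx \<Omega> D u \<phi> (Vgrad \<Omega> D u)" unfolding Vgrad_def by (rule someI_ex)
 hence *: "(\<forall>i. L2\<Omega> (Vgrad \<Omega> D u i)) \<and> (cl u, \<chi> i. cl (Vgrad \<Omega> D u i)) \<in> Gam" using H1_iff[OF u] by blast
 thus "L2\<Omega> (Vgrad \<Omega> D u i)" by blast
 have "grad (cl u) = (\<chi> i. cl (Vgrad \<Omega> D u i))" using * grad_eq by blast
 thus "cl (Vgrad \<Omega> D u i) = grad (cl u) $ i" by simp
qed

lemma Vip_eq: "u \<in> Vspace \<Omega> D ==> v \<in> Vspace \<Omega> D ==> Vip \<Omega> D u v = grad (cl u) \<bullet> grad (cl v)"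
 unfolding Vip_def inner_vec_def by (simp add: ip_eq Vgrad_spec)

lemma Vnorm_eq: "u \<in> Vspace \<Omega> D ==> Vnorm \<Omega> D u = norm (grad (cl u))"
 by (simp add: Vnorm_def Vip_eq norm_eq_sqrt_inner)

text \<open>Off V the choice in the definition of the gradient ranges over an empty predicate, hence is the same junk value for all fields.\<close>
lemma Vnorm_junk: "\<exists>c. \<forall>u. u \<in> Hspace \<Omega> D --> u \<notin> Vspace \<Omega> D --> Vnorm \<Omega> D u = c"
proof -
 have "Vgrad \<Omega> D u = (SOME G. False)" if "u \<in> Hspace \<Omega> D" "u \<notin> Vspace \<Omega> D" for u
  using that unfolding Vgrad_def Vspace_def by (intro arg_cong[of _ _ Eps]) (auto simp: fun_eq_iff)
 thus ?thesis unfolding Vnorm_def Vip_def by auto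
qed

lemma rep_cl: "L2\<Omega> u ==> AE t in lborel. rep_l2 (cl u) t = cut u t"
 unfolding cl_def by (rule rep_abs_l2[OF L2\<Omega>_cut])

lemma btri_eq:
 assumes u: "u \<in> Vspace \<Omega> D" and w: "w \<in> Vspace \<Omega> D" and v: "v \<in> Vspace \<Omega> D"
 shows "btri \<Omega> D u w v = tri (cl u) (grad (cl w)) (cl v)"
proof -
 have L: "L2\<Omega> u" "L2\<Omega> w" "L2\<Omega> v" "cl u \<in> VV" "cl v \<in> VV" using assms Vspace_iff by blast+
 have [measurable]: "u \<in> borel_measurable borel" "v \<in> borel_measurable borel" "Vgrad \<Omega> D w i \<in> borel_measurable borel" for i
  using L Vgrad_spec(1)[OF w] by (auto simp: L2\<Omega>_def)
 let ?I = "%i t. rep_l2 (cl u) t $ i * (rep_l2 (grad (cl w) $ i) t \<bullet> rep_l2 (cl v) t)"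
 have AEg: "AE t in lborel. \<forall>i. rep_l2 (grad (cl w) $ i) t = cut (Vgrad \<Omega> D w i) t"
  using rep_cl[OF Vgrad_spec(1)[OF w]] by (intro eventually_all_finite) (simp add: Vgrad_spec(2)[OF w])
 have "btri \<Omega> D u w v = (LBINT t. (\<Sum>i\<in>UNIV. ?I i t))"
  unfolding btri_def set_lebesgue_integral_def
 proof (rule integral_cong_AE)
  show "AE t in lborel. indicat_real \<Omega> t *\<^sub>R (\<Sum>i\<in>UNIV. \<Sum>j\<in>UNIV. u t $ i * Vgrad \<Omega> D w i t $ j * v t $ j) = (\<Sum>i\<in>UNIV. ?I i t)"
   using rep_cl[OF L(1)] rep_cl[OF L(3)] AEg
   by eventually_elim (auto simp: cut_def inner_vec_def sum_distrib_left mult_ac split: split_indicator)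
 qed measurable
 also have "\<dots> = tri (cl u) (grad (cl w)) (cl v)"
  unfolding tri_def using tri_integrable[OF L(4,5)] by (intro Bochner_Integration.integral_sum)
 finally show ?thesis .
qed

end

section \<open>Weak solutions as curves of classes\<close>

locale nse_domain = flow_domain +
 fixes \<nu> :: real and f :: vf
 assumes \<nu>: "\<nu> > 0" and f_Hspace: "f \<in> Hspace \<Omega> D"
begin

text \<open>The right-hand side of the equation with all derivatives on \<open>w\<close>. It is
  continuous on \<open>L^2\<close>, so limits of the equation can do without convergence of
  gradients.\<close>

definition Ff :: "vf => l2 => real" where "Ff w x = cl f \<bullet> cl w + \<nu> * (x \<bullet> lap w) + Qf w x"

abbreviation (input) diss :: "(real => l2) => real => real => real" where
 "diss v p q \<equiv> LBINT s:{p..q}. (norm (grad (v s)))^2"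

abbreviation (input) energy_le :: "(real => l2) => real => real => bool" where
 "energy_le v t' t \<equiv> (norm (v t))^2 / 2 + \<nu> * diss v t' t <= (norm (v t'))^2 / 2 + (LBINT s:{t'..t}. cl f \<bullet> v s)"

text \<open>A notion stable under limits: the equation is kept for test fields only, and the time
  derivative is not mentioned. Weak continuity is tested with all of \<open>L^2\<close>, which
  \<open>weak_cont_HH\<close> reduces to \<open>HH\<close>.\<close>

definition wsol :: "real set => (real => l2) => bool" where
 "wsol J v \<longleftrightarrow> (\<forall>t\<in>J. v t \<in> HH) \<and> (\<forall>y. continuous_on J (%t. v t \<bullet> y)) \<and>
   (AE t in lborel. t \<in> J --> v t \<in> VV) \<and>
   (\<forall>p q. {p..q} \<subseteq> J --> set_integrable lborel {p..q} (%s. (norm (grad (v s)))^2)) \<and>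
   (\<forall>w\<in>D. \<forall>\<theta>. test_fun J \<theta> --> - (LBINT t. (v t \<bullet> cl w) * deriv \<theta> t) = (LBINT t. Ff w (v t) * \<theta> t)) \<and>
   (AE t' in lborel. t' \<in> J --> (\<forall>t\<in>J. t' < t -->
    energy_le v t' t))"

lemma L2\<Omega>_f: "L2\<Omega> f" and f_HH: "cl f \<in> HH" using f_Hspace Hspace_iff by blast+

lemma Ff_VV:
 assumes "x \<in> VV" "w \<in> D"
 shows "Ff w x = cl f \<bullet> cl w - \<nu> * (grad x \<bullet> grad (cl w)) - tri x (grad x) (cl w)"
 using Gam_lap[OF grad_Gam[OF assms(1)] assms(2)] Gam_Tri[OF grad_Gam[OF assms(1)] assms(2)] grad_D[OF assms(2)] tri_cl[OF assms(2)]
 by (simp add: Ff_def)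

lemma continuous_Ff: "w \<in> D ==> continuous_on UNIV (Ff w)"
 unfolding Ff_def by (intro continuous_intros continuous_Qf)

text \<open>On \<open>HH\<close> a test class acts through its projection onto
  \<open>HH\<close>.\<close>

lemma weak_cont_HH:
 assumes "!!t. t \<in> J ==> v t \<in> HH" "!!y. y \<in> HH ==> continuous_on J (%t. v t \<bullet> y)"
 shows "continuous_on J (%t. v t \<bullet> y)"
proof -
 obtain p where p: "p \<in> HH" "!!s. s \<in> HH ==> s \<bullet> y = s \<bullet> p"
  using closed_subspace_projection[OF closed_HH subspace_HH] by metis
 have "continuous_on J (%t. v t \<bullet> p)" by (rule assms(2)[OF p(1)])
 thus ?thesis by (rule continuous_on_eq) (use p(2) assms(1) in simp)
qed

text \<open>By weak lower semicontinuity the times with gradient norm at most \<open>C\<close> form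
  a set closed in \<open>J\<close>.\<close>

lemma grad_measurable:
 fixes J :: "real set" and v :: "real => l2"
 assumes J: "open J" and v: "!!y. continuous_on J (%t. v t \<bullet> y)"
 shows "{t\<in>J. v t \<in> VV} \<in> sets borel" "(%t. indicator J t * norm (grad (v t))) \<in> borel_measurable borel"
proof -
 define T where "T C = {t\<in>J. v t \<in> VV \<and> norm (grad (v t)) <= C}" for C
 have T[measurable]: "T C \<in> sets borel" for C
 proof -
  have "closedin (top_of_set J) (T C)"
   unfolding closedin_limpt
  proof (intro conjI allI impI)
   fix t assume t: "t islimpt T C \<and> t \<in> J"
   then obtain s where "\<forall>n. s n \<in> T C - {t}" and s2: "s ----> t" unfolding islimpt_sequential by blast
   hence s: "!!n. s n \<in> T C" "s ----> t" by auto
   have "v t \<in> VV \<and> norm (grad (v t)) <= C"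
   proof (rule VV_weakly_closed[of sequentially "%n. v (s n)"])
    show "(%n. v (s n) \<bullet> w) ----> v t \<bullet> w" for w
     using s t continuous_on_tendsto_compose[OF v[of w] s(2)] by (auto simp: T_def)
   qed (use s in \<open>auto simp: T_def\<close>)
   thus "t \<in> T C" using t by (auto simp: T_def)
  qed (auto simp: T_def)
  then obtain C' where "closed C'" "T C = C' \<inter> J" by (auto simp: closedin_closed)
  thus ?thesis using J by auto
 qed
 have U: "{t\<in>J. v t \<in> VV} = (\<Union>n. T (real n))"
  using real_arch_simple by (auto simp: T_def)
 thus VVm: "{t\<in>J. v t \<in> VV} \<in> sets borel" by auto
 show "(%t. indicator J t * norm (grad (v t))) \<in> borel_measurable borel"
  unfolding borel_measurable_iff_le
 proof
  fix C :: real
  have "{t \<in> space borel. indicator J t * norm (grad (v t)) <= C} = (if C \<ge> 0 then T C \<union> - {t\<in>J. v t \<in> VV} else {})"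
   by (auto simp: T_def grad_def split: split_indicator_asm) (smt (verit) norm_ge_zero)+
  also have "\<dots> \<in> sets borel" using T VVm by auto
  finally show "{t \<in> space borel. indicator J t * norm (grad (v t)) <= C} \<in> sets borel" .
 qed
qed

end

lemma test_fun_smooth: "test_fun J \<theta> ==> smooth_real \<theta>"
 by (simp add: test_fun_def smooth_real_def)

lemma test_fun_cont: "test_fun J \<theta> ==> continuous_on UNIV \<theta>" "test_fun J \<theta> ==> continuous_on UNIV (deriv \<theta>)"
 using smooth_real_continuous smooth_realD(2) test_fun_smooth by blast+

lemma test_fun_zero:
 assumes \<theta>: "test_fun J \<theta>" and t: "t \<notin> closure {t. \<theta> t \<noteq> 0}"
 shows "\<theta> t = 0" "deriv \<theta> t = 0"
proof -
 show "\<theta> t = 0" using t closure_subset[of "{t. \<theta> t \<noteq> 0}"] by auto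
 have "\<forall>\<^sub>F s in nhds t. s \<in> - closure {t. \<theta> t \<noteq> 0}" using t by (intro eventually_nhds_in_open) auto
 hence ev: "\<forall>\<^sub>F s in nhds t. \<theta> s = 0"
  by eventually_elim (use closure_subset[of "{t. \<theta> t \<noteq> 0}"] in auto)
 have "(\<theta> has_real_derivative 0) (at t)" using DERIV_cong_ev[OF refl ev refl, of 0] by simp
 thus "deriv \<theta> t = 0" by (rule DERIV_imp_deriv)
qed

text \<open>The extreme points of the compact support lie in \<open>J\<close>, hence so does
  everything between them; an empty support is served by the empty interval from 1 to 0.\<close>

lemma test_fun_support:
 assumes \<theta>: "test_fun J \<theta>" and J: "is_interval J"
 obtains p q where "{p..q} \<subseteq> J" "!!t. t \<notin> {p..q} ==> \<theta> t = 0" "!!t. t \<notin> {p..q} ==> deriv \<theta> t = 0"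
proof -
 define K where "K = closure {t. \<theta> t \<noteq> 0}"
 have K: "compact K" "K \<subseteq> J" using \<theta> by (auto simp: test_fun_def K_def)
 show ?thesis
 proof (cases "K = {}")
  case True
  have nz: "t \<notin> closure {t. \<theta> t \<noteq> 0}" for t using True unfolding K_def by simp
  have "\<theta> t = 0" "deriv \<theta> t = 0" for t by (rule test_fun_zero(1)[OF \<theta> nz], rule test_fun_zero(2)[OF \<theta> nz])
  thus ?thesis by (intro that[of 1 0]) auto
 next
  case False
  obtain p where p: "p \<in> K" "\<forall>t\<in>K. p <= t" using compact_attains_inf[OF K(1) False] by blast
  obtain q where q: "q \<in> K" "\<forall>t\<in>K. t <= q" using compact_attains_sup[OF K(1) False] by blast
  have "{p..q} \<subseteq> J" using J p(1) q(1) K(2) unfolding is_interval_1 by (meson atLeastAtMost_iff subsetD subsetI)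
  moreover have "t \<notin> K" if "t \<notin> {p..q}" for t using p q that by auto
  ultimately show ?thesis using test_fun_zero[OF \<theta>] unfolding K_def by (intro that[of p q]) blast+
 qed
qed

section \<open>Dissipation and the absorbing ball\<close>

text \<open>As long as \<open>\<phi>\<close> is at least \<open>2 * M / \<kappa>\<close>, the loss
  is at least \<open>2 * M\<close> per unit of time against a gain of \<open>M\<close>. The
  inequality holds only from almost every start and \<open>\<phi>\<close> may jump, so good starting
  times and a supremum replace the usual first exit time.\<close>

lemma dissipative_absorbing:
 fixes \<phi> :: "real => real"
 assumes J: "open J" "J \<noteq> {}" "!!s t. s \<in> J ==> s <= t ==> t \<in> J"
  and \<phi>0: "!!t. 0 <= \<phi> t"
  and int: "!!p q. {p..q} \<subseteq> J ==> set_integrable lborel {p..q} \<phi>"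
  and \<kappa>: "\<kappa> > 0" and M: "M > 0"
  and good: "AE s in lborel. s \<in> J --> (\<forall>t. s < t --> \<phi> t + \<kappa> * (LBINT \<tau>:{s..t}. \<phi> \<tau>) <= \<phi> s + M * (t - s))"
 shows "\<exists>T\<in>J. \<forall>t\<ge>T. \<phi> t <= 2 * M / \<kappa>"
proof -
 define r where "r = 2 * M / \<kappa>"
 define G where "G s \<longleftrightarrow> s \<in> J \<and> (\<forall>t. s < t --> \<phi> t + \<kappa> * (LBINT \<tau>:{s..t}. \<phi> \<tau>) <= \<phi> s + M * (t - s))" for s
 have AEG: "AE s in lborel. s \<in> J --> G s" using good by eventually_elim (auto simp: G_def)
 have Icc: "{s..t} \<subseteq> J" if "s \<in> J" for s t using J(3)[OF that] by auto
 \<comment> \<open>The integral may start before the stretch on which the level is high; on the rest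
   the integrand is nonnegative.\<close>
 have below: "r * (t - s) <= (LBINT \<tau>:{x..t}. \<phi> \<tau>)"
  if x: "x \<in> J" "x <= s" "s <= t" and ae: "AE \<tau> in lborel. \<tau> \<in> {s<..<t} --> r <= \<phi> \<tau>" for x s t
 proof -
  have "r * (t - s) = (LBINT \<tau>. indicator {s<..<t} \<tau> *\<^sub>R r)" using x by simp
  also have "\<dots> <= (LBINT \<tau>. indicator {x..t} \<tau> *\<^sub>R \<phi> \<tau>)"
  proof (rule integral_mono_AE)
   show "integrable lborel (%\<tau>. indicator {s<..<t} \<tau> *\<^sub>R r)" using x by (intro integrable_indicator) auto
   show "integrable lborel (%\<tau>. indicator {x..t} \<tau> *\<^sub>R \<phi> \<tau>)" using int[OF Icc[OF x(1)]] by (simp add: set_integrable_def)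
   show "AE \<tau> in lborel. indicator {s<..<t} \<tau> *\<^sub>R r <= indicator {x..t} \<tau> *\<^sub>R \<phi> \<tau>"
    using ae by eventually_elim (use x \<phi>0 in \<open>auto split: split_indicator\<close>)
  qed
  finally show ?thesis by (simp add: set_lebesgue_integral_def)
 qed
 have Gex: "\<exists>s. G s"
 proof -
  obtain c where c: "c \<in> J" using J(2) by blast
  have "\<not> (AE s in lborel. s \<notin> {c<..<c+1::real})"
   by (subst AE_iff_null_sets[symmetric]) (auto simp: null_sets_def)
  then obtain s where "s \<in> J" "G s"
   using AEG J(3)[OF c] by (smt (verit) eventually_mono greaterThanLessThan_iff)
  thus ?thesis by blast
 qed
 have "\<exists>s. G s \<and> \<phi> s <= r"
 proof (rule ccontr)
  assume neg: "\<not> (\<exists>s. G s \<and> \<phi> s <= r)"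
  obtain s where s: "G s" using Gex by blast
  \<comment> \<open>So late that the net loss \<open>M * (t - s)\<close> exceeds
    \<open>\<phi> s\<close>.\<close>
  define t where "t = s + \<phi> s / M + 1"
  have st: "s < t" using \<phi>0[of s] M by (simp add: t_def add_nonneg_pos)
  have "AE \<tau> in lborel. \<tau> \<in> {s<..<t} --> r <= \<phi> \<tau>"
   using AEG
  proof eventually_elim
   case (elim \<tau>)
   show ?case
   proof
    assume "\<tau> \<in> {s<..<t}"
    hence "\<tau> \<in> J" using J(3)[of s \<tau>] s by (simp add: G_def)
    thus "r <= \<phi> \<tau>" using elim neg by (meson linear)
   qed
  qed
  hence "r * (t - s) <= (LBINT \<tau>:{s..t}. \<phi> \<tau>)" using s st by (intro below) (auto simp: G_def)
  hence "\<kappa> * (r * (t - s)) <= \<kappa> * (LBINT \<tau>:{s..t}. \<phi> \<tau>)" using \<kappa> by (intro mult_left_mono) auto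
  moreover have "\<kappa> * (r * (t - s)) = 2 * M * (t - s)" using \<kappa> by (simp add: r_def)
  moreover have "\<phi> t + \<kappa> * (LBINT \<tau>:{s..t}. \<phi> \<tau>) <= \<phi> s + M * (t - s)" using s st by (auto simp: G_def)
  moreover have "M * (t - s) = \<phi> s + M" using M by (simp add: t_def field_simps)
  ultimately show False using \<phi>0[of t] M by linarith
 qed
 then obtain s where s: "G s" "\<phi> s <= r" by blast
 have "\<phi> t <= r" if t: "t \<ge> s" for t
 proof (cases "t = s")
  case False
  hence st: "s < t" using t by simp
  \<comment> \<open>Good starting times at which the level is low. After their supremum
    \<open>S\<close> the level is at least \<open>r\<close> almost everywhere; \<open>S\<close> need
    not belong to \<open>A\<close>, so an element close to it is used, at the cost
    \<open>e\<close>.\<close>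
  define A where "A = {x\<in>{s..t}. G x \<and> \<phi> x <= r}"
  have sA: "s \<in> A" using s st by (simp add: A_def)
  have bdd: "bdd_above A" unfolding A_def by (rule bdd_aboveI[of _ t]) auto
  define S where "S = Sup A"
  have S3: "x <= S" if "x \<in> A" for x unfolding S_def by (rule cSup_upper[OF that bdd])
  have S2: "S <= t" unfolding S_def by (rule cSup_least) (use sA in \<open>auto simp: A_def\<close>)
  note S = S3[OF sA] S2 S3
  have ae: "AE \<tau> in lborel. \<tau> \<in> {S<..<t} --> r <= \<phi> \<tau>"
   using AEG
  proof eventually_elim
   case (elim \<tau>)
   show ?case
   proof
    assume \<tau>: "\<tau> \<in> {S<..<t}"
    hence "\<tau> \<in> J" using J(3)[of s \<tau>] s S by (auto simp: G_def)
    hence "G \<tau>" using elim by blast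
    moreover have "\<tau> \<notin> A" using S(3) \<tau> by force
    ultimately show "r <= \<phi> \<tau>" using \<tau> S by (auto simp: A_def)
   qed
  qed
  have "\<phi> t <= r + e" if e: "e > 0" for e
  proof -
   obtain x where x: "x \<in> A" "S - e / M < x"
    using less_cSupD[of A "S - e / M"] sA e M unfolding S_def by auto
   show ?thesis
   proof (cases "x = t")
    case True thus ?thesis using x e by (auto simp: A_def)
   next
    case False
    hence xt: "x < t" "G x" "\<phi> x <= r" using x by (auto simp: A_def)
    have "r * (t - S) <= (LBINT \<tau>:{x..t}. \<phi> \<tau>)"
     using xt S x(1) ae by (intro below) (auto simp: G_def)
    hence "\<kappa> * (r * (t - S)) <= \<kappa> * (LBINT \<tau>:{x..t}. \<phi> \<tau>)" using \<kappa> by (intro mult_left_mono) auto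
    moreover have "\<kappa> * (r * (t - S)) = 2 * M * (t - S)" using \<kappa> by (simp add: r_def)
    moreover have "\<phi> t + \<kappa> * (LBINT \<tau>:{x..t}. \<phi> \<tau>) <= \<phi> x + M * (t - x)" using xt by (auto simp: G_def)
    moreover have "M * (t - x) <= M * (t - S) + e"
    proof -
     have "M * (S - x) <= M * (e / M)" using x(2) M by (intro mult_left_mono) auto
     thus ?thesis using M by (simp add: algebra_simps)
    qed
    moreover have "0 <= M * (t - S)" using M S by simp
    ultimately show ?thesis using xt(3) by linarith
   qed
  qed
  thus ?thesis by (rule field_le_epsilon)
 qed (use s in simp)
 moreover have "s \<in> J" using s by (simp add: G_def)
 ultimately show ?thesis unfolding r_def by blast
qed

context nse_domain
begin

lemma wsolD:
 assumes "wsol J v"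
 shows "!!t. t \<in> J ==> v t \<in> HH" "!!y. continuous_on J (%t. v t \<bullet> y)" "AE t in lborel. t \<in> J --> v t \<in> VV"
  "!!p q. {p..q} \<subseteq> J ==> set_integrable lborel {p..q} (%s. (norm (grad (v s)))^2)"
  "!!w \<theta>. w \<in> D ==> test_fun J \<theta> ==> - (LBINT t. (v t \<bullet> cl w) * deriv \<theta> t) = (LBINT t. Ff w (v t) * \<theta> t)"
  "AE t' in lborel. t' \<in> J --> (\<forall>t\<in>J. t' < t -->
    energy_le v t' t)"
proof -
 note c1 = assms[unfolded wsol_def]
 note c2 = c1[THEN conjunct2]
 note c3 = c2[THEN conjunct2]
 note c4 = c3[THEN conjunct2]
 note c5 = c4[THEN conjunct2]
 show "v t \<in> HH" if "t \<in> J" for t using c1[THEN conjunct1] that by (rule bspec)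
 show "continuous_on J (%t. v t \<bullet> y)" for y using c2[THEN conjunct1] by (rule spec)
 show "AE t in lborel. t \<in> J --> v t \<in> VV" by (rule c3[THEN conjunct1])
 show "set_integrable lborel {p..q} (%s. (norm (grad (v s)))^2)" if "{p..q} \<subseteq> J" for p q
  using c4[THEN conjunct1, rule_format, OF that] .
 show "- (LBINT t. (v t \<bullet> cl w) * deriv \<theta> t) = (LBINT t. Ff w (v t) * \<theta> t)" if "w \<in> D" "test_fun J \<theta>" for w \<theta>
  using c5[THEN conjunct1, rule_format, OF that] .
 show "AE t' in lborel. t' \<in> J --> (\<forall>t\<in>J. t' < t -->
    energy_le v t' t)" by (rule c5[THEN conjunct2])
qed

text \<open>Outside \<open>J\<close> nothing is known about \<open>v\<close>, but there
  \<open>\<theta>\<close> is 0, so \<open>v\<close> can be replaced by its cut to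
  \<open>J\<close>.\<close>

lemma Ff_measurable:
 assumes "open J" "!!y. continuous_on J (%t. v t \<bullet> y)" "w \<in> D" "test_fun J \<theta>"
 shows "(%t. Ff w (v t) * \<theta> t) \<in> borel_measurable borel"
proof -
 have [measurable]: "(%t. indicator J t *\<^sub>R v t) \<in> borel_measurable borel" by (rule weakly_continuous_measurable[OF assms(1,2)])
 have [measurable]: "Ff w \<in> borel_measurable borel" "\<theta> \<in> borel_measurable borel"
  using continuous_Ff[OF assms(3)] test_fun_cont(1)[OF assms(4)] by (auto intro: borel_measurable_continuous_onI)
 have "(%t. Ff w (indicator J t *\<^sub>R v t) * \<theta> t) \<in> borel_measurable borel" by measurable
 also have "(%t. Ff w (indicator J t *\<^sub>R v t) * \<theta> t) = (%t. Ff w (v t) * \<theta> t)"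
 proof
  fix t
  show "Ff w (indicator J t *\<^sub>R v t) * \<theta> t = Ff w (v t) * \<theta> t"
  proof (cases "t \<in> J")
   case False
   hence "t \<notin> closure {t. \<theta> t \<noteq> 0}" using assms(4) by (auto simp: test_fun_def)
   hence "\<theta> t = 0" by (rule test_fun_zero(1)[OF assms(4)])
   thus ?thesis by simp
  qed simp
 qed
 finally show ?thesis .
qed

lemma test_fun_off: "test_fun J \<theta> ==> t \<notin> J ==> \<theta> t = 0 \<and> deriv \<theta> t = 0"
 using test_fun_zero[of J \<theta> t] by (auto simp: test_fun_def)

text \<open>The derivative \<open>g\<close> is eliminated: tested with a smooth field it equals
  \<open>Ff\<close> at almost every time.\<close>

lemma weak_to_wsol:
 assumes J: "open J" "is_interval J" and ws: "weak_solution \<Omega> D \<nu> f J u"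
 shows "wsol J (%t. cl (u t))"
proof -
 define v where "v t = cl (u t)" for t
 have uH: "u t \<in> Hspace \<Omega> D" if "t \<in> J" for t using ws that by (simp add: weak_solution_def)
 have uL: "L2\<Omega> (u t)" "v t \<in> HH" if "t \<in> J" for t using uH[OF that] by (auto simp: Hspace_iff v_def)
 have uV: "AE t in lborel. t \<in> J --> u t \<in> Vspace \<Omega> D" using ws by (simp add: weak_solution_def)
 have uVint: "(\<integral>\<^sup>+t. ennreal ((Vnorm \<Omega> D (u t))^2) * indicator K t \<partial>lborel) < \<infinity>" if "compact K" "K \<subseteq> J" for K
  using ws that by (simp add: weak_solution_def)
 have wc: "continuous_on J (%t. ip \<Omega> (u t) \<phi>)" if "\<phi> \<in> Hspace \<Omega> D" for \<phi> using ws that by (simp add: weak_solution_def weakly_cont_def)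
 note ex = ws[unfolded weak_solution_def, THEN conjunct2, THEN conjunct2, THEN conjunct2, THEN conjunct2, THEN conjunct2, THEN conjunct1]
 from ex obtain g :: "real => vf => real" and h :: "real => real" where g0:
  "\<forall>v\<in>Vspace \<Omega> D. \<forall>\<theta>. test_fun (interior J) \<theta> -->
      integrable lborel (%t. ip \<Omega> (u t) v * deriv \<theta> t) \<and>
      integrable lborel (%t. g t v * \<theta> t) \<and>
      - (LBINT t. ip \<Omega> (u t) v * deriv \<theta> t) = (LBINT t. g t v * \<theta> t)"
  "AE t in lborel. t \<in> J -->
      (\<forall>v\<in>Vspace \<Omega> D. g t v + \<nu> * Vip \<Omega> D (u t) v + btri \<Omega> D (u t) (u t) v = ip \<Omega> f v)"
  by (elim exE conjE) (erule (1) that)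
 have g: "integrable lborel (%t. g t w * \<theta> t) \<and>
      - (LBINT t. ip \<Omega> (u t) w * deriv \<theta> t) = (LBINT t. g t w * \<theta> t)"
  if "w \<in> Vspace \<Omega> D" "test_fun (interior J) \<theta>" for w \<theta>
  using g0(1)[rule_format, OF that] by simp
 have en: "AE t' in lborel. t' \<in> J --> (\<forall>t\<in>J. t' < t -->
    (Hnorm \<Omega> (u t))^2 / 2 + \<nu> * set_lebesgue_integral lborel {t'..t} (%s. (Vnorm \<Omega> D (u s))^2)
     <= (Hnorm \<Omega> (u t'))^2 / 2 + set_lebesgue_integral lborel {t'..t} (%s. ip \<Omega> f (u s)))"
  using ws by (simp add: weak_solution_def)
 have vc: "continuous_on J (%t. v t \<bullet> y)" for y
 proof (rule weak_cont_HH)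
  fix y assume y: "y \<in> HH"
  have "rep_l2 y \<in> Hspace \<Omega> D" using y by (simp add: Hspace_iff L2\<Omega>_rep cl_rep proj_HH)
  from wc[OF this] show "continuous_on J (%t. v t \<bullet> y)"
   by (rule continuous_on_eq) (use y uL in \<open>simp add: ip_eq L2\<Omega>_rep v_def cl_rep proj_HH\<close>)
 qed (rule uL)
 note gm = grad_measurable[OF J(1) vc]
 note [measurable] = gm
 have [measurable]: "J \<in> sets borel" using J(1) by auto
 \<comment> \<open>Off \<open>V\<close> the given norm is the junk constant \<open>c\<close>. These
   times are negligible, but the constancy makes the norm measurable in time, which the comparison
   of integrals requires.\<close>
 obtain c where c: "!!u. u \<in> Hspace \<Omega> D ==> u \<notin> Vspace \<Omega> D ==> Vnorm \<Omega> D u = c" using Vnorm_junk by blast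
 have Vn: "Vnorm \<Omega> D (u t) = (if v t \<in> VV then norm (grad (v t)) else c)" if "t \<in> J" for t
  using c[OF uH[OF that]] Vnorm_eq[of "u t"] uL[OF that] by (auto simp: Vspace_iff v_def)
 have vV: "AE t in lborel. t \<in> J --> v t \<in> VV" using uV by eventually_elim (auto simp: Vspace_iff v_def)
 have mg: "(%s. indicator {p..q} s *\<^sub>R (norm (grad (v s)))^2) \<in> borel_measurable borel" if "{p..q} \<subseteq> J" for p q
 proof -
  have "(%s. indicator {p..q} s *\<^sub>R (indicator J s * norm (grad (v s)))^2) \<in> borel_measurable borel" by measurable
  also have "(%s. indicator {p..q} s *\<^sub>R (indicator J s * norm (grad (v s)))^2) = (%s. indicator {p..q} s *\<^sub>R (norm (grad (v s)))^2)"
   using that by (auto simp: fun_eq_iff split: split_indicator)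
  finally show ?thesis .
 qed
 have mV: "(%s. indicator {p..q} s *\<^sub>R (Vnorm \<Omega> D (u s))^2) \<in> borel_measurable borel" if "{p..q} \<subseteq> J" for p q
 proof -
  have "(%s. indicator {p..q} s *\<^sub>R (norm (grad (v s)))^2 + indicator ({p..q} - {t\<in>J. v t \<in> VV}) s * (c\<^sup>2 - 0)) \<in> borel_measurable borel"
   using mg[OF that] by measurable
  also have "(%s. indicator {p..q} s *\<^sub>R (norm (grad (v s)))^2 + indicator ({p..q} - {t\<in>J. v t \<in> VV}) s * (c\<^sup>2 - 0)) = (%s. indicator {p..q} s *\<^sub>R (Vnorm \<Omega> D (u s))^2)"
  proof
   fix s
   show "indicator {p..q} s *\<^sub>R (norm (grad (v s)))^2 + indicator ({p..q} - {t\<in>J. v t \<in> VV}) s * (c\<^sup>2 - 0) = indicator {p..q} s *\<^sub>R (Vnorm \<Omega> D (u s))^2"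
    using that Vn[of s] by (auto simp: grad_def split: split_indicator)
  qed
  finally show ?thesis .
 qed
 have AEeq: "AE s in lborel. indicator {p..q} s *\<^sub>R (Vnorm \<Omega> D (u s))^2 = indicator {p..q} s *\<^sub>R (norm (grad (v s)))^2" if "{p..q} \<subseteq> J" for p q
  using vV by eventually_elim (use that Vn in \<open>auto split: split_indicator\<close>)
 have "set_integrable lborel {p..q} (%s. (norm (grad (v s)))^2)" if "{p..q} \<subseteq> J" for p q
  unfolding set_integrable_def
 proof (rule integrableI_bounded)
  have "(\<integral>\<^sup>+s. ennreal (norm (indicator {p..q} s *\<^sub>R (norm (grad (v s)))^2)) \<partial>lborel) = (\<integral>\<^sup>+t. ennreal ((Vnorm \<Omega> D (u t))^2) * indicator {p..q} t \<partial>lborel)"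
   using AEeq[OF that] by (intro nn_integral_cong_AE) (auto elim!: eventually_mono split: split_indicator)
  also have "\<dots> < \<infinity>" using that by (intro uVint) auto
  finally show "(\<integral>\<^sup>+s. ennreal (norm (indicat_real {p..q} s *\<^sub>R (norm (grad (v s)))^2)) \<partial>lborel) < \<infinity>" .
 qed (use mg[OF that] in simp)
 moreover have "- (LBINT t. (v t \<bullet> cl w) * deriv \<theta> t) = (LBINT t. Ff w (v t) * \<theta> t)" if w: "w \<in> D" and \<theta>: "test_fun J \<theta>" for w \<theta>
 proof -
  have wV: "w \<in> Vspace \<Omega> D" using grad_D[OF w] L2\<Omega>_D0[OF w] by (simp add: Vspace_iff)
  have \<theta>': "test_fun (interior J) \<theta>" using \<theta> J by (simp add: interior_open)
  have "(%t. (v t \<bullet> cl w) * deriv \<theta> t) = (%t. ip \<Omega> (u t) w * deriv \<theta> t)"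
  proof
   show "(v t \<bullet> cl w) * deriv \<theta> t = ip \<Omega> (u t) w * deriv \<theta> t" for t
    using test_fun_off[OF \<theta>, of t] uL[of t] L2\<Omega>_D0[OF w] by (cases "t \<in> J") (auto simp: ip_eq v_def)
  qed
  hence "- (LBINT t. (v t \<bullet> cl w) * deriv \<theta> t) = (LBINT t. g t w * \<theta> t)" using g[OF wV \<theta>'] by simp
  also have "\<dots> = (LBINT t. Ff w (v t) * \<theta> t)"
  proof (rule integral_cong_AE)
   show "(%t. g t w * \<theta> t) \<in> borel_measurable lborel" using g[OF wV \<theta>'] by blast
   show "(%t. Ff w (v t) * \<theta> t) \<in> borel_measurable lborel" using Ff_measurable[OF J(1) vc w \<theta>] by simp
   show "AE t in lborel. g t w * \<theta> t = Ff w (v t) * \<theta> t"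
    using g0(2) uV
   proof eventually_elim
    case (elim t)
    show ?case
    proof (cases "t \<in> J")
     case True
     hence V: "u t \<in> Vspace \<Omega> D" "v t \<in> VV" using elim by (auto simp: Vspace_iff v_def)
     have "g t w + \<nu> * (grad (v t) \<bullet> grad (cl w)) + tri (v t) (grad (v t)) (cl w) = cl f \<bullet> cl w"
      using elim(1) True wV V by (simp add: Vip_eq btri_eq ip_eq L2\<Omega>_f L2\<Omega>_D0[OF w] v_def)
     hence "g t w = Ff w (v t)" using Ff_VV[OF V(2) w] by linarith
     thus ?thesis by simp
    qed (use test_fun_off[OF \<theta>] in simp)
   qed
  qed
  finally show ?thesis .
 qed
 moreover have "AE t' in lborel. t' \<in> J --> (\<forall>t\<in>J. t' < t -->
    energy_le v t' t)"
  using en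
 proof eventually_elim
  case (elim t')
  show ?case
  proof (intro impI ballI)
   fix t assume "t' \<in> J" "t \<in> J" "t' < t"
   moreover from this have "{t'..t} \<subseteq> J" using J(2) unfolding is_interval_1 by (meson atLeastAtMost_iff subsetI)
   ultimately have t: "t' \<in> J" "t \<in> J" "t' < t" "{t'..t} \<subseteq> J" by auto
   have "(LBINT s:{t'..t}. (Vnorm \<Omega> D (u s))^2) = (diss v t' t)"
    unfolding set_lebesgue_integral_def using mV[OF t(4)] mg[OF t(4)] AEeq[OF t(4)] by (intro integral_cong_AE) auto
   moreover have "(LBINT s:{t'..t}. ip \<Omega> f (u s)) = (LBINT s:{t'..t}. cl f \<bullet> v s)"
    unfolding set_lebesgue_integral_def using t(4) uL L2\<Omega>_f
    by (intro Bochner_Integration.integral_cong refl) (auto simp: ip_eq v_def split: split_indicator)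
   moreover have "Hnorm \<Omega> (u t) = norm (v t)" "Hnorm \<Omega> (u t') = norm (v t')"
    using uL t by (auto simp: Hnorm_eq v_def)
   ultimately show "energy_le v t' t" using elim t by metis
  qed
 qed
 ultimately show ?thesis unfolding wsol_def v_def[symmetric] using uL(2) vc vV by simp
qed

lemma grad_measurable_Icc:
 fixes J :: "real set" and v :: "real => l2"
 assumes "open J" "!!y. continuous_on J (%t. v t \<bullet> y)" "{p..q} \<subseteq> J"
 shows "(%s. indicator {p..q} s * (norm (grad (v s)))^2) \<in> borel_measurable borel"
proof -
 note [measurable] = grad_measurable(2)[OF assms(1,2)]
 have "(%s. indicator {p..q} s * (indicator J s * norm (grad (v s)))^2) \<in> borel_measurable borel" by measurable
 also have "(%s. indicator {p..q} s * (indicator J s * norm (grad (v s)))^2) = (%s. indicator {p..q} s * (norm (grad (v s)))^2)"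
  using assms(3) by (auto simp: fun_eq_iff split: split_indicator)
 finally show ?thesis .
qed

text \<open>Poincare turns the doubled dissipation into \<open>2 * \<kappa>\<close> times the
  integral of the squared norm, and Young's inequality spends half of it on the force. The radius
  depends on the data only, not on \<open>J\<close> or \<open>v\<close>.\<close>

lemma absorbing_ball:
 obtains R where "R > 0" "!!J v. open J ==> J \<noteq> {} ==> (!!s t. s \<in> J ==> s <= t ==> t \<in> J) ==> wsol J v ==> \<exists>T\<in>J. \<forall>t\<ge>T. norm (v t) <= R"
proof -
 obtain C where C: "C > 0" "!!x G. (x, G) \<in> Gam ==> (norm x)^2 <= C * (norm G)^2" using poincare by blast
 define \<kappa> where "\<kappa> = \<nu> / C"
 have \<kappa>: "\<kappa> > 0" using \<nu> C by (simp add: \<kappa>_def)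
 \<comment> \<open>The summand 1 keeps \<open>M\<close> positive when the force vanishes.\<close>
 define M where "M = (norm (cl f))^2 / \<kappa> + 1"
 have M: "M > 0" using \<kappa> by (simp add: M_def add_nonneg_pos)
 define R where "R = sqrt (2 * M / \<kappa>)"
 have R: "R > 0" using M \<kappa> by (simp add: R_def)
 have "\<exists>T\<in>J. \<forall>t\<ge>T. norm (v t) <= R"
  if J: "open J" "J \<noteq> {}" "!!s t. s \<in> J ==> s <= t ==> t \<in> J" and v: "wsol J v" for J v
 proof -
  note w = wsolD[OF v]
  define \<phi> where "\<phi> t = (norm (indicator J t *\<^sub>R v t))^2" for t
  have [measurable]: "(%t. indicator J t *\<^sub>R v t) \<in> borel_measurable borel" by (rule weakly_continuous_measurable[OF J(1) w(2)])
  have [measurable]: "\<phi> \<in> borel_measurable borel" unfolding \<phi>_def by measurable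
  have Icc: "{s..t} \<subseteq> J" if "s \<in> J" for s t using J(3)[OF that] by auto
  have \<phi>J: "\<phi> t = (norm (v t))^2" if "t \<in> J" for t using that by (simp add: \<phi>_def)
  have AEle: "AE s in lborel. s \<in> J --> \<phi> s <= C * (norm (grad (v s)))^2"
   using w(3) by eventually_elim (use C(2)[OF grad_Gam] \<phi>J in auto)
  have int: "set_integrable lborel {p..q} \<phi>" if pq: "{p..q} \<subseteq> J" for p q
   unfolding set_integrable_def
  proof (rule Bochner_Integration.integrable_bound)
   show "integrable lborel (%s. C * (indicator {p..q} s *\<^sub>R (norm (grad (v s)))^2))"
    using w(4)[OF pq] by (simp add: set_integrable_def)
   show "AE s in lborel. norm (indicat_real {p..q} s *\<^sub>R \<phi> s) <= norm (C * (indicat_real {p..q} s *\<^sub>R (norm (grad (v s)))^2))"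
    using AEle by eventually_elim (use pq C(1) in \<open>auto simp: \<phi>_def split: split_indicator\<close>)
  qed measurable
  have fint: "set_integrable lborel {p..q} (%s. cl f \<bullet> v s)" if "{p..q} \<subseteq> J" for p q
   unfolding set_integrable_def using continuous_on_subset[OF w(2)[of "cl f"] that]
   by (intro borel_integrable_compact) (auto simp: inner_commute)
  have "\<exists>T\<in>J. \<forall>t\<ge>T. \<phi> t <= 2 * M / \<kappa>"
  proof (rule dissipative_absorbing[OF J _ int \<kappa> M])
   show "AE s in lborel. s \<in> J --> (\<forall>t. s < t --> \<phi> t + \<kappa> * (LBINT \<tau>:{s..t}. \<phi> \<tau>) <= \<phi> s + M * (t - s))"
    using w(6)
   proof eventually_elim
    case (elim s)
    show ?case
    proof (intro impI allI)
     fix t assume s: "s \<in> J" and st: "s < t"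
     have t: "t \<in> J" using J(3) s st by simp
     have st': "{s..t} \<subseteq> J" by (rule Icc[OF s])
     have G: "(LBINT \<tau>:{s..t}. \<phi> \<tau>) <= C * (diss v s t)"
     proof -
      have "(LBINT \<tau>:{s..t}. \<phi> \<tau>) <= (LBINT \<tau>. C * (indicator {s..t} \<tau> *\<^sub>R (norm (grad (v \<tau>)))^2))"
       unfolding set_lebesgue_integral_def
      proof (rule integral_mono_AE)
       show "AE \<tau> in lborel. indicat_real {s..t} \<tau> *\<^sub>R \<phi> \<tau> <= C * (indicat_real {s..t} \<tau> *\<^sub>R (norm (grad (v \<tau>)))^2)"
        using AEle by eventually_elim (use st' in \<open>auto split: split_indicator\<close>)
      qed (use int[OF st'] w(4)[OF st'] in \<open>auto simp: set_integrable_def\<close>)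
      thus ?thesis by (simp add: set_lebesgue_integral_def)
     qed
     have F: "2 * (LBINT \<tau>:{s..t}. cl f \<bullet> v \<tau>) <= \<kappa> * (LBINT \<tau>:{s..t}. \<phi> \<tau>) + (norm (cl f))^2 / \<kappa> * (t - s)"
     proof -
      have ik: "set_integrable lborel {s..t} (%\<tau>. \<kappa> * \<phi> \<tau>)" using int[OF st'] by simp
      have ic: "set_integrable lborel {s..t} (%\<tau>. (norm (cl f))^2 / \<kappa>)"
       unfolding set_integrable_def by (rule borel_integrable_compact) auto
      have "2 * (LBINT \<tau>:{s..t}. cl f \<bullet> v \<tau>) = (LBINT \<tau>:{s..t}. 2 * (cl f \<bullet> v \<tau>))" by simp
      also have "\<dots> <= (LBINT \<tau>:{s..t}. \<kappa> * \<phi> \<tau> + (norm (cl f))^2 / \<kappa>)"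
      proof (rule set_integral_mono)
       show "set_integrable lborel {s..t} (%\<tau>. 2 * (cl f \<bullet> v \<tau>))" using fint[OF st'] by simp
       show "set_integrable lborel {s..t} (%\<tau>. \<kappa> * \<phi> \<tau> + (norm (cl f))^2 / \<kappa>)"
        by (rule set_integral_add(1)[OF ik ic])
       fix \<tau> assume \<tau>: "\<tau> \<in> {s..t}"
       have "2 * (norm (cl f) * norm (v \<tau>)) <= \<kappa> * (norm (v \<tau>))^2 + (norm (cl f))^2 / \<kappa>"
       proof -
        have "0 <= (\<kappa> * norm (v \<tau>) - norm (cl f))^2 / \<kappa>" using \<kappa> by simp
        also have "\<dots> = \<kappa> * (norm (v \<tau>))^2 + (norm (cl f))^2 / \<kappa> - 2 * (norm (cl f) * norm (v \<tau>))"
         using \<kappa> by (simp add: power2_diff field_simps power2_eq_square)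
        finally show ?thesis by simp
       qed
       thus "2 * (cl f \<bullet> v \<tau>) <= \<kappa> * \<phi> \<tau> + (norm (cl f))^2 / \<kappa>"
        using norm_cauchy_schwarz[of "cl f" "v \<tau>"] \<phi>J[of \<tau>] st' \<tau> by auto
      qed
      also have "\<dots> = (LBINT \<tau>:{s..t}. \<kappa> * \<phi> \<tau>) + (LBINT \<tau>:{s..t}. (norm (cl f))^2 / \<kappa>)"
       by (rule set_integral_add(2)[OF ik ic])
      also have "(LBINT \<tau>:{s..t}. (norm (cl f))^2 / \<kappa>) = (norm (cl f))^2 / \<kappa> * (t - s)"
       using st by (simp add: set_lebesgue_integral_def)
      finally show ?thesis by simp
     qed
     have E: "(norm (v t))^2 / 2 + \<nu> * (diss v s t) <= (norm (v s))^2 / 2 + (LBINT \<tau>:{s..t}. cl f \<bullet> v \<tau>)"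
      using elim s t st by blast
     have "\<kappa> * (LBINT \<tau>:{s..t}. \<phi> \<tau>) <= \<nu> * (diss v s t)"
     proof -
      have "\<kappa> * (LBINT \<tau>:{s..t}. \<phi> \<tau>) <= \<kappa> * (C * (diss v s t))"
       using G \<kappa> by (intro mult_left_mono) auto
      thus ?thesis using C(1) by (simp add: \<kappa>_def)
     qed
     moreover have "M * (t - s) = (norm (cl f))^2 / \<kappa> * (t - s) + (t - s)" by (simp add: M_def distrib_right)
     ultimately show "\<phi> t + \<kappa> * (LBINT \<tau>:{s..t}. \<phi> \<tau>) <= \<phi> s + M * (t - s)"
      using E F st \<phi>J[OF s] \<phi>J[OF t] by linarith
    qed
   qed
   show "0 <= \<phi> t" for t by (simp add: \<phi>_def)
  qed
  then obtain T where T: "T \<in> J" "!!t. t \<ge> T ==> \<phi> t <= 2 * M / \<kappa>" by blast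
  have "norm (v t) <= R" if "t \<ge> T" for t
   unfolding R_def using T(2)[OF that] \<phi>J[OF J(3)[OF T(1) that]] by (intro real_le_rsqrt) simp
  thus ?thesis using T(1) by blast
 qed
 thus ?thesis using that R by blast
qed

section \<open>Bounds on the right-hand side and equicontinuity in time\<close>

lemma mop_bound: "w \<in> D ==> \<exists>K\<ge>0. \<forall>i x. norm (mop (pd i w) i x) <= K * norm x"
proof -
 assume w: "w \<in> D"
 have "\<exists>K. \<forall>x. norm (mop (pd i w) i x) <= norm x * K" for i
  using bounded_linear.bounded[OF bounded_linear_mop[OF D_cont1[OF w]]] by blast
 then obtain k where k: "!!i x. norm (mop (pd i w) i x) <= norm x * k i" by metis
 have "norm (mop (pd i w) i x) <= (\<Sum>i\<in>UNIV. \<bar>k i\<bar>) * norm x" for i x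
 proof -
  have "k i <= (\<Sum>i\<in>UNIV. \<bar>k i\<bar>)" using member_le_sum[of i UNIV "%i. \<bar>k i\<bar>"] by force
  hence "norm x * k i <= norm x * (\<Sum>i\<in>UNIV. \<bar>k i\<bar>)" by (intro mult_left_mono) auto
  thus ?thesis using k[of i x] by (simp add: mult.commute)
 qed
 thus ?thesis by (intro exI[of _ "\<Sum>i\<in>UNIV. \<bar>k i\<bar>"]) (auto intro: sum_nonneg)
qed

lemma Qf_lipschitz: "w \<in> D ==> \<exists>K\<ge>0. \<forall>x y. \<bar>Qf w x - Qf w y\<bar> <= K * (norm x + norm y) * norm (x - y)"
proof -
 assume w: "w \<in> D"
 obtain K where K: "K \<ge> 0" "!!i x. norm (mop (pd i w) i x) <= K * norm x" using mop_bound[OF w] by blast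
 have one: "\<bar>x \<bullet> mop (pd i w) i x - y \<bullet> mop (pd i w) i y\<bar> <= K * (norm x + norm y) * norm (x - y)" for i x y
 proof -
  let ?m = "mop (pd i w) i"
  have lin: "?m (x - y) = ?m x - ?m y" using bounded_linear.linear[OF bounded_linear_mop[OF D_cont1[OF w]]] linear_diff by blast
  have "x \<bullet> ?m x - y \<bullet> ?m y = (x - y) \<bullet> ?m x + y \<bullet> ?m (x - y)" unfolding lin by (simp add: inner_diff_left inner_diff_right)
  also have "\<bar>\<dots>\<bar> <= norm (x - y) * norm (?m x) + norm y * norm (?m (x - y))"
   by (rule order_trans[OF abs_triangle_ineq add_mono[OF Cauchy_Schwarz_ineq2 Cauchy_Schwarz_ineq2]])
  also have "\<dots> <= norm (x - y) * (K * norm x) + norm y * (K * norm (x - y))" using K by (intro add_mono mult_left_mono) auto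
  finally show ?thesis by (simp add: algebra_simps)
 qed
 have "\<bar>Qf w x - Qf w y\<bar> <= (3 * K) * (norm x + norm y) * norm (x - y)" for x y
 proof -
  have "Qf w x - Qf w y = (\<Sum>i\<in>UNIV. x \<bullet> mop (pd i w) i x - y \<bullet> mop (pd i w) i y)" by (simp add: Qf_def sum_subtractf)
  also have "\<bar>\<dots>\<bar> <= (\<Sum>i\<in>(UNIV::3 set). K * (norm x + norm y) * norm (x - y))"
   by (rule order_trans[OF sum_abs sum_mono[OF one]])
  finally show ?thesis by simp
 qed
 thus ?thesis using K(1) by (intro exI[of _ "3 * K"]) auto
qed

lemma Ff_bounded: "w \<in> D ==> \<exists>C\<ge>0. \<forall>x. norm x <= R --> \<bar>Ff w x\<bar> <= C"
proof -
 assume w: "w \<in> D"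
 obtain K where K: "K \<ge> 0" "!!x y. \<bar>Qf w x - Qf w y\<bar> <= K * (norm x + norm y) * norm (x - y)" using Qf_lipschitz[OF w] by blast
 have "\<bar>Ff w x\<bar> <= norm (cl f) * norm (cl w) + \<nu> * (\<bar>R\<bar> * norm (lap w)) + K * \<bar>R\<bar> * \<bar>R\<bar>" if x: "norm x <= R" for x
 proof -
  have "Qf w 0 = 0" by (simp add: Qf_def)
  hence "\<bar>Qf w x\<bar> <= K * norm x * norm x" using K(2)[of x 0] by simp
  also have "\<dots> <= K * \<bar>R\<bar> * \<bar>R\<bar>" using x K(1) by (intro mult_mono) auto
  finally have q: "\<bar>Qf w x\<bar> <= K * \<bar>R\<bar> * \<bar>R\<bar>" .
  have "\<bar>x \<bullet> lap w\<bar> <= norm x * norm (lap w)" by (rule Cauchy_Schwarz_ineq2)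
  also have "\<dots> <= \<bar>R\<bar> * norm (lap w)" using x by (intro mult_right_mono) auto
  finally have l: "\<nu> * \<bar>x \<bullet> lap w\<bar> <= \<nu> * (\<bar>R\<bar> * norm (lap w))" using \<nu> by (intro mult_left_mono) auto
  have "\<bar>Ff w x\<bar> <= \<bar>cl f \<bullet> cl w\<bar> + \<nu> * \<bar>x \<bullet> lap w\<bar> + \<bar>Qf w x\<bar>"
  proof -
   have "\<bar>\<nu> * (x \<bullet> lap w)\<bar> = \<nu> * \<bar>x \<bullet> lap w\<bar>" using \<nu> by (simp add: abs_mult)
   thus ?thesis unfolding Ff_def by linarith
  qed
  thus ?thesis using q l Cauchy_Schwarz_ineq2[of "cl f" "cl w"] by linarith
 qed
 thus ?thesis using K(1) \<nu> by (intro exI[of _ "norm (cl f) * norm (cl w) + \<nu> * (\<bar>R\<bar> * norm (lap w)) + K * \<bar>R\<bar> * \<bar>R\<bar>"]) auto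
qed

text \<open>The weak time derivative is \<open>Ff\<close>, which is bounded on balls. One constant
  serves all intervals and all solutions in the ball: this is the equicontinuity behind
  compactness.\<close>

lemma wsol_lipschitz:
 assumes w: "w \<in> D"
 shows "\<exists>C\<ge>0. \<forall>J v. open J --> is_interval J --> wsol J v --> (\<forall>t\<in>J. norm (v t) <= R) -->
   (\<forall>s\<in>J. \<forall>t\<in>J. \<bar>v t \<bullet> cl w - v s \<bullet> cl w\<bar> <= C * \<bar>t - s\<bar>)"
proof -
 obtain C where C: "C \<ge> 0" "!!x. norm x <= R ==> \<bar>Ff w x\<bar> <= C" using Ff_bounded[OF w] by blast
 have "\<bar>v t \<bullet> cl w - v s \<bullet> cl w\<bar> <= C * \<bar>t - s\<bar>"
  if J: "open J" "is_interval J" and v: "wsol J v" "\<forall>t\<in>J. norm (v t) <= R" and st: "s \<in> J" "t \<in> J" for J v s t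
 proof -
  have lt: "\<bar>v t \<bullet> cl w - v s \<bullet> cl w\<bar> <= C * (t - s)" if "s \<in> J" "t \<in> J" "s < t" for s t
   by (rule weak_derivative_bound_imp_lipschitz[OF J wsolD(2)[OF v(1)] _ C(1) wsolD(5)[OF v(1) w] that])
    (use v(2) C(2) in blast)
  show ?thesis using lt[of s t] lt[of t s] st by (cases s t rule: linorder_cases) (auto simp: abs_minus_commute)
 qed
 thus ?thesis using C(1) by blast
qed

end

lemma convergent_of_approx:
 fixes a :: "nat => real"
 assumes "!!e. e > 0 ==> \<exists>b. convergent b \<and> (EV k. \<bar>a k - b k\<bar> <= e)"
 shows "convergent a"
proof -
 have "Cauchy a"
 proof (rule CauchyI)
  fix e :: real assume e: "0 < e"
  obtain b where b: "convergent b" "EV k. \<bar>a k - b k\<bar> <= e / 4" using assms[of "e/4"] e by auto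
  obtain N where N: "!!k. k \<ge> N ==> \<bar>a k - b k\<bar> <= e / 4" using b(2) by (auto simp: eventually_sequentially)
  obtain N' where N': "!!m n. m \<ge> N' ==> n \<ge> N' ==> norm (b m - b n) < e / 4"
   using CauchyD[OF convergent_Cauchy[OF b(1)], of "e/4"] e by auto
  have "norm (a m - a n) < e" if "m \<ge> max N N'" "n \<ge> max N N'" for m n
  proof -
   have "\<bar>a m - b m\<bar> <= e / 4" "\<bar>a n - b n\<bar> <= e / 4" "\<bar>b m - b n\<bar> < e / 4"
    using N[of m] N[of n] N'[of m n] that by auto
   thus ?thesis unfolding real_norm_def using e by linarith
  qed
  thus "\<exists>M. \<forall>m\<ge>M. \<forall>n\<ge>M. norm (a m - a n) < e" by blast
 qed
 thus ?thesis by (simp add: Cauchy_convergent_iff)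
qed

lemma continuous_on_of_approx:
 fixes g :: "real => real"
 assumes "!!e. e > 0 ==> \<exists>h. continuous_on J h \<and> (\<forall>t\<in>J. \<bar>g t - h t\<bar> <= e)"
 shows "continuous_on J g"
 unfolding continuous_on_iff
proof (intro ballI allI impI)
 fix t and e :: real assume t: "t \<in> J" and e: "0 < e"
 obtain h where h: "continuous_on J h" "!!t. t \<in> J ==> \<bar>g t - h t\<bar> <= e / 4" using assms[of "e/4"] e by auto
 obtain d where d: "d > 0" "!!s. s \<in> J ==> dist s t < d ==> dist (h s) (h t) < e / 4"
  using h(1)[unfolded continuous_on_iff, rule_format, OF t, of "e/4"] e by auto
 have "dist (g s) (g t) < e" if "s \<in> J" "dist s t < d" for s
  using d(2)[OF that] h(2)[OF that(1)] h(2)[OF t] e unfolding dist_real_def by linarith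
 thus "\<exists>d>0. \<forall>s\<in>J. dist s t < d --> dist (g s) (g t) < e" using d(1) by blast
qed

text \<open>Countably many rational intervals exhaust \<open>J\<close>, so the exceptional set may
  depend on the interval.\<close>

lemma AE_interval_exhaust:
 fixes J :: "real set"
 assumes J: "open J" and "!!p q. {p..q} \<subseteq> J ==> AE t in lborel. t \<in> {p..q} --> P t"
 shows "AE t in lborel. t \<in> J --> P t"
proof -
 have "AE t in lborel. \<forall>p q. {real_of_rat p..real_of_rat q} \<subseteq> J --> t \<in> {real_of_rat p..real_of_rat q} --> P t"
  unfolding AE_all_countable
 proof (intro allI)
  fix p q :: rat
  show "AE t in lborel. {real_of_rat p..real_of_rat q} \<subseteq> J --> t \<in> {real_of_rat p..real_of_rat q} --> P t"
   using assms(2)[of "of_rat p" "of_rat q"] by (cases "{real_of_rat p..real_of_rat q} \<subseteq> J") auto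
 qed
 thus ?thesis
 proof eventually_elim
  case (elim t)
  show ?case
  proof
   assume "t \<in> J"
   then obtain d where d: "d > 0" "ball t d \<subseteq> J" using J open_contains_ball by blast
   obtain p where p: "t - d < real_of_rat p" "real_of_rat p < t" using of_rat_dense[of "t - d" t] d by auto
   obtain q where q: "t < real_of_rat q" "real_of_rat q < t + d" using of_rat_dense[of t "t + d"] d by auto
   have "{real_of_rat p..real_of_rat q} \<subseteq> ball t d" using p q by (auto simp: dist_real_def)
   thus "P t" using elim d p q by (meson atLeastAtMost_iff less_imp_le subset_trans)
  qed
 qed
qed

context nse_domain
begin

section \<open>Weak limits of bounded families of solutions\<close>

text \<open>The intervals \<open>K k\<close> may vary and need only contain each compact subinterval
  of \<open>J\<close> in the end. Constant intervals will give closedness of sets of initial states,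
  growing half-lines will give complete solutions.\<close>

definition approx_seq :: "real => real set => (nat => real set) => (nat => real => l2) => bool" where
 "approx_seq R J K u \<longleftrightarrow> (\<forall>k. open (K k) \<and> is_interval (K k) \<and> wsol (K k) (u k) \<and> (\<forall>t\<in>K k. norm (u k t) <= R)) \<and>
   (\<forall>p q. {p..q} \<subseteq> J --> (EV k. {p..q} \<subseteq> K k))"

lemma approx_seqD:
 assumes "approx_seq R J K u"
 shows "open (K k)" "is_interval (K k)" "wsol (K k) (u k)" "t \<in> K k ==> norm (u k t) <= R"
  "{p..q} \<subseteq> J ==> EV k. {p..q} \<subseteq> K k"
  "t \<in> J ==> EV k. t \<in> K k"
proof -
 show "open (K k)" "is_interval (K k)" "wsol (K k) (u k)" "t \<in> K k ==> norm (u k t) <= R" "{p..q} \<subseteq> J ==> EV k. {p..q} \<subseteq> K k"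
  using assms unfolding approx_seq_def by blast+
 have "{t..t} \<subseteq> J --> (EV k. {t..t} \<subseteq> K k)" using assms unfolding approx_seq_def by blast
 thus "t \<in> J ==> EV k. t \<in> K k" by simp
qed

lemma approx_seq_subseq:
 assumes "approx_seq R J K u" "strict_mono (s::nat=>nat)"
 shows "approx_seq R J (%k. K (s k)) (%k. u (s k))"
proof -
 have "EV k. P (s k)" if "EV k. P k" for P
  using that assms(2) filterlim_subseq by (auto simp: filterlim_iff)
 thus ?thesis using assms(1) unfolding approx_seq_def by blast
qed

lemma approx_seq_lipschitz:
 assumes u: "approx_seq R J K u" and w: "w \<in> D"
 shows "\<exists>C\<ge>0. \<forall>k. \<forall>s\<in>K k. \<forall>t\<in>K k. \<bar>u k t \<bullet> cl w - u k s \<bullet> cl w\<bar> <= C * \<bar>t - s\<bar>"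
proof -
 note ex = wsol_lipschitz[OF w, of R]
 from ex obtain C where "C \<ge> 0 \<and> (\<forall>J v. open J --> is_interval J --> wsol J v --> (\<forall>t\<in>J. norm (v t) <= R) -->
   (\<forall>s\<in>J. \<forall>t\<in>J. \<bar>v t \<bullet> cl w - v s \<bullet> cl w\<bar> <= C * \<bar>t - s\<bar>))" by (rule exE)
 note C = this[THEN conjunct1] this[THEN conjunct2, rule_format]
 have "\<bar>u k t \<bullet> cl w - u k s \<bullet> cl w\<bar> <= C * \<bar>t - s\<bar>" if "s \<in> K k" "t \<in> K k" for k s t
  by (rule C(2)[OF approx_seqD(1-3)[OF u] _ that]) (rule approx_seqD(4)[OF u])
 thus ?thesis using C(1) by blast
qed

text \<open>Arzela-Ascoli by hand: a diagonal subsequence for rational times and countably many test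
  classes, then all times by the uniform Lipschitz bound, all of \<open>HH\<close> by density, and
  all of \<open>L^2\<close> by projection onto \<open>HH\<close>.\<close>

lemma approx_seq_weak_subseq:
 assumes J: "open J" and u: "approx_seq R J K u"
 obtains r v where "strict_mono (r::nat=>nat)" "!!t y. t \<in> J ==> (%k. u (r k) t \<bullet> y) ----> v t \<bullet> y"
proof -
 note uD = approx_seqD[OF u]
 obtain T where T: "countable T" "T \<subseteq> cl ` D" "cl ` D \<subseteq> closure T" using separable by blast
 define S where "S = (J \<inter> \<rat>) \<times> T"
 have "countable S" unfolding S_def using T(1) countable_rat by (intro countable_SIGMA countable_Int2) auto
 \<comment> \<open>Division by \<open>norm (snd z) + 1\<close> gives one bound for all test classes,
   as the extraction of the subsequence wants; 0 stands in for times not yet in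
   \<open>K n\<close>.\<close>
 define h where "h n z = (if fst z \<in> K n then (u n (fst z) \<bullet> snd z) / (norm (snd z) + 1) else 0)" for n z
 have hb: "norm (h n z) <= \<bar>R\<bar>" for n z
 proof (cases "fst z \<in> K n")
  case True
  have "\<bar>u n (fst z) \<bullet> snd z\<bar> <= norm (u n (fst z)) * norm (snd z)" by (rule Cauchy_Schwarz_ineq2)
  also have "\<dots> <= \<bar>R\<bar> * (norm (snd z) + 1)" using uD(4)[OF True] by (intro mult_mono) auto
  finally show ?thesis using True by (simp add: h_def divide_le_eq add_nonneg_pos abs_of_nonneg)
 qed (simp add: h_def)
 obtain r where r: "strict_mono (r::nat=>nat)" "!!z. z \<in> S ==> \<exists>l. (%n. h (r n) z) ----> l"
  using function_convergent_subsequence[OF \<open>countable S\<close>, of h "\<bar>R\<bar>"] hb by blast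
 note sD = approx_seqD[OF approx_seq_subseq[OF u r(1)]]
 have c1: "convergent (%k. u (r k) q \<bullet> e)" if q: "q \<in> J" "q \<in> \<rat>" and e: "e \<in> T" for q e
 proof -
  obtain l where "(%n. h (r n) (q, e)) ----> l" using r(2)[of "(q, e)"] q e by (auto simp: S_def)
  hence hl: "(%n. h (r n) (q, e) * (norm e + 1)) ----> l * (norm e + 1)" by (intro tendsto_intros)
  have "EV n. h (r n) (q, e) * (norm e + 1) = u (r n) q \<bullet> e"
   using sD(6)[OF q(1)]
  proof eventually_elim
   case (elim n)
   have "norm e + 1 \<noteq> 0" by (metis add_nonneg_pos norm_ge_zero order_less_irrefl zero_less_one)
   thus ?case using elim by (simp add: h_def)
  qed
  from Lim_transform_eventually[OF hl this] show ?thesis by (rule convergentI)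
 qed
 have c2: "convergent (%k. u (r k) t \<bullet> e)" if t: "t \<in> J" and e: "e \<in> T" for t e
 proof (rule convergent_of_approx)
  fix \<epsilon> :: real assume \<epsilon>: "\<epsilon> > 0"
  obtain w where w: "w \<in> D" "e = cl w" using T(2) e by blast
  obtain C where C: "C \<ge> 0" "!!k s t. s \<in> K k ==> t \<in> K k ==> \<bar>u k t \<bullet> cl w - u k s \<bullet> cl w\<bar> <= C * \<bar>t - s\<bar>"
   using approx_seq_lipschitz[OF u w(1)] by blast
  obtain d where d: "d > 0" "ball t d \<subseteq> J" using J t open_contains_ball by blast
  \<comment> \<open>Close enough for the Lipschitz bound; \<open>C + 1\<close> also covers
    \<open>C = 0\<close>.\<close>
  define d' where "d' = min d (\<epsilon> / (C + 1))"
  have d': "d' > 0" using d \<epsilon> C(1) by (simp add: d'_def)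
  obtain q where q: "q \<in> \<rat>" "t < q" "q < t + d'" using Rats_dense_in_real[of t "t + d'"] d' by auto
  have qJ: "q \<in> J" using d q by (auto simp: d'_def dist_real_def)
  have "EV k. \<bar>u (r k) t \<bullet> e - u (r k) q \<bullet> e\<bar> <= \<epsilon>"
   using sD(6)[OF t] sD(6)[OF qJ]
  proof eventually_elim
   case (elim k)
   have "\<bar>u (r k) t \<bullet> cl w - u (r k) q \<bullet> cl w\<bar> <= C * \<bar>t - q\<bar>"
    by (rule C(2)[OF elim(2,1)])
   also have "\<dots> <= (C + 1) * (\<epsilon> / (C + 1))" using q C(1) by (intro mult_mono) (auto simp: d'_def)
   also have "\<dots> = \<epsilon>" using C(1) by simp
   finally show ?case by (simp add: w)
  qed
  thus "\<exists>b. convergent b \<and> (EV k. \<bar>u (r k) t \<bullet> e - b k\<bar> <= \<epsilon>)" using c1[OF qJ q(1) e] by blast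
 qed
 have c3: "convergent (%k. u (r k) t \<bullet> y)" if t: "t \<in> J" and y: "y \<in> HH" for t y
 proof (rule convergent_of_approx)
  fix \<epsilon> :: real assume \<epsilon>: "\<epsilon> > 0"
  have "y \<in> closure T" using y T(3) closure_minimal[OF T(3) closed_closure] by (auto simp: HH_def)
  moreover have "\<epsilon> / (\<bar>R\<bar> + 1) > 0" using \<epsilon> by simp
  ultimately obtain e where e: "e \<in> T" "dist e y < \<epsilon> / (\<bar>R\<bar> + 1)" by (meson closure_approachable)
  have "EV k. \<bar>u (r k) t \<bullet> y - u (r k) t \<bullet> e\<bar> <= \<epsilon>"
   using sD(6)[OF t]
  proof eventually_elim
   case (elim k)
   have "\<bar>u (r k) t \<bullet> y - u (r k) t \<bullet> e\<bar> = \<bar>u (r k) t \<bullet> (y - e)\<bar>" by (simp add: inner_diff_right)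
   also have "\<dots> <= norm (u (r k) t) * norm (y - e)" by (rule Cauchy_Schwarz_ineq2)
   also have "\<dots> <= (\<bar>R\<bar> + 1) * (\<epsilon> / (\<bar>R\<bar> + 1))"
    using sD(4)[OF elim] e(2) \<epsilon> by (intro mult_mono) (auto simp: dist_norm norm_minus_commute)
   also have "\<dots> = \<epsilon>" by simp
   finally show ?case .
  qed
  thus "\<exists>b. convergent b \<and> (EV k. \<bar>u (r k) t \<bullet> y - b k\<bar> <= \<epsilon>)" using c2[OF t e(1)] by blast
 qed
 have lim: "\<exists>x. \<forall>y. (%k. u (r k) t \<bullet> y) ----> x \<bullet> y" if t: "t \<in> J" for t
 proof -
  \<comment> \<open>A uniformly bounded sequence for every index; its weak cluster point is the
    limit because all inner products converge.\<close>
  define z where "z k = (if t \<in> K (r k) then u (r k) t else 0)" for k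
  have zb: "norm (z k) <= \<bar>R\<bar>" for k unfolding z_def using sD(4)[of t k] by auto
  obtain x where x: "!!w l. (%n. z n \<bullet> w) ----> l ==> x \<bullet> w = l"
   by (rule bounded_weak_cluster[of z "\<bar>R\<bar>"]) (use zb in auto)
  have ev: "EV k. z k \<bullet> y = u (r k) t \<bullet> y" for y
   using sD(6)[OF t] by eventually_elim (simp add: z_def)
  have "(%k. u (r k) t \<bullet> y) ----> x \<bullet> y" for y
  proof -
   obtain p where p: "p \<in> HH" "!!s. s \<in> HH ==> s \<bullet> y = s \<bullet> p"
    using closed_subspace_projection[OF closed_HH subspace_HH] by metis
   obtain l where l: "(%k. u (r k) t \<bullet> p) ----> l" using c3[OF t p(1)] by (auto simp: convergent_def)
   have "EV k. u (r k) t \<bullet> p = u (r k) t \<bullet> y"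
    using sD(6)[OF t]
   proof eventually_elim
    case (elim k)
    show ?case by (rule p(2)[OF wsolD(1)[OF sD(3) elim], symmetric])
   qed
   from Lim_transform_eventually[OF l this] have l': "(%k. u (r k) t \<bullet> y) ----> l" .
   have "EV k. u (r k) t \<bullet> y = z k \<bullet> y" using ev[of y] by eventually_elim simp
   from Lim_transform_eventually[OF l' this] have "x \<bullet> y = l" by (rule x)
   thus ?thesis using l' by simp
  qed
  thus ?thesis by blast
 qed
 hence "\<forall>t. \<exists>x. t \<in> J --> (\<forall>y. (%k. u (r k) t \<bullet> y) ----> x \<bullet> y)" by blast
 then obtain v where "\<forall>t. t \<in> J --> (\<forall>y. (%k. u (r k) t \<bullet> y) ----> v t \<bullet> y)" by (rule choice[THEN exE])
 thus ?thesis using that[OF r(1), of v] by blast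
qed

definition weak_lim :: "real set => (nat => real => l2) => (real => l2) => bool" where
 "weak_lim J u v \<longleftrightarrow> (\<forall>t\<in>J. \<forall>y. (%k. u k t \<bullet> y) ----> v t \<bullet> y)"

lemma weak_limD: "weak_lim J u v ==> t \<in> J ==> (%k. u k t \<bullet> y) ----> v t \<bullet> y"
 by (simp add: weak_lim_def)

lemma weak_lim_subseq: "weak_lim J u v ==> strict_mono (s::nat=>nat) ==> weak_lim J (%k. u (s k)) v"
 unfolding weak_lim_def using LIMSEQ_subseq_LIMSEQ unfolding o_def by blast

context
 fixes R :: real and J :: "real set" and K and u and v
 assumes J: "open J" "is_interval J" and u: "approx_seq R J K u" and uv: "weak_lim J u v" and R0: "R \<ge> 0"
begin

lemma lim_HH: "t \<in> J ==> v t \<in> HH"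
 and lim_norm: "t \<in> J ==> norm (v t) <= R"
proof -
 assume t: "t \<in> J"
 show "v t \<in> HH"
 proof (rule closed_convex_weakly_closed[OF closed_HH subspace_imp_convex[OF subspace_HH], of sequentially "%k. u k t"])
  show "EV k. u k t \<in> HH"
   using approx_seqD(6)[OF u t] by eventually_elim (rule wsolD(1)[OF approx_seqD(3)[OF u]])
 qed (use weak_limD[OF uv t] in auto)
 have "v t \<in> cball 0 R"
 proof (rule closed_convex_weakly_closed[OF closed_cball convex_cball, of sequentially "%k. u k t"])
  show "EV k. u k t \<in> cball 0 R"
   using approx_seqD(6)[OF u t] by eventually_elim (use approx_seqD(4)[OF u] in simp)
 qed (use weak_limD[OF uv t] in auto)
 thus "norm (v t) <= R" by simp
qed

text \<open>The Lipschitz bounds against test fields pass to the limit; for other \<open>y\<close>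
  in \<open>HH\<close> the function is a uniform limit of these, thanks to the bound
  \<open>R\<close>.\<close>

lemma lim_cont: "continuous_on J (%t. v t \<bullet> y)"
proof (rule weak_cont_HH[OF lim_HH])
 fix y assume y: "y \<in> HH"
 show "continuous_on J (%t. v t \<bullet> y)"
 proof (rule continuous_on_of_approx)
  fix \<epsilon> :: real assume \<epsilon>: "\<epsilon> > 0"
  hence "\<epsilon> / (R + 1) > 0" using R0 by simp
  then obtain z where "z \<in> cl ` D" "dist z y < \<epsilon> / (R + 1)" using y unfolding HH_def by (meson closure_approachable)
  then obtain w where w: "w \<in> D" "dist (cl w) y < \<epsilon> / (R + 1)" by blast
  obtain C where C: "C \<ge> 0" "!!k s t. s \<in> K k ==> t \<in> K k ==> \<bar>u k t \<bullet> cl w - u k s \<bullet> cl w\<bar> <= C * \<bar>t - s\<bar>"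
   using approx_seq_lipschitz[OF u w(1)] by blast
  have lip: "\<bar>v t \<bullet> cl w - v s \<bullet> cl w\<bar> <= C * \<bar>t - s\<bar>" if s: "s \<in> J" and t: "t \<in> J" for s t
  proof (rule tendsto_upperbound)
   show "(%k. \<bar>u k t \<bullet> cl w - u k s \<bullet> cl w\<bar>) ----> \<bar>v t \<bullet> cl w - v s \<bullet> cl w\<bar>"
    by (intro tendsto_intros weak_limD[OF uv] s t)
   show "EV k. \<bar>u k t \<bullet> cl w - u k s \<bullet> cl w\<bar> <= C * \<bar>t - s\<bar>"
    using approx_seqD(6)[OF u s] approx_seqD(6)[OF u t]
    by eventually_elim (rule C(2))
  qed simp
  have "C-lipschitz_on J (%t. v t \<bullet> cl w)"
   by (rule lipschitz_onI) (use lip C(1) in \<open>auto simp: dist_real_def\<close>)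
  hence "continuous_on J (%t. v t \<bullet> cl w)" by (rule lipschitz_on_continuous_on)
  moreover have "\<bar>v t \<bullet> y - v t \<bullet> cl w\<bar> <= \<epsilon>" if t: "t \<in> J" for t
  proof -
   have "\<bar>v t \<bullet> y - v t \<bullet> cl w\<bar> = \<bar>v t \<bullet> (y - cl w)\<bar>" by (simp add: inner_diff_right)
   also have "\<dots> <= norm (v t) * norm (y - cl w)" by (rule Cauchy_Schwarz_ineq2)
   also have "\<dots> <= (R + 1) * (\<epsilon> / (R + 1))"
    using lim_norm[OF t] w(2) \<epsilon> R0 by (intro mult_mono) (auto simp: dist_norm norm_minus_commute)
   also have "\<dots> = \<epsilon>" using R0 by simp
   finally show ?thesis .
  qed
  ultimately show "\<exists>h. continuous_on J h \<and> (\<forall>t\<in>J. \<bar>v t \<bullet> y - h t\<bar> <= \<epsilon>)" by blast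
 qed
qed

lemma AE_VV_all: "AE t in lborel. \<forall>k. t \<in> K k --> u k t \<in> VV"
 unfolding AE_all_countable using wsolD(3)[OF approx_seqD(3)[OF u]] by blast

text \<open>The lower limit may be approached along a subsequence only; restricting the filter to
  the indices with small gradient replaces its extraction.\<close>

lemma lim_grad_lsc:
 assumes t: "t \<in> J" and VV: "\<forall>k. t \<in> K k --> u k t \<in> VV"
 defines "l \<equiv> liminf (%k. ennreal ((norm (grad (u k t)))^2))"
 shows "l < \<infinity> ==> v t \<in> VV" "ennreal ((norm (grad (v t)))^2) <= l"
proof -
 have main: "v t \<in> VV \<and> norm (grad (v t)) <= c" if c: "c \<ge> 0" "l < ennreal (c\<^sup>2)" for c
 proof -
  have fr: "\<exists>\<^sub>F k in sequentially. norm (grad (u k t)) <= c"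
  proof (rule ccontr)
   assume "\<not> (\<exists>\<^sub>F k in sequentially. norm (grad (u k t)) <= c)"
   hence "EV k. ennreal (c\<^sup>2) <= ennreal ((norm (grad (u k t)))^2)"
    unfolding not_frequently by eventually_elim (use c(1) in \<open>auto intro!: ennreal_leI power_mono\<close>)
   hence "ennreal (c\<^sup>2) <= l" unfolding l_def by (intro Liminf_bounded)
   thus False using c(2) by simp
  qed
  define F where "F = inf sequentially (principal {k. norm (grad (u k t)) <= c})"
  have F: "F \<noteq> bot" using fr unfolding F_def trivial_limit_def eventually_inf_principal frequently_def by simp
  show ?thesis
  proof (rule VV_weakly_closed[OF F])
   have "\<forall>\<^sub>F k in F. norm (grad (u k t)) <= c" unfolding F_def eventually_inf_principal by simp
   moreover have "\<forall>\<^sub>F k in F. t \<in> K k" using approx_seqD(6)[OF u t] unfolding F_def eventually_inf_principal by (rule eventually_mono) simp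
   ultimately show "\<forall>\<^sub>F k in F. u k t \<in> VV \<and> norm (grad (u k t)) <= c" by eventually_elim (use VV in blast)
   show "((%k. u k t \<bullet> w) \<longlongrightarrow> v t \<bullet> w) F" for w
    unfolding F_def by (rule tendsto_mono[OF inf_le1 weak_limD[OF uv t]])
  qed
 qed
 show "v t \<in> VV" if lf: "l < \<infinity>"
 proof -
  obtain m where m: "l = ennreal m" "m \<ge> 0" using lf by (cases l) auto
  have "l < ennreal ((m + 1)^2)"
  proof -
   have "(m + 1)^2 = m * m + 2 * m + 1" by (simp add: power2_eq_square algebra_simps)
   hence "m < (m + 1)^2" using m(2) mult_nonneg_nonneg[OF m(2) m(2)] by linarith
   thus ?thesis using m by (simp add: ennreal_lessI)
  qed
  thus ?thesis using main[of "m + 1"] m(2) by simp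
 qed
 show "ennreal ((norm (grad (v t)))^2) <= l"
 proof (rule dense_ge)
  fix z assume z: "l < z"
  show "ennreal ((norm (grad (v t)))^2) <= z"
  proof (cases z)
   case (real c)
   hence "l < ennreal ((sqrt c)^2)" using z by simp
   hence "norm (grad (v t)) <= sqrt c" using main[of "sqrt c"] real by simp
   hence "(norm (grad (v t)))^2 <= (sqrt c)^2" by (intro power_mono) auto
   thus ?thesis using real by (simp add: ennreal_leI)
  qed simp
 qed
qed

lemma u_meas: "{p..q} \<subseteq> K k ==> (%s. indicator {p..q} s * (norm (grad (u k s)))^2) \<in> borel_measurable borel"
 by (rule grad_measurable_Icc[OF approx_seqD(1)[OF u] wsolD(2)[OF approx_seqD(3)[OF u]]])

text \<open>The bounds \<open>M k\<close> vary with \<open>k\<close> because in the energy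
  inequality they contain quantities of \<open>u k\<close> itself.\<close>

lemma lim_fatou:
 assumes pq: "{p..q} \<subseteq> J" and M: "M ----> m"
  and b: "EV k. (diss (u k) p q) <= M k"
 shows "(\<integral>\<^sup>+s. indicator {p..q} s * ennreal ((norm (grad (v s)))^2) \<partial>lborel) <= ennreal m"
  and "AE s in lborel. s \<in> {p..q} --> v s \<in> VV"
proof -
 \<comment> \<open>Set to 0 while the interval is not inside \<open>K k\<close>, so that every
   \<open>F k\<close> is measurable.\<close>
 define F where "F k s = (if {p..q} \<subseteq> K k then ennreal (indicator {p..q} s * (norm (grad (u k s)))^2) else 0)" for k s
 have [measurable]: "F k \<in> borel_measurable lborel" for k
 proof (cases "{p..q} \<subseteq> K k")
  case True
  have "(%s. ennreal (indicator {p..q} s * (norm (grad (u k s)))^2)) \<in> borel_measurable borel"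
   using u_meas[OF True] by measurable
  thus ?thesis using True by (simp add: F_def[abs_def])
 qed (simp add: F_def[abs_def])
 have FM: "EV k. (\<integral>\<^sup>+s. F k s \<partial>lborel) <= ennreal (M k)"
  using b approx_seqD(5)[OF u pq]
 proof eventually_elim
  case (elim k)
  have i: "integrable lborel (%s. indicator {p..q} s * (norm (grad (u k s)))^2)"
   using wsolD(4)[OF approx_seqD(3)[OF u] elim(2)] by (simp add: set_integrable_def)
  have "(\<integral>\<^sup>+s. F k s \<partial>lborel) = ennreal (diss (u k) p q)"
   unfolding F_def set_lebesgue_integral_def using elim(2) i by (simp add: nn_integral_eq_integral)
  thus ?case using elim(1) by (simp add: ennreal_leI)
 qed
 have fat: "(\<integral>\<^sup>+s. liminf (%k. F k s) \<partial>lborel) <= ennreal m"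
 proof -
  have "(\<integral>\<^sup>+s. liminf (%k. F k s) \<partial>lborel) <= liminf (%k. \<integral>\<^sup>+s. F k s \<partial>lborel)" by (intro nn_integral_liminf) simp
  also have "\<dots> <= liminf (%k. ennreal (M k))" by (rule Liminf_mono[OF FM])
  also have "\<dots> = ennreal m" using tendsto_ennrealI[OF M] by (metis lim_imp_Liminf sequentially_bot)
  finally show ?thesis .
 qed
 have Fl: "liminf (%k. F k s) = liminf (%k. ennreal ((norm (grad (u k s)))^2))" if s: "s \<in> {p..q}" for s
  by (rule Liminf_eq) (use approx_seqD(5)[OF u pq] s in \<open>auto elim!: eventually_mono simp: F_def\<close>)
 have "AE s in lborel. indicator {p..q} s * ennreal ((norm (grad (v s)))^2) <= liminf (%k. F k s)"
  using AE_VV_all by eventually_elim (use lim_grad_lsc(2) Fl pq in \<open>auto split: split_indicator\<close>)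
 thus "(\<integral>\<^sup>+s. indicator {p..q} s * ennreal ((norm (grad (v s)))^2) \<partial>lborel) <= ennreal m"
  by (rule order_trans[OF nn_integral_mono_AE fat])
 have "AE s in lborel. liminf (%k. F k s) \<noteq> \<infinity>"
  using fat by (intro nn_integral_PInf_AE) (auto simp: top_unique)
 thus "AE s in lborel. s \<in> {p..q} --> v s \<in> VV"
  using AE_VV_all
 proof eventually_elim
  case (elim s)
  show ?case
  proof
   assume s: "s \<in> {p..q}"
   hence "liminf (%k. ennreal ((norm (grad (u k s)))^2)) < \<infinity>" using elim(1) Fl[OF s] by (simp add: less_top)
   thus "v s \<in> VV" using lim_grad_lsc(1)[of s] s pq elim(2) by blast
  qed
 qed
qed

lemma u_inner_int: "{p..q} \<subseteq> K k ==> set_integrable lborel {p..q} (%s. cl f \<bullet> u k s)"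
 unfolding set_integrable_def using continuous_on_subset[OF wsolD(2)[OF approx_seqD(3)[OF u], of k "cl f"]]
 by (intro borel_integrable_compact) (auto simp: inner_commute)

text \<open>The energy inequality is available only from almost every start, so it is started
  slightly to the left of \<open>p\<close>, for which the open set \<open>J\<close> leaves
  room.\<close>

lemma u_energy_bound:
 assumes pq: "{p..q} \<subseteq> J" "p <= q"
 obtains M where "M \<ge> 0" "EV k. (diss (u k) p q) <= M"
proof -
 have "p \<in> J" using pq by auto
 then obtain d where d: "d > 0" "ball p d \<subseteq> J" using J(1) open_contains_ball by blast
 define p' where "p' = p - d / 2"
 have p': "p' < p" using d by (simp add: p'_def)
 have p'J: "p' \<in> J" using d by (auto simp: p'_def dist_real_def)
 have sub: "{p'..q} \<subseteq> J" using J(2) p'J pq unfolding is_interval_1 by (meson atLeastAtMost_iff order_refl subsetI subsetD)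
 define M where "M = (R\<^sup>2 / 2 + (q - p') * (norm (cl f) * R)) / \<nu>"
 have "M \<ge> 0" using R0 \<nu> p' pq(2) by (simp add: M_def)
 moreover have "EV k. (diss (u k) p q) <= M"
  using approx_seqD(5)[OF u sub]
 proof eventually_elim
  case (elim k)
  note w = wsolD[OF approx_seqD(3)[OF u, of k]]
  have "\<not> (AE s in lborel. s \<notin> {p'<..<p})"
   using p' by (subst AE_iff_null_sets[symmetric]) (auto simp: null_sets_def)
  then obtain t' where t': "t' \<in> {p'<..<p}" "t' \<in> K k --> (\<forall>t\<in>K k. t' < t -->
    energy_le (u k) t' t)"
   using w(6) by (smt (verit, best) eventually_mono)
  have tK: "t' \<in> K k" "q \<in> K k" "t' < q" "{t'..q} \<subseteq> K k" using elim t' pq(2) p' by auto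
  have E: "(norm (u k q))^2 / 2 + \<nu> * (diss (u k) t' q) <= (norm (u k t'))^2 / 2 + (LBINT s:{t'..q}. cl f \<bullet> u k s)"
   using t'(2) tK by blast
  have "(LBINT s:{t'..q}. cl f \<bullet> u k s) <= (LBINT s:{t'..q}. norm (cl f) * R)"
  proof (rule set_integral_mono[OF u_inner_int[OF tK(4)]])
   show "set_integrable lborel {t'..q} (%s. norm (cl f) * R)" unfolding set_integrable_def by (rule borel_integrable_compact) auto
   fix s assume "s \<in> {t'..q}"
   hence "norm (u k s) <= R" using tK(4) approx_seqD(4)[OF u] by blast
   hence "norm (cl f) * norm (u k s) <= norm (cl f) * R" by (intro mult_left_mono) auto
   thus "cl f \<bullet> u k s <= norm (cl f) * R" using norm_cauchy_schwarz[of "cl f" "u k s"] by linarith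
  qed
  also have "\<dots> = (q - t') * (norm (cl f) * R)" using tK(3) by (simp add: set_lebesgue_integral_def)
  also have "\<dots> <= (q - p') * (norm (cl f) * R)" using t'(1) R0 by (intro mult_right_mono) auto
  finally have F: "(LBINT s:{t'..q}. cl f \<bullet> u k s) <= (q - p') * (norm (cl f) * R)" .
  have "(norm (u k t'))^2 <= R\<^sup>2" using approx_seqD(4)[OF u tK(1)] by (intro power_mono) auto
  hence "\<nu> * (diss (u k) t' q) <= R\<^sup>2 / 2 + (q - p') * (norm (cl f) * R)"
   using E F zero_le_power2[of "norm (u k q)"] by linarith
  hence "(diss (u k) t' q) <= M" using \<nu> by (simp add: M_def pos_le_divide_eq mult.commute)
  moreover have "(diss (u k) p q) <= (diss (u k) t' q)"
   unfolding set_lebesgue_integral_def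
  proof (rule integral_mono)
   have "{p..q} \<subseteq> K k" using elim p' by auto
   thus "integrable lborel (%s. indicat_real {p..q} s *\<^sub>R (norm (grad (u k s)))^2)" using w(4) by (simp add: set_integrable_def)
   show "integrable lborel (%s. indicat_real {t'..q} s *\<^sub>R (norm (grad (u k s)))^2)" using w(4)[OF tK(4)] by (simp add: set_integrable_def)
   show "indicat_real {p..q} s *\<^sub>R (norm (grad (u k s)))^2 <= indicat_real {t'..q} s *\<^sub>R (norm (grad (u k s)))^2" for s
    using t'(1) by (auto split: split_indicator)
  qed
  ultimately show ?case by linarith
 qed
 ultimately show ?thesis by (rule that)
qed

lemma lim_grad_integrable:
 assumes pq: "{p..q} \<subseteq> J" shows "set_integrable lborel {p..q} (%s. (norm (grad (v s)))^2)"
proof (cases "p <= q")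
 case True
 obtain M where M: "M \<ge> 0" "EV k. (diss (u k) p q) <= M" using u_energy_bound[OF pq True] by blast
 show ?thesis unfolding set_integrable_def
 proof (rule integrableI_bounded)
  have "(\<integral>\<^sup>+s. ennreal (norm (indicator {p..q} s *\<^sub>R (norm (grad (v s)))^2)) \<partial>lborel) = (\<integral>\<^sup>+s. indicator {p..q} s * ennreal ((norm (grad (v s)))^2) \<partial>lborel)"
   by (intro nn_integral_cong) (auto split: split_indicator)
  also have "\<dots> <= ennreal M" by (rule lim_fatou(1)[OF pq tendsto_const M(2)])
  finally show "(\<integral>\<^sup>+s. ennreal (norm (indicat_real {p..q} s *\<^sub>R (norm (grad (v s)))^2)) \<partial>lborel) < \<infinity>" by (rule le_less_trans) simp
 qed (use grad_measurable_Icc[OF J(1) lim_cont pq] in simp)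
qed (simp add: set_integrable_def)

lemma lim_AE_VV: "AE t in lborel. t \<in> J --> v t \<in> VV"
proof (rule AE_interval_exhaust[OF J(1)])
 fix p q assume pq: "{p..q} \<subseteq> J"
 show "AE t in lborel. t \<in> {p..q} --> v t \<in> VV"
 proof (cases "p <= q")
  case True
  obtain M where M: "M \<ge> 0" "EV k. (diss (u k) p q) <= M" using u_energy_bound[OF pq True] by blast
  show ?thesis by (rule lim_fatou(2)[OF pq tendsto_const M(2)])
 qed simp
qed

end

end

lemma integrable_indicator_Icc: "integrable lborel (indicat_real {p..q::real})"
 by (rule integrable_real_indicator) (auto simp: emeasure_lborel_Icc_eq)

context nse_domain
begin

context
 fixes R :: real and J :: "real set" and K and u and v
 assumes J: "open J" "is_interval J" and u: "approx_seq R J K u" and uv: "weak_lim J u v" and R0: "R \<ge> 0"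
begin

section \<open>Strong convergence and passage to the limit\<close>

text \<open>Makes the approximations measurable functions on the whole line with one bound, also for
  those \<open>k\<close> at which \<open>S\<close> is not yet inside \<open>K k\<close>.\<close>

definition Utr :: "real set => nat => real => l2" where
 "Utr S k t = (if S \<subseteq> K k then indicator S t *\<^sub>R u k t else 0)"

lemma Utr_eq: "S \<subseteq> K k ==> t \<in> S ==> Utr S k t = u k t"
 by (simp add: Utr_def)

lemma Utr_measurable: "S \<in> sets borel ==> Utr S k \<in> borel_measurable borel"
proof (cases "S \<subseteq> K k")
 case True
 assume [measurable]: "S \<in> sets borel"
 have [measurable]: "(%t. indicator (K k) t *\<^sub>R u k t) \<in> borel_measurable borel"
  by (rule weakly_continuous_measurable[OF approx_seqD(1)[OF u] wsolD(2)[OF approx_seqD(3)[OF u]]])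
 have "(%t. indicator S t *\<^sub>R (indicator (K k) t *\<^sub>R u k t)) \<in> borel_measurable borel" by measurable
 also have "(%t. indicator S t *\<^sub>R (indicator (K k) t *\<^sub>R u k t)) = Utr S k"
  using True by (auto simp: Utr_def fun_eq_iff split: split_indicator)
 finally show ?thesis .
qed (simp add: Utr_def[abs_def])

lemma Utr_bound: "norm (Utr S k t) <= R"
 using approx_seqD(4)[OF u, of t k] R0 by (auto simp: Utr_def split: split_indicator)

lemma Utr_lim: "{p..q} \<subseteq> J ==> (%k. Utr {p..q} k t \<bullet> y) ----> indicator {p..q} t *\<^sub>R v t \<bullet> y"
proof (cases "t \<in> {p..q}")
 case True
 assume pq: "{p..q} \<subseteq> J"
 have "EV k. u k t \<bullet> y = Utr {p..q} k t \<bullet> y"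
  using approx_seqD(5)[OF u pq] by eventually_elim (use True in \<open>simp add: Utr_eq\<close>)
 from Lim_transform_eventually[OF weak_limD[OF uv] this] show ?thesis using True pq by auto
next
 case False
 have "Utr {p..q} k t = 0" for k using False by (auto simp: Utr_def)
 thus ?thesis using False by simp
qed

lemma V_measurable: "{p..q} \<subseteq> J ==> (%t. indicator {p..q} t *\<^sub>R v t) \<in> borel_measurable borel"
proof -
 assume pq: "{p..q} \<subseteq> J"
 have [measurable]: "(%t. indicator J t *\<^sub>R v t) \<in> borel_measurable borel"
  by (rule weakly_continuous_measurable[OF J(1) lim_cont[OF J u uv R0]])
 have "(%t. indicator {p..q} t *\<^sub>R (indicator J t *\<^sub>R v t)) \<in> borel_measurable borel" by measurable
 also have "(%t. indicator {p..q} t *\<^sub>R (indicator J t *\<^sub>R v t)) = (%t. indicator {p..q} t *\<^sub>R v t)"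
  using pq by (auto simp: fun_eq_iff split: split_indicator)
 finally show ?thesis .
qed

lemma V_bound: "{p..q} \<subseteq> J ==> norm (indicator {p..q} t *\<^sub>R v t) <= R"
 using lim_norm[OF J u uv R0, of t] R0 by (auto split: split_indicator)

lemma bounded_Icc_integrable:
 fixes g :: "real => real"
 assumes "g \<in> borel_measurable borel" "!!t. \<bar>g t\<bar> <= B" "!!t. t \<notin> {p..q} ==> g t = 0"
 shows "integrable lborel g"
proof (rule Bochner_Integration.integrable_bound)
 show "integrable lborel (%t. B * indicator {p..q} t :: real)" by (intro integrable_mult_right integrable_indicator_Icc)
 show "AE t in lborel. norm (g t) <= norm (B * indicator {p..q} t :: real)"
 proof (rule AE_I2)
  show "norm (g t) <= norm (B * indicator {p..q} t :: real)" for t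
   using assms(2)[of t] assms(3)[of t] by (cases "t \<in> {p..q}") auto
 qed
qed (use assms(1) in simp)

text \<open>An argument of Aubin-Lions type: Friedrichs' inequality bounds the difference by
  finitely many inner products, which tend to 0 pointwise and boundedly, plus
  \<open>\<delta>\<close> times gradients that are bounded in mean square.\<close>

lemma strong_L2:
 assumes pq: "{p..q} \<subseteq> J" "p <= q"
 shows "(%k. \<integral>t. (norm (Utr {p..q} k t - indicator {p..q} t *\<^sub>R v t))^2 \<partial>lborel) ----> 0"
  and "integrable lborel (%t. (norm (Utr {p..q} k t - indicator {p..q} t *\<^sub>R v t))^2)"
proof -
 define d where "d k t = Utr {p..q} k t - indicator {p..q} t *\<^sub>R v t" for k t
 have [measurable]: "d k \<in> borel_measurable borel" for k
  unfolding d_def[abs_def] using Utr_measurable[of "{p..q}" k] V_measurable[OF pq(1)] by measurable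
 have dB: "norm (d k t) <= 2 * R" for k t
  unfolding d_def using norm_triangle_ineq4[of "Utr {p..q} k t" "indicator {p..q} t *\<^sub>R v t"] Utr_bound[of "{p..q}" k t] V_bound[OF pq(1), of t] by linarith
 have d0: "d k t = 0" if "t \<notin> {p..q}" for k t using that by (auto simp: d_def Utr_def)
 have dint: "integrable lborel (%t. (norm (d k t))^2)" for k
  by (rule bounded_Icc_integrable[of _ "(2 * R)^2" p q]) (use power_mono[OF dB norm_ge_zero, of k _ 2] d0 in auto)
 thus "integrable lborel (%t. (norm (Utr {p..q} k t - indicator {p..q} t *\<^sub>R v t))^2)" by (simp add: d_def)
 have dy: "(%k. d k t \<bullet> y) ----> 0" for t y
  using tendsto_diff[OF Utr_lim[OF pq(1)] tendsto_const, of t y "indicator {p..q} t *\<^sub>R v t \<bullet> y"] by (simp add: d_def inner_diff_left)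
 have dyB: "(d k t \<bullet> y)^2 <= (2 * R * norm y)^2" for k t y
 proof -
  have "\<bar>d k t \<bullet> y\<bar> <= 2 * R * norm y"
   by (rule order_trans[OF Cauchy_Schwarz_ineq2 mult_right_mono[OF dB]]) simp
  thus ?thesis by (metis abs_ge_zero power2_abs power_mono)
 qed
 have dyint: "integrable lborel (%t. (d k t \<bullet> y)^2)" for k y
  by (rule bounded_Icc_integrable[of _ "(2 * R * norm y)^2" p q]) (use dyB d0 in auto)
 have dylim: "(%k. \<integral>t. (d k t \<bullet> y)^2 \<partial>lborel) ----> 0" for y
 proof -
  have "(%k. \<integral>t. (d k t \<bullet> y)^2 \<partial>lborel) ----> (\<integral>t. 0 \<partial>(lborel :: real measure))"
  proof (rule integral_dominated_convergence[where w = "%t. (2 * R * norm y)^2 * indicator {p..q} t"])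
   show "integrable lborel (%t. (2 * R * norm y)^2 * indicator {p..q} t :: real)" by (intro integrable_mult_right integrable_indicator_Icc)
   have "(%k. (d k t \<bullet> y)^2) ----> 0" for t using tendsto_power[OF dy, of t y 2] by simp
   thus "AE t in lborel. (%k. (d k t \<bullet> y)^2) ----> 0" by simp
   show "AE t in lborel. norm ((d k t \<bullet> y)^2) <= (2 * R * norm y)^2 * indicator {p..q} t" for k
    using dyB d0 by (intro AE_I2) (auto split: split_indicator)
  qed auto
  thus ?thesis by simp
 qed
 obtain M where M: "M \<ge> 0" "EV k. (diss (u k) p q) <= M"
  using u_energy_bound[OF J u uv R0 pq] by blast
 define M' where "M' = (diss v p q)"
 have M': "M' \<ge> 0" unfolding M'_def set_lebesgue_integral_def by (intro integral_nonneg_AE) auto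
 have small: "EV k. (LBINT t. (norm (d k t))^2) < e" if e: "e > 0" for e
 proof -
  \<comment> \<open>The summand 1 avoids division by 0; with the resulting \<open>\<delta>\<close>
    the gradients contribute at most half of \<open>e\<close>.\<close>
  define X where "X = M + M' + 1"
  define \<delta> where "\<delta> = e / (4 * X)"
  have X: "X > 0" using M(1) M' by (simp add: X_def)
  have \<delta>: "\<delta> > 0" using e X by (simp add: \<delta>_def)
  have \<delta>2: "2 * \<delta> * (M + M') <= e / 2"
  proof -
   have "2 * \<delta> * (M + M') <= 2 * \<delta> * X" using \<delta> by (intro mult_left_mono) (auto simp: X_def)
   also have "\<dots> = e / 2" using X by (simp add: \<delta>_def)
   finally show ?thesis .
  qed
  obtain I :: "((real^3) set \<times> 3) set" and y where I: "finite I"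
   "!!x G. (x, G) \<in> Gam ==> (norm x)^2 <= (\<Sum>k\<in>I. (x \<bullet> y k)^2) + \<delta> * (norm G)^2"
   using friedrichs[OF \<delta>] by blast
  have "(%k. \<Sum>i\<in>I. \<integral>t. (d k t \<bullet> y i)^2 \<partial>lborel) ----> (\<Sum>i\<in>I. 0)" by (intro tendsto_sum dylim)
  hence "EV k. (\<Sum>i\<in>I. \<integral>t. (d k t \<bullet> y i)^2 \<partial>lborel) < e / 2"
   using e by (intro order_tendstoD(2)[of _ 0]) auto
  thus ?thesis using M(2) approx_seqD(5)[OF u pq(1)]
  proof eventually_elim
   case (elim k)
   have iu: "integrable lborel (%s. indicat_real {p..q} s *\<^sub>R (norm (grad (u k s)))^2)"
    using wsolD(4)[OF approx_seqD(3)[OF u] elim(3)] by (simp add: set_integrable_def)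
   have iv: "integrable lborel (%s. indicat_real {p..q} s *\<^sub>R (norm (grad (v s)))^2)"
    using lim_grad_integrable[OF J u uv R0 pq(1)] by (simp add: set_integrable_def)
   have isum: "integrable lborel (%t. \<Sum>i\<in>I. (d k t \<bullet> y i)^2)" by (intro Bochner_Integration.integrable_sum dyint)
   have "(LBINT t. (norm (d k t))^2) <= (LBINT t. (\<Sum>i\<in>I. (d k t \<bullet> y i)^2) + 2 * \<delta> * (indicator {p..q} t *\<^sub>R (norm (grad (u k t)))^2 + indicator {p..q} t *\<^sub>R (norm (grad (v t)))^2))"
   proof (rule integral_mono_AE[OF dint])
    show "integrable lborel (%t. (\<Sum>i\<in>I. (d k t \<bullet> y i)^2) + 2 * \<delta> * (indicator {p..q} t *\<^sub>R (norm (grad (u k t)))^2 + indicator {p..q} t *\<^sub>R (norm (grad (v t)))^2))"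
     by (intro Bochner_Integration.integrable_add integrable_mult_right isum iu iv)
    show "AE t in lborel. (norm (d k t))^2 <= (\<Sum>i\<in>I. (d k t \<bullet> y i)^2) + 2 * \<delta> * (indicator {p..q} t *\<^sub>R (norm (grad (u k t)))^2 + indicator {p..q} t *\<^sub>R (norm (grad (v t)))^2)"
     using AE_VV_all[OF J u uv R0] lim_AE_VV[OF J u uv R0]
    proof eventually_elim
     case (elim t)
     show ?case
     proof (cases "t \<in> {p..q}")
      case True
      have V: "u k t \<in> VV" "v t \<in> VV" using elim True pq(1) \<open>{p..q} \<subseteq> K k\<close> by blast+
      have dt: "d k t = u k t - v t" using True \<open>{p..q} \<subseteq> K k\<close> by (simp add: d_def Utr_eq)
      have dV: "d k t \<in> VV" "grad (d k t) = grad (u k t) - grad (v t)" unfolding dt using grad_diff[OF V] by auto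
      have "(norm (grad (u k t) - grad (v t)))^2 <= 2 * ((norm (grad (u k t)))^2 + (norm (grad (v t)))^2)"
      proof -
       have "0 <= (grad (u k t) + grad (v t)) \<bullet> (grad (u k t) + grad (v t))" by simp
       thus ?thesis unfolding power2_norm_eq_inner
        by (simp add: inner_add_left inner_add_right inner_diff_left inner_diff_right inner_commute)
      qed
      hence "\<delta> * (norm (grad (d k t)))^2 <= \<delta> * (2 * ((norm (grad (u k t)))^2 + (norm (grad (v t)))^2))"
       using \<delta> unfolding dV(2) by (intro mult_left_mono) auto
      with I(2)[OF grad_Gam[OF dV(1)]] show ?thesis using True by (simp add: mult_ac)
     qed (simp add: d0 sum_nonneg)
    qed
   qed
   also have "\<dots> = (\<Sum>i\<in>I. \<integral>t. (d k t \<bullet> y i)^2 \<partial>lborel) + 2 * \<delta> * ((diss (u k) p q) + M')"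
    unfolding M'_def set_lebesgue_integral_def
    using isum iu iv dyint by (simp add: Bochner_Integration.integral_sum)
   also have "\<dots> <= (\<Sum>i\<in>I. \<integral>t. (d k t \<bullet> y i)^2 \<partial>lborel) + 2 * \<delta> * (M + M')"
    using elim(2) \<delta> by (intro add_left_mono mult_left_mono) auto
   finally show ?case using elim(1) \<delta>2 by linarith
  qed
 qed
 have nn: "(LBINT t. (norm (d k t))^2) \<ge> 0" for k by (intro integral_nonneg_AE) auto
 have "(%k. \<integral>t. (norm (d k t))^2 \<partial>lborel) ----> 0"
 proof (rule order_tendstoI)
  fix e :: real assume "e < 0"
  thus "EV k. e < (LBINT t. (norm (d k t))^2)"
   by (intro always_eventually allI less_le_trans[OF _ nn])
 qed (rule small)
 thus "(%k. \<integral>t. (norm (Utr {p..q} k t - indicator {p..q} t *\<^sub>R v t))^2 \<partial>lborel) ----> 0" by (simp add: d_def)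
qed

lemma strong_AE:
 assumes pq: "{p..q} \<subseteq> J"
 shows "\<exists>s. strict_mono (s::nat=>nat) \<and> (AE t in lborel. t \<in> {p..q} --> (%k. Utr {p..q} (s k) t) ----> v t)"
proof (cases "p <= q")
 case True
 obtain s where s: "strict_mono (s::nat=>nat)" "AE t in lborel. (%k. (norm (Utr {p..q} (s k) t - indicator {p..q} t *\<^sub>R v t))^2) ----> 0"
  using tendsto_L1_AE_subseq[of lborel "%k t. (norm (Utr {p..q} k t - indicator {p..q} t *\<^sub>R v t))^2"] strong_L2[OF pq True] by auto
 have "AE t in lborel. t \<in> {p..q} --> (%k. Utr {p..q} (s k) t) ----> v t"
  using s(2) by eventually_elim (auto simp: tendsto_norm_zero_iff LIM_zero_iff)
 thus ?thesis using s(1) by blast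
next
 case False
 thus ?thesis by (intro exI[of _ id]) (auto simp: strict_mono_id)
qed

text \<open>The term with the time derivative needs weak convergence only. The right-hand side uses
  strong convergence at almost every time, along a subsequence, and is dominated because
  \<open>Ff\<close> is bounded on balls.\<close>

lemma lim_equation:
 assumes w: "w \<in> D" and \<theta>: "test_fun J \<theta>"
 shows "- (LBINT t. (v t \<bullet> cl w) * deriv \<theta> t) = (LBINT t. Ff w (v t) * \<theta> t)"
proof -
 obtain p q where pq: "{p..q} \<subseteq> J" and z: "!!t. t \<notin> {p..q} ==> \<theta> t = 0" "!!t. t \<notin> {p..q} ==> deriv \<theta> t = 0"
  using test_fun_support[OF \<theta> J(2)] by metis
 obtain s where s: "strict_mono (s::nat=>nat)" "AE t in lborel. t \<in> {p..q} --> (%k. Utr {p..q} (s k) t) ----> v t"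
  using strong_AE[OF pq] by blast
 have us: "approx_seq R J (%k. K (s k)) (%k. u (s k))" by (rule approx_seq_subseq[OF u s(1)])
 have \<theta>int: "integrable lborel (%t. \<bar>\<theta> t\<bar>)" "integrable lborel (%t. \<bar>deriv \<theta> t\<bar>)"
 proof -
  have "integrable lborel (%t. indicator {p..q} t *\<^sub>R \<bar>\<theta> t\<bar>)"
   by (intro borel_integrable_compact continuous_intros continuous_on_subset[OF test_fun_cont(1)[OF \<theta>]]) auto
  moreover have "(%t. indicator {p..q} t *\<^sub>R \<bar>\<theta> t\<bar>) = (%t. \<bar>\<theta> t\<bar>)" using z(1) by (auto simp: fun_eq_iff split: split_indicator)
  ultimately show "integrable lborel (%t. \<bar>\<theta> t\<bar>)" by simp
  have "integrable lborel (%t. indicator {p..q} t *\<^sub>R \<bar>deriv \<theta> t\<bar>)"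
   by (intro borel_integrable_compact continuous_intros continuous_on_subset[OF test_fun_cont(2)[OF \<theta>]]) auto
  moreover have "(%t. indicator {p..q} t *\<^sub>R \<bar>deriv \<theta> t\<bar>) = (%t. \<bar>deriv \<theta> t\<bar>)" using z(2) by (auto simp: fun_eq_iff split: split_indicator)
  ultimately show "integrable lborel (%t. \<bar>deriv \<theta> t\<bar>)" by simp
 qed
 define V where "V t = indicator {p..q} t *\<^sub>R v t" for t
 have [measurable]: "V \<in> borel_measurable borel" unfolding V_def[abs_def] by (rule V_measurable[OF pq])
 have [measurable]: "Utr {p..q} k \<in> borel_measurable borel" for k by (rule Utr_measurable) simp
 have [measurable]: "\<theta> \<in> borel_measurable borel" "deriv \<theta> \<in> borel_measurable borel" "Ff w \<in> borel_measurable borel"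
  using test_fun_cont[OF \<theta>] continuous_Ff[OF w] by (auto intro: borel_measurable_continuous_onI)
 obtain C where C: "C \<ge> 0" "!!x. norm x <= R ==> \<bar>Ff w x\<bar> <= C" using Ff_bounded[OF w, of R] by blast
 have "(%k. \<integral>t. (Utr {p..q} (s k) t \<bullet> cl w) * deriv \<theta> t \<partial>lborel) ----> (LBINT t. (V t \<bullet> cl w) * deriv \<theta> t)"
 proof (rule integral_dominated_convergence[where w = "%t. (R * norm (cl w)) * \<bar>deriv \<theta> t\<bar>"])
  have "(%k. (Utr {p..q} (s k) t \<bullet> cl w) * deriv \<theta> t) ----> (V t \<bullet> cl w) * deriv \<theta> t" for t
   using LIMSEQ_subseq_LIMSEQ[OF Utr_lim[OF pq] s(1), of t "cl w"] unfolding o_def V_def by (intro tendsto_mult tendsto_const)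
  thus "AE t in lborel. (%k. (Utr {p..q} (s k) t \<bullet> cl w) * deriv \<theta> t) ----> (V t \<bullet> cl w) * deriv \<theta> t" by simp
  have "\<bar>Utr {p..q} (s k) t \<bullet> cl w\<bar> <= R * norm (cl w)" for k t
   by (rule order_trans[OF Cauchy_Schwarz_ineq2 mult_right_mono[OF Utr_bound]]) simp
  thus "AE t in lborel. norm ((Utr {p..q} (s k) t \<bullet> cl w) * deriv \<theta> t) <= (R * norm (cl w)) * \<bar>deriv \<theta> t\<bar>" for k
   unfolding real_norm_def abs_mult by (intro AE_I2 mult_right_mono) auto
 qed (use \<theta>int in auto)
 note L1 = tendsto_minus[OF this]
 have L2: "(%k. \<integral>t. Ff w (Utr {p..q} (s k) t) * \<theta> t \<partial>lborel) ----> (LBINT t. Ff w (V t) * \<theta> t)"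
 proof (rule integral_dominated_convergence[where w = "%t. C * \<bar>\<theta> t\<bar>"])
  show "AE t in lborel. (%k. Ff w (Utr {p..q} (s k) t) * \<theta> t) ----> Ff w (V t) * \<theta> t"
   using s(2)
  proof eventually_elim
   case (elim t)
   show ?case
   proof (cases "t \<in> {p..q}")
    case True
    hence "(%k. Utr {p..q} (s k) t) ----> V t" using elim by (simp add: V_def)
    hence "(%k. Ff w (Utr {p..q} (s k) t)) ----> Ff w (V t)"
     by (intro continuous_on_tendsto_compose[OF continuous_Ff[OF w]]) auto
    thus ?thesis by (intro tendsto_mult tendsto_const)
   qed (simp add: z)
  qed
  have "\<bar>Ff w (Utr {p..q} (s k) t)\<bar> <= C" for k t by (rule C(2)[OF Utr_bound])
  thus "AE t in lborel. norm (Ff w (Utr {p..q} (s k) t) * \<theta> t) <= C * \<bar>\<theta> t\<bar>" for k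
   unfolding real_norm_def abs_mult by (intro AE_I2 mult_right_mono) auto
 qed (use \<theta>int in auto)
 have ev: "EV k. - (LBINT t. (Utr {p..q} (s k) t \<bullet> cl w) * deriv \<theta> t) = (LBINT t. Ff w (Utr {p..q} (s k) t) * \<theta> t)"
  using approx_seqD(5)[OF us pq]
 proof eventually_elim
  case (elim k)
  \<comment> \<open>The support lies in the interval, so \<open>\<theta>\<close> is admissible for
    \<open>u (s k)\<close> as well.\<close>
  have "closure {t. \<theta> t \<noteq> 0} \<subseteq> {p..q}" by (rule closure_minimal) (use z(1) in blast, simp)
  hence "test_fun (K (s k)) \<theta>" using \<theta> elim by (auto simp: test_fun_def)
  hence eq: "- (LBINT t. (u (s k) t \<bullet> cl w) * deriv \<theta> t) = (LBINT t. Ff w (u (s k) t) * \<theta> t)"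
   by (rule wsolD(5)[OF approx_seqD(3)[OF u] w])
  have "(%t. (Utr {p..q} (s k) t \<bullet> cl w) * deriv \<theta> t) = (%t. (u (s k) t \<bullet> cl w) * deriv \<theta> t)"
  proof
   show "(Utr {p..q} (s k) t \<bullet> cl w) * deriv \<theta> t = (u (s k) t \<bullet> cl w) * deriv \<theta> t" for t
    using Utr_eq[OF elim, of t] z(2)[of t] by (cases "t \<in> {p..q}") auto
  qed
  moreover have "(%t. Ff w (Utr {p..q} (s k) t) * \<theta> t) = (%t. Ff w (u (s k) t) * \<theta> t)"
  proof
   show "Ff w (Utr {p..q} (s k) t) * \<theta> t = Ff w (u (s k) t) * \<theta> t" for t
    using Utr_eq[OF elim, of t] z(1)[of t] by (cases "t \<in> {p..q}") auto
  qed
  ultimately show ?case using eq by simp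
 qed
 have "- (LBINT t. (V t \<bullet> cl w) * deriv \<theta> t) = (LBINT t. Ff w (V t) * \<theta> t)"
  by (rule LIMSEQ_unique[OF Lim_transform_eventually[OF L1 ev] L2])
 moreover have "(%t. (V t \<bullet> cl w) * deriv \<theta> t) = (%t. (v t \<bullet> cl w) * deriv \<theta> t)"
  using z(2) by (auto simp: V_def fun_eq_iff split: split_indicator)
 moreover have "(%t. Ff w (V t) * \<theta> t) = (%t. Ff w (v t) * \<theta> t)"
 proof
  show "Ff w (V t) * \<theta> t = Ff w (v t) * \<theta> t" for t using z(1)[of t] by (cases "t \<in> {p..q}") (auto simp: V_def)
 qed
 ultimately show ?thesis by simp
qed

lemma lim_inner_int:
 assumes pq: "{p..q} \<subseteq> J"
 shows "(%k. LBINT s:{p..q}. cl f \<bullet> u k s) ----> (LBINT s:{p..q}. cl f \<bullet> v s)"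
proof -
 have [measurable]: "(%t. indicator {p..q} t *\<^sub>R v t) \<in> borel_measurable borel" by (rule V_measurable[OF pq])
 have [measurable]: "Utr {p..q} k \<in> borel_measurable borel" for k by (rule Utr_measurable) simp
 have "(%k. \<integral>t. Utr {p..q} k t \<bullet> cl f \<partial>lborel) ----> (LBINT t. indicator {p..q} t *\<^sub>R v t \<bullet> cl f)"
 proof (rule integral_dominated_convergence[where w = "%t. R * norm (cl f) * indicator {p..q} t"])
  show "integrable lborel (%t. R * norm (cl f) * indicator {p..q} t :: real)" by (intro integrable_mult_right integrable_indicator_Icc)
  show "AE t in lborel. (%k. Utr {p..q} k t \<bullet> cl f) ----> indicator {p..q} t *\<^sub>R v t \<bullet> cl f"
   using Utr_lim[OF pq] by simp
  have "\<bar>Utr {p..q} k t \<bullet> cl f\<bar> <= R * norm (cl f)" for k t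
   by (rule order_trans[OF Cauchy_Schwarz_ineq2 mult_right_mono[OF Utr_bound]]) simp
  moreover have "Utr {p..q} k t = 0" if "t \<notin> {p..q}" for k t using that by (auto simp: Utr_def)
  ultimately show "AE t in lborel. norm (Utr {p..q} k t \<bullet> cl f) <= R * norm (cl f) * indicator {p..q} t" for k
   by (intro AE_I2) (auto split: split_indicator)
  show "(%t. indicator {p..q} t *\<^sub>R v t \<bullet> cl f) \<in> borel_measurable lborel" by measurable
  show "(%t. Utr {p..q} k t \<bullet> cl f) \<in> borel_measurable lborel" for k by measurable
 qed
 moreover have "EV k. (LBINT t. Utr {p..q} k t \<bullet> cl f) = (LBINT s:{p..q}. cl f \<bullet> u k s)"
  using approx_seqD(5)[OF u pq]
  by eventually_elim (auto simp: Utr_def set_lebesgue_integral_def inner_commute intro!: Bochner_Integration.integral_cong split: split_indicator)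
 moreover have "(LBINT t. indicator {p..q} t *\<^sub>R v t \<bullet> cl f) = (LBINT s:{p..q}. cl f \<bullet> v s)"
  by (auto simp: set_lebesgue_integral_def inner_commute intro!: Bochner_Integration.integral_cong split: split_indicator)
 ultimately show ?thesis using Lim_transform_eventually by fastforce
qed

text \<open>At the start \<open>t'\<close> the convergence is strong, but at \<open>t\<close> only
  weak. There the squared norm is replaced by its affine minorant at \<open>v t\<close>, which
  converges; this gives a convergent upper bound for the dissipation, to which Fatou
  applies.\<close>

lemma lim_energy_at:
 assumes t': "t' \<in> J" and t: "t \<in> J" "t' < t" and strong: "(%k. u k t') ----> v t'"
  and en: "!!k t. t' \<in> K k ==> t \<in> K k ==> t' < t ==>
    energy_le (u k) t' t"
 shows "energy_le v t' t"
proof -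
 have pq: "{t'..t} \<subseteq> J" using J(2) t' t unfolding is_interval_1 by (meson atLeastAtMost_iff subsetI)
 define M where "M k = ((norm (u k t'))^2 / 2 + (LBINT s:{t'..t}. cl f \<bullet> u k s) - (2 * (u k t \<bullet> v t) - (norm (v t))^2) / 2) / \<nu>" for k
 define m where "m = ((norm (v t'))^2 / 2 + (LBINT s:{t'..t}. cl f \<bullet> v s) - (2 * (v t \<bullet> v t) - (norm (v t))^2) / 2) / \<nu>"
 have aux: "a / 2 + n * g <= A + F ==> x - y <= a ==> g * n <= A + F - (x - y) / 2" for a n g A F x y :: real
  by (simp add: mult.commute diff_divide_distrib)
 have lim: "M ----> m" unfolding M_def m_def
  by (intro tendsto_intros strong lim_inner_int[OF pq] weak_limD[OF uv t(1)]) (use \<nu> in auto)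
 have ev: "EV k. (diss (u k) t' t) <= M k"
  using approx_seqD(5)[OF u pq]
 proof eventually_elim
  case (elim k)
  have "energy_le (u k) t' t" using elim t(2) by (intro en) auto
  moreover have "2 * (u k t \<bullet> v t) - (norm (v t))^2 <= (norm (u k t))^2"
  proof -
   have "0 <= (norm (u k t - v t))^2" by simp
   also have "\<dots> = (norm (u k t))^2 - 2 * (u k t \<bullet> v t) + (norm (v t))^2"
    unfolding power2_norm_eq_inner by (simp add: inner_diff_left inner_diff_right inner_commute)
   finally show ?thesis by linarith
  qed
  ultimately have "(diss (u k) t' t) * \<nu> <= (norm (u k t'))^2 / 2 + (LBINT s:{t'..t}. cl f \<bullet> u k s) - (2 * (u k t \<bullet> v t) - (norm (v t))^2) / 2"
   by (rule aux)
  thus ?case unfolding M_def pos_le_divide_eq[OF \<nu>] .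
 qed
 \<comment> \<open>\<open>ennreal m\<close> is 0 for negative \<open>m\<close>, so the sign is
   settled before returning to real numbers.\<close>
 have m0: "m \<ge> 0"
 proof (rule tendsto_lowerbound[OF lim])
  show "EV k. 0 <= M k"
   using ev
  proof eventually_elim
   case (elim k)
   have "0 <= (diss (u k) t' t)" unfolding set_lebesgue_integral_def by (intro integral_nonneg_AE) auto
   thus ?case using elim by linarith
  qed
 qed simp
 have iv: "integrable lborel (%s. indicat_real {t'..t} s *\<^sub>R (norm (grad (v s)))^2)"
  using lim_grad_integrable[OF J u uv R0 pq] by (simp add: set_integrable_def)
 have "ennreal (diss v t' t) = (\<integral>\<^sup>+s. ennreal (indicator {t'..t} s *\<^sub>R (norm (grad (v s)))^2) \<partial>lborel)"
  unfolding set_lebesgue_integral_def by (rule nn_integral_eq_integral[OF iv, symmetric]) auto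
 also have "\<dots> = (\<integral>\<^sup>+s. indicator {t'..t} s * ennreal ((norm (grad (v s)))^2) \<partial>lborel)"
  by (intro nn_integral_cong) (auto split: split_indicator)
 also have "\<dots> <= ennreal m" by (rule lim_fatou(1)[OF J u uv R0 pq lim ev])
 finally have "(diss v t' t) <= m" using m0 by (simp add: ennreal_le_iff)
 hence "(diss v t' t) * \<nu> <= (norm (v t'))^2 / 2 + (LBINT s:{t'..t}. cl f \<bullet> v s) - (2 * (v t \<bullet> v t) - (norm (v t))^2) / 2"
  unfolding m_def pos_le_divide_eq[OF \<nu>] .
 moreover have "(2 * (v t \<bullet> v t) - (norm (v t))^2) / 2 = (norm (v t))^2 / 2" by (simp add: power2_norm_eq_inner)
 ultimately show ?thesis by (simp add: mult.commute)
qed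

end

text \<open>The strongly convergent subsequence depends on the compact interval. This is harmless:
  the weak limit \<open>v\<close> is the same for all of them, and almost everywhere statements are
  assembled interval by interval.\<close>

lemma lim_wsol:
 assumes J: "open J" "is_interval J" and u: "approx_seq R J K u" and uv: "weak_lim J u v" and R0: "R \<ge> 0"
 shows "wsol J v"
proof -
 note A = J u uv R0
 have "AE t' in lborel. t' \<in> J --> (\<forall>t\<in>J. t' < t -->
    energy_le v t' t)"
 proof (rule AE_interval_exhaust[OF J(1)])
  fix p q assume pq: "{p..q} \<subseteq> J"
  obtain s where s: "strict_mono (s::nat=>nat)" "AE t in lborel. t \<in> {p..q} --> (%k. Utr K u {p..q} (s k) t) ----> v t"
   using strong_AE[OF A pq] by blast
  have us: "approx_seq R J (%k. K (s k)) (%k. u (s k))" by (rule approx_seq_subseq[OF u s(1)])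
  have uvs: "weak_lim J (%k. u (s k)) v" by (rule weak_lim_subseq[OF uv s(1)])
  have "AE t' in lborel. \<forall>k. t' \<in> K (s k) --> (\<forall>t\<in>K (s k). t' < t -->
    energy_le (u (s k)) t' t)"
   unfolding AE_all_countable using wsolD(6)[OF approx_seqD(3)[OF us]] by blast
  thus "AE t' in lborel. t' \<in> {p..q} --> (\<forall>t\<in>J. t' < t -->
    energy_le v t' t)"
   using s(2)
  proof eventually_elim
   case (elim t')
   show ?case
   proof (intro impI ballI)
    fix t assume t': "t' \<in> {p..q}" and t: "t \<in> J" "t' < t"
    have U: "(%k. Utr K u {p..q} (s k) t') ----> v t'" using elim(2) t' by blast
    have "EV k. Utr K u {p..q} (s k) t' = u (s k) t'"
     using approx_seqD(5)[OF us pq] by eventually_elim (rule Utr_eq[OF A _ t'])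
    from Lim_transform_eventually[OF U this] have st: "(%k. u (s k) t') ----> v t'" .
    have t'J: "t' \<in> J" using t' pq by blast
    show "energy_le v t' t"
     by (rule lim_energy_at[OF J us uvs R0 t'J t st]) (use elim(1) in blast)
   qed
  qed
 qed
 thus ?thesis
  unfolding wsol_def using lim_HH[OF A] lim_cont[OF A] lim_AE_VV[OF A] lim_grad_integrable[OF A] lim_equation[OF A] by blast
qed

theorem wsol_compactness:
 assumes J: "open J" "is_interval J" and u: "approx_seq R J K u" and R0: "R \<ge> 0"
 obtains r v where "strict_mono (r::nat=>nat)" "wsol J v" "!!t. t \<in> J ==> norm (v t) <= R"
  "!!t y. t \<in> J ==> (%k. u (r k) t \<bullet> y) ----> v t \<bullet> y"
proof -
 obtain r v where r: "strict_mono (r::nat=>nat)" "!!t y. t \<in> J ==> (%k. u (r k) t \<bullet> y) ----> v t \<bullet> y"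
  by (rule approx_seq_weak_subseq[OF J(1) u]) blast
 have uv: "weak_lim J (%k. u (r k)) v" using r(2) by (simp add: weak_lim_def)
 note A = J approx_seq_subseq[OF u r(1)] uv R0
 show ?thesis by (rule that[OF r(1) lim_wsol[OF A] lim_norm[OF A] r(2)])
qed

end

section \<open>Recovering the equation in V' for complete solutions\<close>

text \<open>With \<open>n\<close> for a gradient norm, \<open>y\<close> dominates all growth rates
  that occur in the equation, and its power 4/3 is locally integrable in time along
  solutions.\<close>

lemma powr_three_quarters:
 fixes n :: real
 assumes "n \<ge> 0"
 defines "y \<equiv> (1 + n\<^sup>2) powr (3/4)"
 shows "1 <= y" "n <= y" "sqrt n * n <= y" "y <= 1 + n\<^sup>2" "y powr (4/3) = 1 + n\<^sup>2"
proof -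
 have 1: "1 <= 1 + n\<^sup>2" by simp
 show y1: "1 <= y" unfolding y_def by (rule ge_one_powr_ge_zero) auto
 have "n = sqrt (n\<^sup>2)" using assms by simp
 also have "\<dots> <= sqrt (1 + n\<^sup>2)" by (rule real_sqrt_le_mono) simp
 also have "\<dots> = (1 + n\<^sup>2) powr (1/2)" by (simp add: powr_half_sqrt)
 also have "\<dots> <= y" unfolding y_def by (rule powr_mono) auto
 finally show "n <= y" .
 show "sqrt n * n <= y"
 proof (cases "n = 0")
  case False
  hence n: "n > 0" using assms by simp
  have "sqrt n * n = n powr (1/2) * n powr 1" using n by (simp add: powr_half_sqrt)
  also have "\<dots> = n powr (3/2)" by (subst powr_add[symmetric]) simp
  also have "\<dots> = (n\<^sup>2) powr (3/4)" using n by (simp add: powr_powr flip: powr_numeral)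
  also have "\<dots> <= y" unfolding y_def by (rule powr_mono2) auto
  finally show ?thesis .
 qed (use y1 in simp)
 have "y <= (1 + n\<^sup>2) powr 1" unfolding y_def by (rule powr_mono) auto
 thus "y <= 1 + n\<^sup>2" using powr_one[of "1 + n\<^sup>2"] 1 by linarith
 have "y powr (4/3) = (1 + n\<^sup>2) powr 1" unfolding y_def powr_powr by simp
 thus "y powr (4/3) = 1 + n\<^sup>2" using powr_one[of "1 + n\<^sup>2"] 1 by linarith
qed

context nse_domain
begin

text \<open>The right-hand side before the derivatives are moved, hence meaningful for a test class
  \<open>y\<close> that is merely in \<open>V\<close>.\<close>

definition Gf :: "l2 => l2 => real" where
 "Gf x y = cl f \<bullet> y - \<nu> * (grad x \<bullet> grad y) - tri x (grad x) y"

lemma Gf_D: "x \<in> VV ==> w \<in> D ==> Gf x (cl w) = Ff w x"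
 by (simp add: Gf_def Ff_VV)

lemma Gf_diff: "x \<in> VV ==> y \<in> VV ==> z \<in> VV ==> Gf x (y - z) = Gf x y - Gf x z"
 by (simp add: Gf_def tri_diff grad_diff inner_diff_right algebra_simps)

text \<open>The force, the viscous and the convective term grow like \<open>1\<close>,
  \<open>n\<close> and \<open>n^(3/2)\<close> in the gradient norm \<open>n\<close> of
  \<open>x\<close>; the norm of \<open>x\<close> itself is absorbed by \<open>R\<close>.\<close>

lemma Gf_bound:
 assumes R: "R \<ge> 0"
 obtains A where "A \<ge> 0" "!!x y. x \<in> VV ==> norm x <= R ==> y \<in> VV ==>
   \<bar>Gf x y\<bar> <= A * (1 + (norm (grad x))^2) powr (3/4) * norm (grad y)"
proof -
 obtain C where C: "C > 0" "!!x G. (x, G) \<in> Gam ==> (norm x)^2 <= C * (norm G)^2" using poincare by blast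
 obtain K where K: "K \<ge> 0" "!!x y G. x \<in> VV ==> y \<in> VV ==>
   \<bar>tri x G y\<bar> <= K * sqrt (norm x * norm (grad x)) * norm (grad y) * norm G" using tri_bound by blast
 define A where "A = norm (cl f) * sqrt C + \<nu> + K * sqrt R"
 have A: "A \<ge> 0" using C(1) K(1) R \<nu> by (simp add: A_def)
 have "\<bar>Gf x y\<bar> <= A * (1 + (norm (grad x))^2) powr (3/4) * norm (grad y)"
  if x: "x \<in> VV" "norm x <= R" and y: "y \<in> VV" for x y
 proof -
  define n where "n = norm (grad x)"
  define m where "m = norm (grad y)"
  define Y where "Y = (1 + n\<^sup>2) powr (3/4)"
  have nm: "n \<ge> 0" "m \<ge> 0" by (simp_all add: n_def m_def)
  note Y = powr_three_quarters(1-3)[OF nm(1), folded Y_def]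
  have "norm y <= sqrt (C * m\<^sup>2)" unfolding m_def by (rule real_le_rsqrt[OF C(2)[OF grad_Gam[OF y]]])
  hence ny: "norm y <= sqrt C * m" using nm(2) by (simp add: real_sqrt_mult)
  have "\<bar>cl f \<bullet> y\<bar> <= norm (cl f) * norm y" by (rule Cauchy_Schwarz_ineq2)
  also have "\<dots> <= norm (cl f) * (sqrt C * m)" using ny by (intro mult_left_mono) auto
  also have "\<dots> <= norm (cl f) * (sqrt C * m) * Y" using mult_left_mono[OF Y(1), of "norm (cl f) * (sqrt C * m)"] nm(2) C(1) by simp
  finally have 1: "\<bar>cl f \<bullet> y\<bar> <= norm (cl f) * sqrt C * Y * m" by (simp add: mult_ac)
  have "\<nu> * \<bar>grad x \<bullet> grad y\<bar> <= \<nu> * (n * m)" unfolding n_def m_def using \<nu> by (intro mult_left_mono Cauchy_Schwarz_ineq2) auto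
  also have "\<dots> <= \<nu> * (Y * m)" using Y(2) nm \<nu> by (intro mult_left_mono mult_right_mono) auto
  finally have 2: "\<nu> * \<bar>grad x \<bullet> grad y\<bar> <= \<nu> * (Y * m)" .
  have "\<bar>tri x (grad x) y\<bar> <= K * sqrt (norm x * n) * m * n" unfolding n_def m_def by (rule K(2)[OF x(1) y])
  also have "\<dots> <= K * sqrt (R * n) * m * n"
   using x(2) K(1) nm by (intro mult_right_mono mult_left_mono real_sqrt_le_mono) auto
  also have "\<dots> = K * sqrt R * m * (sqrt n * n)" by (simp add: real_sqrt_mult)
  also have "\<dots> <= K * sqrt R * m * Y" using Y(3) K(1) R nm by (intro mult_left_mono) auto
  finally have 3: "\<bar>tri x (grad x) y\<bar> <= K * sqrt R * m * Y" .
  have "\<bar>Gf x y\<bar> <= \<bar>cl f \<bullet> y\<bar> + \<bar>\<nu> * (grad x \<bullet> grad y)\<bar> + \<bar>tri x (grad x) y\<bar>" unfolding Gf_def by linarith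
  also have "\<bar>\<nu> * (grad x \<bullet> grad y)\<bar> = \<nu> * \<bar>grad x \<bullet> grad y\<bar>" using \<nu> by (simp add: abs_mult)
  finally have "\<bar>Gf x y\<bar> <= norm (cl f) * sqrt C * Y * m + \<nu> * (Y * m) + K * sqrt R * m * Y" using 1 2 3 by linarith
  also have "\<dots> = A * Y * m" by (simp add: A_def algebra_simps)
  finally show ?thesis unfolding Y_def n_def m_def .
 qed
 thus ?thesis using that A by blast
qed

context
 fixes v :: "real => l2" and R :: real
 assumes v: "wsol UNIV v" and vR: "!!t. norm (v t) <= R"
begin

lemma global_VV_sets: "{t. v t \<in> VV} \<in> sets borel"
 using grad_measurable(1)[OF open_UNIV wsolD(2)[OF v]] by simp

lemma global_grad_measurable: "(%t. norm (grad (v t))) \<in> borel_measurable borel"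
 using grad_measurable(2)[OF open_UNIV wsolD(2)[OF v]] by simp

lemma global_dom_integrable: "integrable lborel (%t. c * (indicator {p..q} t * (1 + (norm (grad (v t)))^2)))"
proof -
 have "integrable lborel (%t. indicator {p..q} t + indicator {p..q} t * (norm (grad (v t)))^2)"
  using integrable_indicator_Icc[of p q] wsolD(4)[OF v, of p q] by (simp add: set_integrable_def)
 thus ?thesis by (intro integrable_mult_right) (simp add: distrib_left)
qed

text \<open>Both sides depend continuously on \<open>x\<close> in \<open>V\<close>, so the equation
  extends from test fields by density. On the right, multiples of
  \<open>1 + (norm (grad (v t)))^2\<close> dominate.\<close>

lemma global_equation:
 assumes x: "x \<in> VV" and \<theta>: "test_fun UNIV \<theta>"
 shows "integrable lborel (%t. (v t \<bullet> x) * deriv \<theta> t)"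
  and "integrable lborel (%t. (if v t \<in> VV then Gf (v t) x else 0) * \<theta> t)"
  and "- (LBINT t. (v t \<bullet> x) * deriv \<theta> t) = (LBINT t. (if v t \<in> VV then Gf (v t) x else 0) * \<theta> t)"
proof -
 have R: "R \<ge> 0" using norm_ge_zero[of "v 0"] vR[of 0] by linarith
 obtain p q where z: "!!t. t \<notin> {p..q} ==> \<theta> t = 0" "!!t. t \<notin> {p..q} ==> deriv \<theta> t = 0"
  using test_fun_support[OF \<theta> is_interval_univ] by metis
 have \<theta>c: "continuous_on UNIV \<theta>" "continuous_on UNIV (deriv \<theta>)" by (rule test_fun_cont[OF \<theta>])+
 have [measurable]: "\<theta> \<in> borel_measurable borel" "deriv \<theta> \<in> borel_measurable borel"
  using \<theta>c by (auto intro: borel_measurable_continuous_onI)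
 have vm[measurable]: "(%t. v t \<bullet> y) \<in> borel_measurable borel" for y
  by (rule borel_measurable_continuous_onI[OF wsolD(2)[OF v]])
 have "compact (\<theta> ` {p..q})" by (intro compact_continuous_image continuous_on_subset[OF \<theta>c(1)]) auto
 then obtain B' where B': "!!t. t \<in> {p..q} ==> norm (\<theta> t) <= B'" using compact_imp_bounded by (metis bounded_iff imageI)
 have "compact (deriv \<theta> ` {p..q})" by (intro compact_continuous_image continuous_on_subset[OF \<theta>c(2)]) auto
 then obtain B2 where B2: "!!t. t \<in> {p..q} ==> norm (deriv \<theta> t) <= B2" using compact_imp_bounded by (metis bounded_iff imageI)
 define B where "B = \<bar>B'\<bar> + \<bar>B2\<bar>"
 have B: "B \<ge> 0" "\<bar>\<theta> t\<bar> <= B * indicator {p..q} t" "\<bar>deriv \<theta> t\<bar> <= B * indicator {p..q} t" for t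
  using B'[of t] B2[of t] z[of t] by (auto simp: B_def split: split_indicator)
 have bd1: "norm ((v t \<bullet> y) * deriv \<theta> t) <= (R * N * B) * indicator {p..q} t" if "norm y <= N" for t y N
 proof -
  have "\<bar>v t \<bullet> y\<bar> <= R * N" by (rule order_trans[OF Cauchy_Schwarz_ineq2 mult_mono[OF vR that R]]) simp
  moreover have "R * N \<ge> 0" using R that norm_ge_zero[of y] by (intro mult_nonneg_nonneg) linarith+
  ultimately have "\<bar>v t \<bullet> y\<bar> * \<bar>deriv \<theta> t\<bar> <= (R * N) * (B * indicator {p..q} t)" using B by (intro mult_mono) auto
  thus ?thesis by (simp add: abs_mult mult_ac)
 qed
 have di: "integrable lborel (%t. c * indicator {p..q} t)" for c :: real
  by (intro integrable_mult_right integrable_indicator_Icc)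
 show "integrable lborel (%t. (v t \<bullet> x) * deriv \<theta> t)"
 proof (rule Bochner_Integration.integrable_bound[OF di[of "R * norm x * B"]])
  show "(%t. (v t \<bullet> x) * deriv \<theta> t) \<in> borel_measurable lborel" by measurable
  show "AE t in lborel. norm ((v t \<bullet> x) * deriv \<theta> t) <= norm ((R * norm x * B) * indicator {p..q} t)"
  proof (rule AE_I2)
   show "norm ((v t \<bullet> x) * deriv \<theta> t) <= norm ((R * norm x * B) * indicator {p..q} t)" for t
    using bd1[of x "norm x" t] by simp
  qed
 qed
 obtain A where A: "A \<ge> 0" "!!x y. x \<in> VV ==> norm x <= R ==> y \<in> VV ==>
   \<bar>Gf x y\<bar> <= A * (1 + (norm (grad x))^2) powr (3/4) * norm (grad y)" using Gf_bound[OF R] by blast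
 define g where "g y t = (if v t \<in> VV then Gf (v t) y else 0)" for y t
 define H where "H t = 1 + (norm (grad (v t)))^2" for t
 have gb: "\<bar>g y t\<bar> <= A * H t * norm (grad y)" if y: "y \<in> VV" for y t
 proof (cases "v t \<in> VV")
  case True
  have "\<bar>Gf (v t) y\<bar> <= A * (1 + (norm (grad (v t)))^2) powr (3/4) * norm (grad y)" by (rule A(2)[OF True vR y])
  also have "\<dots> <= A * H t * norm (grad y)"
   unfolding H_def using A(1) by (intro mult_right_mono mult_left_mono powr_three_quarters(4)) auto
  finally show ?thesis using True by (simp add: g_def)
 next
  case False
  have "0 <= A * H t * norm (grad y)" using A(1) by (intro mult_nonneg_nonneg) (auto simp: H_def)
  thus ?thesis using False by (simp add: g_def)
 qed
 have bd2: "norm (g y t * \<theta> t) <= (A * N * B) * (indicator {p..q} t * (1 + (norm (grad (v t)))^2))" if y: "y \<in> VV" "norm (grad y) <= N" for t y N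
 proof -
  have H: "H t \<ge> 0" by (simp add: H_def)
  have "\<bar>g y t\<bar> <= A * H t * N" by (rule order_trans[OF gb[OF y(1)] mult_left_mono[OF y(2)]]) (use A(1) H in simp)
  moreover have "A * H t * N \<ge> 0" using A(1) H y(2) norm_ge_zero[of "grad y"] by (intro mult_nonneg_nonneg) linarith+
  ultimately have "\<bar>g y t\<bar> * \<bar>\<theta> t\<bar> <= (A * H t * N) * (B * indicator {p..q} t)" using B by (intro mult_mono) auto
  thus ?thesis by (simp add: abs_mult mult_ac H_def)
 qed
 obtain \<phi> where \<phi>: "!!n. \<phi> n \<in> D" "(%n. gr (\<phi> n)) ----> (x, grad x)" using Gam_seq[OF grad_Gam[OF x]] by blast
 have \<phi>V: "cl (\<phi> n) \<in> VV" for n using grad_D[OF \<phi>(1)] by blast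
 have c1: "(%n. cl (\<phi> n)) ----> x" using tendsto_fst[OF \<phi>(2)] by (simp add: gr_def)
 have c2: "(%n. grad (cl (\<phi> n))) ----> grad x" using tendsto_snd[OF \<phi>(2)] grad_D[OF \<phi>(1)] by simp
 obtain N1 where N1: "!!n. norm (cl (\<phi> n)) <= N1" using convergent_imp_bounded[OF c1] by (auto simp: bounded_iff)
 obtain N2 where N2: "!!n. norm (grad (cl (\<phi> n))) <= N2" using convergent_imp_bounded[OF c2] by (auto simp: bounded_iff)
 have gD: "g (cl (\<phi> n)) t * \<theta> t = (if v t \<in> VV then Ff (\<phi> n) (v t) * \<theta> t else 0)" for n t
  using Gf_D[OF _ \<phi>(1)] by (simp add: g_def)
 have [measurable]: "(%t. g (cl (\<phi> n)) t * \<theta> t) \<in> borel_measurable borel" for n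
 proof -
  have [measurable]: "(%t. Ff (\<phi> n) (v t) * \<theta> t) \<in> borel_measurable borel" by (rule Ff_measurable[OF open_UNIV wsolD(2)[OF v] \<phi>(1) \<theta>])
  have [measurable]: "Measurable.pred borel (%t. v t \<in> VV)" using global_VV_sets by (simp add: pred_def)
  show ?thesis unfolding gD by measurable
 qed
 \<comment> \<open>Convergence at every single time: \<open>Gf\<close> is linear in the test class
   and bounded by its gradient norm.\<close>
 have lim: "(%n. g (cl (\<phi> n)) t * \<theta> t) ----> g x t * \<theta> t" for t
 proof (intro tendsto_mult tendsto_const)
  have "(%n. g (cl (\<phi> n)) t - g x t) ----> 0"
  proof (rule Lim_null_comparison)
   have "(%n. A * H t * norm (grad (cl (\<phi> n)) - grad x)) ----> A * H t * norm (grad x - grad x)"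
    by (intro tendsto_intros c2)
   thus "(%n. A * H t * norm (grad (cl (\<phi> n)) - grad x)) ----> 0" by simp
   have "norm (g (cl (\<phi> n)) t - g x t) <= A * H t * norm (grad (cl (\<phi> n)) - grad x)" for n
   proof -
    have d: "cl (\<phi> n) - x \<in> VV" "grad (cl (\<phi> n) - x) = grad (cl (\<phi> n)) - grad x" using grad_diff[OF \<phi>V x] by auto
    have "g (cl (\<phi> n)) t - g x t = g (cl (\<phi> n) - x) t" using Gf_diff[OF _ \<phi>V x] by (simp add: g_def)
    thus ?thesis using gb[OF d(1), of t] d(2) by simp
   qed
   thus "EV n. norm (g (cl (\<phi> n)) t - g x t) <= A * H t * norm (grad (cl (\<phi> n)) - grad x)" by simp
  qed
  thus "(%n. g (cl (\<phi> n)) t) ----> g x t" by (rule LIM_zero_cancel)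
 qed
 have [measurable]: "(%t. g x t * \<theta> t) \<in> borel_measurable borel"
  by (rule borel_measurable_LIMSEQ_real[OF lim]) measurable
 have gi: "integrable lborel (%t. g x t * \<theta> t)"
 proof (rule Bochner_Integration.integrable_bound[OF global_dom_integrable[of "A * norm (grad x) * B" p q]])
  show "(%t. g x t * \<theta> t) \<in> borel_measurable lborel" by measurable
  show "AE t in lborel. norm (g x t * \<theta> t) <= norm ((A * norm (grad x) * B) * (indicator {p..q} t * (1 + (norm (grad (v t)))^2)))"
  proof (rule AE_I2)
   show "norm (g x t * \<theta> t) <= norm ((A * norm (grad x) * B) * (indicator {p..q} t * (1 + (norm (grad (v t)))^2)))" for t
    using bd2[OF x order_refl, of t] by (rule order_trans) (simp only: real_norm_def abs_ge_self)
  qed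
 qed
 thus "integrable lborel (%t. (if v t \<in> VV then Gf (v t) x else 0) * \<theta> t)" by (simp add: g_def)
 have L1: "(%n. \<integral>t. g (cl (\<phi> n)) t * \<theta> t \<partial>lborel) ----> (LBINT t. g x t * \<theta> t)"
 proof (rule integral_dominated_convergence[OF _ _ global_dom_integrable[of "A * N2 * B" p q]])
  show "(%t. g x t * \<theta> t) \<in> borel_measurable lborel" by measurable
  show "(%t. g (cl (\<phi> n)) t * \<theta> t) \<in> borel_measurable lborel" for n by measurable
  show "AE t in lborel. (%n. g (cl (\<phi> n)) t * \<theta> t) ----> g x t * \<theta> t" using lim by simp
  show "AE t in lborel. norm (g (cl (\<phi> n)) t * \<theta> t) <= (A * N2 * B) * (indicator {p..q} t * (1 + (norm (grad (v t)))^2))" for n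
   using bd2[OF \<phi>V N2] by (intro AE_I2)
 qed
 have L2: "(%n. - (LBINT t. (v t \<bullet> cl (\<phi> n)) * deriv \<theta> t)) ----> - (LBINT t. (v t \<bullet> x) * deriv \<theta> t)"
 proof (intro tendsto_minus integral_dominated_convergence[OF _ _ di[of "R * N1 * B"]])
  show "(%t. (v t \<bullet> x) * deriv \<theta> t) \<in> borel_measurable lborel" by measurable
  show "(%t. (v t \<bullet> cl (\<phi> n)) * deriv \<theta> t) \<in> borel_measurable lborel" for n by measurable
  have "(%n. (v t \<bullet> cl (\<phi> n)) * deriv \<theta> t) ----> (v t \<bullet> x) * deriv \<theta> t" for t by (intro tendsto_intros c1)
  thus "AE t in lborel. (%n. (v t \<bullet> cl (\<phi> n)) * deriv \<theta> t) ----> (v t \<bullet> x) * deriv \<theta> t" by simp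
  show "AE t in lborel. norm ((v t \<bullet> cl (\<phi> n)) * deriv \<theta> t) <= (R * N1 * B) * indicator {p..q} t" for n
   using bd1[OF N1] by (intro AE_I2)
 qed
 have "- (LBINT t. (v t \<bullet> cl (\<phi> n)) * deriv \<theta> t) = (LBINT t. g (cl (\<phi> n)) t * \<theta> t)" for n
 proof -
  have "- (LBINT t. (v t \<bullet> cl (\<phi> n)) * deriv \<theta> t) = (LBINT t. Ff (\<phi> n) (v t) * \<theta> t)" by (rule wsolD(5)[OF v \<phi>(1) \<theta>])
  also have "\<dots> = (LBINT t. g (cl (\<phi> n)) t * \<theta> t)"
  proof (rule integral_cong_AE)
   show "(%t. Ff (\<phi> n) (v t) * \<theta> t) \<in> borel_measurable lborel" using Ff_measurable[OF open_UNIV wsolD(2)[OF v] \<phi>(1) \<theta>] by simp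
   show "(%t. g (cl (\<phi> n)) t * \<theta> t) \<in> borel_measurable lborel" by measurable
   show "AE t in lborel. Ff (\<phi> n) (v t) * \<theta> t = g (cl (\<phi> n)) t * \<theta> t"
    using wsolD(3)[OF v] by eventually_elim (simp add: gD)
  qed
  finally show ?thesis .
 qed
 hence "- (LBINT t. (v t \<bullet> x) * deriv \<theta> t) = (LBINT t. g x t * \<theta> t)"
  using L1 L2 by (simp add: LIMSEQ_unique)
 thus "- (LBINT t. (v t \<bullet> x) * deriv \<theta> t) = (LBINT t. (if v t \<in> VV then Gf (v t) x else 0) * \<theta> t)"
  by (simp add: g_def)
qed

text \<open>Stated for arbitrary representatives \<open>u t\<close>, so that later one of them can
  be prescribed.\<close>

lemma global_weak_solution:
 assumes u: "!!t. L2\<Omega> (u t)" "!!t. cl (u t) = v t"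
 shows "weak_solution \<Omega> D \<nu> f UNIV u"
proof -
 have R: "R \<ge> 0" using norm_ge_zero[of "v 0"] vR[of 0] by linarith
 have uH: "u t \<in> Hspace \<Omega> D" for t using u wsolD(1)[OF v] by (simp add: Hspace_iff)
 have uV: "u t \<in> Vspace \<Omega> D \<longleftrightarrow> v t \<in> VV" for t using u by (simp add: Vspace_iff)
 have Vn: "Vnorm \<Omega> D (u t) = norm (grad (v t))" if "v t \<in> VV" for t using that uV u by (simp add: Vnorm_eq)
 have hb: "Hnorm \<Omega> (u t) = norm (v t)" for t using u by (simp add: Hnorm_eq)
 have cK: "\<exists>p q. K \<subseteq> {p..q}" if "compact K" for K :: "real set"
  using bounded_subset_cbox_symmetric[OF compact_imp_bounded[OF that]] unfolding cbox_interval by blast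
 have dom: "(\<integral>\<^sup>+t. ennreal (c * (indicator {p..q} t * (1 + (norm (grad (v t)))^2))) \<partial>lborel) < \<infinity>" for c p q
  using integrableD(2)[OF global_dom_integrable[of c p q]] ennreal_leI
  by (rule_tac le_less_trans[OF nn_integral_mono]) (auto simp: top.not_eq_extremum)
 have P4: "(\<integral>\<^sup>+t. ennreal ((Vnorm \<Omega> D (u t))^2) * indicator K t \<partial>lborel) < \<infinity>" if K: "compact K" for K
 proof -
  obtain p q where pq: "K \<subseteq> {p..q}" using cK[OF K] by blast
  have "(\<integral>\<^sup>+t. ennreal ((Vnorm \<Omega> D (u t))^2) * indicator K t \<partial>lborel) <= (\<integral>\<^sup>+t. ennreal (1 * (indicator {p..q} t * (1 + (norm (grad (v t)))^2))) \<partial>lborel)"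
  proof (rule nn_integral_mono_AE)
   show "AE t in lborel. ennreal ((Vnorm \<Omega> D (u t))^2) * indicator K t <= ennreal (1 * (indicator {p..q} t * (1 + (norm (grad (v t)))^2)))"
    using wsolD(3)[OF v]
   proof eventually_elim
    case (elim t)
    thus ?case using Vn[of t] pq by (cases "t \<in> K") (auto intro!: ennreal_leI)
   qed
  qed
  also have "\<dots> < \<infinity>" by (rule dom)
  finally show ?thesis .
 qed
 have P5: "weakly_cont \<Omega> D UNIV u"
  unfolding weakly_cont_def
 proof
  fix \<phi> assume "\<phi> \<in> Hspace \<Omega> D"
  hence eq: "(%t. ip \<Omega> (u t) \<phi>) = (%t. v t \<bullet> cl \<phi>)" using u by (auto simp: fun_eq_iff ip_eq Hspace_iff)
  show "continuous_on UNIV (%t. ip \<Omega> (u t) \<phi>)" unfolding eq by (rule wsolD(2)[OF v])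
 qed
 obtain A where A: "A \<ge> 0" "!!x y. x \<in> VV ==> norm x <= R ==> y \<in> VV ==>
   \<bar>Gf x y\<bar> <= A * (1 + (norm (grad x))^2) powr (3/4) * norm (grad y)" using Gf_bound[OF R] by blast
 \<comment> \<open>The value 0 off \<open>VV\<close> keeps the bound by \<open>h\<close> true at
   every time.\<close>
 define g where "g t w = (if v t \<in> VV then Gf (v t) (cl w) else 0)" for t w
 define h where "h t = A * (1 + (norm (grad (v t)))^2) powr (3/4)" for t
 have G1: "AE t in lborel. t \<in> UNIV --> (\<forall>w\<in>Vspace \<Omega> D. \<bar>g t w\<bar> <= h t * Vnorm \<Omega> D w)"
 proof (intro AE_I2 impI ballI)
  fix t w assume w: "w \<in> Vspace \<Omega> D"
  hence "cl w \<in> VV" by (simp add: Vspace_iff)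
  thus "\<bar>g t w\<bar> <= h t * Vnorm \<Omega> D w" unfolding g_def h_def using A(2)[OF _ vR, of t "cl w"] A(1) by (simp add: Vnorm_eq[OF w])
 qed
 have G2: "(\<integral>\<^sup>+t. ennreal (\<bar>h t\<bar> powr (4/3)) * indicator K t \<partial>lborel) < \<infinity>" if K: "compact K" for K
 proof -
  obtain p q where pq: "K \<subseteq> {p..q}" using cK[OF K] by blast
  have "\<bar>h t\<bar> powr (4/3) = A powr (4/3) * (1 + (norm (grad (v t)))^2)" for t
   unfolding h_def using A(1) powr_three_quarters(5)[OF norm_ge_zero[of "grad (v t)"]] by (simp add: powr_mult abs_mult)
  hence "(\<integral>\<^sup>+t. ennreal (\<bar>h t\<bar> powr (4/3)) * indicator K t \<partial>lborel) <= (\<integral>\<^sup>+t. ennreal (A powr (4/3) * (indicator {p..q} t * (1 + (norm (grad (v t)))^2))) \<partial>lborel)"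
   using pq by (intro nn_integral_mono) (auto split: split_indicator)
  also have "\<dots> < \<infinity>" by (rule dom)
  finally show ?thesis .
 qed
 have G3: "integrable lborel (%t. ip \<Omega> (u t) w * deriv \<theta> t) \<and> integrable lborel (%t. g t w * \<theta> t) \<and>
      - (LBINT t. ip \<Omega> (u t) w * deriv \<theta> t) = (LBINT t. g t w * \<theta> t)"
  if w: "w \<in> Vspace \<Omega> D" and \<theta>: "test_fun (interior UNIV) \<theta>" for w \<theta>
 proof -
  have w': "L2\<Omega> w" "cl w \<in> VV" using w by (auto simp: Vspace_iff)
  have "(%t. ip \<Omega> (u t) w * deriv \<theta> t) = (%t. (v t \<bullet> cl w) * deriv \<theta> t)" using u w' by (simp add: ip_eq)
  thus ?thesis unfolding g_def using global_equation[OF w'(2), of \<theta>] \<theta> by simp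
 qed
 have G4: "AE t in lborel. t \<in> UNIV --> (\<forall>w\<in>Vspace \<Omega> D. g t w + \<nu> * Vip \<Omega> D (u t) w + btri \<Omega> D (u t) (u t) w = ip \<Omega> f w)"
  using wsolD(3)[OF v]
 proof eventually_elim
  case (elim t)
  hence V: "v t \<in> VV" "u t \<in> Vspace \<Omega> D" using uV by auto
  show ?case
  proof (intro impI ballI)
   fix w assume w: "w \<in> Vspace \<Omega> D"
   hence "L2\<Omega> w" by (simp add: Vspace_iff)
   thus "g t w + \<nu> * Vip \<Omega> D (u t) w + btri \<Omega> D (u t) (u t) w = ip \<Omega> f w"
    using V by (simp add: g_def Gf_def Vip_eq[OF V(2) w] btri_eq[OF V(2) V(2) w] ip_eq L2\<Omega>_f u(2))
  qed
 qed
 obtain c where c: "!!x. x \<in> Hspace \<Omega> D ==> x \<notin> Vspace \<Omega> D ==> Vnorm \<Omega> D x = c" using Vnorm_junk by blast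
 have Vm[measurable]: "(%t. Vnorm \<Omega> D (u t)) \<in> borel_measurable borel"
 proof -
  have [measurable]: "Measurable.pred borel (%t. v t \<in> VV)" using global_VV_sets by (simp add: pred_def)
  note [measurable] = global_grad_measurable
  have "(%t. Vnorm \<Omega> D (u t)) = (%t. if v t \<in> VV then norm (grad (v t)) else c)"
   using Vn c uH uV by auto
  also have "\<dots> \<in> borel_measurable borel" by measurable
  finally show ?thesis .
 qed
 have E: "(LBINT s:{t'..t}. (Vnorm \<Omega> D (u s))^2) = (diss v t' t)" for t' t
  unfolding set_lebesgue_integral_def
 proof (rule integral_cong_AE)
  note [measurable] = global_grad_measurable
  show "(%s. indicat_real {t'..t} s *\<^sub>R (Vnorm \<Omega> D (u s))^2) \<in> borel_measurable lborel" by measurable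
  show "(%s. indicat_real {t'..t} s *\<^sub>R (norm (grad (v s)))^2) \<in> borel_measurable lborel" by measurable
  show "AE s in lborel. indicat_real {t'..t} s *\<^sub>R (Vnorm \<Omega> D (u s))^2 = indicat_real {t'..t} s *\<^sub>R (norm (grad (v s)))^2"
   using wsolD(3)[OF v] by eventually_elim (simp add: Vn)
 qed
 have P7: "AE t' in lborel. t' \<in> UNIV --> (\<forall>t\<in>UNIV. t' < t -->
    (Hnorm \<Omega> (u t))^2 / 2 + \<nu> * set_lebesgue_integral lborel {t'..t} (%s. (Vnorm \<Omega> D (u s))^2)
     <= (Hnorm \<Omega> (u t'))^2 / 2 + set_lebesgue_integral lborel {t'..t} (%s. ip \<Omega> f (u s)))"
  using wsolD(6)[OF v] unfolding E hb ip_eq[OF L2\<Omega>_f u(1)] u(2) .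
 \<comment> \<open>Vacuous: the real line has no least element.\<close>
 have P8: "\<forall>t0\<in>UNIV. (\<forall>t\<in>UNIV. t0 <= t) --> ((%t. Hnorm \<Omega> (%x. u t x - u t0 x)) \<longlongrightarrow> 0) (at t0 within UNIV)"
 proof (intro ballI impI)
  fix t0 :: real assume "\<forall>t\<in>UNIV. t0 <= t"
  hence "t0 <= t0 - 1" by blast
  thus "((%t. Hnorm \<Omega> (%x. u t x - u t0 x)) \<longlongrightarrow> 0) (at t0 within UNIV)" by simp
 qed
 show ?thesis
  unfolding weak_solution_def
 proof (intro conjI)
  show "\<exists>g h. (AE t in lborel. t \<in> UNIV --> (\<forall>v\<in>Vspace \<Omega> D. \<bar>g t v\<bar> <= h t * Vnorm \<Omega> D v)) \<and>
    (\<forall>K. compact K \<and> K \<subseteq> UNIV --> (\<integral>\<^sup>+t. ennreal (\<bar>h t\<bar> powr (4/3)) * indicator K t \<partial>lborel) < \<infinity>) \<and>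
    (\<forall>v\<in>Vspace \<Omega> D. \<forall>\<theta>. test_fun (interior UNIV) \<theta> -->
      integrable lborel (%t. ip \<Omega> (u t) v * deriv \<theta> t) \<and>
      integrable lborel (%t. g t v * \<theta> t) \<and>
      - (LBINT t. ip \<Omega> (u t) v * deriv \<theta> t) = (LBINT t. g t v * \<theta> t)) \<and>
    (AE t in lborel. t \<in> UNIV -->
      (\<forall>v\<in>Vspace \<Omega> D. g t v + \<nu> * Vip \<Omega> D (u t) v + btri \<Omega> D (u t) (u t) v = ip \<Omega> f v))"
   by (rule exI[of _ g], rule exI[of _ h]) (use G1 G2 G3 G4 in blast)
  show "\<forall>t\<in>UNIV. u t \<in> Hspace \<Omega> D" using uH by blast
  show "\<forall>K. compact K \<and> K \<subseteq> UNIV --> (\<exists>C. AE t in lborel. t \<in> K --> Hnorm \<Omega> (u t) <= C)"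
   unfolding hb using vR by (intro allI impI exI[of _ R]) simp
  show "AE t in lborel. t \<in> UNIV --> u t \<in> Vspace \<Omega> D" using wsolD(3)[OF v] by (simp add: uV)
  show "\<forall>K. compact K \<and> K \<subseteq> UNIV --> (\<integral>\<^sup>+t. ennreal ((Vnorm \<Omega> D (u t))^2) * indicator K t \<partial>lborel) < \<infinity>" using P4 by blast
 qed (rule P5 P7 P8)+
qed

end

end

section \<open>The two settings\<close>

lemma iter_pd_zero: "iter_pd is (%x. 0) = (%x::real^'n. 0::'b::real_normed_vector)"
 by (induction "is") (auto simp: pd_def)

lemma smooth_fun_zero: "smooth_fun (%x::real^'n. 0::'b::real_normed_vector)"
 unfolding smooth_fun_def iter_pd_zero by auto

lemma div_free_zero: "div_free (%x. 0)"
 unfolding div_free_def pd_def by simp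

lemma div_free_lincomb:
 assumes "smooth_fun \<phi>" "smooth_fun \<psi>" "div_free \<phi>" "div_free \<psi>"
 shows "div_free (%x. c *\<^sub>R \<phi> x + d *\<^sub>R \<psi> x)"
proof -
 have "pd i (%x. c *\<^sub>R \<phi> x + d *\<^sub>R \<psi> x) x = c *\<^sub>R pd i \<phi> x + d *\<^sub>R pd i \<psi> x" for i x
  using fun_cong[OF iter_pd_lincomb[OF assms(1,2), of "[i]" c d], of x] by simp
 hence "(\<Sum>i\<in>UNIV. pd i (%x. c *\<^sub>R \<phi> x + d *\<^sub>R \<psi> x) x $ i) = c * (\<Sum>i\<in>UNIV. pd i \<phi> x $ i) + d * (\<Sum>i\<in>UNIV. pd i \<psi> x $ i)" for x
  by (simp add: sum.distrib sum_distrib_left)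
 thus ?thesis using assms(3,4) by (simp add: div_free_def)
qed

lemma iter_pd_periodic:
 assumes "!!x. g (x + c) = g x"
 shows "iter_pd is g (x + c) = iter_pd is g x"
proof (induction "is" arbitrary: x)
 case (Cons i "is")
 have "iter_pd is g (x + c + s *\<^sub>R axis i 1) = iter_pd is g (x + s *\<^sub>R axis i 1)" for s
  using Cons.IH[of "x + s *\<^sub>R axis i 1"] by (simp add: add_ac)
 thus ?case by (simp add: pd_def)
qed (simp add: assms)

lemma iter_pd_outside_support:
 assumes "x \<notin> closure {x. g x \<noteq> 0}"
 shows "iter_pd is g x = 0"
 using assms
proof (induction "is" arbitrary: x)
 case Nil
 thus ?case using closure_subset[of "{x. g x \<noteq> 0}"] by auto
next
 case (Cons i "is")
 let ?f = "%s::real. x + s *\<^sub>R axis i 1"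
 have "open (?f -` (- closure {x. g x \<noteq> 0}))"
  by (intro open_vimage continuous_intros) auto
 hence "((%s. iter_pd is g (?f s)) has_vector_derivative 0) (at 0)"
 proof (rule has_vector_derivative_transform_within_open[OF has_vector_derivative_const[of 0 "at (0::real)"]])
  show "0 \<in> ?f -` (- closure {x. g x \<noteq> 0})" using Cons.prems by simp
  show "0 = iter_pd is g (?f s)" if "s \<in> ?f -` (- closure {x. g x \<noteq> 0})" for s using Cons.IH[of "?f s"] that by simp
 qed
 hence "vector_derivative (%s. iter_pd is g (?f s)) (at 0) = 0" by (rule vector_derivative_at)
 thus ?case by (simp add: pd_def)
qed

lemma AE_cbox_box: "AE x in lborel. x \<in> cbox a b --> x \<in> box a (b::real^3)"
proof -
 have "cbox a b - box a b \<in> null_sets lborel"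
  using negligible_frontier_interval[of a b] by (simp add: negligible_iff_null_sets null_sets_completion_iff)
 hence "AE x in lborel. x \<notin> cbox a b - box a b" by (rule AE_not_in)
 thus ?thesis by eventually_elim auto
qed

text \<open>Derivatives of periodic fields are periodic, and the boundary of the box is a null
  set.\<close>

lemma flow_domain_per:
 assumes L: "!!i. L $ i > 0"
 shows "flow_domain (box 0 L) (D_per L) 0 L"
proof
 show "open (box 0 L)" "box 0 L \<subseteq> box 0 L" "(0::real^3) $ m < L $ m" for m using L by (auto simp: open_box)
 show "smooth_fun \<phi>" "div_free \<phi>" "set_lebesgue_integral lborel (box 0 L) \<phi> = 0" if "\<phi> \<in> D_per L" for \<phi>
  using that by (auto simp: D_per_def)
 show "(%x. 0) \<in> D_per L" by (simp add: D_per_def smooth_fun_zero div_free_zero set_lebesgue_integral_def)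
 show "iter_pd is \<phi> (x + (L $ i - 0 $ i) *\<^sub>R axis i 1) = iter_pd is \<phi> x" if "\<phi> \<in> D_per L" for \<phi> "is" i x
 proof -
  have "\<phi> (x + (L $ i - 0 $ i) *\<^sub>R axis i 1) = \<phi> x" for x using that by (simp add: D_per_def)
  thus ?thesis by (rule iter_pd_periodic)
 qed
 show "AE x in lborel. x \<in> cbox 0 L --> x \<notin> box 0 L --> iter_pd is \<phi> x = 0" for \<phi> :: vf and "is"
  using AE_cbox_box[of 0 L] by eventually_elim auto
 show "(%x. c *\<^sub>R \<phi> x + d *\<^sub>R \<psi> x) \<in> D_per L" if \<phi>: "\<phi> \<in> D_per L" and \<psi>: "\<psi> \<in> D_per L" for \<phi> \<psi> c d
 proof -
  have int: "set_integrable lborel (box 0 L) \<phi>" if "\<phi> \<in> D_per L" for \<phi>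
  proof (rule set_integrable_subset)
   have "continuous_on UNIV \<phi>" using that smooth_iter_pd_cont[of \<phi> "[]"] by (simp add: D_per_def)
   thus "set_integrable lborel (cbox 0 L) \<phi>" unfolding set_integrable_def
    by (intro borel_integrable_compact) (auto intro: continuous_on_subset)
  qed (auto simp: box_subset_cbox)
  have "set_lebesgue_integral lborel (box 0 L) (%x. c *\<^sub>R \<phi> x + d *\<^sub>R \<psi> x) = 0"
  proof -
   have "set_integrable lborel (box 0 L) (%x. c *\<^sub>R \<phi> x)" "set_integrable lborel (box 0 L) (%x. d *\<^sub>R \<psi> x)"
    using int[OF \<phi>] int[OF \<psi>] by (auto intro: set_integrable_scaleR_right)
   thus ?thesis using \<phi> \<psi> by (simp add: set_integral_add(2) D_per_def)
  qed
  thus ?thesis using \<phi> \<psi> by (simp add: D_per_def smooth_fun_lincomb div_free_lincomb)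
 qed
qed

lemma integral_vec_nth: "integrable M f ==> (\<integral>x. f x \<partial>M) $ j = (\<integral>x. f x $ j \<partial>M)" for f :: "_ => real^3"
 by (rule integral_bounded_linear[OF bounded_linear_vec_nth, symmetric])

text \<open>All derivatives of the fields vanish off \<open>\<Omega>\<close>, in particular on the
  faces of a symmetric box around it.\<close>

lemma flow_domain_noslip:
 assumes \<Omega>: "smooth_domain \<Omega>"
 obtains a b where "flow_domain \<Omega> (D_noslip \<Omega>) a b"
proof -
 have o: "open \<Omega>" "bounded \<Omega>" "\<Omega> \<noteq> {}" using \<Omega> by (auto simp: smooth_domain_def)
 obtain b where b: "\<Omega> \<subseteq> box (- b) b" using bounded_subset_box_symmetric[OF o(2)] by blast
 obtain y where "y \<in> \<Omega>" using o(3) by blast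
 hence y: "y \<in> box (- b) b" using b by blast
 have ab: "(- b) $ m < b $ m" for m using y unfolding mem_box_cart by (meson less_trans)
 have zero: "iter_pd is \<phi> x = 0" if "\<phi> \<in> D_noslip \<Omega>" "x \<notin> \<Omega>" for \<phi> x "is"
  using that by (intro iter_pd_outside_support) (auto simp: D_noslip_def)
 have notin: "x \<notin> \<Omega>" "x + (b $ i - (- b) $ i) *\<^sub>R axis i 1 \<notin> \<Omega>" if "x $ i = (- b) $ i" for x i
 proof -
  have "x \<notin> box (- b) b" using that unfolding mem_box_cart by (metis less_irrefl)
  thus "x \<notin> \<Omega>" using b by blast
  have "(x + (b $ i - (- b) $ i) *\<^sub>R axis i 1) $ i = b $ i" using that by simp
  hence "x + (b $ i - (- b) $ i) *\<^sub>R axis i 1 \<notin> box (- b) b" unfolding mem_box_cart by (metis less_irrefl)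
  thus "x + (b $ i - (- b) $ i) *\<^sub>R axis i 1 \<notin> \<Omega>" using b by blast
 qed
 have mean: "set_lebesgue_integral lborel \<Omega> \<phi> = 0" if \<phi>: "\<phi> \<in> D_noslip \<Omega>" for \<phi>
 proof -
  have sm: "smooth_fun \<phi>" and dv: "div_free \<phi>" using \<phi> by (auto simp: D_noslip_def)
  have cont: "continuous_on UNIV \<phi>" using smooth_iter_pd_cont[OF sm, of "[]"] by simp
  have int: "integrable lborel (%x. indicator (cbox (- b) b) x *\<^sub>R \<phi> x)"
   by (intro borel_integrable_compact continuous_on_subset[OF cont]) auto
  have "(LBINT x:\<Omega>. \<phi> x) = (LBINT x:cbox (- b) b. \<phi> x)"
   unfolding set_lebesgue_integral_def
   using zero[OF \<phi>, of _ "[]"] b box_subset_cbox[of "- b" b]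
   by (intro Bochner_Integration.integral_cong refl) (auto split: split_indicator)
  moreover have "(LBINT x:cbox (- b) b. \<phi> x) $ j = 0" for j
  proof -
   \<comment> \<open>The mean is 0 because \<open>\<phi> $ j\<close> is the divergence of
     \<open>x $ j\<close> times \<open>\<phi>\<close>, and this product vanishes on all
     faces.\<close>
   have hp: "has_pd i (%x. x $ j * \<phi> x $ i) (%x. (if j = i then 1 else 0) * \<phi> x $ i + x $ j * pd i \<phi> x $ i)" for i
    using has_pd_mult[OF has_pd_nth[of i j] smooth_has_pd[OF sm, of i "[]" i]] by simp
   have z: "(LBINT x:cbox (- b) b. (if j = i then 1 else 0) * \<phi> x $ i + x $ j * pd i \<phi> x $ i) = 0" for i
    by (rule integral_pd_faces_zero[OF hp less_imp_le[OF ab]]) (use zero[OF \<phi>, of _ "[]"] notin in simp)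
   have si: "integrable lborel (%x. indicator (cbox (- b) b) x *\<^sub>R ((if j = i then 1 else 0) * \<phi> x $ i + x $ j * pd i \<phi> x $ i))" for i
    using set_integrable_cbox[of "%x. (if j = i then 1 else 0) * \<phi> x $ i + x $ j * pd i \<phi> x $ i" "- b" b] hp[of i]
    unfolding has_pd_def set_integrable_def by blast
   have pt: "(indicator (cbox (- b) b) x *\<^sub>R \<phi> x) $ j = (\<Sum>i\<in>UNIV. indicator (cbox (- b) b) x *\<^sub>R ((if j = i then 1 else 0) * \<phi> x $ i + x $ j * pd i \<phi> x $ i))" for x
   proof -
    have "(\<Sum>i\<in>UNIV. (if j = i then 1 else 0) * \<phi> x $ i + x $ j * pd i \<phi> x $ i) = (\<Sum>i\<in>UNIV. if j = i then \<phi> x $ i else 0) + x $ j * (\<Sum>i\<in>UNIV. pd i \<phi> x $ i)"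
     unfolding sum.distrib sum_distrib_left by (intro arg_cong2[of _ _ _ _ "(+)"] sum.cong) auto
    also have "\<dots> = \<phi> x $ j" using dv by (simp add: div_free_def)
    finally have e: "(\<Sum>i\<in>UNIV. (if j = i then 1 else 0) * \<phi> x $ i + x $ j * pd i \<phi> x $ i) = \<phi> x $ j" .
    show ?thesis unfolding scaleR_sum_right[symmetric] vector_scaleR_component e by simp
   qed
   have "(LBINT x:cbox (- b) b. \<phi> x) $ j = (LBINT x. (indicator (cbox (- b) b) x *\<^sub>R \<phi> x) $ j)"
    unfolding set_lebesgue_integral_def by (rule integral_vec_nth[OF int])
   also have "\<dots> = (\<Sum>i\<in>UNIV. LBINT x:cbox (- b) b. (if j = i then 1 else 0) * \<phi> x $ i + x $ j * pd i \<phi> x $ i)"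
    unfolding pt set_lebesgue_integral_def by (rule Bochner_Integration.integral_sum[OF si])
   also have "\<dots> = 0" unfolding z by simp
   finally show ?thesis .
  qed
  ultimately show ?thesis by (simp add: vec_eq_iff)
 qed
 have "flow_domain \<Omega> (D_noslip \<Omega>) (- b) b"
 proof
  show "open \<Omega>" "\<Omega> \<subseteq> box (- b) b" "(- b) $ m < b $ m" for m using o b ab by auto
  show "smooth_fun \<phi>" "div_free \<phi>" if "\<phi> \<in> D_noslip \<Omega>" for \<phi> using that by (auto simp: D_noslip_def)
  show "set_lebesgue_integral lborel \<Omega> \<phi> = 0" if "\<phi> \<in> D_noslip \<Omega>" for \<phi> by (rule mean[OF that])
  show "(%x. 0) \<in> D_noslip \<Omega>" by (simp add: D_noslip_def smooth_fun_zero div_free_zero)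
  show "(%x. c *\<^sub>R \<phi> x + d *\<^sub>R \<psi> x) \<in> D_noslip \<Omega>" if \<phi>: "\<phi> \<in> D_noslip \<Omega>" and \<psi>: "\<psi> \<in> D_noslip \<Omega>" for \<phi> \<psi> c d
  proof -
   let ?S = "%\<phi>::vf. closure {x. \<phi> x \<noteq> 0}" and ?h = "%x. c *\<^sub>R \<phi> x + d *\<^sub>R \<psi> x"
   have "{x. ?h x \<noteq> 0} \<subseteq> {x. \<phi> x \<noteq> 0} \<union> {x. \<psi> x \<noteq> 0}" by auto
   hence "?S ?h \<subseteq> closure ({x. \<phi> x \<noteq> 0} \<union> {x. \<psi> x \<noteq> 0})" by (rule closure_mono)
   hence sub: "?S ?h \<subseteq> ?S \<phi> \<union> ?S \<psi>" by (simp only: closure_Un)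
   have "compact (?S \<phi> \<union> ?S \<psi>)" using \<phi> \<psi> by (auto simp: D_noslip_def)
   from bounded_subset[OF compact_imp_bounded[OF this] sub] have "compact (?S ?h)"
    by (simp only: compact_eq_bounded_closed closed_closure)
   moreover have "?S ?h \<subseteq> \<Omega>" using sub \<phi> \<psi> by (auto simp: D_noslip_def)
   ultimately show ?thesis using \<phi> \<psi> by (simp add: D_noslip_def smooth_fun_lincomb div_free_lincomb)
  qed
  show "iter_pd is \<phi> (x + (b $ i - (- b) $ i) *\<^sub>R axis i 1) = iter_pd is \<phi> x"
   if "\<phi> \<in> D_noslip \<Omega>" "x \<in> cbox (- b) b" "x $ i = (- b) $ i" for \<phi> "is" i x
   using zero[OF that(1)] notin[OF that(3)] by simp
  show "AE x in lborel. x \<in> cbox (- b) b --> x \<notin> \<Omega> --> iter_pd is \<phi> x = 0" if "\<phi> \<in> D_noslip \<Omega>" for \<phi> "is"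
   using zero[OF that] by simp
 qed
 thus ?thesis by (rule that)
qed

lemma NSE_setting_flow_domain:
 assumes "NSE_setting \<Omega> D"
 obtains a b where "flow_domain \<Omega> D a b"
 using assms unfolding NSE_setting_def
proof (elim disjE exE conjE)
 fix L assume "\<forall>i. L $ i > 0" "\<Omega> = box 0 L" "D = D_per L"
 thus ?thesis using that[of 0 L] flow_domain_per[of L] by simp
next
 assume "smooth_domain \<Omega>" "D = D_noslip \<Omega>"
 thus ?thesis using flow_domain_noslip that by metis
qed

section \<open>Time translation and restriction\<close>

lemma deriv_translate: "deriv (%t. g (t + c)) = (%t. deriv g (t + c))" for g :: "real => real"
 by (simp add: deriv_def DERIV_shift fun_eq_iff)

lemma funpow_deriv_translate: "(deriv ^^ n) (%t. g (t + c)) = (%t. (deriv ^^ n) g (t + c))" for g :: "real => real"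
 by (induction n) (simp_all add: deriv_translate)

lemma test_fun_translate:
 assumes \<theta>: "test_fun J \<theta>" and J: "!!t. t \<in> J ==> t - c \<in> J'"
 shows "test_fun J' (%t. \<theta> (t + c))"
proof -
 have S: "{t. \<theta> (t + c) \<noteq> 0} = (%t. - c + t) ` {t. \<theta> t \<noteq> 0}"
 proof -
  have "t \<in> (%t. - c + t) ` {t. \<theta> t \<noteq> 0}" if "\<theta> (t + c) \<noteq> 0" for t
   using that by (intro image_eqI[of _ _ "t + c"]) auto
  thus ?thesis by auto
 qed
 have cl: "closure {t. \<theta> (t + c) \<noteq> 0} = (%t. - c + t) ` closure {t. \<theta> t \<noteq> 0}"
  unfolding S by (rule closure_translation)
 have "compact (closure {t. \<theta> (t + c) \<noteq> 0})" unfolding cl using \<theta> by (intro compact_translation) (simp add: test_fun_def)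
 moreover have "closure {t. \<theta> (t + c) \<noteq> 0} \<subseteq> J'"
  unfolding cl
 proof
  fix y assume "y \<in> (%t. - c + t) ` closure {t. \<theta> t \<noteq> 0}"
  then obtain t where t: "t \<in> closure {t. \<theta> t \<noteq> 0}" "y = - c + t" by blast
  hence "t \<in> J" using \<theta> by (auto simp: test_fun_def)
  thus "y \<in> J'" using J[of t] t(2) by simp
 qed
 moreover have "(deriv ^^ n) (%t. \<theta> (t + c)) field_differentiable at x" for n x
 proof -
  obtain d where "((deriv ^^ n) \<theta> has_field_derivative d) (at (x + c))"
   using \<theta> unfolding test_fun_def field_differentiable_def by blast
  hence "((%t. (deriv ^^ n) \<theta> (t + c)) has_field_derivative d) (at x)" by (simp add: DERIV_shift)
  thus ?thesis unfolding funpow_deriv_translate field_differentiable_def by blast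
 qed
 ultimately show ?thesis unfolding test_fun_def by blast
qed

lemma AE_lborel_translate: "AE t in lborel. P t ==> AE t in lborel. P (t + c)" for c :: real
proof -
 assume "AE t in lborel. P t"
 hence "AE t in distr lborel borel ((+) c). P t" unfolding lborel_distr_plus .
 hence "AE t in lborel. P (c + t)" by (rule AE_distrD[rotated]) simp
 thus ?thesis by (simp add: add.commute)
qed

lemma set_integral_translate:
 fixes g :: "real => real"
 shows "(LBINT s:{p..q}. g (s + c)) = (LBINT s:{p + c..q + c}. g s)"
proof -
 have "(LBINT s:{p + c..q + c}. g s) = (LBINT s. indicator {p + c..q + c} (c + 1 * s) *\<^sub>R g (c + 1 * s))"
  unfolding set_lebesgue_integral_def using lborel_integral_real_affine[of 1 "%s. indicator {p + c..q + c} s *\<^sub>R g s" c] by simp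
 also have "\<dots> = (LBINT s:{p..q}. g (s + c))"
  unfolding set_lebesgue_integral_def by (intro Bochner_Integration.integral_cong refl) (auto simp: add.commute split: split_indicator)
 finally show ?thesis by simp
qed

context nse_domain
begin

text \<open>The force does not depend on time, so translates solve the same equation. As
  \<open>J'\<close> shifted by \<open>c\<close> need only lie inside \<open>J\<close>, this also
  restricts solutions to smaller intervals.\<close>

lemma wsol_translate:
 assumes v: "wsol J v" and J': "!!t. t \<in> J' ==> t + c \<in> J"
 shows "wsol J' (%t. v (t + c))"
proof -
 note w = wsolD[OF v]
 have Icc: "{p + c..q + c} \<subseteq> J" if "{p..q} \<subseteq> J'" for p q
 proof
  fix t assume "t \<in> {p + c..q + c}"
  hence "t - c \<in> J'" using that by auto
  thus "t \<in> J" using J'[of "t - c"] by simp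
 qed
 have "v (t + c) \<in> HH" if "t \<in> J'" for t by (rule w(1)[OF J'[OF that]])
 moreover have "continuous_on J' (%t. v (t + c) \<bullet> y)" for y
  by (rule continuous_on_compose2[OF w(2)[of y]]) (auto intro!: continuous_intros J')
 moreover have "AE t in lborel. t \<in> J' --> v (t + c) \<in> VV"
  using AE_lborel_translate[OF w(3), of c] by eventually_elim (use J' in auto)
 moreover have "set_integrable lborel {p..q} (%s. (norm (grad (v (s + c))))^2)" if "{p..q} \<subseteq> J'" for p q
 proof -
  have "integrable lborel (%s. indicator {p + c..q + c} (c + 1 * s) *\<^sub>R (norm (grad (v (c + 1 * s))))^2)"
   by (rule lborel_integrable_real_affine[of "%s. indicator {p + c..q + c} s *\<^sub>R (norm (grad (v s)))^2"])
    (use w(4)[OF Icc[OF that]] in \<open>simp_all add: set_integrable_def\<close>)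
  also have "(%s. indicator {p + c..q + c} (c + 1 * s) *\<^sub>R (norm (grad (v (c + 1 * s))))^2) = (%s. indicator {p..q} s *\<^sub>R (norm (grad (v (s + c))))^2)"
   by (auto simp: fun_eq_iff add.commute split: split_indicator)
  finally show ?thesis by (simp add: set_integrable_def)
 qed
 moreover have "- (LBINT t. (v (t + c) \<bullet> cl w) * deriv \<theta> t) = (LBINT t. Ff w (v (t + c)) * \<theta> t)"
  if wD: "w \<in> D" and \<theta>: "test_fun J' \<theta>" for w \<theta>
 proof -
  have \<theta>': "test_fun J (%t. \<theta> (t + - c))" by (rule test_fun_translate[OF \<theta>]) (use J' in auto)
  have "- (LBINT t. (v t \<bullet> cl w) * deriv (%t. \<theta> (t + - c)) t) = (LBINT t. Ff w (v t) * \<theta> (t + - c))"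
   by (rule w(5)[OF wD \<theta>'])
  thus ?thesis
   unfolding deriv_translate
   using lborel_integral_real_affine[of 1 "%t. (v t \<bullet> cl w) * deriv \<theta> (t + - c)" c]
    lborel_integral_real_affine[of 1 "%t. Ff w (v t) * \<theta> (t + - c)" c] by (simp add: add.commute)
 qed
 moreover have "AE t' in lborel. t' \<in> J' --> (\<forall>t\<in>J'. t' < t -->
    (norm (v (t + c)))^2 / 2 + \<nu> * (LBINT s:{t'..t}. (norm (grad (v (s + c))))^2)
     <= (norm (v (t' + c)))^2 / 2 + (LBINT s:{t'..t}. cl f \<bullet> v (s + c)))"
  using AE_lborel_translate[OF w(6), of c]
 proof eventually_elim
  case (elim t')
  show ?case
  proof (intro impI ballI)
   fix t assume t: "t' \<in> J'" "t \<in> J'" "t' < t"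
   hence "t' + c \<in> J" "t + c \<in> J" "t' + c < t + c" using J' by auto
   thus "(norm (v (t + c)))^2 / 2 + \<nu> * (LBINT s:{t'..t}. (norm (grad (v (s + c))))^2)
     <= (norm (v (t' + c)))^2 / 2 + (LBINT s:{t'..t}. cl f \<bullet> v (s + c))"
    unfolding set_integral_translate[of t' t "%s. (norm (grad (v s)))^2"] set_integral_translate[of t' t "%s. cl f \<bullet> v s"]
    using elim by blast
  qed
 qed
 ultimately show ?thesis unfolding wsol_def by blast
qed

end

section \<open>The weak topologies and their Borel structure\<close>

text \<open>Both weak topologies are described by neighbourhoods of points; intersections stay open
  because two neighbourhoods of a point contain a third.\<close>

lemma istopology_neighbourhoods:
 assumes "!!u p q. P p ==> P q ==> \<exists>r. P r \<and> N r u \<subseteq> N p u \<inter> N q u"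
 shows "istopology (%U. U \<subseteq> X \<and> (\<forall>u\<in>U. \<exists>p. P p \<and> N p u \<subseteq> U))"
 unfolding istopology_def
proof (intro conjI allI impI)
 fix S T assume S: "S \<subseteq> X \<and> (\<forall>u\<in>S. \<exists>p. P p \<and> N p u \<subseteq> S)" and T: "T \<subseteq> X \<and> (\<forall>u\<in>T. \<exists>p. P p \<and> N p u \<subseteq> T)"
 show "S \<inter> T \<subseteq> X" using S by blast
 show "\<forall>u\<in>S \<inter> T. \<exists>p. P p \<and> N p u \<subseteq> S \<inter> T"
 proof
  fix u assume "u \<in> S \<inter> T"
  then obtain p q where "P p" "N p u \<subseteq> S" "P q" "N q u \<subseteq> T" using S T by blast
  moreover from this obtain r where "P r" "N r u \<subseteq> N p u \<inter> N q u" using assms by blast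
  ultimately show "\<exists>p. P p \<and> N p u \<subseteq> S \<inter> T" by blast
 qed
next
 fix \<K> assume K: "\<forall>K\<in>\<K>. K \<subseteq> X \<and> (\<forall>u\<in>K. \<exists>p. P p \<and> N p u \<subseteq> K)"
 show "\<Union>\<K> \<subseteq> X" using K by blast
 show "\<forall>u\<in>\<Union>\<K>. \<exists>p. P p \<and> N p u \<subseteq> \<Union>\<K>"
 proof
  fix u assume "u \<in> \<Union>\<K>"
  then obtain K where "K \<in> \<K>" "u \<in> K" by blast
  moreover from this obtain p where "P p" "N p u \<subseteq> K" using K by blast
  ultimately show "\<exists>p. P p \<and> N p u \<subseteq> \<Union>\<K>" by blast
 qed
qed

lemma openin_Hw:
 "openin (Hw \<Omega> D) U \<longleftrightarrow> U \<subseteq> Hspace \<Omega> D \<and> (\<forall>u\<in>U. \<exists>F \<epsilon>. finite F \<and> F \<subseteq> Hspace \<Omega> D \<and> \<epsilon> > 0 \<and>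
    {v\<in>Hspace \<Omega> D. \<forall>\<phi>\<in>F. \<bar>ip \<Omega> v \<phi> - ip \<Omega> u \<phi>\<bar> < \<epsilon>} \<subseteq> U)"
proof -
 define P where "P p \<longleftrightarrow> finite (fst p) \<and> fst p \<subseteq> Hspace \<Omega> D \<and> snd p > 0" for p :: "vf set \<times> real"
 define N where "N p u = {v\<in>Hspace \<Omega> D. \<forall>\<phi>\<in>fst p. \<bar>ip \<Omega> v \<phi> - ip \<Omega> u \<phi>\<bar> < snd p}" for p :: "vf set \<times> real" and u
 have "istopology (%U. U \<subseteq> Hspace \<Omega> D \<and> (\<forall>u\<in>U. \<exists>p. P p \<and> N p u \<subseteq> U))"
 proof (rule istopology_neighbourhoods)
  fix u p q assume "P p" "P q"
  thus "\<exists>r. P r \<and> N r u \<subseteq> N p u \<inter> N q u"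
   by (intro exI[of _ "(fst p \<union> fst q, min (snd p) (snd q))"]) (auto simp: P_def N_def)
 qed
 hence "istopology (%U. U \<subseteq> Hspace \<Omega> D \<and> (\<forall>u\<in>U. \<exists>F \<epsilon>. finite F \<and> F \<subseteq> Hspace \<Omega> D \<and> \<epsilon> > 0 \<and>
    {v\<in>Hspace \<Omega> D. \<forall>\<phi>\<in>F. \<bar>ip \<Omega> v \<phi> - ip \<Omega> u \<phi>\<bar> < \<epsilon>} \<subseteq> U))"
  unfolding P_def N_def split_paired_Ex fst_conv snd_conv conj_assoc .
 thus ?thesis unfolding Hw_def by (simp only: topology_inverse')
qed

lemma openin_Cloc_top:
 "openin (Cloc_top \<Omega> D I) U \<longleftrightarrow> U \<subseteq> Cloc \<Omega> D I \<and> (\<forall>u\<in>U. \<exists>K F \<epsilon>. compact K \<and> K \<subseteq> I \<and> finite F \<and> F \<subseteq> Hspace \<Omega> D \<and> \<epsilon> > 0 \<and>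
    {v\<in>Cloc \<Omega> D I. \<forall>t\<in>K. \<forall>\<phi>\<in>F. \<bar>ip \<Omega> (v t) \<phi> - ip \<Omega> (u t) \<phi>\<bar> < \<epsilon>} \<subseteq> U)"
proof -
 define P where "P p \<longleftrightarrow> compact (fst p) \<and> fst p \<subseteq> I \<and> finite (fst (snd p)) \<and> fst (snd p) \<subseteq> Hspace \<Omega> D \<and> snd (snd p) > 0"
  for p :: "real set \<times> vf set \<times> real"
 define N where "N p u = {v\<in>Cloc \<Omega> D I. \<forall>t\<in>fst p. \<forall>\<phi>\<in>fst (snd p). \<bar>ip \<Omega> (v t) \<phi> - ip \<Omega> (u t) \<phi>\<bar> < snd (snd p)}"
  for p :: "real set \<times> vf set \<times> real" and u
 have "istopology (%U. U \<subseteq> Cloc \<Omega> D I \<and> (\<forall>u\<in>U. \<exists>p. P p \<and> N p u \<subseteq> U))"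
 proof (rule istopology_neighbourhoods)
  fix u p q assume "P p" "P q"
  thus "\<exists>r. P r \<and> N r u \<subseteq> N p u \<inter> N q u"
   by (intro exI[of _ "(fst p \<union> fst q, fst (snd p) \<union> fst (snd q), min (snd (snd p)) (snd (snd q)))"]) (auto simp: P_def N_def)
 qed
 hence "istopology (%U. U \<subseteq> Cloc \<Omega> D I \<and> (\<forall>u\<in>U. \<exists>K F \<epsilon>. compact K \<and> K \<subseteq> I \<and> finite F \<and> F \<subseteq> Hspace \<Omega> D \<and> \<epsilon> > 0 \<and>
    {v\<in>Cloc \<Omega> D I. \<forall>t\<in>K. \<forall>\<phi>\<in>F. \<bar>ip \<Omega> (v t) \<phi> - ip \<Omega> (u t) \<phi>\<bar> < \<epsilon>} \<subseteq> U))"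
  unfolding P_def N_def split_paired_Ex fst_conv snd_conv conj_assoc .
 thus ?thesis unfolding Cloc_top_def by (simp only: topology_inverse')
qed

lemma topspace_Hw: "topspace (Hw \<Omega> D) = Hspace \<Omega> D"
proof
 show "topspace (Hw \<Omega> D) \<subseteq> Hspace \<Omega> D" using openin_Hw[of \<Omega> D "topspace (Hw \<Omega> D)"] by simp
 have "openin (Hw \<Omega> D) (Hspace \<Omega> D)"
  unfolding openin_Hw by (auto intro!: exI[of _ "{}"] exI[of _ "1::real"])
 thus "Hspace \<Omega> D \<subseteq> topspace (Hw \<Omega> D)" by (rule openin_subset)
qed

lemma topspace_Cloc_top: "topspace (Cloc_top \<Omega> D I) = Cloc \<Omega> D I"
proof
 show "topspace (Cloc_top \<Omega> D I) \<subseteq> Cloc \<Omega> D I" using openin_Cloc_top[of \<Omega> D I "topspace (Cloc_top \<Omega> D I)"] by simp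
 have "openin (Cloc_top \<Omega> D I) (Cloc \<Omega> D I)"
  unfolding openin_Cloc_top by (auto intro!: exI[of _ "{}"] exI[of _ "1::real"])
 thus "Cloc \<Omega> D I \<subseteq> topspace (Cloc_top \<Omega> D I)" by (rule openin_subset)
qed

lemma space_borel_of: "space (borel_of X) = topspace X"
 by (simp add: borel_of_def space_measure_of_conv)

lemma openin_sets_borel_of: "openin X U ==> U \<in> sets (borel_of X)"
 unfolding borel_of_def by (subst sets_measure_of) (auto dest: openin_subset)

lemma closedin_sets_borel_of: "closedin X S ==> S \<in> sets (borel_of X)"
proof -
 assume S: "closedin X S"
 hence "topspace X - S \<in> sets (borel_of X)" by (intro openin_sets_borel_of) auto
 hence "space (borel_of X) - (topspace X - S) \<in> sets (borel_of X)" by (rule sets.compl_sets)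
 thus ?thesis using closedin_subset[OF S] by (simp add: space_borel_of double_diff)
qed

text \<open>Evaluation is continuous, since a single time is a compact subset of
  \<open>I\<close>.\<close>

lemma eval_measurable:
 assumes t: "t \<in> I"
 shows "(%u. u t) \<in> borel_of (Cloc_top \<Omega> D I) \<rightarrow>\<^sub>M borel_of (Hw \<Omega> D)"
proof (subst borel_of_def, rule measurable_measure_of)
 show "{U. openin (Hw \<Omega> D) U} \<subseteq> Pow (topspace (Hw \<Omega> D))" by (auto dest: openin_subset)
 show "(%u. u t) \<in> space (borel_of (Cloc_top \<Omega> D I)) \<rightarrow> topspace (Hw \<Omega> D)"
  using t by (auto simp: space_borel_of topspace_Cloc_top topspace_Hw Cloc_def)
 fix U assume "U \<in> {U. openin (Hw \<Omega> D) U}"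
 hence U: "U \<subseteq> Hspace \<Omega> D" "!!u. u \<in> U ==> \<exists>F \<epsilon>. finite F \<and> F \<subseteq> Hspace \<Omega> D \<and> \<epsilon> > 0 \<and>
    {v\<in>Hspace \<Omega> D. \<forall>\<phi>\<in>F. \<bar>ip \<Omega> v \<phi> - ip \<Omega> u \<phi>\<bar> < \<epsilon>} \<subseteq> U" by (auto simp: openin_Hw)
 have "openin (Cloc_top \<Omega> D I) {u\<in>Cloc \<Omega> D I. u t \<in> U}"
  unfolding openin_Cloc_top
 proof (intro conjI ballI)
  fix u assume "u \<in> {u\<in>Cloc \<Omega> D I. u t \<in> U}"
  then obtain F \<epsilon> where F: "finite F" "F \<subseteq> Hspace \<Omega> D" "\<epsilon> > 0"
   "{v\<in>Hspace \<Omega> D. \<forall>\<phi>\<in>F. \<bar>ip \<Omega> v \<phi> - ip \<Omega> (u t) \<phi>\<bar> < \<epsilon>} \<subseteq> U" using U(2)[of "u t"] by auto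
  have "{v\<in>Cloc \<Omega> D I. \<forall>s\<in>{t}. \<forall>\<phi>\<in>F. \<bar>ip \<Omega> (v s) \<phi> - ip \<Omega> (u s) \<phi>\<bar> < \<epsilon>} \<subseteq> {u\<in>Cloc \<Omega> D I. u t \<in> U}"
   using F(4) t by (auto simp: Cloc_def)
  thus "\<exists>K F \<epsilon>. compact K \<and> K \<subseteq> I \<and> finite F \<and> F \<subseteq> Hspace \<Omega> D \<and> \<epsilon> > 0 \<and>
    {v\<in>Cloc \<Omega> D I. \<forall>t\<in>K. \<forall>\<phi>\<in>F. \<bar>ip \<Omega> (v t) \<phi> - ip \<Omega> (u t) \<phi>\<bar> < \<epsilon>} \<subseteq> {u\<in>Cloc \<Omega> D I. u t \<in> U}"
   using F(1-3) t by (intro exI[of _ "{t}"] exI[of _ F] exI[of _ \<epsilon>]) auto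
 qed auto
 moreover have "(%u. u t) -` U \<inter> space (borel_of (Cloc_top \<Omega> D I)) = {u\<in>Cloc \<Omega> D I. u t \<in> U}"
  by (auto simp: space_borel_of topspace_Cloc_top)
 ultimately show "(%u. u t) -` U \<inter> space (borel_of (Cloc_top \<Omega> D I)) \<in> sets (borel_of (Cloc_top \<Omega> D I))"
  using openin_sets_borel_of by simp
qed

context nse_domain
begin

lemma HH_eqI:
 assumes "x \<in> HH" "z \<in> HH" "cl ` D \<subseteq> closure T" "!!e. e \<in> T ==> x \<bullet> e = z \<bullet> e"
 shows "x = z"
proof -
 have "closed {e. (x - z) \<bullet> e = 0}" by (intro closed_Collect_eq continuous_intros)
 hence "closure T \<subseteq> {e. (x - z) \<bullet> e = 0}"
  using assms(4) by (intro closure_minimal) (auto simp: inner_diff_left)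
 moreover have "HH \<subseteq> closure T" unfolding HH_def by (rule closure_minimal[OF assms(3) closed_closure])
 moreover have "x - z \<in> HH" by (rule subspace_diff[OF subspace_HH assms(1,2)])
 ultimately have "(x - z) \<bullet> (x - z) = 0" by blast
 thus ?thesis by simp
qed

text \<open>The weak topology of H is not first countable, but by separability sequences tested against a countable dense set give a sufficient criterion.\<close>
lemma closedin_HwI:
 assumes S: "S \<subseteq> Hspace \<Omega> D" and T: "countable T" "T \<subseteq> cl ` D" "T \<noteq> {}"
  and seq: "!!y x. (!!n::nat. y n \<in> S) ==> x \<in> Hspace \<Omega> D ==> (!!e. e \<in> T ==> (%n. cl (y n) \<bullet> e) ----> cl x \<bullet> e) ==> x \<in> S"
 shows "closedin (Hw \<Omega> D) S"
 unfolding closedin_def topspace_Hw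
proof (intro conjI S)
 have "\<forall>i. \<exists>w. w \<in> D \<and> from_nat_into T i = cl w" using from_nat_into[OF T(3)] T(2) by blast
 then obtain w where w: "!!i. w i \<in> D" "!!i. from_nat_into T i = cl (w i)" by metis
 have wH: "w i \<in> Hspace \<Omega> D" for i using L2\<Omega>_D0[OF w(1)] cl_D_HH[OF w(1)] by (simp add: Hspace_iff)
 show "openin (Hw \<Omega> D) (Hspace \<Omega> D - S)"
  unfolding openin_Hw
 proof (intro conjI ballI)
  fix x assume x: "x \<in> Hspace \<Omega> D - S"
  show "\<exists>F \<epsilon>. finite F \<and> F \<subseteq> Hspace \<Omega> D \<and> \<epsilon> > 0 \<and> {v\<in>Hspace \<Omega> D. \<forall>\<phi>\<in>F. \<bar>ip \<Omega> v \<phi> - ip \<Omega> x \<phi>\<bar> < \<epsilon>} \<subseteq> Hspace \<Omega> D - S"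
  proof (rule ccontr)
   assume neg: "\<not> (\<exists>F \<epsilon>. finite F \<and> F \<subseteq> Hspace \<Omega> D \<and> \<epsilon> > 0 \<and> {v\<in>Hspace \<Omega> D. \<forall>\<phi>\<in>F. \<bar>ip \<Omega> v \<phi> - ip \<Omega> x \<phi>\<bar> < \<epsilon>} \<subseteq> Hspace \<Omega> D - S)"
   have "\<exists>y. y \<in> S \<and> (\<forall>i\<le>n. \<bar>ip \<Omega> y (w i) - ip \<Omega> x (w i)\<bar> < 1 / real (Suc n))" for n
   proof (rule ccontr)
    assume no: "\<not> (\<exists>y. y \<in> S \<and> (\<forall>i\<le>n. \<bar>ip \<Omega> y (w i) - ip \<Omega> x (w i)\<bar> < 1 / real (Suc n)))"
    have "{v\<in>Hspace \<Omega> D. \<forall>\<phi>\<in>w ` {..n}. \<bar>ip \<Omega> v \<phi> - ip \<Omega> x \<phi>\<bar> < 1 / real (Suc n)} \<subseteq> Hspace \<Omega> D - S" using no by auto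
    moreover have "finite (w ` {..n})" "w ` {..n} \<subseteq> Hspace \<Omega> D" "1 / real (Suc n) > 0" using wH by auto
    ultimately show False using neg by blast
   qed
   hence "\<forall>n. \<exists>y. y \<in> S \<and> (\<forall>i\<le>n. \<bar>ip \<Omega> y (w i) - ip \<Omega> x (w i)\<bar> < 1 / real (Suc n))" by (rule allI)
   then obtain y where y: "!!n. y n \<in> S" "!!n i. i <= n ==> \<bar>ip \<Omega> (y n) (w i) - ip \<Omega> x (w i)\<bar> < 1 / real (Suc n)" by metis
   have "x \<in> S"
   proof (rule seq[of y])
    show "y n \<in> S" for n by (rule y(1))
    show "x \<in> Hspace \<Omega> D" using x by blast
    fix e assume "e \<in> T"
    then obtain i where i: "e = cl (w i)" using w(2) from_nat_into_surj[OF T(1)] by metis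
    have "(%n. cl (y n) \<bullet> e - cl x \<bullet> e) ----> 0"
    proof (rule Lim_null_comparison)
     show "(%n. 1 / real (Suc n)) ----> 0" using LIMSEQ_inverse_real_of_nat by (simp add: inverse_eq_divide)
     show "EV n. norm (cl (y n) \<bullet> e - cl x \<bullet> e) <= 1 / real (Suc n)"
     proof (rule eventually_sequentiallyI[of i])
      fix n assume n: "i <= n"
      have "L2\<Omega> (y n)" "L2\<Omega> x" "L2\<Omega> (w i)" using y(1)[of n] S x wH[of i] by (auto simp: Hspace_iff)
      thus "norm (cl (y n) \<bullet> e - cl x \<bullet> e) <= 1 / real (Suc n)"
       using y(2)[OF n] by (simp add: ip_eq i)
     qed
    qed
    thus "(%n. cl (y n) \<bullet> e) ----> cl x \<bullet> e" by (rule LIM_zero_cancel)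
   qed
   thus False using x by blast
  qed
 qed auto
qed

section \<open>Initial states of bounded solutions and the attractor\<close>

text \<open>Membership of a field depends only on its class \<open>cl x\<close>, as it must for a
  closed set: \<open>Hw\<close> does not separate the representatives of one class.\<close>

definition reach :: "real set => real => vf set" where
 "reach J R = {x\<in>Hspace \<Omega> D. \<exists>v. wsol J v \<and> (\<forall>t\<in>J. norm (v t) <= R) \<and> v 0 = cl x}"

text \<open>Compactness with constant intervals; the limit solution starts in the class of
  \<open>x\<close> because both have the same products with a dense set.\<close>

lemma closedin_reach:
 assumes J: "open J" "is_interval J" "0 \<in> J" and R: "R \<ge> 0"
 shows "closedin (Hw \<Omega> D) (reach J R)"
proof -
 obtain T where T: "countable T" "T \<subseteq> cl ` D" "cl ` D \<subseteq> closure T" using separable by blast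
 have "T \<noteq> {}" using T(3) D_0 by auto
 show ?thesis
 proof (rule closedin_HwI[OF _ T(1,2) \<open>T \<noteq> {}\<close>])
  show "reach J R \<subseteq> Hspace \<Omega> D" by (auto simp: reach_def)
  fix y x assume y: "!!n::nat. y n \<in> reach J R" and x: "x \<in> Hspace \<Omega> D" and lim: "!!e. e \<in> T ==> (%n. cl (y n) \<bullet> e) ----> cl x \<bullet> e"
  have "\<forall>n. \<exists>v. wsol J v \<and> (\<forall>t\<in>J. norm (v t) <= R) \<and> v 0 = cl (y n)" using y by (simp add: reach_def)
  then obtain v where v: "!!n. wsol J (v n)" "!!n t. t \<in> J ==> norm (v n t) <= R" "!!n. v n 0 = cl (y n)" by metis
  have "approx_seq R J (%k. J) v" unfolding approx_seq_def using J v by simp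
  then obtain r z where r: "strict_mono (r::nat=>nat)" "wsol J z" "!!t. t \<in> J ==> norm (z t) <= R"
   "!!t y. t \<in> J ==> (%k. v (r k) t \<bullet> y) ----> z t \<bullet> y"
   by (rule wsol_compactness[OF J(1,2) _ R]) blast
  have "z 0 = cl x"
  proof (rule HH_eqI[OF _ _ T(3)])
   show "z 0 \<in> HH" by (rule wsolD(1)[OF r(2) J(3)])
   show "cl x \<in> HH" using x by (simp add: Hspace_iff)
   fix e assume e: "e \<in> T"
   have "(%k. v (r k) 0 \<bullet> e) ----> cl x \<bullet> e" using LIMSEQ_subseq_LIMSEQ[OF lim[OF e] r(1)] by (simp add: o_def v(3))
   thus "z 0 \<bullet> e = cl x \<bullet> e" using r(4)[OF J(3), of e] LIMSEQ_unique by blast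
  qed
  thus "x \<in> reach J R" using x r(2,3) by (auto simp: reach_def)
 qed
qed

text \<open>Compactness along growing half-lines. All solutions pass through the same class at time
  0, so the limit does as well.\<close>

lemma reach_Inter: 
 assumes R: "R \<ge> 0"
 shows "(\<Inter>n. reach {- real (Suc n)<..} R) \<subseteq> reach UNIV R"
proof
 fix x assume x: "x \<in> (\<Inter>n. reach {- real (Suc n)<..} R)"
 hence xn: "x \<in> reach {- real (Suc n)<..} R" for n by blast
 define K where "K n = {- real (Suc n)<..}" for n
 have "\<forall>n. \<exists>v. wsol (K n) v \<and> (\<forall>t\<in>K n. norm (v t) <= R) \<and> v 0 = cl x" using xn by (simp add: reach_def K_def)
 then obtain v where v: "!!n. wsol (K n) (v n)" "!!n t. t \<in> K n ==> norm (v n t) <= R" "!!n. v n 0 = cl x" by metis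
 have ev: "EV k. {p..q} \<subseteq> K k" for p q :: real
 proof -
  obtain m :: nat where m: "- p < real m" using reals_Archimedean2 by blast
  show ?thesis by (rule eventually_sequentiallyI[of m]) (use m in \<open>auto simp: K_def\<close>)
 qed
 have Ki: "open (K n)" "is_interval (K n)" for n by (auto simp: K_def is_interval_1)
 have "approx_seq R UNIV K v" unfolding approx_seq_def using v ev Ki by blast
 then obtain r z where r: "strict_mono (r::nat=>nat)" "wsol UNIV z" "!!t. t \<in> UNIV ==> norm (z t) <= R"
  "!!t y. t \<in> UNIV ==> (%k. v (r k) t \<bullet> y) ----> z t \<bullet> y"
  by (rule wsol_compactness[OF open_UNIV is_interval_univ _ R]) blast
 have "z 0 \<bullet> y = cl x \<bullet> y" for y using r(4)[of 0 y] by (simp add: v(3) LIMSEQ_const_iff)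
 hence "z 0 = cl x" by (metis inner_eq_zero_iff inner_diff_left inner_diff_right right_minus_eq diff_self)
 thus "x \<in> reach UNIV R" using xn[of 0] r(2,3) by (auto simp: reach_def)
qed

lemma reach_UNIV_attractor: "reach UNIV R \<subseteq> weak_attractor \<Omega> D \<nu> f"
proof
 fix x assume "x \<in> reach UNIV R"
 then obtain v where x: "x \<in> Hspace \<Omega> D" and v: "wsol UNIV v" "!!t. norm (v t) <= R" "v 0 = cl x" by (auto simp: reach_def)
 \<comment> \<open>The attractor consists of functions, so at time 0 the given representative
   \<open>x\<close> itself has to be used.\<close>
 define u where "u t = (if t = 0 then x else rep_l2 (v t))" for t
 have uL: "L2\<Omega> (u t)" for t using x by (simp add: u_def L2\<Omega>_rep Hspace_iff)
 have uv: "cl (u t) = v t" for t using wsolD(1)[OF v(1), of t] v(3) by (simp add: u_def cl_rep proj_HH)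
 have "weak_solution \<Omega> D \<nu> f UNIV u" by (rule global_weak_solution[OF v(1,2) uL uv])
 moreover have "\<exists>C. \<forall>t. Hnorm \<Omega> (u t) <= C" using v(2) by (auto simp: Hnorm_eq[OF uL] uv)
 ultimately have "u \<in> W_sol \<Omega> D \<nu> f" by (simp add: W_sol_def)
 thus "x \<in> weak_attractor \<Omega> D \<nu> f" unfolding weak_attractor_def by (rule image_eqI[rotated]) (simp add: u_def)
qed

text \<open>The source of measurability: a complete solution may have any bound, but integer bounds
  suffice, and each set in the union is weakly closed.\<close>

lemma weak_attractor_eq: "weak_attractor \<Omega> D \<nu> f = (\<Union>n. reach UNIV (real n))"
proof
 show "(\<Union>n. reach UNIV (real n)) \<subseteq> weak_attractor \<Omega> D \<nu> f" using reach_UNIV_attractor by blast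
 show "weak_attractor \<Omega> D \<nu> f \<subseteq> (\<Union>n. reach UNIV (real n))"
 proof
  fix x assume "x \<in> weak_attractor \<Omega> D \<nu> f"
  then obtain u C where u: "weak_solution \<Omega> D \<nu> f UNIV u" "!!t. Hnorm \<Omega> (u t) <= C" "x = u 0"
   by (auto simp: weak_attractor_def W_sol_def)
  have uH: "u t \<in> Hspace \<Omega> D" for t using u(1) by (simp add: weak_solution_def)
  obtain n :: nat where "C <= real n" using real_arch_simple by blast
  hence "norm (cl (u t)) <= real n" for t using u(2)[of t] uH[of t] by (simp add: Hspace_iff Hnorm_eq)
  hence "x \<in> reach UNIV (real n)" unfolding reach_def
   using u(3) uH weak_to_wsol[OF open_UNIV is_interval_univ u(1)] by auto
  thus "x \<in> (\<Union>n. reach UNIV (real n))" by blast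
 qed
qed

lemma weak_attractor_sets: "weak_attractor \<Omega> D \<nu> f \<in> sets (borel_of (Hw \<Omega> D))"
 unfolding weak_attractor_eq
 by (intro sets.countable_UN closedin_sets_borel_of image_subsetI closedin_reach) (auto intro: is_interval_univ)

lemma closedin_norm_ball: "closedin (Hw \<Omega> D) {x\<in>Hspace \<Omega> D. norm (cl x) <= r}"
 unfolding closedin_def topspace_Hw openin_Hw
proof (intro conjI ballI)
 fix x assume x': "x \<in> Hspace \<Omega> D - {x \<in> Hspace \<Omega> D. norm (cl x) <= r}"
 hence x: "x \<in> Hspace \<Omega> D" "norm (cl x) > r" by auto
 show "\<exists>F \<epsilon>. finite F \<and> F \<subseteq> Hspace \<Omega> D \<and> 0 < \<epsilon> \<and> {v \<in> Hspace \<Omega> D. \<forall>\<phi>\<in>F. \<bar>ip \<Omega> v \<phi> - ip \<Omega> x \<phi>\<bar> < \<epsilon>} \<subseteq> Hspace \<Omega> D - {x \<in> Hspace \<Omega> D. norm (cl x) <= r}"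
 proof (cases "r < 0")
  case True
  have "{x \<in> Hspace \<Omega> D. norm (cl x) <= r} = {}"
  proof -
   have "\<not> norm (cl x) <= r" for x using True norm_ge_zero[of "cl x"] by linarith
   thus ?thesis by simp
  qed
  thus ?thesis by (intro exI[of _ "{}"] exI[of _ "1::real"]) auto
 next
  case False
  \<comment> \<open>Tested with \<open>x\<close> itself, a neighbour \<open>v\<close> has an inner
    product above \<open>norm (cl x) * r\<close>, so its norm exceeds \<open>r\<close>.\<close>
  define \<epsilon> where "\<epsilon> = norm (cl x) * (norm (cl x) - r)"
  have \<epsilon>: "\<epsilon> > 0" unfolding \<epsilon>_def using False x(2) by (intro mult_pos_pos) auto
  have "{v \<in> Hspace \<Omega> D. \<forall>\<phi>\<in>{x}. \<bar>ip \<Omega> v \<phi> - ip \<Omega> x \<phi>\<bar> < \<epsilon>} \<subseteq> Hspace \<Omega> D - {x \<in> Hspace \<Omega> D. norm (cl x) <= r}"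
  proof
   fix v assume "v \<in> {v \<in> Hspace \<Omega> D. \<forall>\<phi>\<in>{x}. \<bar>ip \<Omega> v \<phi> - ip \<Omega> x \<phi>\<bar> < \<epsilon>}"
   hence v: "v \<in> Hspace \<Omega> D" "\<bar>ip \<Omega> v x - ip \<Omega> x x\<bar> < \<epsilon>" by auto
   have "\<bar>cl v \<bullet> cl x - cl x \<bullet> cl x\<bar> < \<epsilon>" using v x(1) by (simp add: ip_eq Hspace_iff)
   moreover have "cl x \<bullet> cl x = norm (cl x) * norm (cl x)" by (simp add: norm_eq_sqrt_inner)
   moreover have "\<epsilon> = norm (cl x) * norm (cl x) - norm (cl x) * r" by (simp add: \<epsilon>_def right_diff_distrib)
   ultimately have "norm (cl x) * r < cl v \<bullet> cl x" by linarith
   also have "\<dots> <= norm (cl x) * norm (cl v)" using norm_cauchy_schwarz[of "cl v" "cl x"] by (simp add: mult.commute)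
   finally have "r < norm (cl v)" using mult_less_cancel_left_pos[of "norm (cl x)" r "norm (cl v)"] x(2) False by linarith
   thus "v \<in> Hspace \<Omega> D - {x \<in> Hspace \<Omega> D. norm (cl x) <= r}" using v(1) by simp
  qed
  thus ?thesis using x(1) \<epsilon> by (intro exI[of _ "{x}"] exI[of _ \<epsilon>]) auto
 qed
qed auto

end

section \<open>Stationary statistical solutions\<close>

text \<open>Trajectories solve the equation on the interior of \<open>I\<close> only, so the times
  used later are taken there.\<close>

lemma interior_unbounded_interval:
 fixes I :: "real set"
 assumes I: "is_interval I" and unb: "!!a. \<exists>t\<in>I. a < t"
 shows "interior I \<noteq> {}" "!!s t. s \<in> interior I ==> s <= t ==> t \<in> interior I" "is_interval (interior I)"
proof -
 have Ioo: "{p<..<q} \<subseteq> interior I" if "p \<in> I" "q \<in> I" for p q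
 proof (rule interior_maximal)
  show "{p<..<q} \<subseteq> I" using I that unfolding is_interval_1 by (meson greaterThanLessThan_iff less_imp_le subsetI)
 qed simp
 obtain p where p: "p \<in> I" using unb by blast
 obtain q where q: "q \<in> I" "p < q" using unb by blast
 have "(p + q) / 2 \<in> {p<..<q}" using q(2) by (simp add: field_simps)
 thus "interior I \<noteq> {}" using Ioo[OF p q(1)] by blast
 show up: "t \<in> interior I" if s: "s \<in> interior I" "s <= t" for s t
 proof (cases "s = t")
  case False
  obtain q where q: "q \<in> I" "t < q" using unb by blast
  have "s \<in> I" using s(1) interior_subset by blast
  moreover have "t \<in> {s<..<q}" using False s(2) q(2) by simp
  ultimately show ?thesis using Ioo[of s q] q(1) by blast
 qed (use s in simp)
 show "is_interval (interior I)" unfolding is_interval_1 using up by blast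
qed

context nse_domain
begin

text \<open>Reduces the bound to countably many times, so that null sets of trajectories can be
  collected: a ball is weakly closed and the curve weakly continuous.\<close>

lemma wsol_norm_rational:
 assumes J: "open J" and v: "wsol J v" and q: "!!q. q \<in> J ==> q \<in> \<rat> ==> norm (v q) <= R" and t: "t \<in> J"
 shows "norm (v t) <= R"
proof -
 have "\<exists>q\<in>\<rat>. t < q \<and> q < t + 1 / real (Suc n)" for n by (rule Rats_dense_in_real) simp
 then obtain s where s: "!!n. s n \<in> \<rat>" "!!n. t < s n" "!!n. s n < t + 1 / real (Suc n)" by metis
 have "(%n. 1 / real (Suc n)) ----> 0" using LIMSEQ_inverse_real_of_nat by (simp add: inverse_eq_divide)
 hence "(%n. t + 1 / real (Suc n)) ----> t + 0" by (intro tendsto_add tendsto_const)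
 hence ub: "(%n. t + 1 / real (Suc n)) ----> t" by simp
 have st: "s ----> t"
  by (rule real_tendsto_sandwich[OF _ _ tendsto_const ub]) (intro always_eventually allI less_imp_le s)+
 have ev: "EV n. s n \<in> J" using topological_tendstoD[OF st J t] .
 have "v t \<in> cball 0 R"
 proof (rule closed_convex_weakly_closed[OF closed_cball convex_cball, of sequentially "%n. v (s n)"])
  show "EV n. v (s n) \<in> cball 0 R" using ev by eventually_elim (use q s(1) in simp)
  show "(%n. v (s n) \<bullet> w) ----> v t \<bullet> w" for w by (rule continuous_on_tendsto_compose[OF wsolD(2)[OF v] st t ev])
 qed simp
 thus ?thesis by simp
qed

text \<open>By stationarity the mass outside the absorbing ball is the same at all times, and it tends to 0 because every
 trajectory is eventually absorbed. Hence almost every trajectory stays in the ball on the whole interval,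
 and its state at a late time has a bounded past of any prescribed length.\<close>
lemma stationary_reach:
 assumes "VF_stationary \<Omega> D \<nu> f \<rho>0"
 obtains R where "R > 0" "!!n. AE x in \<rho>0. x \<in> reach {- real (Suc n)<..} R"
proof -
 from assms obtain I \<rho> where I: "is_interval I" "\<forall>a. \<exists>t\<in>I. a < t" and VF: "VF_measure \<Omega> D \<nu> f I \<rho>"
  and st: "\<forall>t\<in>I. \<rho>0 = distr \<rho> (borel_of (Hw \<Omega> D)) (%u. u t)" and p0: "prob_space \<rho>0"
  unfolding VF_stationary_def by blast
 interpret \<rho>: prob_space \<rho> using VF by (simp add: VF_measure_def)
 have sets\<rho>: "sets \<rho> = sets (borel_of (Cloc_top \<Omega> D I))" using VF by (simp add: VF_measure_def)
 hence space\<rho>: "space \<rho> = Cloc \<Omega> D I" using sets_eq_imp_space_eq space_borel_of topspace_Cloc_top by metis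
 have ev: "(%u. u t) \<in> \<rho> \<rightarrow>\<^sub>M borel_of (Hw \<Omega> D)" if "t \<in> I" for t
  using eval_measurable[OF that, of \<Omega> D] measurable_cong_sets[OF sets\<rho> refl] by blast
 define J where "J = interior I"
 have J: "open J" "J \<noteq> {}" "is_interval J" and up: "!!s t. s \<in> J ==> s <= t ==> t \<in> J"
  unfolding J_def using interior_unbounded_interval[of I] I by auto
 have JI: "J \<subseteq> I" unfolding J_def by (rule interior_subset)
 have "\<rho>.prob (U_sharp \<Omega> D \<nu> f I) = 1" using VF by (simp add: VF_measure_def measure_def)
 hence AEU: "AE u in \<rho>. u \<in> U_sharp \<Omega> D \<nu> f I" by (rule \<rho>.AE_prob_1)
 have AEw: "AE u in \<rho>. wsol J (%t. cl (u t)) \<and> (\<forall>t\<in>I. u t \<in> Hspace \<Omega> D)"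
  using AEU
 proof eventually_elim
  case (elim u)
  thus ?case using weak_to_wsol[OF J(1,3), of u] by (auto simp: U_sharp_def Cloc_def J_def)
 qed
 obtain R where R: "R > 0" "!!v. wsol J v ==> \<exists>T\<in>J. \<forall>t\<ge>T. norm (v t) <= R"
 proof (rule absorbing_ball)
  fix R assume "R > 0" and *: "!!J v. open J ==> J \<noteq> {} ==> (!!s t. s \<in> J ==> s <= t ==> t \<in> J) ==> wsol J v ==> \<exists>T\<in>J. \<forall>t\<ge>T. norm (v t) <= R"
  show thesis by (rule that[OF \<open>R > 0\<close> *[OF J(1,2) up]])
 qed
 define N where "N = Hspace \<Omega> D - {x\<in>Hspace \<Omega> D. norm (cl x) <= R}"
 have N: "N \<in> sets (borel_of (Hw \<Omega> D))"
  using openin_sets_borel_of closedin_norm_ball[of R] unfolding closedin_def topspace_Hw N_def by blast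
 have evN: "measure \<rho>0 N = (\<integral>u. indicator ((%u. u t) -` N \<inter> space \<rho>) u \<partial>\<rho>)" if t: "t \<in> I" for t
 proof -
  have "measure \<rho>0 N = \<rho>.prob ((%u. u t) -` N \<inter> space \<rho>)"
   using st[rule_format, OF t] measure_distr[OF ev[OF t] N] by simp
  thus ?thesis by simp
 qed
 have "\<forall>n::nat. \<exists>t. t \<in> I \<and> real n < t" using I(2) by blast
 then obtain \<tau> where \<tau>: "!!n. \<tau> n \<in> I" "!!n. real n < \<tau> n" by metis
 \<comment> \<open>Pathwise: beyond its own absorption time each trajectory makes the indicator 0,
   and no common absorption time is required.\<close>
 have "(%n. \<integral>u. indicator ((%u. u (\<tau> n)) -` N \<inter> space \<rho>) u \<partial>\<rho>) ----> (\<integral>u. (0::real) \<partial>\<rho>)"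
 proof (rule integral_dominated_convergence[where w = "%u. 1"])
  show "indicat_real ((%u. u (\<tau> n)) -` N \<inter> space \<rho>) \<in> borel_measurable \<rho>" for n
   using measurable_sets[OF ev[OF \<tau>(1)] N] by simp
  show "AE u in \<rho>. (%n. indicat_real ((%u. u (\<tau> n)) -` N \<inter> space \<rho>) u) ----> 0"
   using AEw
  proof eventually_elim
   case (elim u)
   then obtain T where T: "T \<in> J" "!!t. t \<ge> T ==> norm (cl (u t)) <= R" using R(2)[of "%t. cl (u t)"] by blast
   obtain m :: nat where m: "T <= real m" using real_arch_simple by blast
   have "EV n. indicat_real ((%u. u (\<tau> n)) -` N \<inter> space \<rho>) u = 0"
   proof (rule eventually_sequentiallyI[of m])
    fix n assume "m <= n"
    hence "T <= \<tau> n" using m \<tau>(2)[of n] by linarith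
    thus "indicat_real ((%u. u (\<tau> n)) -` N \<inter> space \<rho>) u = 0" using T(2) by (auto simp: N_def split: split_indicator)
   qed
   thus ?case by (rule tendsto_eventually)
  qed
  show "AE u in \<rho>. norm (indicat_real ((%u. u (\<tau> n)) -` N \<inter> space \<rho>) u) <= 1" for n by (simp add: indicator_def)
 qed auto
 hence "(%n::nat. measure \<rho>0 N) ----> 0" using evN[OF \<tau>(1)] by simp
 hence N0: "measure \<rho>0 N = 0" by (simp add: LIMSEQ_const_iff)
 have AEt: "AE u in \<rho>. norm (cl (u t)) <= R" if t: "t \<in> I" for t
 proof -
  have "\<rho>.prob ((%u. u t) -` N \<inter> space \<rho>) = 0" using evN[OF t] N0 by simp
  hence "AE u in \<rho>. u \<notin> (%u. u t) -` N \<inter> space \<rho>"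
   using measurable_sets[OF ev[OF t] N] by (simp add: \<rho>.prob_eq_0)
  thus ?thesis using AE_space AEw
   by eventually_elim (use t in \<open>auto simp: N_def\<close>)
 qed
 have "countable (J \<inter> \<rat>)" using countable_rat by (rule countable_Int2)
 hence "AE u in \<rho>. \<forall>q\<in>J \<inter> \<rat>. norm (cl (u q)) <= R" using AEt JI by (subst AE_ball_countable) auto
 hence AEb: "AE u in \<rho>. wsol J (%t. cl (u t)) \<and> (\<forall>t\<in>J. norm (cl (u t)) <= R) \<and> (\<forall>t\<in>I. u t \<in> Hspace \<Omega> D)"
  using AEw
 proof eventually_elim
  case (elim u)
  have w: "wsol J (%t. cl (u t))" using elim by blast
  have "norm (cl (u t)) <= R" if "t \<in> J" for t
   by (rule wsol_norm_rational[OF J(1) w _ that]) (use elim in blast)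
  thus ?case using elim by blast
 qed
 obtain s where s: "s \<in> J" using J(2) by blast
 have "AE x in \<rho>0. x \<in> reach {- real (Suc n)<..} R" for n
 proof -
  \<comment> \<open>A shift by \<open>t\<close> sends \<open>- real (Suc n)\<close> to
    \<open>s\<close>, so the shifted half-line stays inside \<open>J\<close>.\<close>
  define t where "t = s + real (Suc n)"
  have tJ: "t \<in> J" by (rule up[OF s]) (simp add: t_def)
  hence tI: "t \<in> I" using JI by blast
  have rs: "reach {- real (Suc n)<..} R \<in> sets (borel_of (Hw \<Omega> D))"
   using R(1) by (intro closedin_sets_borel_of closedin_reach) (auto simp: is_interval_1)
  have "AE u in \<rho>. u t \<in> reach {- real (Suc n)<..} R"
   using AEb
  proof eventually_elim
   case (elim u)
   have in_J: "\<tau> + t \<in> J" if "\<tau> \<in> {- real (Suc n)<..}" for \<tau> by (rule up[OF s]) (use that in \<open>simp add: t_def\<close>)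
   have "wsol {- real (Suc n)<..} (%\<tau>. cl (u (\<tau> + t)))"
    by (rule wsol_translate[of J "%t. cl (u t)"]) (use elim in_J in auto)
   thus ?case unfolding reach_def using elim in_J tI by (auto intro!: exI[of _ "%\<tau>. cl (u (\<tau> + t))"])
  qed
  moreover have "{x \<in> space (borel_of (Hw \<Omega> D)). x \<in> reach {- real (Suc n)<..} R} \<in> sets (borel_of (Hw \<Omega> D))"
   using sets.Int[OF sets.top rs] by (simp add: Int_def)
  ultimately show ?thesis
   by (subst st[rule_format, OF tI], subst AE_distr_iff[OF ev[OF tI]])
 qed
 thus ?thesis using that R(1) by blast
qed

text \<open>The support calls for a closed set of full measure. The attractor is only exhibited as a
  countable union of closed sets, so \<open>reach UNIV R\<close> with the absorbing radius is used:
  its complement is an open null set.\<close>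

lemma stationary_attractor:
 assumes st: "VF_stationary \<Omega> D \<nu> f \<rho>0"
 shows "emeasure \<rho>0 (weak_attractor \<Omega> D \<nu> f) = 1" "Hsupp \<Omega> D \<rho>0 \<subseteq> weak_attractor \<Omega> D \<nu> f"
proof -
 interpret \<rho>0: prob_space \<rho>0 using st by (simp add: VF_stationary_def)
 have sets\<rho>: "sets \<rho>0 = sets (borel_of (Hw \<Omega> D))" using st by (simp add: VF_stationary_def)
 obtain R where R: "R > 0" "!!n. AE x in \<rho>0. x \<in> reach {- real (Suc n)<..} R" using stationary_reach[OF st] by blast
 have "AE x in \<rho>0. \<forall>n. x \<in> reach {- real (Suc n)<..} R" unfolding AE_all_countable using R(2) by blast
 hence AE: "AE x in \<rho>0. x \<in> reach UNIV R"
 proof eventually_elim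
  case (elim x)
  hence "x \<in> (\<Inter>n. reach {- real (Suc n)<..} R)" by blast
  thus ?case using reach_Inter[of R] R(1) by auto
 qed
 have "AE x in \<rho>0. x \<in> weak_attractor \<Omega> D \<nu> f" using AE by eventually_elim (use reach_UNIV_attractor in blast)
 thus "emeasure \<rho>0 (weak_attractor \<Omega> D \<nu> f) = 1"
  using weak_attractor_sets sets\<rho> by (intro \<rho>0.emeasure_eq_1_AE) auto
 have cl: "closedin (Hw \<Omega> D) (reach UNIV R)" using R(1) by (intro closedin_reach) (auto intro: is_interval_univ)
 show "Hsupp \<Omega> D \<rho>0 \<subseteq> weak_attractor \<Omega> D \<nu> f"
 proof
  fix x assume x: "x \<in> Hsupp \<Omega> D \<rho>0"
  have "x \<in> reach UNIV R"
  proof (rule ccontr)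
   assume "x \<notin> reach UNIV R"
   moreover have o: "openin (Hw \<Omega> D) (Hspace \<Omega> D - reach UNIV R)" using cl unfolding closedin_def topspace_Hw by blast
   ultimately have pos: "emeasure \<rho>0 (Hspace \<Omega> D - reach UNIV R) > 0" using x unfolding Hsupp_def by blast
   have "Hspace \<Omega> D - reach UNIV R \<in> null_sets \<rho>0"
    using AE openin_sets_borel_of[OF o] sets\<rho> by (intro AE_iff_null_sets[THEN iffD2]) auto
   thus False using pos by auto
  qed
  thus "x \<in> weak_attractor \<Omega> D \<nu> f" using reach_UNIV_attractor by blast
 qed
qed

end

theorem theorem5p3:
  fixes \<Omega> :: "(real^3) set" and D :: "vf set" and \<nu> :: real and f :: vf and \<rho>0 :: "vf measure"
  assumes "NSE_setting \<Omega> D"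
    and "\<nu> > 0"
    and "f \<in> Hspace \<Omega> D"
    and "VF_stationary \<Omega> D \<nu> f \<rho>0"
  shows "emeasure \<rho>0 (weak_attractor \<Omega> D \<nu> f) = 1 \<and>
         Hsupp \<Omega> D \<rho>0 \<subseteq> weak_attractor \<Omega> D \<nu> f"
proof -
  obtain a b where ab: "flow_domain \<Omega> D a b" using NSE_setting_flow_domain[OF assms(1)] by blast
  interpret nse_domain \<Omega> D a b \<nu> f
    by (intro nse_domain.intro ab nse_domain_axioms.intro assms(2,3))
  show ?thesis using stationary_attractor[OF assms(4)] by blast
qed

end
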